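(* Let $\Gamma$ be a countable group with an infinite normal subgroup $\Gamma_0$ such that the inclusion $\Gamma_0\subset\Gamma$ has relative property (T) and $\Gamma/\Gamma_0$ is finitely generated. Let $\Gamma\curvearrowright^{\alpha}(X,\mu)$ be a free ergodic measure preserving profinite action on a standard probability space such that the restriction $\Gamma_0\curvearrowright^{\alpha|_{\Gamma_0}}(X,\mu)$ is also ergodic. Let $\Lambda\curvearrowright^{\beta}(Y,\nu)$ be a free ergodic measure preserving action of a countable group $\Lambda$ on a standard probability space, and let $\theta:X\rightarrow Y$ be an orbit equivalence between $\alpha$ and $\beta$. Then there exist an automorphism $\tau$ of $(Y,\nu)$ with $\tau(y)\in\Lambda y$ for a.e. $y\in Y$, finite index subgroups $\Gamma_1\subset\Gamma$ and $\Lambda_1\subset\Lambda$, a $\Gamma_1$-ergodic component $X_1\subset X$ and a $\Lambda_1$-ergodic component $Y_1\subset Y$ such that $(\tau\circ\theta)(X_1)=Y_1$ and $(\tau\circ\theta)|_{X_1}:X_1\rightarrow Y_1$ is a conjugacy between $\Gamma_1\curvearrowright^{\alpha|_{\Gamma_1}}X_1$ and $\Lambda_1\curvearrowright^{\beta|_{\Lambda_1}}Y_1$.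
   Context: A standard probability space is one isomorphic to the unit interval with Lebesgue measure. Equalities of sets and maps are understood up to null sets. Relative property (T): an inclusion of countable groups $\Gamma_0\subset\Gamma$ has relative property (T) if every unitary representation of $\Gamma$ which weakly contains the trivial representation of $\Gamma$ contains the trivial representation of $\Gamma_0$ (i.e. has a non-zero $\Gamma_0$-invariant vector). Profinite actions: a measure preserving action $\Gamma\curvearrowright(X,\mu)$ is profinite if it is the inverse limit of a sequence of measure preserving actions $\Gamma\curvearrowright(X_n,\mu_n)$ on finite probability spaces. Here one is given measure preserving, onto, $\Gamma$-equivariant maps $q_n:X_{n+1}\to X_n$; $X=\{(x_n)_n : x_n\in X_n,\ q_n(x_{n+1})=x_n\ \forall n\}$; $\mu$ is the unique probability measure making all coordinate maps $r_n:X\to X_n$ measure preserving; and $\gamma(x_n)_n=(\gamma x_n)_n$. An action is free if $\mu(\{x:\gamma x=x\})=0$ for all $\gamma\neq e$. An orbit equivalence between $\Gamma\curvearrowright(X,\mu)$ and $\Lambda\curvearrowright(Y,\nu)$ is a probability space isomorphism $\theta:X\to Y$ with $\theta(\Gamma x)=\Lambda\theta(x)$ for a.e. $x\in X$. For a finite index subgroup $\Gamma_1\subset\Gamma$, a $\Gamma_1$-ergodic component is a $\Gamma_1$-invariant measurable set $X_1\subset X$ of positive measure on which $\Gamma_1$ acts ergodically; it carries the normalized restricted measure. Similarly for $\Lambda_1\subset\Lambda$. A conjugacy between two measure preserving actions $\Gamma_1\curvearrowright X_1$ and $\Lambda_1\curvearrowright Y_1$ is a probability space isomorphism $\rho:X_1\to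 Y_1$ for which there is a group isomorphism $\delta:\Gamma_1\to\Lambda_1$ with $\rho(\gamma x)=\delta(\gamma)\rho(x)$ for all $\gamma\in\Gamma_1$ and a.e. $x\in X_1$. *)

theory Defs
  imports "HOL-Algebra.Algebra" "HOL-Probability.Probability"
begin

section \<open>Groups\<close>

definition finitely_generated_group :: "('g, 'k) monoid_scheme \<Rightarrow> bool" where
  "finitely_generated_group G \<longleftrightarrow>
     (\<exists>S. finite S \<and> S \<subseteq> carrier G \<and> generate G S = carrier G)"

definition finite_index_subgroup :: "'g set \<Rightarrow> 'g monoid \<Rightarrow> bool" where
  "finite_index_subgroup H G \<longleftrightarrow> subgroup H G \<and> finite (rcosets\<^bsub>G\<^esub> H)"


section \<open>Measure preserving maps modulo null sets\<close>

text \<open>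
  Maps are only required to be measurable with respect to the completion of the source, so nothing
  below depends on whether a standard probability space is given with its Borel or with its
  Lebesgue measurable sets.  An isomorphism is a measure preserving map that has a measure
  preserving inverse almost everywhere.
\<close>

definition mp_map :: "'a measure \<Rightarrow> 'b measure \<Rightarrow> ('a \<Rightarrow> 'b) \<Rightarrow> bool" where
  "mp_map M N f \<longleftrightarrow> f \<in> measurable (completion M) N \<and>
     (\<forall>B\<in>sets N. emeasure (completion M) (f -` B \<inter> space M) = emeasure N B)"

definition prob_iso :: "'a measure \<Rightarrow> 'b measure \<Rightarrow> ('a \<Rightarrow> 'b) \<Rightarrow> bool" where
  "prob_iso M N f \<longleftrightarrow> prob_space M \<and> prob_space N \<and> mp_map M N f \<and>
     (\<exists>g. mp_map N M g \<and> (AE x in M. g (f x) = x) \<and> (AE y in N. f (g y) = y))"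

definition standard_prob_space :: "'a measure \<Rightarrow> bool" where
  "standard_prob_space M \<longleftrightarrow> (\<exists>f. prob_iso M (lebesgue_on {0..1::real}) f)"

text \<open>
  \<open>f\<close> maps \<open>A\<close> onto \<open>B\<close> up to null sets.  The bare image \<open>f ` A\<close> is not invariant under changing
  \<open>f\<close> on a null set, so the image is taken inside conull sets between which \<open>f\<close> is bijective.
\<close>

definition image_mod_null ::
    "'a measure \<Rightarrow> 'b measure \<Rightarrow> ('a \<Rightarrow> 'b) \<Rightarrow> 'a set \<Rightarrow> 'b set \<Rightarrow> bool" where
  "image_mod_null M N f A B \<longleftrightarrow>
     (\<exists>X\<^sub>0 Y\<^sub>0. X\<^sub>0 \<subseteq> space M \<and> Y\<^sub>0 \<subseteq> space N \<and> (AE x in M. x \<in> X\<^sub>0) \<and> (AE y in N. y \<in> Y\<^sub>0) \<and>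
        bij_betw f X\<^sub>0 Y\<^sub>0 \<and> f ` (A \<inter> X\<^sub>0) = B \<inter> Y\<^sub>0)"


section \<open>Measure preserving actions\<close>

text \<open>The restriction of an action of \<open>G\<close> to a subgroup \<open>H\<close> is the same map \<open>a\<close>, regarded as an
  action of \<open>G\<lparr>carrier := H\<rparr>\<close>.\<close>

definition mp_action :: "'g monoid \<Rightarrow> 'x measure \<Rightarrow> ('g \<Rightarrow> 'x \<Rightarrow> 'x) \<Rightarrow> bool" where
  "mp_action G M a \<longleftrightarrow> prob_space M \<and> group_action G (space M) a \<and>
     (\<forall>g\<in>carrier G. mp_map M M (a g))"

definition free_action :: "'g monoid \<Rightarrow> 'x measure \<Rightarrow> ('g \<Rightarrow> 'x \<Rightarrow> 'x) \<Rightarrow> bool" where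
  "free_action G M a \<longleftrightarrow> (\<forall>g\<in>carrier G. g \<noteq> \<one>\<^bsub>G\<^esub> \<longrightarrow> (AE x in M. a g x \<noteq> x))"

definition invariant_set :: "'g monoid \<Rightarrow> 'x measure \<Rightarrow> ('g \<Rightarrow> 'x \<Rightarrow> 'x) \<Rightarrow> 'x set \<Rightarrow> bool" where
  "invariant_set G M a A \<longleftrightarrow> (\<forall>g\<in>carrier G. AE x in M. a g x \<in> A \<longleftrightarrow> x \<in> A)"

definition ergodic_action :: "'g monoid \<Rightarrow> 'x measure \<Rightarrow> ('g \<Rightarrow> 'x \<Rightarrow> 'x) \<Rightarrow> bool" where
  "ergodic_action G M a \<longleftrightarrow>
     (\<forall>A\<in>sets M. invariant_set G M a A \<longrightarrow> emeasure M A = 0 \<or> emeasure M (space M - A) = 0)"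

text \<open>The normalized restriction of \<open>M\<close> to \<open>X\<^sub>1\<close> is \<open>uniform_measure M X\<^sub>1\<close>: it still lives on
  \<open>space M\<close>, but the complement of \<open>X\<^sub>1\<close> is null.\<close>

definition ergodic_component ::
    "'g monoid \<Rightarrow> 'x measure \<Rightarrow> ('g \<Rightarrow> 'x \<Rightarrow> 'x) \<Rightarrow> 'x set \<Rightarrow> bool" where
  "ergodic_component G M a X\<^sub>1 \<longleftrightarrow> X\<^sub>1 \<in> sets M \<and> emeasure M X\<^sub>1 > 0 \<and> invariant_set G M a X\<^sub>1 \<and>
     ergodic_action G (uniform_measure M X\<^sub>1) a"

definition orbit_equivalence ::
    "'g monoid \<Rightarrow> 'x measure \<Rightarrow> ('g \<Rightarrow> 'x \<Rightarrow> 'x) \<Rightarrow>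
     'l monoid \<Rightarrow> 'y measure \<Rightarrow> ('l \<Rightarrow> 'y \<Rightarrow> 'y) \<Rightarrow> ('x \<Rightarrow> 'y) \<Rightarrow> bool" where
  "orbit_equivalence G M a H N b \<theta> \<longleftrightarrow> prob_iso M N \<theta> \<and>
     (AE x in M. \<theta> ` orbit G a x = orbit H b (\<theta> x))"

definition conjugacy ::
    "'g monoid \<Rightarrow> 'x measure \<Rightarrow> ('g \<Rightarrow> 'x \<Rightarrow> 'x) \<Rightarrow>
     'l monoid \<Rightarrow> 'y measure \<Rightarrow> ('l \<Rightarrow> 'y \<Rightarrow> 'y) \<Rightarrow> ('x \<Rightarrow> 'y) \<Rightarrow> bool" where
  "conjugacy G M a H N b \<rho> \<longleftrightarrow> prob_iso M N \<rho> \<and>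
     (\<exists>\<delta>\<in>iso G H. \<forall>g\<in>carrier G. AE x in M. \<rho> (a g x) = b (\<delta> g) (\<rho> x))"


section \<open>Profinite actions\<close>

text \<open>Finite sets are coded as sets of natural numbers.\<close>

definition inverse_system ::
    "'g monoid \<Rightarrow> (nat \<Rightarrow> nat measure) \<Rightarrow> (nat \<Rightarrow> 'g \<Rightarrow> nat \<Rightarrow> nat) \<Rightarrow> (nat \<Rightarrow> nat \<Rightarrow> nat) \<Rightarrow> bool" where
  "inverse_system G P c q \<longleftrightarrow>
     (\<forall>n. finite (space (P n)) \<and> sets (P n) = Pow (space (P n)) \<and> mp_action G (P n) (c n) \<and>
          mp_map (P (Suc n)) (P n) (q n) \<and> q n ` space (P (Suc n)) = space (P n) \<and>
          (\<forall>g\<in>carrier G. \<forall>x\<in>space (P (Suc n)). q n (c (Suc n) g x) = c n g (q n x)))"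

definition inverse_limit_set ::
    "(nat \<Rightarrow> nat measure) \<Rightarrow> (nat \<Rightarrow> nat \<Rightarrow> nat) \<Rightarrow> (nat \<Rightarrow> nat) set" where
  "inverse_limit_set P q = {x. \<forall>n. x n \<in> space (P n) \<and> q n (x (Suc n)) = x n}"

definition inverse_limit_measure ::
    "(nat \<Rightarrow> nat measure) \<Rightarrow> (nat \<Rightarrow> nat \<Rightarrow> nat) \<Rightarrow> (nat \<Rightarrow> nat) measure \<Rightarrow> bool" where
  "inverse_limit_measure P q L \<longleftrightarrow> prob_space L \<and> space L = inverse_limit_set P q \<and>
     sets L = sets (restrict_space (PiM UNIV P) (inverse_limit_set P q)) \<and>
     (\<forall>n. mp_map L (P n) (\<lambda>x. x n))"

definition profinite_action :: "'g monoid \<Rightarrow> 'x measure \<Rightarrow> ('g \<Rightarrow> 'x \<Rightarrow> 'x) \<Rightarrow> bool" where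
  "profinite_action G M a \<longleftrightarrow>
     (\<exists>P c q L f. inverse_system G P c q \<and> inverse_limit_measure P q L \<and> prob_iso M L f \<and>
        (\<forall>g\<in>carrier G. AE x in M. f (a g x) = (\<lambda>n. c n g (f x n))))"


section \<open>Relative property (T)\<close>

definition complex_ring :: "complex ring" where
  "complex_ring =
     \<lparr>carrier = UNIV, monoid.mult = (*), one = 1, ring.zero = 0, ring.add = (+)\<rparr>"

locale complex_hilbert_space = module complex_ring V
  for V :: "(complex, 'h) module" (structure) +
  fixes ip :: "'h \<Rightarrow> 'h \<Rightarrow> complex"
  assumes ip_add: "\<lbrakk>x \<in> carrier V; y \<in> carrier V; z \<in> carrier V\<rbrakk>
      \<Longrightarrow> ip (x \<oplus>\<^bsub>V\<^esub> y) z = ip x z + ip y z"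
    and ip_smult: "\<lbrakk>x \<in> carrier V; z \<in> carrier V\<rbrakk> \<Longrightarrow> ip (t \<odot>\<^bsub>V\<^esub> x) z = t * ip x z"
    and ip_cnj: "\<lbrakk>x \<in> carrier V; y \<in> carrier V\<rbrakk> \<Longrightarrow> ip y x = cnj (ip x y)"
    and ip_pos: "\<lbrakk>x \<in> carrier V; x \<noteq> \<zero>\<^bsub>V\<^esub>\<rbrakk> \<Longrightarrow> Re (ip x x) > 0"
    and complete: "\<lbrakk>\<forall>n. s n \<in> carrier V;
        \<forall>e>0. \<exists>k. \<forall>m\<ge>k. \<forall>n\<ge>k. sqrt (Re (ip (s m \<ominus>\<^bsub>V\<^esub> s n) (s m \<ominus>\<^bsub>V\<^esub> s n))) < e\<rbrakk>
      \<Longrightarrow> \<exists>l\<in>carrier V. (\<lambda>n. sqrt (Re (ip (s n \<ominus>\<^bsub>V\<^esub> l) (s n \<ominus>\<^bsub>V\<^esub> l)))) \<longlonglongrightarrow> 0"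

definition unitary_rep ::
    "'g monoid \<Rightarrow> (complex, 'h) module \<Rightarrow> ('h \<Rightarrow> 'h \<Rightarrow> complex) \<Rightarrow> ('g \<Rightarrow> 'h \<Rightarrow> 'h) \<Rightarrow> bool" where
  "unitary_rep G V ip \<pi> \<longleftrightarrow> complex_hilbert_space V ip \<and> group_action G (carrier V) \<pi> \<and>
     (\<forall>g\<in>carrier G. \<forall>x\<in>carrier V. \<forall>y\<in>carrier V.
        \<pi> g (x \<oplus>\<^bsub>V\<^esub> y) = \<pi> g x \<oplus>\<^bsub>V\<^esub> \<pi> g y \<and>
        (\<forall>t. \<pi> g (t \<odot>\<^bsub>V\<^esub> x) = t \<odot>\<^bsub>V\<^esub> \<pi> g x) \<and>
        ip (\<pi> g x) (\<pi> g y) = ip x y)"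

text \<open>
  Weak containment of \<open>\<sigma>\<close> in \<open>\<pi>\<close> in the sense of Fell: the diagonal matrix coefficients of \<open>\<sigma>\<close> are
  limits, uniformly on finite (that is, compact) subsets of the discrete group \<open>G\<close>, of finite sums
  of diagonal matrix coefficients of \<open>\<pi>\<close>.
\<close>

definition weakly_contains ::
    "'g monoid \<Rightarrow> (complex, 'h) module \<Rightarrow> ('h \<Rightarrow> 'h \<Rightarrow> complex) \<Rightarrow> ('g \<Rightarrow> 'h \<Rightarrow> 'h) \<Rightarrow>
     (complex, 'k) module \<Rightarrow> ('k \<Rightarrow> 'k \<Rightarrow> complex) \<Rightarrow> ('g \<Rightarrow> 'k \<Rightarrow> 'k) \<Rightarrow> bool" where
  "weakly_contains G V ip \<pi> W ip' \<sigma> \<longleftrightarrow>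
     (\<forall>\<xi>\<in>carrier W. \<forall>F. finite F \<and> F \<subseteq> carrier G \<longrightarrow> (\<forall>e>0. \<exists>\<eta>s. set \<eta>s \<subseteq> carrier V \<and>
        (\<forall>g\<in>F. cmod (ip' (\<sigma> g \<xi>) \<xi> - (\<Sum>\<eta>\<leftarrow>\<eta>s. ip (\<pi> g \<eta>) \<eta>)) < e)))"

definition complex_line :: "(complex, complex) module" where
  "complex_line = \<lparr>carrier = UNIV, monoid.mult = (*), one = 1, ring.zero = 0, ring.add = (+), module.smult = (*)\<rparr>"

definition weakly_contains_trivial ::
    "'g monoid \<Rightarrow> (complex, 'h) module \<Rightarrow> ('h \<Rightarrow> 'h \<Rightarrow> complex) \<Rightarrow> ('g \<Rightarrow> 'h \<Rightarrow> 'h) \<Rightarrow> bool" where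
  "weakly_contains_trivial G V ip \<pi> \<longleftrightarrow>
     weakly_contains G V ip \<pi> complex_line (\<lambda>z w. z * cnj w) (\<lambda>g z. z)"

definition relative_property_T_on :: "'h itself \<Rightarrow> 'g monoid \<Rightarrow> 'g set \<Rightarrow> bool" where
  "relative_property_T_on T G H \<longleftrightarrow>
     (\<forall>(V :: (complex, 'h) module) ip \<pi>.
        unitary_rep G V ip \<pi> \<and> weakly_contains_trivial G V ip \<pi> \<longrightarrow>
        (\<exists>\<xi>\<in>carrier V. \<xi> \<noteq> \<zero>\<^bsub>V\<^esub> \<and> (\<forall>h\<in>H. \<pi> h \<xi> = \<xi>)))"

definition relative_property_T :: "'g monoid \<Rightarrow> 'g set \<Rightarrow> bool" where
  "relative_property_T G H \<longleftrightarrow> relative_property_T_on TYPE(nat \<Rightarrow> complex) G H"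


subsection \<open>Independence of the underlying type\<close>

lemma complex_ring_simps [simp]:
  "carrier complex_ring = UNIV" "a \<otimes>\<^bsub>complex_ring\<^esub> b = a * b" "\<one>\<^bsub>complex_ring\<^esub> = 1"
  "\<zero>\<^bsub>complex_ring\<^esub> = 0" "a \<oplus>\<^bsub>complex_ring\<^esub> b = a + b"
  by (simp_all add: complex_ring_def)


lemma cring_complex_ring: "cring complex_ring"
  by (rule cringI[OF abelian_groupI comm_monoidI])
     (auto simp: algebra_simps intro: exI[of _ "- _"])

lemma complex_line_simps [simp]:
  "carrier complex_line = UNIV" "\<zero>\<^bsub>complex_line\<^esub> = 0" "x \<oplus>\<^bsub>complex_line\<^esub> y = x + y"
  "x \<odot>\<^bsub>complex_line\<^esub> y = x * y"
  by (simp_all add: complex_line_def)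

lemma unitary_rep_complex_line:
  assumes "Group.group G"
  shows "unitary_rep G complex_line (\<lambda>z w. z * cnj w) (\<lambda>g z. z)"
proof -
  have ag: "abelian_group complex_line"
    by (rule abelian_groupI) (auto simp: algebra_simps intro: exI[of _ "- _"])
  have "\<ominus>\<^bsub>complex_line\<^esub> x = - x" for x
    by (rule abelian_group.minus_equality[OF ag]) auto
  then have diff: "x \<ominus>\<^bsub>complex_line\<^esub> y = x - y" for x y
    by (simp add: a_minus_def)
  have md: "module complex_ring complex_line"
    by (rule moduleI[OF cring_complex_ring ag]) (auto simp: algebra_simps)
  have nrm: "sqrt (Re (z * cnj z)) = cmod z" for z
    by (simp add: cmod_def power2_eq_square)
  have hs: "complex_hilbert_space complex_line (\<lambda>z w. z * cnj w)"
  proof (intro complex_hilbert_space.intro md complex_hilbert_space_axioms.intro)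
    fix x :: complex assume "x \<noteq> \<zero>\<^bsub>complex_line\<^esub>"
    then show "Re (x * cnj x) > 0"
      by (simp add: complex_eq_iff) (metis sum_squares_gt_zero_iff)
  next
    fix s :: "nat \<Rightarrow> complex"
    assume "\<forall>e>0. \<exists>k. \<forall>m\<ge>k. \<forall>n\<ge>k. sqrt (Re ((s m \<ominus>\<^bsub>complex_line\<^esub> s n) *
      cnj (s m \<ominus>\<^bsub>complex_line\<^esub> s n))) < e"
    then have "Cauchy s" unfolding nrm diff by (simp add: Cauchy_def dist_norm)
    then obtain l where "s \<longlonglongrightarrow> l" using Cauchy_convergent_iff convergent_def by blast
    then have "(\<lambda>n. cmod (s n - l)) \<longlonglongrightarrow> 0"
      using LIM_zero tendsto_norm_zero by blast
    then show "\<exists>l\<in>carrier complex_line. (\<lambda>n. sqrt (Re ((s n \<ominus>\<^bsub>complex_line\<^esub> l) *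
      cnj (s n \<ominus>\<^bsub>complex_line\<^esub> l)))) \<longlonglongrightarrow> 0"
      unfolding nrm diff by auto
  qed (auto simp: algebra_simps)
  have "group_action G (carrier complex_line) (\<lambda>g z. z)"
    unfolding group_action_def group_hom_def group_hom_axioms_def
  proof (intro conjI)
    show "(\<lambda>g z. z) \<in> hom G (BijGroup (carrier complex_line))"
      by (auto simp: hom_def BijGroup_def Bij_def compose_def fun_eq_iff bij_betw_def inj_on_def)
  qed (simp_all add: assms group_BijGroup)
  then show ?thesis using hs by (simp add: unitary_rep_def)
qed

context complex_hilbert_space
begin

lemma ip_zero_left [simp]: "z \<in> carrier V \<Longrightarrow> ip \<zero>\<^bsub>V\<^esub> z = 0"
  using ip_add[of "\<zero>\<^bsub>V\<^esub>" "\<zero>\<^bsub>V\<^esub>" z] by simp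

lemma ip_add_right:
  "\<lbrakk>x \<in> carrier V; y \<in> carrier V; z \<in> carrier V\<rbrakk> \<Longrightarrow> ip z (x \<oplus>\<^bsub>V\<^esub> y) = ip z x + ip z y"
  using ip_add[of x y z] ip_cnj[of x z] ip_cnj[of y z] ip_cnj[of "x \<oplus>\<^bsub>V\<^esub> y" z] by simp

lemma ip_smult_right:
  "\<lbrakk>x \<in> carrier V; z \<in> carrier V\<rbrakk> \<Longrightarrow> ip z (t \<odot>\<^bsub>V\<^esub> x) = cnj t * ip z x"
  using ip_smult[of x z t] ip_cnj[of x z] ip_cnj[of "t \<odot>\<^bsub>V\<^esub> x" z] smult_closed[of t x] by simp

lemma ip_minus_left: "\<lbrakk>x \<in> carrier V; z \<in> carrier V\<rbrakk> \<Longrightarrow> ip (\<ominus>\<^bsub>V\<^esub> x) z = - ip x z"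
  using ip_add[of x "\<ominus>\<^bsub>V\<^esub> x" z] by (simp add: M.r_neg eq_neg_iff_add_eq_0 add.commute)

lemma ip_diff_left:
  "\<lbrakk>x \<in> carrier V; y \<in> carrier V; z \<in> carrier V\<rbrakk> \<Longrightarrow> ip (x \<ominus>\<^bsub>V\<^esub> y) z = ip x z - ip y z"
  by (simp add: a_minus_def ip_add ip_minus_left)

lemma ip_self: assumes "x \<in> carrier V" shows "ip x x = of_real (Re (ip x x))" "Re (ip x x) \<ge> 0"
proof -
  show "ip x x = of_real (Re (ip x x))"
    using ip_cnj[OF assms assms] by (simp add: complex_eq_iff)
  show "Re (ip x x) \<ge> 0"
    using ip_pos[OF assms] assms by (cases "x = \<zero>\<^bsub>V\<^esub>") auto
qed

lemma cauchy_schwarz: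
  assumes x: "x \<in> carrier V" and y: "y \<in> carrier V"
  shows "cmod (ip x y) \<le> sqrt (Re (ip x x)) * sqrt (Re (ip y y))"
proof (cases "y = \<zero>\<^bsub>V\<^esub>")
  case True
  then show ?thesis using ip_cnj[OF y x] x by simp
next
  case False
  define b where "b = Re (ip y y)"
  have b: "b > 0" "ip y y = of_real b" using ip_pos[OF y False] ip_self[OF y] by (auto simp: b_def)
  define t where "t = - (ip x y / of_real b)"
  have ty: "t \<odot>\<^bsub>V\<^esub> y \<in> carrier V" using y by simp
  have yx: "ip y x = cnj (ip x y)" using ip_cnj[OF x y] .
  have cm: "ip x y * cnj (ip x y) = of_real ((cmod (ip x y))\<^sup>2)"
    by (rule complex_norm_square[symmetric])
  have "ip (x \<oplus>\<^bsub>V\<^esub> t \<odot>\<^bsub>V\<^esub> y) (x \<oplus>\<^bsub>V\<^esub> t \<odot>\<^bsub>V\<^esub> y) =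
      ip x x + cnj t * ip x y + t * ip y x + t * cnj t * ip y y"
    using x y ty by (simp add: ip_add ip_add_right ip_smult ip_smult_right algebra_simps)
  also have "\<dots> = ip x x - (ip x y * cnj (ip x y)) / of_real b"
    using b by (simp add: t_def yx field_simps)
  also have "\<dots> = ip x x - of_real ((cmod (ip x y))\<^sup>2 / b)"
    by (simp only: cm of_real_divide)
  finally have "Re (ip x x) - (cmod (ip x y))\<^sup>2 / b \<ge> 0"
    using ip_self(2)[of "x \<oplus>\<^bsub>V\<^esub> t \<odot>\<^bsub>V\<^esub> y"] x ty by simp
  then have "(cmod (ip x y))\<^sup>2 \<le> Re (ip x x) * b"
    using b by (simp add: field_simps)
  then have "sqrt ((cmod (ip x y))\<^sup>2) \<le> sqrt (Re (ip x x) * b)" by (rule real_sqrt_le_mono)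
  then show ?thesis by (simp add: b_def real_sqrt_mult)
qed

definition perp :: "'h set \<Rightarrow> 'h set" where
  "perp S = {x \<in> carrier V. \<forall>y\<in>S. ip x y = 0}"

lemma perp_closed:
  assumes S: "S \<subseteq> carrier V" and s: "\<And>n::nat. s n \<in> perp S" and l: "l \<in> carrier V"
    and lim: "(\<lambda>n. sqrt (Re (ip (s n \<ominus>\<^bsub>V\<^esub> l) (s n \<ominus>\<^bsub>V\<^esub> l)))) \<longlonglongrightarrow> 0"
  shows "l \<in> perp S"
proof -
  have "ip l y = 0" if y: "y \<in> S" for y
  proof -
    have yV: "y \<in> carrier V" and sV: "\<And>n. s n \<in> carrier V" using S y s by (auto simp: perp_def)
    have "ip (s n \<ominus>\<^bsub>V\<^esub> l) y = - ip l y" for n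
      using s[of n] y yV sV l by (simp add: ip_diff_left perp_def)
    then have "cmod (ip l y) \<le> sqrt (Re (ip (s n \<ominus>\<^bsub>V\<^esub> l) (s n \<ominus>\<^bsub>V\<^esub> l))) * sqrt (Re (ip y y))" for n
      using cauchy_schwarz[of "s n \<ominus>\<^bsub>V\<^esub> l" y] sV l yV by simp
    moreover have "(\<lambda>n. sqrt (Re (ip (s n \<ominus>\<^bsub>V\<^esub> l) (s n \<ominus>\<^bsub>V\<^esub> l))) * sqrt (Re (ip y y)))
        \<longlonglongrightarrow> 0 * sqrt (Re (ip y y))"
      by (intro tendsto_mult lim tendsto_const)
    ultimately have "cmod (ip l y) \<le> 0 * sqrt (Re (ip y y))"
      by (intro LIMSEQ_le_const) auto
    then show ?thesis by simp
  qed
  then show ?thesis using l by (simp add: perp_def)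
qed

lemma perp_props:
  assumes "S \<subseteq> carrier V"
  shows "perp S \<subseteq> carrier V" "\<zero>\<^bsub>V\<^esub> \<in> perp S"
    "\<And>x y. \<lbrakk>x \<in> perp S; y \<in> perp S\<rbrakk> \<Longrightarrow> x \<oplus>\<^bsub>V\<^esub> y \<in> perp S"
    "\<And>x t. x \<in> perp S \<Longrightarrow> t \<odot>\<^bsub>V\<^esub> x \<in> perp S"
    "\<And>x. x \<in> perp S \<Longrightarrow> \<ominus>\<^bsub>V\<^esub> x \<in> perp S"
  using assms by (auto simp: perp_def ip_add ip_smult ip_minus_left subset_iff)

end

lemma unitary_repD:
  assumes "unitary_rep G V ip \<pi>"
  shows "complex_hilbert_space V ip" "group_action G (carrier V) \<pi>"
    "\<And>g x y. \<lbrakk>g \<in> carrier G; x \<in> carrier V; y \<in> carrier V\<rbrakk> \<Longrightarrow> \<pi> g (x \<oplus>\<^bsub>V\<^esub> y) = \<pi> g x \<oplus>\<^bsub>V\<^esub> \<pi> g y"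
    "\<And>g x t. \<lbrakk>g \<in> carrier G; x \<in> carrier V\<rbrakk> \<Longrightarrow> \<pi> g (t \<odot>\<^bsub>V\<^esub> x) = t \<odot>\<^bsub>V\<^esub> \<pi> g x"
    "\<And>g x y. \<lbrakk>g \<in> carrier G; x \<in> carrier V; y \<in> carrier V\<rbrakk> \<Longrightarrow> ip (\<pi> g x) (\<pi> g y) = ip x y"
    "\<And>g x. \<lbrakk>g \<in> carrier G; x \<in> carrier V\<rbrakk> \<Longrightarrow> \<pi> g x \<in> carrier V"
  using assms group_action.element_image[of G "carrier V" \<pi>] by (auto simp: unitary_rep_def)

text \<open>
  For a countable group it makes no difference on which type the Hilbert spaces live: a
  representation weakly containing the trivial one has a separable subrepresentation with the same
  property, and a separable Hilbert space embeds into sequences.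
\<close>

proposition relative_property_T_any_type:
  assumes G: "Group.group G" and cG: "countable (carrier G)" and HG: "H \<subseteq> carrier G"
    and T: "relative_property_T G H"
  shows "relative_property_T_on TYPE('h) G H"
  unfolding relative_property_T_on_def
proof (intro allI impI, elim conjE)
  fix V :: "(complex, 'h) module" and ip :: "'h \<Rightarrow> 'h \<Rightarrow> complex" and \<pi> :: "'a \<Rightarrow> 'h \<Rightarrow> 'h"
  assume U: "unitary_rep G V ip \<pi>" and W: "weakly_contains_trivial G V ip \<pi>"
  interpret G: Group.group G by fact
  interpret complex_hilbert_space V ip using unitary_repD(1)[OF U] .
  interpret A: group_action G "carrier V" \<pi> using unitary_repD(2)[OF U] .
  note pi_add = unitary_repD(3)[OF U] and pi_smult = unitary_repD(4)[OF U]
    and pi_ip = unitary_repD(5)[OF U] and pi_closed = unitary_repD(6)[OF U]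
  have pi_mult: "\<pi> (g \<otimes>\<^bsub>G\<^esub> h) x = \<pi> g (\<pi> h x)"
    if "g \<in> carrier G" "h \<in> carrier G" "x \<in> carrier V" for g h x
    using A.composition_rule[OF that(3,1,2)] .
  have pi_one: "\<pi> \<one>\<^bsub>G\<^esub> x = x" if "x \<in> carrier V" for x
    using A.id_eq_one that by (metis restrict_apply')
  have pi_adj: "ip (\<pi> g x) y = ip x (\<pi> (inv\<^bsub>G\<^esub> g) y)"
    if "g \<in> carrier G" "x \<in> carrier V" "y \<in> carrier V" for g x y
  proof -
    have "y = \<pi> g (\<pi> (inv\<^bsub>G\<^esub> g) y)"
      using pi_mult[of g "inv\<^bsub>G\<^esub> g" y] pi_one that by simp
    then show ?thesis using pi_ip[of g x "\<pi> (inv\<^bsub>G\<^esub> g) y"] pi_closed that by simp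
  qed

  text \<open>A countable invariant set of vectors witnessing weak containment.\<close>
  have "\<exists>\<eta>s. set \<eta>s \<subseteq> carrier V \<and>
      (\<forall>g\<in>F. cmod (1 - (\<Sum>\<eta>\<leftarrow>\<eta>s. ip (\<pi> g \<eta>) \<eta>)) < 1 / real (Suc n))"
    if "finite F" "F \<subseteq> carrier G" for F n
  proof -
    have "1 / real (Suc n) > 0" by simp
    then show ?thesis
      using W[unfolded weakly_contains_trivial_def weakly_contains_def, rule_format,
          of 1 F "1 / real (Suc n)"] that
      by (simp del: of_nat_Suc)
  qed
  then obtain E where E: "\<And>F n. \<lbrakk>finite F; F \<subseteq> carrier G\<rbrakk> \<Longrightarrow> set (E F n) \<subseteq> carrier V"
    "\<And>F n g. \<lbrakk>finite F; F \<subseteq> carrier G; g \<in> F\<rbrakk> \<Longrightarrow>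
       cmod (1 - (\<Sum>\<eta>\<leftarrow>E F n. ip (\<pi> g \<eta>) \<eta>)) < 1 / real (Suc n)"
    by metis
  define Fs where "Fs = {F. finite F \<and> F \<subseteq> carrier G}"
  have cFs: "countable Fs"
    unfolding Fs_def using countable_Collect_finite_subset[OF cG] by (simp add: conj_commute)
  define S0 where "S0 = insert \<zero>\<^bsub>V\<^esub> (\<Union>F\<in>Fs. \<Union>n. set (E F n))"
  define S where "S = (\<Union>g\<in>carrier G. \<pi> g ` S0)"
  have S0V: "S0 \<subseteq> carrier V" using E(1) by (auto simp: S0_def Fs_def)
  then have SV: "S \<subseteq> carrier V" using pi_closed by (auto simp: S_def)
  have "countable S0" unfolding S0_def
    by (intro countable_insert countable_UN cFs) (auto intro: countable_finite)
  then have cS: "countable S" unfolding S_def by (intro countable_UN cG) auto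
  have S0S: "S0 \<subseteq> S" using pi_one S0V G.one_closed by (force simp: S_def)
  have Sne: "S \<noteq> {}" using S0S by (auto simp: S0_def)
  have Sinv: "\<pi> g x \<in> S" if g: "g \<in> carrier G" and x: "x \<in> S" for g x
  proof -
    obtain h y where hy: "h \<in> carrier G" "y \<in> S0" "x = \<pi> h y" using x by (auto simp: S_def)
    then have "\<pi> g x = \<pi> (g \<otimes>\<^bsub>G\<^esub> h) y" using pi_mult g S0V by auto
    then show ?thesis using hy g by (auto simp: S_def)
  qed
  have perp_inv: "\<pi> g x \<in> perp B"
    if B: "B \<subseteq> carrier V" "\<And>g y. \<lbrakk>g \<in> carrier G; y \<in> B\<rbrakk> \<Longrightarrow> \<pi> g y \<in> B"
      and g: "g \<in> carrier G" and x: "x \<in> perp B" for B g x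
    using B g x by (auto simp: perp_def pi_closed pi_adj subset_iff)

  text \<open>The closed invariant subspace \<open>K\<close> spanned by \<open>S\<close>, embedded into sequences by \<open>j\<close>.\<close>
  define K where "K = perp (perp S)"
  have PV: "perp S \<subseteq> carrier V" by (auto simp: perp_def)
  note K = perp_props[OF PV, folded K_def]
  have SK: "S \<subseteq> K"
    using SV by (auto simp: K_def perp_def subset_iff) (metis complex_cnj_zero ip_cnj)
  have Kinv: "\<pi> g x \<in> K" if "g \<in> carrier G" "x \<in> K" for g x
    using that perp_inv[OF PV perp_inv[OF SV Sinv]] by (simp add: K_def)
  define s where "s = from_nat_into S"
  have s: "range s = S" using range_from_nat_into[OF Sne cS] by (simp add: s_def)
  have sV: "s n \<in> carrier V" for n using s SV by blast
  define j where "j = (\<lambda>x n. ip x (s n))"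
  have j_zero: "j \<zero>\<^bsub>V\<^esub> = (\<lambda>n. 0)" by (simp add: j_def sV)
  have j_add: "j (x \<oplus>\<^bsub>V\<^esub> y) = (\<lambda>n. j x n + j y n)" if "x \<in> K" "y \<in> K" for x y
    using that K(1) by (simp add: j_def sV ip_add subset_iff)
  have j_smult: "j (t \<odot>\<^bsub>V\<^esub> x) = (\<lambda>n. t * j x n)" if "x \<in> K" for x t
    using that K(1) by (simp add: j_def sV ip_smult subset_iff)
  have j_minus: "j (\<ominus>\<^bsub>V\<^esub> x) = (\<lambda>n. - j x n)" if "x \<in> K" for x
    using that K(1) by (simp add: j_def sV ip_minus_left subset_iff)
  have j_ker: "x = \<zero>\<^bsub>V\<^esub>" if x: "x \<in> K" and "j x = (\<lambda>n. 0)" for x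
  proof (rule ccontr)
    assume "x \<noteq> \<zero>\<^bsub>V\<^esub>"
    have xV: "x \<in> carrier V" using x K(1) by blast
    have "x \<in> perp S" using that xV s by (force simp: perp_def j_def fun_eq_iff)
    then have "ip x x = 0" using x by (auto simp: K_def perp_def)
    then show False using ip_pos[OF xV \<open>x \<noteq> \<zero>\<^bsub>V\<^esub>\<close>] by simp
  qed
  have inj: "inj_on j K"
  proof (rule inj_onI)
    fix x y assume xy: "x \<in> K" "y \<in> K" "j x = j y"
    then have V: "x \<in> carrier V" "y \<in> carrier V" using K(1) by auto
    have "j (x \<oplus>\<^bsub>V\<^esub> \<ominus>\<^bsub>V\<^esub> y) = (\<lambda>n. 0)" using xy K(5) by (simp add: j_add j_minus)
    then have "x \<oplus>\<^bsub>V\<^esub> \<ominus>\<^bsub>V\<^esub> y = \<zero>\<^bsub>V\<^esub>" using j_ker xy K(3,5) by blast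
    then show "x = y" using V M.minus_equality[of x "\<ominus>\<^bsub>V\<^esub> y"] by simp
  qed
  define k where "k = inv_into K j"
  have kj [simp]: "k (j x) = x" if "x \<in> K" for x using inj that by (simp add: k_def)

  define V' :: "(complex, nat \<Rightarrow> complex) module" where "V' = \<lparr>carrier = j ` K, monoid.mult = (\<lambda>a b n. 0), one = (\<lambda>n. 0),
      ring.zero = (\<lambda>n. 0), ring.add = (\<lambda>a b n. a n + b n), module.smult = (\<lambda>t a n. t * a n)\<rparr>"
  define ip' where "ip' = (\<lambda>a b. ip (k a) (k b))"
  define \<pi>' where "\<pi>' = (\<lambda>g. \<lambda>a\<in>j ` K. j (\<pi> g (k a)))"
  have V' [simp]: "carrier V' = j ` K" "\<zero>\<^bsub>V'\<^esub> = (\<lambda>n. 0)" "a \<oplus>\<^bsub>V'\<^esub> b = (\<lambda>n. a n + b n)"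
    "t \<odot>\<^bsub>V'\<^esub> a = (\<lambda>n. t * a n)" for a b t
    by (simp_all add: V'_def)
  have jK: "(\<lambda>n. 0) \<in> j ` K" "\<And>a b. \<lbrakk>a \<in> j ` K; b \<in> j ` K\<rbrakk> \<Longrightarrow> (\<lambda>n. a n + b n) \<in> j ` K"
    "\<And>t a. a \<in> j ` K \<Longrightarrow> (\<lambda>n. t * a n) \<in> j ` K" "\<And>a. a \<in> j ` K \<Longrightarrow> (\<lambda>n. - a n) \<in> j ` K"
    by (auto simp: K simp flip: j_zero j_add j_smult j_minus)
  have ag: "abelian_group V'"
  proof (rule abelian_groupI)
    fix a assume "a \<in> carrier V'"
    then show "\<exists>b\<in>carrier V'. b \<oplus>\<^bsub>V'\<^esub> a = \<zero>\<^bsub>V'\<^esub>"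
      by (intro bexI[of _ "\<lambda>n. - a n"]) (simp_all add: jK)
  qed (simp_all add: jK algebra_simps)
  have md: "module complex_ring V'"
    by (rule moduleI[OF cring_complex_ring ag]) (auto simp: jK algebra_simps)
  have neg': "\<ominus>\<^bsub>V'\<^esub> a = (\<lambda>n. - a n)" if "a \<in> j ` K" for a
    by (rule abelian_group.minus_equality[OF ag]) (use that jK in auto)
  have diff': "j x \<ominus>\<^bsub>V'\<^esub> j y = j (x \<ominus>\<^bsub>V\<^esub> y)" if "x \<in> K" "y \<in> K" for x y
    using that K(5) by (simp add: a_minus_def neg' j_add j_minus)
  have Kdiff: "x \<ominus>\<^bsub>V\<^esub> y \<in> K" if "x \<in> K" "y \<in> K" for x y
    using that K(3,5) by (simp add: a_minus_def)
  have KV: "x \<in> carrier V" if "x \<in> K" for x using K(1) that by blast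
  have hs: "complex_hilbert_space V' ip'"
  proof (intro complex_hilbert_space.intro md complex_hilbert_space_axioms.intro)
    fix a b c assume "a \<in> carrier V'" "b \<in> carrier V'" "c \<in> carrier V'"
    then show "ip' (a \<oplus>\<^bsub>V'\<^esub> b) c = ip' a c + ip' b c"
      by (auto simp: ip'_def K KV ip_add simp flip: j_add)
  next
    fix a c t assume "a \<in> carrier V'" "c \<in> carrier V'"
    then show "ip' (t \<odot>\<^bsub>V'\<^esub> a) c = t * ip' a c"
      by (auto simp: ip'_def K KV ip_smult simp flip: j_smult)
  next
    fix a b assume "a \<in> carrier V'" "b \<in> carrier V'"
    then have "k a \<in> carrier V" "k b \<in> carrier V" using KV by auto
    then show "ip' b a = cnj (ip' a b)" unfolding ip'_def by (rule ip_cnj)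
  next
    fix a assume "a \<in> carrier V'" "a \<noteq> \<zero>\<^bsub>V'\<^esub>"
    then obtain x where "x \<in> K" "a = j x" "x \<noteq> \<zero>\<^bsub>V\<^esub>" using j_zero by auto
    then show "Re (ip' a a) > 0" using ip_pos[OF KV] by (simp add: ip'_def)
  next
    fix f :: "nat \<Rightarrow> nat \<Rightarrow> complex" assume f: "\<forall>n. f n \<in> carrier V'" and C: "\<forall>e>0. \<exists>k. \<forall>m\<ge>k. \<forall>n\<ge>k.
      sqrt (Re (ip' (f m \<ominus>\<^bsub>V'\<^esub> f n) (f m \<ominus>\<^bsub>V'\<^esub> f n))) < e"
    define x where "x n = k (f n)" for n
    have x: "x n \<in> K" "f n = j (x n)" for n
      using f[rule_format, of n] by (auto simp: x_def)
    have "\<exists>l\<in>carrier V. (\<lambda>n. sqrt (Re (ip (x n \<ominus>\<^bsub>V\<^esub> l) (x n \<ominus>\<^bsub>V\<^esub> l)))) \<longlonglongrightarrow> 0"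
      by (rule complete) (use x C KV in \<open>simp_all add: diff' ip'_def Kdiff\<close>)
    then obtain l where l: "l \<in> carrier V"
      "(\<lambda>n. sqrt (Re (ip (x n \<ominus>\<^bsub>V\<^esub> l) (x n \<ominus>\<^bsub>V\<^esub> l)))) \<longlonglongrightarrow> 0" by blast
    then have "l \<in> K" using perp_closed[OF PV x(1)[unfolded K_def]] by (simp add: K_def)
    then show "\<exists>l\<in>carrier V'. (\<lambda>n. sqrt (Re (ip' (f n \<ominus>\<^bsub>V'\<^esub> l) (f n \<ominus>\<^bsub>V'\<^esub> l)))) \<longlonglongrightarrow> 0"
      using l x by (intro bexI[of _ "j l"]) (simp_all add: diff' ip'_def Kdiff)
  qed
  have pi'_j: "\<pi>' g (j x) = j (\<pi> g x)" if "x \<in> K" for g x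
    using that by (simp add: \<pi>'_def)
  have pi'_comp: "\<pi>' (g \<otimes>\<^bsub>G\<^esub> h) = compose (j ` K) (\<pi>' g) (\<pi>' h)"
    if "g \<in> carrier G" "h \<in> carrier G" for g h
    using that by (auto simp: \<pi>'_def compose_def fun_eq_iff Kinv pi_mult KV)
  have pi'_Bij: "\<pi>' g \<in> Bij (j ` K)" if g: "g \<in> carrier G" for g
  proof -
    have "bij_betw (\<pi>' g) (j ` K) (j ` K)"
    proof (rule bij_betw_byWitness[where f' = "\<pi>' (inv\<^bsub>G\<^esub> g)"])
      show "\<forall>a\<in>j ` K. \<pi>' (inv\<^bsub>G\<^esub> g) (\<pi>' g a) = a" "\<forall>a\<in>j ` K. \<pi>' g (\<pi>' (inv\<^bsub>G\<^esub> g) a) = a"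
        using g by (auto simp: pi'_j Kinv KV pi_one simp flip: pi_mult)
      show "\<pi>' g ` j ` K \<subseteq> j ` K" "\<pi>' (inv\<^bsub>G\<^esub> g) ` j ` K \<subseteq> j ` K"
        using g by (auto simp: pi'_j Kinv)
    qed
    then show ?thesis by (simp add: Bij_def \<pi>'_def)
  qed
  have "group_action G (carrier V') \<pi>'"
    unfolding group_action_def group_hom_def group_hom_axioms_def
  proof (intro conjI G group_BijGroup)
    show "\<pi>' \<in> hom G (BijGroup (carrier V'))"
      using pi'_Bij pi'_comp by (auto simp: hom_def BijGroup_def)
  qed
  then have U': "unitary_rep G V' ip' \<pi>'"
    unfolding unitary_rep_def
    using hs by (auto simp: pi'_j K Kinv KV pi_add pi_smult pi_ip ip'_def simp flip: j_add j_smult)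
  have W': "weakly_contains_trivial G V' ip' \<pi>'"
    unfolding weakly_contains_trivial_def weakly_contains_def
  proof (intro ballI allI impI)
    fix z :: complex and F and e :: real assume F: "finite F \<and> F \<subseteq> carrier G" and e: "e > 0"
    obtain n where "(cmod z)\<^sup>2 / e < real n" using reals_Archimedean2 by blast
    then have n: "(cmod z)\<^sup>2 * (1 / real (Suc n)) < e"
      using e by (simp add: field_simps)
    define \<eta>s where "\<eta>s = map (\<lambda>\<eta>. j (z \<odot>\<^bsub>V\<^esub> \<eta>)) (E F n)"
    have EK: "\<eta> \<in> K" if "\<eta> \<in> set (E F n)" for \<eta>
    proof -
      have "\<eta> \<in> S0" using that F by (auto simp: S0_def Fs_def)
      then show ?thesis using S0S SK by blast
    qed
    have "cmod (z * cnj z - (\<Sum>\<eta>\<leftarrow>\<eta>s. ip' (\<pi>' g \<eta>) \<eta>)) < e" if g: "g \<in> F" for g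
    proof -
      have gG: "g \<in> carrier G" using g F by auto
      have "(\<Sum>\<eta>\<leftarrow>\<eta>s. ip' (\<pi>' g \<eta>) \<eta>) = (\<Sum>\<eta>\<leftarrow>E F n. (z * cnj z) * ip (\<pi> g \<eta>) \<eta>)"
        unfolding \<eta>s_def map_map
        by (intro arg_cong[where f = sum_list] map_cong refl)
           (simp add: EK K gG pi'_j Kinv KV ip'_def pi_smult ip_smult ip_smult_right)
      then have "z * cnj z - (\<Sum>\<eta>\<leftarrow>\<eta>s. ip' (\<pi>' g \<eta>) \<eta>) =
          (z * cnj z) * (1 - (\<Sum>\<eta>\<leftarrow>E F n. ip (\<pi> g \<eta>) \<eta>))"
        by (simp add: sum_list_const_mult right_diff_distrib)
      then have "cmod (z * cnj z - (\<Sum>\<eta>\<leftarrow>\<eta>s. ip' (\<pi>' g \<eta>) \<eta>)) =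
          (cmod z)\<^sup>2 * cmod (1 - (\<Sum>\<eta>\<leftarrow>E F n. ip (\<pi> g \<eta>) \<eta>))"
        by (simp add: norm_mult power2_eq_square)
      also have "\<dots> \<le> (cmod z)\<^sup>2 * (1 / real (Suc n))"
        using E(2)[of F g n] F g by (intro mult_left_mono) auto
      finally show ?thesis using n by simp
    qed
    moreover have "set \<eta>s \<subseteq> carrier V'" using EK K(4) by (auto simp: \<eta>s_def)
    ultimately show "\<exists>\<eta>s. set \<eta>s \<subseteq> carrier V' \<and>
        (\<forall>g\<in>F. cmod (z * cnj z - (\<Sum>\<eta>\<leftarrow>\<eta>s. ip' (\<pi>' g \<eta>) \<eta>)) < e)" by blast
  qed
  obtain a where a: "a \<in> carrier V'" "a \<noteq> \<zero>\<^bsub>V'\<^esub>" "\<forall>h\<in>H. \<pi>' h a = a"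
    using T U' W' unfolding relative_property_T_def relative_property_T_on_def by blast
  then obtain x where x: "x \<in> K" "a = j x" by auto
  have "\<pi> h x = x" if "h \<in> H" for h
    using a(3) that x HG Kinv[of h x] inj by (auto simp: pi'_j dest: inj_onD)
  then show "\<exists>\<xi>\<in>carrier V. \<xi> \<noteq> \<zero>\<^bsub>V\<^esub> \<and> (\<forall>h\<in>H. \<pi> h \<xi> = \<xi>)"
    using x a(2) j_zero KV by (intro bexI[of _ x]) auto
qed

end

theory Submission
  imports Defs
begin

text \<open>
  An orbit equivalence is encoded by the cocycle \<open>w\<close> with \<open>\<theta> (g x) = w g x \<cdot> \<theta> x\<close>.  The group \<open>\<Gamma>\<close> acts on
  \<open>X \<times> X \<times> \<Lambda>\<close> by \<open>g (x, y, l) = (g x, g y, w g x \<cdot> l \<cdot> (w g y)\<^sup>-\<^sup>1)\<close>.  The normalized indicator functions of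
  \<open>{(x, y, 1). x and y have the same image in X\<^sub>n}\<close> are almost invariant, because \<open>w g\<close> is almost constant on
  the fibres over \<open>X\<^sub>n\<close> for large \<open>n\<close>.  By relative property (T) one of them is close to a
  \<open>\<Gamma>\<^sub>0\<close>-invariant vector, hence on some fibre \<open>w h\<close> is, uniformly in all \<open>h \<in> \<Gamma>\<^sub>0\<close> stabilizing the fibre,
  close to a constant \<open>\<delta> h\<close>.  A level set of the invariant vector provides a map \<open>\<psi>\<close> into \<open>\<Lambda>\<close> that
  turns \<open>w h\<close> into the constant \<open>\<delta> h\<close>.  Since \<open>\<Gamma>/\<Gamma>\<^sub>0\<close> is finitely generated, passing to a smaller
  fibre makes the untwisted cocycle constant for all \<open>g\<close> in the finite index stabilizer of that fibre.
  Then \<open>x \<mapsto> (\<psi> x)\<^sup>-\<^sup>1 \<cdot> \<theta> x\<close> conjugates the two actions on the fibre, and it is extended to all of \<open>Y\<close>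
  inside the full group of \<open>\<Lambda>\<close>.
\<close>

subsection \<open>Almost invariant vectors and relative property (T)\<close>

text \<open>For a single \<open>g\<close> the cocycle is nearly constant on deep fibres anyway; the
  obstacle is that the depth depends on \<open>g\<close>. Relative property (T) gives one depth for
  all of \<open>\<Gamma>\<^sub>0\<close>. The second copy of \<open>X\<close> allows
  \<open>w h x\<close> to be compared with \<open>w h y\<close> before any candidate for the
  constant value is known. Off \<open>\<Gamma>\<^sub>0\<close> there is no such uniformity, so going
  deeper can serve only finitely many elements, one from each generating coset of
  \<open>\<Gamma>\<^sub>0\<close>; normality then lets ergodicity of \<open>\<Gamma>\<^sub>0\<close>
  turn their near constancy into constancy. Two facts that look algebraic come from measure: the
  homomorphism obtained is injective because \<open>\<psi>\<close> takes one value on more than half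
  of the fibre, and its image has finite index because translates of the image fibre by coset
  representatives are disjoint sets of equal positive measure in a probability space.\<close>

context complex_hilbert_space
begin

lemma ip_diff_right:
  "\<lbrakk>x \<in> carrier V; y \<in> carrier V; z \<in> carrier V\<rbrakk> \<Longrightarrow> ip z (x \<ominus>\<^bsub>V\<^esub> y) = ip z x - ip z y"
  using ip_diff_left[of x y z] ip_cnj[of x z] ip_cnj[of y z] ip_cnj[of "x \<ominus>\<^bsub>V\<^esub> y" z] by simp

lemma ip_zero_right [simp]: "z \<in> carrier V \<Longrightarrow> ip z \<zero>\<^bsub>V\<^esub> = 0"
  using ip_cnj[of "\<zero>\<^bsub>V\<^esub>" z] by simp

lemma ip_eq_zeroD: "\<lbrakk>x \<in> carrier V; ip x x = 0\<rbrakk> \<Longrightarrow> x = \<zero>\<^bsub>V\<^esub>"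
  using ip_pos[of x] by force

lemma norm_diff_expand:
  assumes "x \<in> carrier V" "y \<in> carrier V"
  shows "Re (ip (x \<ominus>\<^bsub>V\<^esub> y) (x \<ominus>\<^bsub>V\<^esub> y)) = Re (ip x x) + Re (ip y y) - 2 * Re (ip x y)"
  using assms ip_cnj[OF assms] by (simp add: ip_diff_left ip_diff_right)

lemma diff_eq_zeroD: "\<lbrakk>x \<in> carrier V; y \<in> carrier V; x \<ominus>\<^bsub>V\<^esub> y = \<zero>\<^bsub>V\<^esub>\<rbrakk> \<Longrightarrow> x = y"
  by (metis M.minus_equality M.minus_minus M.a_inv_closed M.minus_eq M.add.m_comm)

text \<open>This is the parallelogram law for \<open>x - a\<close> and \<open>x - b\<close>, whose
  sum is twice \<open>x - h\<close>. If \<open>a\<close> and \<open>b\<close> nearly minimize the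
  distance from \<open>x\<close> over a subspace, the midpoint cannot do much better, which forces
  \<open>a\<close> and \<open>b\<close> close together.\<close>

lemma parallelogram_midpoint:
  assumes x: "x \<in> carrier V" and a: "a \<in> carrier V" and b: "b \<in> carrier V"
  defines "h \<equiv> (1/2) \<odot>\<^bsub>V\<^esub> (a \<oplus>\<^bsub>V\<^esub> b)"
  shows "Re (ip (a \<ominus>\<^bsub>V\<^esub> b) (a \<ominus>\<^bsub>V\<^esub> b)) =
    2 * Re (ip (x \<ominus>\<^bsub>V\<^esub> a) (x \<ominus>\<^bsub>V\<^esub> a)) + 2 * Re (ip (x \<ominus>\<^bsub>V\<^esub> b) (x \<ominus>\<^bsub>V\<^esub> b))
    - 4 * Re (ip (x \<ominus>\<^bsub>V\<^esub> h) (x \<ominus>\<^bsub>V\<^esub> h))"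
proof -
  have h: "h \<in> carrier V" using a b by (simp add: h_def)
  have 1: "ip h h = (1/4) * (ip a a + ip b b + ip a b + ip b a)"
    using a b by (simp add: h_def ip_smult ip_smult_right ip_add ip_add_right algebra_simps)
  have 2: "ip x h = (1/2) * (ip x a + ip x b)"
    using x a b by (simp add: h_def ip_smult_right ip_add_right algebra_simps)
  show ?thesis
    unfolding norm_diff_expand[OF a b] norm_diff_expand[OF x a] norm_diff_expand[OF x b]
      norm_diff_expand[OF x h] 1 2
    using ip_cnj[OF a b] by (simp add: field_simps)
qed

text \<open>\<open>perp S\<close> is complete, so a minimizing sequence for the distance from
  \<open>x\<close> converges in it; minimality then kills the inner product of \<open>x - p\<close>
  with every vector of the subspace.\<close>

lemma orthogonal_projection:
  assumes S: "S \<subseteq> carrier V" and x: "x \<in> carrier V"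
  obtains p where "p \<in> perp S" "x \<ominus>\<^bsub>V\<^esub> p \<in> perp (perp S)"
proof -
  let ?N = "\<lambda>v. Re (ip v v)"
  note K = perp_props[OF S]
  have KV: "k \<in> carrier V" if "k \<in> perp S" for k using K(1) that by blast
  define D where "D = (\<lambda>k. ?N (x \<ominus>\<^bsub>V\<^esub> k)) ` perp S"
  define d where "d = Inf D"
  have bdd: "bdd_below D"
    by (rule bdd_belowI[of _ 0]) (use x KV in \<open>auto simp: D_def ip_self(2)\<close>)
  have D: "D \<noteq> {}" using K(2) by (auto simp: D_def)
  have dle: "d \<le> ?N (x \<ominus>\<^bsub>V\<^esub> k)" if "k \<in> perp S" for k
    unfolding d_def by (rule cInf_lower[OF _ bdd]) (use that in \<open>auto simp: D_def\<close>)
  have "\<exists>k\<in>perp S. ?N (x \<ominus>\<^bsub>V\<^esub> k) < d + inverse (real (Suc n))" for n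
  proof -
    have "Inf D < d + inverse (real (Suc n))" by (simp add: d_def)
    from cInf_lessD[OF D this] show ?thesis by (auto simp: D_def)
  qed
  then obtain s where s: "\<And>n. s n \<in> perp S"
    "\<And>n. ?N (x \<ominus>\<^bsub>V\<^esub> s n) < d + inverse (real (Suc n))" by metis
  have sV: "s n \<in> carrier V" for n using s(1) KV by blast
  have cau: "?N (s m \<ominus>\<^bsub>V\<^esub> s n) < 2 * inverse (real (Suc m)) + 2 * inverse (real (Suc n))" for m n
  proof -
    have "(1/2) \<odot>\<^bsub>V\<^esub> (s m \<oplus>\<^bsub>V\<^esub> s n) \<in> perp S" by (rule K(4)[OF K(3)[OF s(1) s(1)]])
    from dle[OF this] show ?thesis
      using parallelogram_midpoint[OF x sV sV, of m n] s(2)[of m] s(2)[of n] by argo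
  qed
  have "\<exists>l\<in>carrier V. (\<lambda>n. sqrt (?N (s n \<ominus>\<^bsub>V\<^esub> l))) \<longlonglongrightarrow> 0"
  proof (rule complete)
    show "\<forall>e>0. \<exists>k. \<forall>m\<ge>k. \<forall>n\<ge>k. sqrt (?N (s m \<ominus>\<^bsub>V\<^esub> s n)) < e"
    proof (intro allI impI)
      fix e :: real assume e: "e > 0"
      obtain k where k: "inverse (real (Suc k)) < e\<^sup>2 / 4"
        using reals_Archimedean[of "e\<^sup>2 / 4"] e by auto
      have "sqrt (?N (s m \<ominus>\<^bsub>V\<^esub> s n)) < e" if "m \<ge> k" "n \<ge> k" for m n
      proof -
        have "inverse (real (Suc m)) \<le> inverse (real (Suc k))" "inverse (real (Suc n)) \<le> inverse (real (Suc k))"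
          using that by (auto intro!: le_imp_inverse_le)
        then have "?N (s m \<ominus>\<^bsub>V\<^esub> s n) < e\<^sup>2" using cau[of m n] k by linarith
        then show ?thesis using e real_less_lsqrt by simp
      qed
      then show "\<exists>k. \<forall>m\<ge>k. \<forall>n\<ge>k. sqrt (?N (s m \<ominus>\<^bsub>V\<^esub> s n)) < e" by blast
    qed
  qed (use sV in auto)
  then obtain l where l: "l \<in> carrier V" and lim: "(\<lambda>n. sqrt (?N (s n \<ominus>\<^bsub>V\<^esub> l))) \<longlonglongrightarrow> 0" by blast
  have lK: "l \<in> perp S" using perp_closed[OF S s(1) l lim] .
  have "ip (x \<ominus>\<^bsub>V\<^esub> l) k = 0" if k: "k \<in> perp S" for k
  proof (cases "k = \<zero>\<^bsub>V\<^esub>")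
    case True then show ?thesis using x l by simp
  next
    case False
    note kV = KV[OF k]
    define b where "b = ?N k"
    have b: "b > 0" "ip k k = of_real b"
      using ip_pos[OF kV False] ip_self[OF kV] by (auto simp: b_def)
    \<comment> \<open>First variation, carried out at \<open>s n\<close> with an error term instead
      of at the limit: subtracting from \<open>y\<close> its projection on \<open>k\<close> lowers
      the squared norm by \<open>|ip y k|^2 / b\<close>, while the squared norm of \<open>y\<close>
      exceeds the infimum \<open>d\<close> by less than \<open>inverse (Suc n)\<close>.\<close>
    have var: "(cmod (ip (x \<ominus>\<^bsub>V\<^esub> s n) k))\<^sup>2 \<le> b * inverse (real (Suc n))" for n
    proof -
      define y where "y = x \<ominus>\<^bsub>V\<^esub> s n"
      have y: "y \<in> carrier V" using x sV by (simp add: y_def)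
      define t where "t = ip y k / of_real b"
      have tk: "t \<odot>\<^bsub>V\<^esub> k \<in> carrier V" using kV by simp
      have "s n \<oplus>\<^bsub>V\<^esub> t \<odot>\<^bsub>V\<^esub> k \<in> perp S" by (rule K(3)[OF s(1) K(4)[OF k]])
      moreover have "x \<ominus>\<^bsub>V\<^esub> (s n \<oplus>\<^bsub>V\<^esub> t \<odot>\<^bsub>V\<^esub> k) = y \<ominus>\<^bsub>V\<^esub> t \<odot>\<^bsub>V\<^esub> k"
        using x sV tk by (simp add: y_def a_minus_def M.minus_add M.a_assoc)
      ultimately have "d \<le> ?N (y \<ominus>\<^bsub>V\<^esub> t \<odot>\<^bsub>V\<^esub> k)" using dle by metis
      also have "\<dots> = ?N y + Re (t * cnj t * ip k k) - 2 * Re (cnj t * ip y k)"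
        unfolding norm_diff_expand[OF y tk] ip_smult[OF kV tk] ip_smult_right[OF kV y]
          ip_smult_right[OF kV kV] by (simp only: mult.assoc)
      also have "t * cnj t * ip k k = of_real ((cmod (ip y k))\<^sup>2 / b)"
        using b complex_norm_square[of "ip y k"] by (simp add: t_def field_simps power2_eq_square)
      also have "cnj t * ip y k = of_real ((cmod (ip y k))\<^sup>2 / b)"
        using b complex_norm_square[of "ip y k"] by (simp add: t_def field_simps power2_eq_square)
      finally have "d \<le> ?N y - (cmod (ip y k))\<^sup>2 / b" by simp
      then have "(cmod (ip y k))\<^sup>2 / b \<le> inverse (real (Suc n))" using s(2)[of n] by (simp add: y_def)
      then show ?thesis using b(1) by (simp add: y_def field_simps)
    qed
    have le: "cmod (ip (x \<ominus>\<^bsub>V\<^esub> l) k) \<le> sqrt (b * inverse (real (Suc n))) + sqrt (?N (s n \<ominus>\<^bsub>V\<^esub> l)) * sqrt b" for n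
    proof -
      have "ip (x \<ominus>\<^bsub>V\<^esub> l) k = ip (x \<ominus>\<^bsub>V\<^esub> s n) k + ip (s n \<ominus>\<^bsub>V\<^esub> l) k"
        using x l sV kV by (simp add: ip_diff_left)
      moreover have "cmod (ip (x \<ominus>\<^bsub>V\<^esub> s n) k) \<le> sqrt (b * inverse (real (Suc n)))"
        using var[of n] by (rule real_le_rsqrt)
      moreover have "cmod (ip (s n \<ominus>\<^bsub>V\<^esub> l) k) \<le> sqrt (?N (s n \<ominus>\<^bsub>V\<^esub> l)) * sqrt b"
        using cauchy_schwarz[of "s n \<ominus>\<^bsub>V\<^esub> l" k] sV l kV by (simp add: b_def)
      ultimately show ?thesis by (metis add_mono norm_triangle_le)
    qed
    have "(\<lambda>n. sqrt (b * inverse (real (Suc n))) + sqrt (?N (s n \<ominus>\<^bsub>V\<^esub> l)) * sqrt b)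
        \<longlonglongrightarrow> sqrt (b * 0) + 0 * sqrt b"
      by (intro tendsto_intros lim LIMSEQ_inverse_real_of_nat)
    then have "cmod (ip (x \<ominus>\<^bsub>V\<^esub> l) k) \<le> sqrt (b * 0) + 0 * sqrt b"
      by (rule LIMSEQ_le_const) (use le in auto)
    then show ?thesis by simp
  qed
  then have "x \<ominus>\<^bsub>V\<^esub> l \<in> perp (perp S)" using x l by (simp add: perp_def)
  with lK show thesis by (rule that)
qed

end

text \<open>The adjoint of \<open>\<pi> g\<close> is \<open>\<pi>\<close> of the inverse, so the
  complement of an invariant set is invariant. The maps are cut down by \<open>restrict\<close>
  because elements of \<open>Bij\<close> must be extensional on the carrier.\<close>

lemma unitary_rep_perp:
  assumes U: "unitary_rep G V ip \<pi>" and S: "S \<subseteq> carrier V"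
    and inv: "\<And>g x. \<lbrakk>g \<in> carrier G; x \<in> S\<rbrakk> \<Longrightarrow> \<pi> g x \<in> S"
  defines "W \<equiv> complex_hilbert_space.perp V ip S"
  shows "unitary_rep G (V\<lparr>carrier := W\<rparr>) ip (\<lambda>g. restrict (\<pi> g) W)"
proof -
  interpret complex_hilbert_space V ip using unitary_repD(1)[OF U] .
  interpret A: group_action G "carrier V" \<pi> using unitary_repD(2)[OF U] .
  interpret G: Group.group G using A.group_hom group_hom.axioms(1) by blast
  note pi = unitary_repD(3-6)[OF U]
  let ?V = "V\<lparr>carrier := W\<rparr>"
  note K = perp_props[OF S, folded W_def]
  have KV: "x \<in> carrier V" if "x \<in> W" for x using K(1) that by blast
  have pi_mult: "\<pi> (g \<otimes>\<^bsub>G\<^esub> h) x = \<pi> g (\<pi> h x)"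
    if "g \<in> carrier G" "h \<in> carrier G" "x \<in> carrier V" for g h x
    using A.composition_rule[OF that(3,1,2)] .
  have pi_one: "\<pi> \<one>\<^bsub>G\<^esub> x = x" if "x \<in> carrier V" for x
    using A.id_eq_one that by (metis restrict_apply')
  have Winv: "\<pi> g x \<in> W" if g: "g \<in> carrier G" and x: "x \<in> W" for g x
  proof -
    have "ip (\<pi> g x) y = 0" if y: "y \<in> S" for y
    proof -
      have "y = \<pi> g (\<pi> (inv\<^bsub>G\<^esub> g) y)"
        using pi_mult[of g "inv\<^bsub>G\<^esub> g" y] pi_one g y S by auto
      then have "ip (\<pi> g x) y = ip x (\<pi> (inv\<^bsub>G\<^esub> g) y)"
        using pi(3)[of g x "\<pi> (inv\<^bsub>G\<^esub> g) y"] g KV[OF x] S y pi(4) by auto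
      then show ?thesis using x inv[of "inv\<^bsub>G\<^esub> g" y] g y by (simp add: W_def perp_def)
    qed
    then show ?thesis using pi(4) g KV[OF x] by (simp add: W_def perp_def)
  qed
  have ag: "abelian_group ?V"
  proof (rule abelian_groupI)
    fix a assume "a \<in> carrier ?V"
    then show "\<exists>b\<in>carrier ?V. b \<oplus>\<^bsub>?V\<^esub> a = \<zero>\<^bsub>?V\<^esub>"
      by (intro bexI[of _ "\<ominus>\<^bsub>V\<^esub> a"]) (simp_all add: K KV M.l_neg)
  qed (use KV K in \<open>auto simp: M.a_ac\<close>)
  have md: "module complex_ring ?V"
    by (rule moduleI[OF cring_complex_ring ag])
      (use KV K smult_l_distr smult_r_distr smult_assoc1 smult_one in auto)
  have neg: "\<ominus>\<^bsub>?V\<^esub> a = \<ominus>\<^bsub>V\<^esub> a" if "a \<in> W" for a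
    by (rule abelian_group.minus_equality[OF ag]) (use that K KV M.l_neg in auto)
  have diff: "x \<ominus>\<^bsub>?V\<^esub> y = x \<ominus>\<^bsub>V\<^esub> y" if "x \<in> W" "y \<in> W" for x y
    using that by (simp add: a_minus_def neg)
  have hs: "complex_hilbert_space ?V ip"
  proof (intro complex_hilbert_space.intro md complex_hilbert_space_axioms.intro)
    fix f :: "nat \<Rightarrow> 'b" assume f: "\<forall>n. f n \<in> carrier ?V" and C: "\<forall>e>0. \<exists>k. \<forall>m\<ge>k. \<forall>n\<ge>k.
      sqrt (Re (ip (f m \<ominus>\<^bsub>?V\<^esub> f n) (f m \<ominus>\<^bsub>?V\<^esub> f n))) < e"
    have f: "f n \<in> W" for n using f by simp
    have "\<exists>l\<in>carrier V. (\<lambda>n. sqrt (Re (ip (f n \<ominus>\<^bsub>V\<^esub> l) (f n \<ominus>\<^bsub>V\<^esub> l)))) \<longlonglongrightarrow> 0"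
      by (rule complete) (use f C KV in \<open>simp_all add: diff\<close>)
    then obtain l where l: "l \<in> carrier V"
      "(\<lambda>n. sqrt (Re (ip (f n \<ominus>\<^bsub>V\<^esub> l) (f n \<ominus>\<^bsub>V\<^esub> l)))) \<longlonglongrightarrow> 0" by blast
    then have "l \<in> W" using perp_closed[OF S f[unfolded W_def]] by (simp add: W_def)
    then show "\<exists>l\<in>carrier ?V. (\<lambda>n. sqrt (Re (ip (f n \<ominus>\<^bsub>?V\<^esub> l) (f n \<ominus>\<^bsub>?V\<^esub> l)))) \<longlonglongrightarrow> 0"
      using l f by (intro bexI[of _ l]) (simp_all add: diff)
  next
    fix x y assume "x \<in> carrier ?V" "y \<in> carrier ?V"
    then show "ip y x = cnj (ip x y)" using KV by (intro ip_cnj) auto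
  next
    fix x assume "x \<in> carrier ?V" "x \<noteq> \<zero>\<^bsub>?V\<^esub>"
    then show "Re (ip x x) > 0" using KV by (intro ip_pos) auto
  qed (simp_all add: KV ip_add ip_smult)
  have pi'_Bij: "restrict (\<pi> g) W \<in> Bij W" if g: "g \<in> carrier G" for g
  proof -
    have "bij_betw (restrict (\<pi> g) W) W W"
    proof (rule bij_betw_byWitness[where f' = "\<pi> (inv\<^bsub>G\<^esub> g)"])
      show "\<forall>a\<in>W. \<pi> (inv\<^bsub>G\<^esub> g) (restrict (\<pi> g) W a) = a"
        "\<forall>a\<in>W. restrict (\<pi> g) W (\<pi> (inv\<^bsub>G\<^esub> g) a) = a"
        using g by (auto simp: Winv KV pi_one simp flip: pi_mult)
      show "restrict (\<pi> g) W ` W \<subseteq> W" "\<pi> (inv\<^bsub>G\<^esub> g) ` W \<subseteq> W"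
        using g by (auto simp: Winv)
    qed
    then show ?thesis by (simp add: Bij_def)
  qed
  have "group_action G (carrier ?V) (\<lambda>g. restrict (\<pi> g) W)"
    unfolding group_action_def group_hom_def group_hom_axioms_def
  proof (intro conjI G.is_group group_BijGroup)
    show "(\<lambda>g. restrict (\<pi> g) W) \<in> hom G (BijGroup (carrier ?V))"
      using pi'_Bij by (auto simp: hom_def BijGroup_def compose_def fun_eq_iff Winv pi_mult KV)
  qed
  then show ?thesis
    unfolding unitary_rep_def using hs by (simp add: K KV pi)
qed

text \<open>The quantitative form of relative property (T). If it failed for every \<open>F\<close>
  and \<open>\<kappa>\<close>, the components of the almost invariant unit vectors orthogonal to all
  \<open>H\<close>-invariant vectors would keep squared length at least \<open>e\<close>; rescaled,
  they would show that this complement weakly contains the trivial representation, and property (T)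
  would produce an \<open>H\<close>-invariant vector orthogonal to itself. Normality of
  \<open>H\<close> makes the space of \<open>H\<close>-invariant vectors, and hence its complement,
  invariant under \<open>G\<close>.\<close>

lemma relative_property_T_near_invariant:
  assumes G: "Group.group G" and cG: "countable (carrier G)" and H: "H \<lhd> G"
    and T: "relative_property_T G H" and U: "unitary_rep G V ip \<pi>" and e: "e > 0"
  obtains F \<kappa> where "finite F" "F \<subseteq> carrier G" "\<kappa> > 0"
    "\<And>\<xi>. \<lbrakk>\<xi> \<in> carrier V; ip \<xi> \<xi> = 1; \<And>g. g \<in> F \<Longrightarrow> Re (ip (\<pi> g \<xi>) \<xi>) > 1 - \<kappa>\<rbrakk> \<Longrightarrow>
      \<exists>\<eta>\<in>carrier V. (\<forall>h\<in>H. \<pi> h \<eta> = \<eta>) \<and> Re (ip (\<xi> \<ominus>\<^bsub>V\<^esub> \<eta>) (\<xi> \<ominus>\<^bsub>V\<^esub> \<eta>)) < e"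
proof (rule ccontr)
  assume "\<not> thesis"
  with that have neg: "\<exists>\<xi>\<in>carrier V. ip \<xi> \<xi> = 1 \<and> (\<forall>g\<in>F. Re (ip (\<pi> g \<xi>) \<xi>) > 1 - \<kappa>) \<and>
      (\<forall>\<eta>\<in>carrier V. (\<forall>h\<in>H. \<pi> h \<eta> = \<eta>) \<longrightarrow> Re (ip (\<xi> \<ominus>\<^bsub>V\<^esub> \<eta>) (\<xi> \<ominus>\<^bsub>V\<^esub> \<eta>)) \<ge> e)"
    if "finite F" "F \<subseteq> carrier G" "\<kappa> > 0" for F \<kappa>
    using that by (meson not_le)
  interpret complex_hilbert_space V ip using unitary_repD(1)[OF U] .
  interpret A: group_action G "carrier V" \<pi> using unitary_repD(2)[OF U] .
  interpret G: Group.group G by fact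
  interpret H: normal H G by fact
  note pi = unitary_repD(3-6)[OF U]
  have HG: "h \<in> carrier G" if "h \<in> H" for h using that H.subset by blast
  have pi_mult: "\<pi> (g \<otimes>\<^bsub>G\<^esub> h) x = \<pi> g (\<pi> h x)"
    if "g \<in> carrier G" "h \<in> carrier G" "x \<in> carrier V" for g h x
    using A.composition_rule[OF that(3,1,2)] .
  have pi_one: "\<pi> \<one>\<^bsub>G\<^esub> x = x" if "x \<in> carrier V" for x
    using A.id_eq_one that by (metis restrict_apply')
  have pi_cancel: "\<pi> g (\<pi> (inv\<^bsub>G\<^esub> g) x) = x" "\<pi> (inv\<^bsub>G\<^esub> g) (\<pi> g x) = x"
    if "g \<in> carrier G" "x \<in> carrier V" for g x
    using that pi_mult[of g "inv\<^bsub>G\<^esub> g" x] pi_mult[of "inv\<^bsub>G\<^esub> g" g x] pi_one by auto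
  have pi_adj: "ip (\<pi> g x) y = ip x (\<pi> (inv\<^bsub>G\<^esub> g) y)"
    if "g \<in> carrier G" "x \<in> carrier V" "y \<in> carrier V" for g x y
    using pi_cancel(1)[OF that(1,3)] pi(3)[of g x "\<pi> (inv\<^bsub>G\<^esub> g) y"] pi(4) that by simp
  \<comment> \<open>The vectors orthogonal to all \<open>\<pi> h v - v\<close> are exactly the
    \<open>H\<close>-invariant ones; as a \<open>perp\<close> they form a closed subspace to which
    the projection lemma applies.\<close>
  define S where "S = {\<pi> h v \<ominus>\<^bsub>V\<^esub> v | h v. h \<in> H \<and> v \<in> carrier V}"
  have S: "S \<subseteq> carrier V" using pi(4) HG by (auto simp: S_def)
  define K where "K = perp S"
  note K = perp_props[OF S, folded K_def]
  have KV: "x \<in> carrier V" if "x \<in> K" for x using K(1) that by blast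
  have K_iff: "x \<in> K \<longleftrightarrow> x \<in> carrier V \<and> (\<forall>h\<in>H. \<pi> h x = x)" for x
  proof (intro iffI conjI ballI)
    assume x: "x \<in> K"
    then show xV: "x \<in> carrier V" by (rule KV)
    fix h assume h: "h \<in> H"
    \<comment> \<open>Testing \<open>x\<close> against \<open>\<pi> (inv h) v - v\<close> and moving
      the operator to the other side shows that \<open>v\<close> is orthogonal to itself.\<close>
    define v where "v = \<pi> h x \<ominus>\<^bsub>V\<^esub> x"
    have vV: "v \<in> carrier V" using pi(4) HG[OF h] xV by (simp add: v_def)
    have "ip x (\<pi> (inv\<^bsub>G\<^esub> h) v \<ominus>\<^bsub>V\<^esub> v) = 0"
      using x h vV H.m_inv_closed by (auto simp: K_def perp_def S_def)
    then have "ip (\<pi> h x) v - ip x v = 0"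
      using pi_adj[OF HG[OF h] xV vV] pi(4) HG[OF h] xV vV by (simp add: ip_diff_right)
    then have "ip v v = 0" using xV vV pi(4) HG[OF h] by (simp add: v_def ip_diff_left)
    then have "v = \<zero>\<^bsub>V\<^esub>" by (rule ip_eq_zeroD[OF vV])
    then show "\<pi> h x = x" using diff_eq_zeroD pi(4) HG[OF h] xV by (simp add: v_def)
  next
    assume x: "x \<in> carrier V \<and> (\<forall>h\<in>H. \<pi> h x = x)"
    have "ip x (\<pi> h v \<ominus>\<^bsub>V\<^esub> v) = 0" if "h \<in> H" "v \<in> carrier V" for h v
      using x that HG pi(4) pi(3)[of h x v] by (simp add: ip_diff_right)
    then show "x \<in> K" using x by (auto simp: K_def perp_def S_def)
  qed
  have Kinv: "\<pi> g x \<in> K" if g: "g \<in> carrier G" and x: "x \<in> K" for g x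
    unfolding K_iff
  proof (intro conjI ballI)
    show "\<pi> g x \<in> carrier V" using pi(4) g KV[OF x] by blast
    fix h assume h: "h \<in> H"
    define h' where "h' = inv\<^bsub>G\<^esub> g \<otimes>\<^bsub>G\<^esub> h \<otimes>\<^bsub>G\<^esub> g"
    have h': "h' \<in> H" using H.inv_op_closed1[OF g h] by (simp add: h'_def)
    have "g \<otimes>\<^bsub>G\<^esub> h' = h \<otimes>\<^bsub>G\<^esub> g" using g HG[OF h] by (simp add: h'_def G.m_assoc[symmetric])
    then have "\<pi> h (\<pi> g x) = \<pi> g (\<pi> h' x)"
      using pi_mult g HG[OF h] HG[OF h'] KV[OF x] by metis
    then show "\<pi> h (\<pi> g x) = \<pi> g x" using x h' by (simp add: K_iff)
  qed
  define W where "W = perp K"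
  have W: "x \<in> W \<Longrightarrow> x \<in> carrier V" for x by (auto simp: W_def perp_def)
  let ?V = "V\<lparr>carrier := W\<rparr>" and ?\<pi> = "\<lambda>g. restrict (\<pi> g) W"
  have U': "unitary_rep G ?V ip ?\<pi>"
    unfolding W_def by (rule unitary_rep_perp[OF U K(1) Kinv])
  have "weakly_contains_trivial G ?V ip ?\<pi>"
    unfolding weakly_contains_trivial_def weakly_contains_def
  proof (intro ballI allI impI)
    fix z :: complex and F and e' :: real
    assume F: "finite F \<and> F \<subseteq> carrier G" and e': "e' > 0"
    \<comment> \<open>The final error is \<open>|z|^2 * t\<close>; the \<open>+ 1\<close> covers
      \<open>z = 0\<close>. The choice of \<open>\<kappa>\<close> below gives
      \<open>sqrt (2 * \<kappa>) * sqrt b = sqrt (e * b) * t\<close>, which is at most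
      \<open>b * t\<close> because \<open>b >= e\<close>.\<close>
    define t where "t = e' / ((cmod z)\<^sup>2 + 1)"
    have pos: "(cmod z)\<^sup>2 + 1 > 0" by (simp add: add_nonneg_pos)
    have t: "t > 0" "(cmod z)\<^sup>2 * t < e'"
      using e' pos by (auto simp: t_def field_simps)
    define \<kappa> where "\<kappa> = e * t\<^sup>2 / 2"
    have \<kappa>: "\<kappa> > 0" using e t by (simp add: \<kappa>_def)
    obtain \<xi> where \<xi>: "\<xi> \<in> carrier V" "ip \<xi> \<xi> = 1" "\<And>g. g \<in> F \<Longrightarrow> Re (ip (\<pi> g \<xi>) \<xi>) > 1 - \<kappa>"
      "\<And>\<eta>. \<lbrakk>\<eta> \<in> carrier V; \<forall>h\<in>H. \<pi> h \<eta> = \<eta>\<rbrakk> \<Longrightarrow> Re (ip (\<xi> \<ominus>\<^bsub>V\<^esub> \<eta>) (\<xi> \<ominus>\<^bsub>V\<^esub> \<eta>)) \<ge> e"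
      using neg[OF _ _ \<kappa>, of F] F by blast
    obtain p where p: "p \<in> K" "\<xi> \<ominus>\<^bsub>V\<^esub> p \<in> W"
      using orthogonal_projection[OF S \<xi>(1)] unfolding K_def W_def by blast
    note pV = KV[OF p(1)]
    define \<zeta> where "\<zeta> = \<xi> \<ominus>\<^bsub>V\<^esub> p"
    note \<zeta>W = p(2)[folded \<zeta>_def] and \<zeta>V = W[OF p(2)[folded \<zeta>_def]]
    define b where "b = Re (ip \<zeta> \<zeta>)"
    have b: "b \<ge> e" "ip \<zeta> \<zeta> = of_real b"
      using \<xi>(4)[OF pV] p(1) K_iff ip_self[OF \<zeta>V] by (auto simp: b_def \<zeta>_def)
    have b0: "b > 0" using b e by linarith
    \<comment> \<open>Scales \<open>\<zeta>\<close> to length \<open>|z|\<close>, because the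
      coefficient of the trivial representation at \<open>z\<close> is \<open>|z|^2\<close>; this
      one vector is enough for the finite sum.\<close>
    define c where "c = z / of_real (sqrt b)"
    have orth: "ip \<zeta> k = 0" "ip k \<zeta> = 0" if "k \<in> K" for k
      using \<zeta>W that ip_cnj[OF \<zeta>V KV[OF that]] by (auto simp: W_def perp_def)
    have "cmod (z * cnj z - (\<Sum>\<eta>\<leftarrow>[c \<odot>\<^bsub>V\<^esub> \<zeta>]. ip (?\<pi> g \<eta>) \<eta>)) < e'" if g: "g \<in> F" for g
    proof -
      have gG: "g \<in> carrier G" using g F by blast
      have piz: "\<pi> g \<zeta> \<in> carrier V" using pi(4) gG \<zeta>V by blast
      have cW: "c \<odot>\<^bsub>V\<^esub> \<zeta> \<in> W" using \<zeta>W perp_props(4)[OF K(1)] by (simp add: W_def)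
      have "\<xi> = \<zeta> \<oplus>\<^bsub>V\<^esub> p"
        using \<xi>(1) pV by (simp add: \<zeta>_def a_minus_def M.a_assoc M.l_neg)
      then have pi\<xi>: "\<pi> g \<xi> = \<pi> g \<zeta> \<oplus>\<^bsub>V\<^esub> \<pi> g p"
        using gG pV \<zeta>V pi(1) by metis
      have piV: "\<pi> g \<xi> \<in> carrier V" "\<pi> g p \<in> carrier V" using pi(4) gG \<xi>(1) pV by auto
      have "ip (\<pi> g \<xi>) \<zeta> = ip (\<pi> g \<zeta>) \<zeta> + ip (\<pi> g p) \<zeta>"
        unfolding pi\<xi> by (rule ip_add[OF piz piV(2) \<zeta>V])
      moreover have "ip (\<pi> g p) \<zeta> = 0" by (rule orth(2)[OF Kinv[OF gG p(1)]])
      moreover have "ip (\<pi> g \<xi>) \<zeta> = ip (\<pi> g \<xi>) \<xi> - ip (\<pi> g \<xi>) p"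
        unfolding \<zeta>_def by (rule ip_diff_right[OF \<xi>(1) pV piV(1)])
      ultimately have 1: "ip (\<pi> g \<zeta>) \<zeta> = ip (\<pi> g \<xi>) \<xi> - ip (\<pi> g \<xi>) p" by simp
      have "ip (\<pi> g \<zeta>) p = ip \<zeta> (\<pi> (inv\<^bsub>G\<^esub> g) p)" by (rule pi_adj[OF gG \<zeta>V pV])
      also have "\<dots> = 0" by (rule orth(1)[OF Kinv[OF G.inv_closed[OF gG] p(1)]])
      finally have "ip (\<pi> g \<zeta>) p = 0" .
      then have 2: "ip (\<pi> g \<xi>) p = ip (\<pi> g p) p"
        unfolding pi\<xi> using ip_add[OF piz piV(2) pV] by simp
      have "ip \<zeta> p = 0" by (rule orth(1)[OF p(1)])
      then have "ip \<xi> p = ip p p" unfolding \<zeta>_def using \<xi>(1) pV by (simp add: ip_diff_left)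
      then have 3: "b = 1 - Re (ip p p)"
        using norm_diff_expand[OF \<xi>(1) pV] \<xi>(2) by (simp add: b_def \<zeta>_def)
      \<comment> \<open>Coefficients add over the invariant splitting of \<open>\<xi>\<close> into
        \<open>\<zeta>\<close> and \<open>p\<close>. The part from \<open>p\<close> is at most its
        squared norm \<open>1 - b\<close>, so \<open>\<zeta>\<close> inherits the same defect
        \<open>\<kappa>\<close> relative to its own squared norm \<open>b\<close>.\<close>
      have "cmod (ip (\<pi> g p) p) \<le> Re (ip p p)"
        using cauchy_schwarz[OF pi(4)[OF gG pV] pV] pi(3)[OF gG pV pV] ip_self(2)[OF pV] by simp
      then have "Re (ip (\<pi> g p) p) \<le> Re (ip p p)" using complex_Re_le_cmod order_trans by blast
      then have 4: "b - Re (ip (\<pi> g \<zeta>) \<zeta>) < \<kappa>" using 1 2 3 \<xi>(3)[OF g] by simp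
      have "Re (ip (\<zeta> \<ominus>\<^bsub>V\<^esub> \<pi> g \<zeta>) (\<zeta> \<ominus>\<^bsub>V\<^esub> \<pi> g \<zeta>)) = 2 * (b - Re (ip (\<pi> g \<zeta>) \<zeta>))"
        using norm_diff_expand[OF \<zeta>V piz] pi(3)[OF gG \<zeta>V \<zeta>V] ip_cnj[OF \<zeta>V piz]
        by (simp add: b_def)
      then have 5: "Re (ip (\<zeta> \<ominus>\<^bsub>V\<^esub> \<pi> g \<zeta>) (\<zeta> \<ominus>\<^bsub>V\<^esub> \<pi> g \<zeta>)) \<le> 2 * \<kappa>" using 4 by simp
      have "cmod (of_real b - ip (\<pi> g \<zeta>) \<zeta>) = cmod (ip (\<zeta> \<ominus>\<^bsub>V\<^esub> \<pi> g \<zeta>) \<zeta>)"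
        using \<zeta>V piz b(2) by (simp add: ip_diff_left)
      also have "\<dots> \<le> sqrt (Re (ip (\<zeta> \<ominus>\<^bsub>V\<^esub> \<pi> g \<zeta>) (\<zeta> \<ominus>\<^bsub>V\<^esub> \<pi> g \<zeta>))) * sqrt b"
        using cauchy_schwarz[of "\<zeta> \<ominus>\<^bsub>V\<^esub> \<pi> g \<zeta>" \<zeta>] \<zeta>V piz by (simp add: b_def)
      also have "\<dots> \<le> sqrt (2 * \<kappa>) * sqrt b"
        using 5 b0 by (intro mult_right_mono) auto
      also have "\<dots> = sqrt (e * b) * t"
        using t by (simp add: \<kappa>_def real_sqrt_mult algebra_simps)
      also have "\<dots> \<le> b * t"
        using b(1) e t b0 by (intro mult_right_mono real_le_lsqrt) (auto simp: power2_eq_square)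
      finally have 6: "cmod (of_real b - ip (\<pi> g \<zeta>) \<zeta>) \<le> b * t" .
      have cc: "c * cnj c = z * cnj z / of_real b"
        using b0 by (simp add: c_def flip: of_real_mult)
      have "ip (?\<pi> g (c \<odot>\<^bsub>V\<^esub> \<zeta>)) (c \<odot>\<^bsub>V\<^esub> \<zeta>) = (c * cnj c) * ip (\<pi> g \<zeta>) \<zeta>"
        using cW gG \<zeta>V piz by (simp add: pi ip_smult ip_smult_right)
      then have "z * cnj z - (\<Sum>\<eta>\<leftarrow>[c \<odot>\<^bsub>V\<^esub> \<zeta>]. ip (?\<pi> g \<eta>) \<eta>) =
          (z * cnj z / of_real b) * (of_real b - ip (\<pi> g \<zeta>) \<zeta>)"
        unfolding cc using b0 by (simp add: field_simps)
      then have "cmod (z * cnj z - (\<Sum>\<eta>\<leftarrow>[c \<odot>\<^bsub>V\<^esub> \<zeta>]. ip (?\<pi> g \<eta>) \<eta>)) =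
          (cmod z)\<^sup>2 / b * cmod (of_real b - ip (\<pi> g \<zeta>) \<zeta>)"
        using b0 by (simp add: norm_mult norm_divide power2_eq_square)
      also have "\<dots> \<le> (cmod z)\<^sup>2 / b * (b * t)"
        using 6 b0 by (intro mult_left_mono) auto
      also have "\<dots> = (cmod z)\<^sup>2 * t" using b0 by simp
      finally show ?thesis using t(2) by linarith
    qed
    moreover have "set [c \<odot>\<^bsub>V\<^esub> \<zeta>] \<subseteq> carrier ?V"
      using \<zeta>W perp_props(4)[OF K(1)] by (simp add: W_def)
    ultimately show "\<exists>\<eta>s. set \<eta>s \<subseteq> carrier ?V \<and>
        (\<forall>g\<in>F. cmod (z * cnj z - (\<Sum>\<eta>\<leftarrow>\<eta>s. ip (?\<pi> g \<eta>) \<eta>)) < e')" by blast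
  qed
  then obtain \<xi> where \<xi>: "\<xi> \<in> W" "\<xi> \<noteq> \<zero>\<^bsub>V\<^esub>" "\<forall>h\<in>H. ?\<pi> h \<xi> = \<xi>"
    using relative_property_T_any_type[OF G cG H.subset T, where 'h = 'b] U'
    unfolding relative_property_T_on_def by fastforce
  then have "\<xi> \<in> K" using W by (simp add: K_iff)
  then have "ip \<xi> \<xi> = 0" using \<xi>(1) by (simp add: W_def perp_def)
  then show False using ip_eq_zeroD \<xi> W by blast
qed

subsection \<open>The Koopman representation on square integrable functions\<close>

definition l2_functions :: "'z measure \<Rightarrow> ('z \<Rightarrow> complex) set" where
  "l2_functions Z = {F \<in> borel_measurable Z. integrable Z (\<lambda>z. (cmod (F z))\<^sup>2)}"

text \<open>An element of the Hilbert space is the chosen representative of an almost everywhere class.\<close>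

definition l2_rep :: "'z measure \<Rightarrow> ('z \<Rightarrow> complex) \<Rightarrow> 'z \<Rightarrow> complex" where
  "l2_rep Z F = (SOME F'. F' \<in> l2_functions Z \<and> (AE z in Z. F' z = F z))"

definition l2_module :: "'z measure \<Rightarrow> (complex, 'z \<Rightarrow> complex) module" where
  "l2_module Z = \<lparr>carrier = l2_rep Z ` l2_functions Z, monoid.mult = (\<lambda>F G. F), one = (\<lambda>z. 1),
     ring.zero = l2_rep Z (\<lambda>z. 0), ring.add = (\<lambda>F G. l2_rep Z (\<lambda>z. F z + G z)),
     module.smult = (\<lambda>t F. l2_rep Z (\<lambda>z. t * F z))\<rparr>"

definition l2_ip :: "'z measure \<Rightarrow> ('z \<Rightarrow> complex) \<Rightarrow> ('z \<Rightarrow> complex) \<Rightarrow> complex" where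
  "l2_ip Z F G = (\<integral>z. F z * cnj (G z) \<partial>Z)"

definition koopman ::
    "'g monoid \<Rightarrow> 'z measure \<Rightarrow> ('g \<Rightarrow> 'z \<Rightarrow> 'z) \<Rightarrow> 'g \<Rightarrow> ('z \<Rightarrow> complex) \<Rightarrow> 'z \<Rightarrow> complex" where
  "koopman G Z T g = restrict (\<lambda>F. l2_rep Z (\<lambda>z. F (T (inv\<^bsub>G\<^esub> g) z))) (carrier (l2_module Z))"

lemma l2_measurable: "F \<in> l2_functions Z \<Longrightarrow> F \<in> borel_measurable Z"
  by (simp add: l2_functions_def)

lemma l2_integrable: "F \<in> l2_functions Z \<Longrightarrow> integrable Z (\<lambda>z. (cmod (F z))\<^sup>2)"
  by (simp add: l2_functions_def)

lemma l2_zero: "(\<lambda>z. 0) \<in> l2_functions Z"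
  by (simp add: l2_functions_def)

lemma l2_add:
  assumes F: "F \<in> l2_functions Z" and G: "G \<in> l2_functions Z"
  shows "(\<lambda>z. F z + G z) \<in> l2_functions Z"
proof -
  have [measurable]: "F \<in> borel_measurable Z" "G \<in> borel_measurable Z"
    using F G by (auto intro: l2_measurable)
  have "integrable Z (\<lambda>z. 2 * (cmod (F z))\<^sup>2 + 2 * (cmod (G z))\<^sup>2)"
    using F G by (simp add: l2_integrable)
  then have "integrable Z (\<lambda>z. (cmod (F z + G z))\<^sup>2)"
  proof (rule Bochner_Integration.integrable_bound)
    have "(cmod (F z + G z))\<^sup>2 \<le> 2 * (cmod (F z))\<^sup>2 + 2 * (cmod (G z))\<^sup>2" for z
    proof -
      have "(cmod (F z + G z))\<^sup>2 \<le> (cmod (F z) + cmod (G z))\<^sup>2"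
        by (intro power_mono norm_triangle_ineq) simp
      also have "\<dots> \<le> 2 * (cmod (F z))\<^sup>2 + 2 * (cmod (G z))\<^sup>2"
        using sum_squares_bound[of "cmod (F z)" "cmod (G z)"] by (simp add: power2_sum)
      finally show ?thesis .
    qed
    then show "AE z in Z. norm ((cmod (F z + G z))\<^sup>2) \<le> norm (2 * (cmod (F z))\<^sup>2 + 2 * (cmod (G z))\<^sup>2)"
      by (intro always_eventually) auto
  qed simp
  then show ?thesis by (simp add: l2_functions_def)
qed

lemma l2_smult: "F \<in> l2_functions Z \<Longrightarrow> (\<lambda>z. t * F z) \<in> l2_functions Z"
  by (auto simp: l2_functions_def norm_mult power_mult_distrib)

lemma l2_diff: "\<lbrakk>F \<in> l2_functions Z; G \<in> l2_functions Z\<rbrakk> \<Longrightarrow> (\<lambda>z. F z - G z) \<in> l2_functions Z"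
  using l2_add[of F Z "\<lambda>z. - 1 * G z"] l2_smult[of G Z "-1"] by simp

lemma l2_rep:
  assumes "F \<in> l2_functions Z"
  shows "l2_rep Z F \<in> l2_functions Z" "AE z in Z. l2_rep Z F z = F z"
  using someI[of "\<lambda>F'. F' \<in> l2_functions Z \<and> (AE z in Z. F' z = F z)" F] assms
  by (auto simp: l2_rep_def)

text \<open>The choice operator sees only the predicate, and almost everywhere equal functions give
  the same one. Equality of classes thereby becomes plain equality, as the carrier of a module
  demands.\<close>

lemma l2_rep_cong:
  assumes "AE z in Z. F z = G z"
  shows "l2_rep Z F = l2_rep Z G"
proof -
  have "(AE z in Z. F' z = F z) \<longleftrightarrow> (AE z in Z. F' z = G z)" for F'
    by (rule iffI) (use assms in \<open>auto elim: AE_mp\<close>)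
  then show ?thesis by (simp add: l2_rep_def)
qed

lemma l2_rep_eqD:
  assumes "F \<in> l2_functions Z" "G \<in> l2_functions Z" "l2_rep Z F = l2_rep Z G"
  shows "AE z in Z. F z = G z"
  using l2_rep(2)[OF assms(1)] l2_rep(2)[OF assms(2)] assms(3) by auto

lemma measurable_cnj [measurable]: "cnj \<in> borel_measurable borel"
  by (intro borel_measurable_continuous_onI continuous_intros)

lemma l2_product_integrable:
  assumes F: "F \<in> l2_functions Z" and G: "G \<in> l2_functions Z"
  shows "integrable Z (\<lambda>z. F z * cnj (G z))"
proof -
  have [measurable]: "F \<in> borel_measurable Z" "G \<in> borel_measurable Z"
    using F G by (auto intro: l2_measurable)
  have m: "(\<lambda>z. F z * cnj (G z)) \<in> borel_measurable Z"
    by measurable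
  have "integrable Z (\<lambda>z. (cmod (F z))\<^sup>2 + (cmod (G z))\<^sup>2)"
    using F G by (simp add: l2_integrable)
  then show ?thesis
  proof (rule Bochner_Integration.integrable_bound[OF _ m])
    have "cmod (F z * cnj (G z)) \<le> (cmod (F z))\<^sup>2 + (cmod (G z))\<^sup>2" for z
      using sum_squares_bound[of "cmod (F z)" "cmod (G z)"]
        mult_nonneg_nonneg[OF norm_ge_zero[of "F z"] norm_ge_zero[of "G z"]]
      unfolding norm_mult complex_mod_cnj by linarith
    then show "AE z in Z. norm (F z * cnj (G z)) \<le> norm ((cmod (F z))\<^sup>2 + (cmod (G z))\<^sup>2)"
      by (intro always_eventually) (auto simp: order_trans[OF _ abs_ge_self])
  qed
qed

lemma l2_ip_cong:
  assumes "AE z in Z. F z = F' z" "AE z in Z. G z = G' z"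
    and "F \<in> l2_functions Z" "F' \<in> l2_functions Z" "G \<in> l2_functions Z" "G' \<in> l2_functions Z"
  shows "l2_ip Z F G = l2_ip Z F' G'"
  unfolding l2_ip_def
proof (rule integral_cong_AE)
  show "(\<lambda>z. F z * cnj (G z)) \<in> borel_measurable Z" "(\<lambda>z. F' z * cnj (G' z)) \<in> borel_measurable Z"
    using assms(3-) l2_product_integrable by (blast intro: borel_measurable_integrable)+
  show "AE z in Z. F z * cnj (G z) = F' z * cnj (G' z)"
    using assms(1,2) by eventually_elim simp
qed

lemma l2_module_simps:
  "carrier (l2_module Z) = l2_rep Z ` l2_functions Z"
  "\<zero>\<^bsub>l2_module Z\<^esub> = l2_rep Z (\<lambda>z. 0)"
  by (simp_all add: l2_module_def)

lemma l2_module_add: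
  assumes "F \<in> l2_functions Z" "G \<in> l2_functions Z"
  shows "l2_rep Z F \<oplus>\<^bsub>l2_module Z\<^esub> l2_rep Z G = l2_rep Z (\<lambda>z. F z + G z)"
proof -
  have "AE z in Z. l2_rep Z F z + l2_rep Z G z = F z + G z"
    using l2_rep(2)[OF assms(1)] l2_rep(2)[OF assms(2)] by eventually_elim simp
  then show ?thesis by (simp add: l2_module_def l2_rep_cong)
qed

lemma l2_module_smult:
  assumes "F \<in> l2_functions Z"
  shows "t \<odot>\<^bsub>l2_module Z\<^esub> l2_rep Z F = l2_rep Z (\<lambda>z. t * F z)"
proof -
  have "AE z in Z. t * l2_rep Z F z = t * F z"
    using l2_rep(2)[OF assms(1)] by eventually_elim simp
  then show ?thesis by (simp add: l2_module_def l2_rep_cong)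
qed

lemma l2_module_ip:
  assumes "F \<in> l2_functions Z" "G \<in> l2_functions Z"
  shows "l2_ip Z (l2_rep Z F) (l2_rep Z G) = l2_ip Z F G"
  by (rule l2_ip_cong) (use assms l2_rep in auto)

lemma abelian_group_l2_module: "abelian_group (l2_module Z)"
proof (rule abelian_groupI)
  fix A assume "A \<in> carrier (l2_module Z)"
  then obtain F where F: "F \<in> l2_functions Z" "A = l2_rep Z F" by (auto simp: l2_module_simps)
  then show "\<exists>B\<in>carrier (l2_module Z). B \<oplus>\<^bsub>l2_module Z\<^esub> A = \<zero>\<^bsub>l2_module Z\<^esub>"
    using l2_smult[of F Z "-1"]
    by (intro bexI[of _ "l2_rep Z (\<lambda>z. - 1 * F z)"]) (auto simp: l2_module_simps l2_module_add)
qed (auto simp: l2_module_simps l2_module_add l2_zero l2_add ac_simps)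

lemma l2_module_diff:
  assumes F: "F \<in> l2_functions Z" and G: "G \<in> l2_functions Z"
  shows "l2_rep Z F \<ominus>\<^bsub>l2_module Z\<^esub> l2_rep Z G = l2_rep Z (\<lambda>z. F z - G z)"
proof -
  have G': "(\<lambda>z. - G z) \<in> l2_functions Z" using l2_smult[OF G, of "-1"] by simp
  have "\<ominus>\<^bsub>l2_module Z\<^esub> l2_rep Z G = l2_rep Z (\<lambda>z. - G z)"
    by (rule abelian_group.minus_equality[OF abelian_group_l2_module])
      (use G G' in \<open>auto simp: l2_module_simps l2_module_add\<close>)
  then show ?thesis using F G' by (simp add: a_minus_def l2_module_add)
qed

lemma l2_norm_eq: "l2_ip Z F F = of_real (\<integral>z. (cmod (F z))\<^sup>2 \<partial>Z)"
proof -
  have "l2_ip Z F F = (\<integral>z. of_real ((cmod (F z))\<^sup>2) \<partial>Z)"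
    unfolding l2_ip_def complex_norm_square ..
  then show ?thesis by (simp only: integral_complex_of_real)
qed

lemma l2_nn_integral:
  assumes "F \<in> l2_functions Z"
  shows "(\<integral>\<^sup>+z. ennreal ((cmod (F z))\<^sup>2) \<partial>Z) = ennreal (\<integral>z. (cmod (F z))\<^sup>2 \<partial>Z)"
  by (rule nn_integral_eq_integral) (use assms l2_integrable in auto)

text \<open>Along a subsequence with rapidly decreasing differences the functions converge almost
  everywhere; Fatou's lemma carries the Cauchy estimate over to the pointwise limit.\<close>

lemma riesz_fischer:
  fixes f :: "nat \<Rightarrow> 'z \<Rightarrow> complex"
  assumes f: "\<And>n. f n \<in> l2_functions Z"
    and cau: "\<And>e. e > 0 \<Longrightarrow> \<exists>k. \<forall>m\<ge>k. \<forall>n\<ge>k. (\<integral>z. (cmod (f m z - f n z))\<^sup>2 \<partial>Z) < e"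
  obtains g where "g \<in> l2_functions Z" "(\<lambda>n. \<integral>z. (cmod (f n z - g z))\<^sup>2 \<partial>Z) \<longlonglongrightarrow> 0"
proof -
  have [measurable]: "f n \<in> borel_measurable Z" for n using f by (rule l2_measurable)
  define N where "N F = (\<integral>\<^sup>+z. ennreal ((cmod (F z))\<^sup>2) \<partial>Z)" for F :: "'z \<Rightarrow> complex"
  have Nd: "N (\<lambda>z. f m z - f n z) = ennreal (\<integral>z. (cmod (f m z - f n z))\<^sup>2 \<partial>Z)" for m n
    unfolding N_def by (rule l2_nn_integral[OF l2_diff[OF f f]])
  have "\<exists>k. \<forall>m\<ge>k. \<forall>n\<ge>k. (\<integral>z. (cmod (f m z - f n z))\<^sup>2 \<partial>Z) < (1/4)^j" for j :: nat
    by (rule cau) simp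
  then obtain \<rho> where \<rho>: "\<And>j m n. \<lbrakk>m \<ge> \<rho> j; n \<ge> \<rho> j\<rbrakk> \<Longrightarrow> (\<integral>z. (cmod (f m z - f n z))\<^sup>2 \<partial>Z) < (1/4)^j"
    by metis
  \<comment> \<open>Partial sums dominate each \<open>\<rho> k\<close> and are monotone at the same
    time.\<close>
  define r where "r k = (\<Sum>i\<le>k. \<rho> i)" for k
  have r: "r k \<ge> \<rho> k" "r (Suc k) \<ge> r k" for k by (auto simp: r_def intro: member_le_sum)
  have rmono: "r j \<le> r k" if "j \<le> k" for j k using lift_Suc_mono_le[of r j k] r(2) that by blast
  define d where "d k z = f (r (Suc k)) z - f (r k) z" for k z
  have [measurable]: "d k \<in> borel_measurable Z" for k unfolding d_def by measurable
  have dN: "N (d k) \<le> ennreal ((1/4)^k)" for k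
  proof -
    have "r k \<ge> \<rho> k" "r (Suc k) \<ge> \<rho> k" using r[of k] by auto
    then show ?thesis unfolding d_def Nd using \<rho> by (intro ennreal_leI less_imp_le) auto
  qed
  \<comment> \<open>The weight \<open>2^k\<close> still leaves the summable bound
    \<open>(1/2)^k\<close> for the integrals, and in return bounds the weighted squares
    pointwise.\<close>
  have "(\<integral>\<^sup>+z. (suminf (\<lambda>k. ennreal (2^k * (cmod (d k z))\<^sup>2))) \<partial>Z) = (suminf (\<lambda>k. \<integral>\<^sup>+z. ennreal (2^k * (cmod (d k z))\<^sup>2) \<partial>Z))"
    by (rule nn_integral_suminf) simp
  also have "\<dots> = (suminf (\<lambda>k. ennreal (2^k) * N (d k)))"
    unfolding N_def by (intro suminf_cong) (simp add: ennreal_mult nn_integral_cmult)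
  also have "\<dots> \<le> (suminf (\<lambda>k. ennreal ((1/2)^k)))"
  proof (intro suminf_le)
    fix k
    have "ennreal (2^k) * N (d k) \<le> ennreal (2^k) * ennreal ((1/4)^k)"
      by (intro mult_left_mono dN) simp
    also have "\<dots> = ennreal ((1/2)^k)"
      by (simp add: ennreal_mult[symmetric] power_mult_distrib[symmetric])
    finally show "ennreal (2^k) * N (d k) \<le> ennreal ((1/2)^k)" .
  qed auto
  also have "\<dots> = ennreal (suminf (\<lambda>k. (1/2)^k))"
    by (rule suminf_ennreal2) (auto intro: summable_geometric)
  also have "\<dots> < \<infinity>" by simp
  finally have "AE z in Z. (suminf (\<lambda>k. ennreal (2^k * (cmod (d k z))\<^sup>2))) \<noteq> \<infinity>"
    by (intro nn_integral_PInf_AE) auto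
  then have AEc: "AE z in Z. convergent (\<lambda>k. f (r k) z)"
  proof eventually_elim
    case (elim z)
    have s1: "summable (\<lambda>k. 2^k * (cmod (d k z))\<^sup>2)"
      by (rule summable_suminf_not_top) (use elim in auto)
    have "summable (\<lambda>k. (1/2)^k + 2^k * (cmod (d k z))\<^sup>2)"
      by (intro summable_add s1 summable_geometric) auto
    moreover have "norm (d k z) \<le> (1/2)^k + 2^k * (cmod (d k z))\<^sup>2" for k
    proof -
      \<comment> \<open>The inequality of arithmetic and geometric means bounds the modulus itself
        by the weighted square and a geometric term, on a space whose measure may be
        infinite.\<close>
      have "0 \<le> (1/2)^k * (1 - 2^k * cmod (d k z))\<^sup>2" by simp
      also have "\<dots> = (1/2)^k + 2^k * (cmod (d k z))\<^sup>2 - 2 * cmod (d k z)"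
        by (simp add: power2_eq_square field_simps)
      finally show ?thesis using norm_ge_zero[of "d k z"] by linarith
    qed
    ultimately have "summable (\<lambda>k. d k z)" by (rule summable_comparison_test'[where N = 0])
    then have "convergent (\<lambda>k. \<Sum>i<k. d i z)" by (simp add: summable_iff_convergent)
    moreover have "(\<Sum>i<k. d i z) = f (r k) z - f (r 0) z" for k
      unfolding d_def by (rule sum_lessThan_telescope)
    ultimately have "convergent (\<lambda>k. (f (r k) z - f (r 0) z) + f (r 0) z)"
      by (intro convergent_add convergent_const) simp
    then show ?case by simp
  qed
  \<comment> \<open>On the null set of divergence \<open>lim\<close> has a fixed junk value, so
    \<open>g\<close> is measurable throughout.\<close>
  define g where "g z = lim (\<lambda>k. f (r k) z)" for z
  have g[measurable]: "g \<in> borel_measurable Z" unfolding g_def by measurable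
  have key: "N (\<lambda>z. f n z - g z) \<le> ennreal ((1/4)^j)" if n: "n \<ge> \<rho> j" for n j
  proof -
    have "N (\<lambda>z. f n z - g z) = (\<integral>\<^sup>+z. liminf (\<lambda>k. ennreal ((cmod (f n z - f (r k) z))\<^sup>2)) \<partial>Z)"
      unfolding N_def
    proof (rule nn_integral_cong_AE)
      show "AE z in Z. ennreal ((cmod (f n z - g z))\<^sup>2) =
          liminf (\<lambda>k. ennreal ((cmod (f n z - f (r k) z))\<^sup>2))"
        using AEc
      proof eventually_elim
        case (elim z)
        then have "(\<lambda>k. f (r k) z) \<longlonglongrightarrow> g z" by (simp add: g_def convergent_LIMSEQ_iff)
        then have "(\<lambda>k. ennreal ((cmod (f n z - f (r k) z))\<^sup>2)) \<longlonglongrightarrow> ennreal ((cmod (f n z - g z))\<^sup>2)"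
          by (intro tendsto_intros)
        then show ?case using lim_imp_Liminf[OF sequentially_bot] by metis
      qed
    qed
    also have "\<dots> \<le> liminf (\<lambda>k. N (\<lambda>z. f n z - f (r k) z))"
      unfolding N_def by (rule nn_integral_liminf) simp
    also have "\<dots> \<le> limsup (\<lambda>k. N (\<lambda>z. f n z - f (r k) z))" by (intro Liminf_le_Limsup) simp
    also have "\<dots> \<le> ennreal ((1/4)^j)"
    proof (rule Limsup_bounded)
      show "\<forall>\<^sub>F k in sequentially. N (\<lambda>z. f n z - f (r k) z) \<le> ennreal ((1/4)^j)"
        using eventually_ge_at_top[of j]
      proof eventually_elim
        case (elim k)
        then have "r k \<ge> \<rho> j" using rmono[OF elim] r(1)[of j] by linarith
        then show ?case unfolding Nd using \<rho>[OF n] by (intro ennreal_leI less_imp_le) auto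
      qed
    qed
    finally show ?thesis .
  qed
  have fg: "(\<lambda>z. f n z - g z) \<in> l2_functions Z" if "n \<ge> \<rho> 0" for n
  proof -
    have "N (\<lambda>z. f n z - g z) < \<infinity>" using key[OF that] by (rule le_less_trans) simp
    then have "integrable Z (\<lambda>z. (cmod (f n z - g z))\<^sup>2)"
      unfolding N_def by (intro integrableI_nonneg) auto
    then show ?thesis by (simp add: l2_functions_def)
  qed
  have gl: "g \<in> l2_functions Z" using l2_diff[OF f[of "\<rho> 0"] fg[of "\<rho> 0"]] by simp
  have "(\<lambda>n. \<integral>z. (cmod (f n z - g z))\<^sup>2 \<partial>Z) \<longlonglongrightarrow> 0"
  proof (rule LIMSEQ_I)
    fix e :: real assume "e > 0"
    then obtain j :: nat where j: "(1/4)^j < e" using real_arch_pow_inv[of e "1/4"] by auto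
    have "norm ((\<integral>z. (cmod (f n z - g z))\<^sup>2 \<partial>Z) - 0) < e" if n: "n \<ge> \<rho> j" for n
    proof -
      have "ennreal (\<integral>z. (cmod (f n z - g z))\<^sup>2 \<partial>Z) \<le> ennreal ((1/4)^j)"
        using key[OF n] l2_nn_integral[OF l2_diff[OF f gl], of n] by (simp add: N_def)
      then have "(\<integral>z. (cmod (f n z - g z))\<^sup>2 \<partial>Z) \<le> (1/4)^j" by (subst (asm) ennreal_le_iff) auto
      then show ?thesis using j by simp
    qed
    then show "\<exists>k. \<forall>n\<ge>k. norm ((\<integral>z. (cmod (f n z - g z))\<^sup>2 \<partial>Z) - 0) < e" by blast
  qed
  with gl show thesis by (rule that)
qed

lemma complex_hilbert_space_l2: "complex_hilbert_space (l2_module Z) (l2_ip Z)"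
proof (intro complex_hilbert_space.intro complex_hilbert_space_axioms.intro)
  show "module complex_ring (l2_module Z)"
    by (rule moduleI[OF cring_complex_ring abelian_group_l2_module])
      (auto simp: l2_module_simps l2_module_add l2_module_smult l2_add l2_smult algebra_simps)
next
  fix A B C
  assume "A \<in> carrier (l2_module Z)" "B \<in> carrier (l2_module Z)" "C \<in> carrier (l2_module Z)"
  then obtain F G H where [simp]: "A = l2_rep Z F" "B = l2_rep Z G" "C = l2_rep Z H"
    and l: "F \<in> l2_functions Z" "G \<in> l2_functions Z" "H \<in> l2_functions Z"
    by (auto simp: l2_module_simps)
  show "l2_ip Z (A \<oplus>\<^bsub>l2_module Z\<^esub> B) C = l2_ip Z A C + l2_ip Z B C"
    using l l2_product_integrable[OF l(1,3)] l2_product_integrable[OF l(2,3)]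
    by (simp add: l2_module_add l2_module_ip l2_add) (simp add: l2_ip_def distrib_right)
next
  fix t A C
  assume "A \<in> carrier (l2_module Z)" "C \<in> carrier (l2_module Z)"
  then obtain F H where [simp]: "A = l2_rep Z F" "C = l2_rep Z H"
    and l: "F \<in> l2_functions Z" "H \<in> l2_functions Z"
    by (auto simp: l2_module_simps)
  show "l2_ip Z (t \<odot>\<^bsub>l2_module Z\<^esub> A) C = t * l2_ip Z A C"
    using l l2_product_integrable[OF l(1,2)]
    by (simp add: l2_module_smult l2_module_ip l2_smult) (simp add: l2_ip_def mult.assoc)
next
  fix A B
  show "l2_ip Z B A = cnj (l2_ip Z A B)"
    unfolding l2_ip_def by (rule trans[OF _ Bochner_Integration.integral_cnj]) (simp add: mult.commute)
next
  fix A assume "A \<in> carrier (l2_module Z)" and nz: "A \<noteq> \<zero>\<^bsub>l2_module Z\<^esub>"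
  then obtain F where A: "A = l2_rep Z F" and F: "F \<in> l2_functions Z"
    by (auto simp: l2_module_simps)
  have "(\<integral>z. (cmod (F z))\<^sup>2 \<partial>Z) \<noteq> 0"
  proof
    assume "(\<integral>z. (cmod (F z))\<^sup>2 \<partial>Z) = 0"
    then have "AE z in Z. (cmod (F z))\<^sup>2 = 0"
      using integral_nonneg_eq_0_iff_AE[OF l2_integrable[OF F]] by simp
    then have "AE z in Z. F z = 0" by eventually_elim simp
    then have "l2_rep Z F = l2_rep Z (\<lambda>z. 0)" by (rule l2_rep_cong)
    then show False using nz A by (simp add: l2_module_simps)
  qed
  moreover have "(\<integral>z. (cmod (F z))\<^sup>2 \<partial>Z) \<ge> 0" by simp
  ultimately show "Re (l2_ip Z A A) > 0"
    unfolding A l2_module_ip[OF F F] unfolding l2_norm_eq by (simp add: order_less_le)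
next
  fix s assume s: "\<forall>n::nat. s n \<in> carrier (l2_module Z)" and C: "\<forall>e>0. \<exists>k. \<forall>m\<ge>k. \<forall>n\<ge>k.
      sqrt (Re (l2_ip Z (s m \<ominus>\<^bsub>l2_module Z\<^esub> s n) (s m \<ominus>\<^bsub>l2_module Z\<^esub> s n))) < e"
  from s have "\<forall>n. \<exists>F. F \<in> l2_functions Z \<and> s n = l2_rep Z F" by (auto simp: l2_module_simps)
  then obtain f where f: "\<And>n. f n \<in> l2_functions Z" and sf: "\<And>n. s n = l2_rep Z (f n)" by metis
  have nrm: "Re (l2_ip Z (l2_rep Z F \<ominus>\<^bsub>l2_module Z\<^esub> l2_rep Z G) (l2_rep Z F \<ominus>\<^bsub>l2_module Z\<^esub> l2_rep Z G)) =
      (\<integral>z. (cmod (F z - G z))\<^sup>2 \<partial>Z)" if "F \<in> l2_functions Z" "G \<in> l2_functions Z" for F G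
    unfolding l2_module_diff[OF that] l2_module_ip[OF l2_diff[OF that] l2_diff[OF that]]
    unfolding l2_norm_eq by simp
  have "\<exists>k. \<forall>m\<ge>k. \<forall>n\<ge>k. (\<integral>z. (cmod (f m z - f n z))\<^sup>2 \<partial>Z) < e" if "e > 0" for e
  proof -
    have "sqrt e > 0" using that by simp
    then obtain k where "\<And>m n. \<lbrakk>m \<ge> k; n \<ge> k\<rbrakk> \<Longrightarrow> sqrt (\<integral>z. (cmod (f m z - f n z))\<^sup>2 \<partial>Z) < sqrt e"
      using C unfolding sf nrm[OF f f] by blast
    then show ?thesis by (intro exI[of _ k]) (auto simp: real_sqrt_less_iff)
  qed
  then obtain g where g: "g \<in> l2_functions Z" "(\<lambda>n. \<integral>z. (cmod (f n z - g z))\<^sup>2 \<partial>Z) \<longlonglongrightarrow> 0"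
    using riesz_fischer[of f Z] f by blast
  have "(\<lambda>n. sqrt (\<integral>z. (cmod (f n z - g z))\<^sup>2 \<partial>Z)) \<longlonglongrightarrow> sqrt 0"
    by (intro tendsto_real_sqrt g)
  then show "\<exists>l\<in>carrier (l2_module Z). (\<lambda>n. sqrt (Re (l2_ip Z (s n \<ominus>\<^bsub>l2_module Z\<^esub> l) (s n \<ominus>\<^bsub>l2_module Z\<^esub> l)))) \<longlonglongrightarrow> 0"
    using g(1) by (intro bexI[of _ "l2_rep Z g"]) (auto simp: sf nrm f l2_module_simps)
qed

locale mp_group_action =
  fixes G :: "'g monoid" and Z :: "'z measure" and T :: "'g \<Rightarrow> 'z \<Rightarrow> 'z"
  assumes G: "Group.group G"
    and T_measurable: "g \<in> carrier G \<Longrightarrow> T g \<in> measurable Z Z"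
    and T_distr: "g \<in> carrier G \<Longrightarrow> distr Z Z (T g) = Z"
    and T_mult: "\<lbrakk>g \<in> carrier G; h \<in> carrier G; z \<in> space Z\<rbrakk> \<Longrightarrow> T (g \<otimes>\<^bsub>G\<^esub> h) z = T g (T h z)"
    and T_one: "z \<in> space Z \<Longrightarrow> T \<one>\<^bsub>G\<^esub> z = z"
begin

interpretation G: Group.group G by (rule G)

lemma AE_T:
  assumes g: "g \<in> carrier G" and P: "AE z in Z. P z"
  shows "AE z in Z. P (T g z)"
proof -
  have "AE z in distr Z Z (T g). P z" unfolding T_distr[OF g] by (rule P)
  then show ?thesis using AE_distrD[OF T_measurable[OF g]] by blast
qed

lemma l2_comp:
  assumes g: "g \<in> carrier G" and F: "F \<in> l2_functions Z"
  shows "(\<lambda>z. F (T g z)) \<in> l2_functions Z"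
    and "H \<in> l2_functions Z \<Longrightarrow> l2_ip Z (\<lambda>z. F (T g z)) (\<lambda>z. H (T g z)) = l2_ip Z F H"
proof -
  note [measurable] = T_measurable[OF g] l2_measurable[OF F]
  have "integrable (distr Z Z (T g)) (\<lambda>z. (cmod (F z))\<^sup>2)"
    using T_distr[OF g] l2_integrable[OF F] by simp
  then have "integrable Z (\<lambda>z. (cmod (F (T g z)))\<^sup>2)" by (subst (asm) integrable_distr_eq) auto
  then show "(\<lambda>z. F (T g z)) \<in> l2_functions Z" by (auto simp: l2_functions_def)
  assume H: "H \<in> l2_functions Z"
  note [measurable] = l2_measurable[OF H]
  have "(\<integral>z. F z * cnj (H z) \<partial>distr Z Z (T g)) = (\<integral>z. F (T g z) * cnj (H (T g z)) \<partial>Z)"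
    by (rule integral_distr) measurable
  then show "l2_ip Z (\<lambda>z. F (T g z)) (\<lambda>z. H (T g z)) = l2_ip Z F H"
    using T_distr[OF g] by (simp add: l2_ip_def)
qed

lemma koopman_rep:
  assumes g: "g \<in> carrier G" and F: "F \<in> l2_functions Z"
  shows "koopman G Z T g (l2_rep Z F) = l2_rep Z (\<lambda>z. F (T (inv\<^bsub>G\<^esub> g) z))"
proof -
  have "AE z in Z. l2_rep Z F (T (inv\<^bsub>G\<^esub> g) z) = F (T (inv\<^bsub>G\<^esub> g) z)"
    by (rule AE_T[OF _ l2_rep(2)[OF F]]) (use g in auto)
  then show ?thesis using F by (simp add: koopman_def l2_module_simps l2_rep_cong)
qed

lemma unitary_rep_koopman: "unitary_rep G (l2_module Z) (l2_ip Z) (koopman G Z T)"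
proof -
  let ?C = "carrier (l2_module Z)"
  have mult: "koopman G Z T (g \<otimes>\<^bsub>G\<^esub> h) (l2_rep Z F) = koopman G Z T g (koopman G Z T h (l2_rep Z F))"
    if "g \<in> carrier G" "h \<in> carrier G" "F \<in> l2_functions Z" for g h F
  proof -
    have "AE z in Z. F (T (inv\<^bsub>G\<^esub> (g \<otimes>\<^bsub>G\<^esub> h)) z) = F (T (inv\<^bsub>G\<^esub> h) (T (inv\<^bsub>G\<^esub> g) z))"
      by (rule AE_I2) (use that in \<open>simp add: G.inv_mult_group T_mult\<close>)
    then show ?thesis using that by (simp add: koopman_rep l2_comp l2_rep_cong)
  qed
  have one: "koopman G Z T \<one>\<^bsub>G\<^esub> (l2_rep Z F) = l2_rep Z F" if "F \<in> l2_functions Z" for F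
    using that by (simp add: koopman_rep) (rule l2_rep_cong, rule AE_I2, simp add: T_one)
  have closed: "koopman G Z T g A \<in> ?C" if "g \<in> carrier G" "A \<in> ?C" for g A
    using that by (auto simp: l2_module_simps koopman_rep l2_comp)
  have Bij: "koopman G Z T g \<in> Bij ?C" if g: "g \<in> carrier G" for g
  proof -
    have "bij_betw (koopman G Z T g) ?C ?C"
    proof (rule bij_betw_byWitness[where f' = "koopman G Z T (inv\<^bsub>G\<^esub> g)"])
      show "\<forall>a\<in>?C. koopman G Z T (inv\<^bsub>G\<^esub> g) (koopman G Z T g a) = a"
        "\<forall>a\<in>?C. koopman G Z T g (koopman G Z T (inv\<^bsub>G\<^esub> g) a) = a"
        using g by (auto simp: l2_module_simps one simp flip: mult)
    qed (use g closed in auto)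
    then show ?thesis by (simp add: Bij_def koopman_def)
  qed
  have "group_action G ?C (koopman G Z T)"
    unfolding group_action_def group_hom_def group_hom_axioms_def
  proof (intro conjI G group_BijGroup)
    have "koopman G Z T (g \<otimes>\<^bsub>G\<^esub> h) = compose ?C (koopman G Z T g) (koopman G Z T h)"
      if "g \<in> carrier G" "h \<in> carrier G" for g h
    proof (rule ext)
      fix A
      show "koopman G Z T (g \<otimes>\<^bsub>G\<^esub> h) A = compose ?C (koopman G Z T g) (koopman G Z T h) A"
      proof (cases "A \<in> ?C")
        case True
        then show ?thesis using that mult by (auto simp: compose_def l2_module_simps)
      next
        case False
        then show ?thesis by (simp add: compose_def koopman_def)
      qed
    qed
    then show "koopman G Z T \<in> hom G (BijGroup ?C)"
      using Bij by (auto simp: hom_def BijGroup_def)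
  qed
  moreover have "koopman G Z T g (A \<oplus>\<^bsub>l2_module Z\<^esub> B) = koopman G Z T g A \<oplus>\<^bsub>l2_module Z\<^esub> koopman G Z T g B \<and>
      (\<forall>t. koopman G Z T g (t \<odot>\<^bsub>l2_module Z\<^esub> A) = t \<odot>\<^bsub>l2_module Z\<^esub> koopman G Z T g A) \<and>
      l2_ip Z (koopman G Z T g A) (koopman G Z T g B) = l2_ip Z A B"
    if "g \<in> carrier G" "A \<in> ?C" "B \<in> ?C" for g A B
    using that
    by (auto simp: l2_module_simps koopman_rep l2_comp l2_module_add l2_module_smult l2_module_ip l2_add l2_smult)
  ultimately show ?thesis
    unfolding unitary_rep_def using complex_hilbert_space_l2 by blast
qed

lemma koopman_invariant:
  assumes g: "g \<in> carrier G" and F: "F \<in> l2_functions Z"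
    and inv: "koopman G Z T (inv\<^bsub>G\<^esub> g) (l2_rep Z F) = l2_rep Z F"
  shows "AE z in Z. F (T g z) = F z"
proof -
  have "l2_rep Z (\<lambda>z. F (T g z)) = l2_rep Z F" using inv koopman_rep[of "inv\<^bsub>G\<^esub> g" F] g F by simp
  then show ?thesis using l2_rep_eqD[OF l2_comp(1)[OF g F] F] by simp
qed

end

subsection \<open>Cocycles of profinite actions\<close>

lemma sets_eq_count_space:
  assumes f: "f \<in> measurable N (count_space C)" and g: "g \<in> measurable N (count_space C)"
    and C: "countable C"
  shows "{p \<in> space N. f p = g p} \<in> sets N"
proof -
  have "{p \<in> space N. f p = g p} = (\<Union>c\<in>C. (f -` {c} \<inter> space N) \<inter> (g -` {c} \<inter> space N))"
    using measurable_space[OF f] measurable_space[OF g] by auto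
  also have "\<dots> \<in> sets N"
    using C by (intro sets.countable_UN'' sets.Int measurable_sets[OF f] measurable_sets[OF g]) auto
  finally show ?thesis .
qed

text \<open>The algebraic axioms hold at every point rather than almost everywhere, so that cocycle
  identities can be composed freely; accordingly \<open>ergodic_H\<close> speaks of exactly
  invariant sets. \<open>r n\<close> is the projection to the finite quotient of level
  \<open>n\<close>, and \<open>r_generates\<close> expresses in metric form that these quotients
  exhaust the measure algebra.\<close>

locale profinite_cocycle =
  fixes G :: "'g monoid" and H :: "'g set" and L :: "'l monoid" and M :: "'x measure"
    and a :: "'g \<Rightarrow> 'x \<Rightarrow> 'x" and w :: "'g \<Rightarrow> 'x \<Rightarrow> 'l" and r :: "nat \<Rightarrow> 'x \<Rightarrow> nat"
  assumes group_G: "Group.group G" and countable_G: "countable (carrier G)"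
    and normal_H: "H \<lhd> G"
    and group_L: "Group.group L" and countable_L: "countable (carrier L)"
    and prob_M: "prob_space M"
    and a_measurable: "g \<in> carrier G \<Longrightarrow> a g \<in> measurable M M"
    and a_distr: "g \<in> carrier G \<Longrightarrow> distr M M (a g) = M"
    and a_mult: "\<lbrakk>g \<in> carrier G; h \<in> carrier G; x \<in> space M\<rbrakk> \<Longrightarrow> a (g \<otimes>\<^bsub>G\<^esub> h) x = a g (a h x)"
    and a_one: "x \<in> space M \<Longrightarrow> a \<one>\<^bsub>G\<^esub> x = x"
    and w_measurable: "g \<in> carrier G \<Longrightarrow> w g \<in> measurable M (count_space (carrier L))"
    and w_mult: "\<lbrakk>g \<in> carrier G; h \<in> carrier G; x \<in> space M\<rbrakk> \<Longrightarrow>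
      w (g \<otimes>\<^bsub>G\<^esub> h) x = w g (a h x) \<otimes>\<^bsub>L\<^esub> w h x"
    and ergodic_H: "\<lbrakk>B \<in> sets M; \<And>h x. \<lbrakk>h \<in> H; x \<in> space M\<rbrakk> \<Longrightarrow> a h x \<in> B \<longleftrightarrow> x \<in> B; emeasure M B \<noteq> 0\<rbrakk>
      \<Longrightarrow> AE x in M. x \<in> B"
    and r_measurable: "r n \<in> measurable M (count_space UNIV)"
    and r_finite: "finite (r n ` space M)"
    and r_equivariant: "\<lbrakk>g \<in> carrier G; x \<in> space M; y \<in> space M; r n x = r n y\<rbrakk> \<Longrightarrow> r n (a g x) = r n (a g y)"
    and r_refines: "\<lbrakk>x \<in> space M; y \<in> space M; r (Suc n) x = r (Suc n) y\<rbrakk> \<Longrightarrow> r n x = r n y"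
    and r_generates: "\<lbrakk>W \<in> sets M; e > 0\<rbrakk> \<Longrightarrow>
      \<exists>n U. measure M {x \<in> space M. (x \<in> W) \<noteq> (r n x \<in> U)} < e"
begin

sublocale G: Group.group G by (rule group_G)
sublocale H: normal H G by (rule normal_H)
sublocale L: Group.group L by (rule group_L)
sublocale prob_space M by (rule prob_M)
sublocale MM: pair_prob_space M M ..

lemmas [measurable] = a_measurable w_measurable r_measurable

definition atom :: "nat \<Rightarrow> nat \<Rightarrow> 'x set" where
  "atom n b = {x \<in> space M. r n x = b}"

definition stab :: "nat \<Rightarrow> nat \<Rightarrow> 'g set" where
  "stab n b = {g \<in> carrier G. \<forall>x\<in>atom n b. a g x \<in> atom n b}"

lemma atom_sets [measurable, simp]: "atom n b \<in> sets M"
  unfolding atom_def by measurable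

lemma H_carrier: "h \<in> H \<Longrightarrow> h \<in> carrier G"
  using H.subset by blast

lemma a_closed: "\<lbrakk>g \<in> carrier G; x \<in> space M\<rbrakk> \<Longrightarrow> a g x \<in> space M"
  using measurable_space[OF a_measurable] by blast

lemma w_closed: "\<lbrakk>g \<in> carrier G; x \<in> space M\<rbrakk> \<Longrightarrow> w g x \<in> carrier L"
  using measurable_space[OF w_measurable] by force

lemma a_inv_cancel:
  "\<lbrakk>g \<in> carrier G; x \<in> space M\<rbrakk> \<Longrightarrow> a g (a (inv\<^bsub>G\<^esub> g) x) = x"
  "\<lbrakk>g \<in> carrier G; x \<in> space M\<rbrakk> \<Longrightarrow> a (inv\<^bsub>G\<^esub> g) (a g x) = x"
  using a_mult[of g "inv\<^bsub>G\<^esub> g" x] a_mult[of "inv\<^bsub>G\<^esub> g" g x] a_one[of x] by auto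

lemma w_one: "x \<in> space M \<Longrightarrow> w \<one>\<^bsub>G\<^esub> x = \<one>\<^bsub>L\<^esub>"
  using w_mult[of "\<one>\<^bsub>G\<^esub>" "\<one>\<^bsub>G\<^esub>" x] w_closed[of "\<one>\<^bsub>G\<^esub>" x] a_one[of x] L.l_cancel_one' by force

lemma AE_a:
  assumes "g \<in> carrier G" "AE x in M. P x"
  shows "AE x in M. P (a g x)"
proof -
  have "AE x in distr M M (a g). P x" unfolding a_distr[OF assms(1)] by (rule assms(2))
  then show ?thesis using AE_distrD[OF a_measurable[OF assms(1)]] by blast
qed

lemma emeasure_a_vimage:
  assumes "g \<in> carrier G" "B \<in> sets M"
  shows "emeasure M (a g -` B \<inter> space M) = emeasure M B"
  using emeasure_distr[OF a_measurable[OF assms(1)] assms(2)] a_distr[OF assms(1)] by simp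

lemma r_mono: "\<lbrakk>n \<le> m; x \<in> space M; y \<in> space M; r m x = r m y\<rbrakk> \<Longrightarrow> r n x = r n y"
  by (induction m rule: dec_induct) (auto dest: r_refines)

text \<open>Equivariance for \<open>g\<close> and for its inverse makes the preimage of one atom a
  whole atom. The weights in the coupling and in the level vectors are therefore invariant.\<close>

lemma measure_atom_eq:
  assumes g: "g \<in> carrier G" and x: "x \<in> space M"
  shows "measure M (atom n (r n (a g x))) = measure M (atom n (r n x))"
proof -
  have "a g -` atom n (r n (a g x)) \<inter> space M = atom n (r n x)"
  proof (rule Set.set_eqI)
    fix y
    have "r n y = r n x" if "y \<in> space M" "r n (a g y) = r n (a g x)"
      using r_equivariant[of "inv\<^bsub>G\<^esub> g" "a g y" "a g x" n] that a_closed a_inv_cancel(2) g x by simp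
    then show "y \<in> a g -` atom n (r n (a g x)) \<inter> space M \<longleftrightarrow> y \<in> atom n (r n x)"
      using g x by (auto simp: atom_def a_closed intro: r_equivariant)
  qed
  then show ?thesis using emeasure_a_vimage[OF g atom_sets, of n "r n (a g x)"] by (simp add: measure_def)
qed

lemma AE_atom_pos: "AE x in M. measure M (atom n (r n x)) > 0"
proof -
  have "AE x in M. \<forall>b\<in>{b\<in>r n ` space M. measure M (atom n b) = 0}. x \<notin> atom n b"
  proof (rule AE_finite_allI)
    fix b assume "b \<in> {b\<in>r n ` space M. measure M (atom n b) = 0}"
    then have "atom n b \<in> null_sets M" by (auto simp: emeasure_eq_measure intro!: null_setsI)
    then show "AE x in M. x \<notin> atom n b" by (rule AE_not_in)
  qed (simp add: r_finite)
  then show ?thesis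
  proof (rule AE_mp, intro AE_I2 impI)
    fix x assume "x \<in> space M"
      "\<forall>b\<in>{b\<in>r n ` space M. measure M (atom n b) = 0}. x \<notin> atom n b"
    then have "measure M (atom n (r n x)) \<noteq> 0" by (auto simp: atom_def)
    then show "measure M (atom n (r n x)) > 0" by (simp add: zero_less_measure_iff)
  qed
qed

text \<open>The relatively independent self-coupling of \<open>M\<close> over the finite level \<open>n\<close>.\<close>

definition coupling :: "nat \<Rightarrow> ('x \<times> 'x) measure" where
  "coupling n = density (M \<Otimes>\<^sub>M M)
     (\<lambda>(x, y). if r n x = r n y then ennreal (1 / measure M (atom n (r n x))) else 0)"

lemma density_measurable [measurable]:
  "(\<lambda>(x, y). if r n x = r n y then ennreal (1 / measure M (atom n (r n x))) else 0) \<in> borel_measurable (M \<Otimes>\<^sub>M M)"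
proof -
  have "(\<lambda>b. ennreal (1 / measure M (atom n b))) \<in> borel_measurable (count_space UNIV)" by simp
  from measurable_compose[OF r_measurable this]
  have [measurable]: "(\<lambda>x. ennreal (1 / measure M (atom n (r n x)))) \<in> borel_measurable M" .
  have "{p \<in> space (M \<Otimes>\<^sub>M M). r n (fst p) = r n (snd p)} \<in> sets (M \<Otimes>\<^sub>M M)"
    by (rule sets_eq_count_space[OF measurable_compose[OF measurable_fst r_measurable]
        measurable_compose[OF measurable_snd r_measurable] countableI_type])
  then show ?thesis unfolding split_def by (intro measurable_If) simp_all
qed

lemma space_coupling [simp]: "space (coupling n) = space M \<times> space M"
  and sets_coupling [simp, measurable_cong]: "sets (coupling n) = sets (M \<Otimes>\<^sub>M M)"
  by (simp_all add: coupling_def space_pair_measure)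

text \<open>Integrating the density over the second point gives the measure of the atom divided by
  itself; the points in null atoms, where this fails, form a null set.\<close>

lemma coupling_marginals:
  assumes B [measurable]: "B \<in> sets M"
  shows "emeasure (coupling n) {p \<in> space M \<times> space M. fst p \<in> B} = emeasure M B"
    and "emeasure (coupling n) {p \<in> space M \<times> space M. snd p \<in> B} = emeasure M B"
proof -
  have s1: "{p \<in> space M \<times> space M. fst p \<in> B} \<in> sets (M \<Otimes>\<^sub>M M)"
    and s2: "{p \<in> space M \<times> space M. snd p \<in> B} \<in> sets (M \<Otimes>\<^sub>M M)"
    unfolding space_pair_measure[symmetric] by measurable
  let ?d = "\<lambda>x y. if r n x = r n y then ennreal (1 / measure M (atom n (r n x))) else 0"
  have inner: "AE x in M. (\<integral>\<^sup>+y. ?d x y * indicator B x \<partial>M) = indicator B x"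
    using AE_atom_pos[of n]
  proof (rule AE_mp, intro AE_I2 impI)
    fix x assume x: "x \<in> space M" "measure M (atom n (r n x)) > 0"
    have "(\<integral>\<^sup>+y. ?d x y * indicator B x \<partial>M) =
        (\<integral>\<^sup>+y. (ennreal (1 / measure M (atom n (r n x))) * indicator B x) * indicator (atom n (r n x)) y \<partial>M)"
      by (intro nn_integral_cong) (auto simp: atom_def indicator_def)
    also have "\<dots> = (ennreal (1 / measure M (atom n (r n x))) * indicator B x) * emeasure M (atom n (r n x))"
      by (rule nn_integral_cmult_indicator) simp
    also have "\<dots> = indicator B x"
      using x by (simp add: emeasure_eq_measure indicator_def ennreal_mult[symmetric])
    finally show "(\<integral>\<^sup>+y. ?d x y * indicator B x \<partial>M) = indicator B x" .
  qed
  have ind: "indicator {p \<in> space M \<times> space M. fst p \<in> B} (x, y) = (indicator B x :: ennreal)"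
    "indicator {p \<in> space M \<times> space M. snd p \<in> B} (x, y) = (indicator B y :: ennreal)"
    if "x \<in> space M" "y \<in> space M" for x y
    using that by (auto simp: indicator_def)
  have "emeasure (coupling n) {p \<in> space M \<times> space M. fst p \<in> B} =
      (\<integral>\<^sup>+p. (case p of (x, y) \<Rightarrow> ?d x y) * indicator {p \<in> space M \<times> space M. fst p \<in> B} p \<partial>(M \<Otimes>\<^sub>M M))"
    unfolding coupling_def by (rule emeasure_density) (use s1 in measurable)
  also have "\<dots> = (\<integral>\<^sup>+x. \<integral>\<^sup>+y. ?d x y * indicator {p \<in> space M \<times> space M. fst p \<in> B} (x, y) \<partial>M \<partial>M)"
    by (subst nn_integral_fst[symmetric]) (use s1 in \<open>simp_all\<close>)
  also have "\<dots> = (\<integral>\<^sup>+x. \<integral>\<^sup>+y. ?d x y * indicator B x \<partial>M \<partial>M)"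
    by (intro nn_integral_cong) (simp add: ind)
  also have "\<dots> = (\<integral>\<^sup>+x. indicator B x \<partial>M)"
    by (rule nn_integral_cong_AE[OF inner])
  finally show "emeasure (coupling n) {p \<in> space M \<times> space M. fst p \<in> B} = emeasure M B" by simp
  have "emeasure (coupling n) {p \<in> space M \<times> space M. snd p \<in> B} =
      (\<integral>\<^sup>+p. (case p of (x, y) \<Rightarrow> ?d x y) * indicator {p \<in> space M \<times> space M. snd p \<in> B} p \<partial>(M \<Otimes>\<^sub>M M))"
    unfolding coupling_def by (rule emeasure_density) (use s2 in measurable)
  also have "\<dots> = (\<integral>\<^sup>+y. \<integral>\<^sup>+x. ?d x y * indicator {p \<in> space M \<times> space M. snd p \<in> B} (x, y) \<partial>M \<partial>M)"
    by (subst MM.nn_integral_snd[symmetric]) (use s2 in \<open>simp_all\<close>)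
  \<comment> \<open>Points of equal level have the same atom, so the density is symmetric and the
    first computation applies with the roles exchanged.\<close>
  also have "\<dots> = (\<integral>\<^sup>+y. \<integral>\<^sup>+x. ?d y x * indicator B y \<partial>M \<partial>M)"
    by (intro nn_integral_cong) (auto simp: ind)
  also have "\<dots> = (\<integral>\<^sup>+y. indicator B y \<partial>M)"
    by (rule nn_integral_cong_AE[OF inner])
  finally show "emeasure (coupling n) {p \<in> space M \<times> space M. snd p \<in> B} = emeasure M B" by simp
qed

lemma prob_space_coupling: "prob_space (coupling n)"
proof (rule prob_spaceI)
  have "{p \<in> space M \<times> space M. fst p \<in> space M} = space M \<times> space M" by auto
  then show "emeasure (coupling n) (space (coupling n)) = 1"
    using coupling_marginals(1)[of "space M" n] emeasure_space_1 by simp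
qed

lemma AE_coupling: "AE p in coupling n. r n (fst p) = r n (snd p)"
  unfolding coupling_def by (subst AE_density) (auto simp: split_beta)

text \<open>Approximate \<open>W\<close> by a union of atoms of some level \<open>N\<close>. From
  there on coupled points share their atom of level \<open>N\<close>, so a pair separated by
  \<open>W\<close> has at least one point in the approximation error; the marginals bound that
  probability.\<close>

lemma coupling_separates_null:
  assumes W: "W \<in> sets M" and e: "e > 0"
  obtains N where "\<And>n. n \<ge> N \<Longrightarrow>
    emeasure (coupling n) {p \<in> space M \<times> space M. fst p \<in> W \<and> snd p \<notin> W} < ennreal e"
proof -
  obtain N U where U: "measure M {x \<in> space M. (x \<in> W) \<noteq> (r N x \<in> U)} < e / 2"
    using r_generates[OF W, of "e / 2"] e by auto
  define D where "D = {x \<in> space M. (x \<in> W) \<noteq> (r N x \<in> U)}"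
  note [measurable] = W
  have D [measurable]: "D \<in> sets M" unfolding D_def by measurable
  have "emeasure (coupling n) {p \<in> space M \<times> space M. fst p \<in> W \<and> snd p \<notin> W} < ennreal e"
    if n: "n \<ge> N" for n
  proof -
    interpret K: prob_space "coupling n" by (rule prob_space_coupling)
    let ?A = "{p \<in> space M \<times> space M. fst p \<in> D}" and ?B = "{p \<in> space M \<times> space M. snd p \<in> D}"
    have s: "?A \<in> sets (coupling n)" "?B \<in> sets (coupling n)"
      unfolding sets_coupling space_pair_measure[symmetric] by measurable
    have "AE p in coupling n. p \<in> {p \<in> space M \<times> space M. fst p \<in> W \<and> snd p \<notin> W} \<longrightarrow> p \<in> ?A \<union> ?B"
      using AE_coupling[of n]
    proof eventually_elim
      case (elim p)
      show ?case
      proof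
        assume p: "p \<in> {p \<in> space M \<times> space M. fst p \<in> W \<and> snd p \<notin> W}"
        then have "r N (fst p) = r N (snd p)" using r_mono[OF n _ _ elim] by auto
        then show "p \<in> ?A \<union> ?B" using p by (auto simp: D_def)
      qed
    qed
    then have "emeasure (coupling n) {p \<in> space M \<times> space M. fst p \<in> W \<and> snd p \<notin> W} \<le> emeasure (coupling n) (?A \<union> ?B)"
      by (rule emeasure_mono_AE) (use s in auto)
    also have "\<dots> \<le> emeasure (coupling n) ?A + emeasure (coupling n) ?B"
      by (rule emeasure_subadditive[OF s])
    also have "\<dots> = ennreal (measure M D + measure M D)"
      by (simp add: coupling_marginals emeasure_eq_measure flip: ennreal_plus)
    also have "\<dots> < ennreal e" using U e by (simp add: D_def ennreal_lessI)
    finally show ?thesis .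
  qed
  then show thesis by (rule that)
qed

text \<open>All but \<open>e / 2\<close> of the mass of \<open>w g\<close> sits on a finite set
  \<open>\<Phi>\<close> of values. If the values at a pair differ, then either the first one lies
  outside \<open>\<Phi>\<close>, or the pair is separated by one of finitely many level
  sets.\<close>

lemma coupling_cocycle_agrees:
  assumes g: "g \<in> carrier G" and e: "e > 0"
  obtains N where "\<And>n. n \<ge> N \<Longrightarrow>
    measure (coupling n) {p \<in> space M \<times> space M. w g (fst p) = w g (snd p)} > 1 - e"
proof -
  note [measurable] = w_measurable[OF g]
  define C where "C = carrier L"
  have C: "countable C" "C \<noteq> {}" using countable_L by (auto simp: C_def)
  define V where "V k = {x \<in> space M. w g x \<in> from_nat_into C ` {..<k}}" for k :: nat
  have V: "V k \<in> sets M" for k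
  proof -
    have "from_nat_into C ` {..<k} \<subseteq> carrier L" using from_nat_into[OF C(2)] by (auto simp: C_def)
    then have "w g -` (from_nat_into C ` {..<k}) \<inter> space M \<in> sets M"
      by (intro measurable_sets[OF w_measurable[OF g]]) auto
    also have "w g -` (from_nat_into C ` {..<k}) \<inter> space M = V k" by (auto simp: V_def)
    finally show ?thesis .
  qed
  have "(\<lambda>k. measure M (V k)) \<longlonglongrightarrow> measure M (\<Union>k. V k)"
    by (rule finite_Lim_measure_incseq) (use V in \<open>auto simp: incseq_def V_def\<close>)
  moreover have "(\<Union>k. V k) = space M"
  proof (intro equalityI subsetI)
    fix x assume x: "x \<in> space M"
    then have "w g x \<in> C" using w_closed g by (simp add: C_def)
    then obtain k where "from_nat_into C k = w g x" using from_nat_into_surj[OF C(1)] by blast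
    then show "x \<in> (\<Union>k. V k)" using x by (auto simp: V_def intro!: exI[of _ "Suc k"] image_eqI[of _ _ k])
  qed (auto simp: V_def)
  ultimately have "(\<lambda>k. measure M (V k)) \<longlonglongrightarrow> 1" using prob_space by simp
  then have "\<forall>\<^sub>F k in sequentially. measure M (V k) > 1 - e / 2"
    by (rule order_tendstoD) (use e in auto)
  then obtain k where k: "measure M (V k) > 1 - e / 2" by (auto simp: eventually_sequentially)
  define \<Phi> where "\<Phi> = from_nat_into C ` {..<k}"
  have \<Phi>: "finite \<Phi>" "\<Phi> \<subseteq> carrier L" using from_nat_into[OF C(2)] by (auto simp: \<Phi>_def C_def)
  define W where "W l = {x \<in> space M. w g x = l}" for l
  have W: "W l \<in> sets M" if "l \<in> \<Phi>" for l
  proof -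
    have "w g -` {l} \<inter> space M \<in> sets M"
      by (rule measurable_sets[OF w_measurable[OF g]]) (use that \<Phi> in auto)
    also have "w g -` {l} \<inter> space M = W l" by (auto simp: W_def)
    finally show ?thesis .
  qed
  \<comment> \<open>The \<open>+ 1\<close> avoids division by zero when \<open>\<Phi>\<close> is
    empty and makes the sum of the errors strictly less than \<open>e / 2\<close>.\<close>
  define e' where "e' = e / (2 * (real (card \<Phi>) + 1))"
  have e': "e' > 0" "real (card \<Phi>) * e' < e / 2"
    using e by (auto simp: e'_def field_simps)
  have "\<exists>N. \<forall>n\<ge>N. emeasure (coupling n) {p \<in> space M \<times> space M. fst p \<in> W l \<and> snd p \<notin> W l} < ennreal e'"
    if "l \<in> \<Phi>" for l
    by (rule coupling_separates_null[OF W[OF that] e'(1)]) blast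
  then have "\<forall>l\<in>\<Phi>. \<exists>N. \<forall>n\<ge>N. emeasure (coupling n) {p \<in> space M \<times> space M. fst p \<in> W l \<and> snd p \<notin> W l} < ennreal e'"
    by blast
  from bchoice[OF this] obtain N where N: "\<forall>l\<in>\<Phi>. \<forall>n\<ge>N l.
      emeasure (coupling n) {p \<in> space M \<times> space M. fst p \<in> W l \<and> snd p \<notin> W l} < ennreal e'" ..
  have "measure (coupling n) {p \<in> space M \<times> space M. w g (fst p) = w g (snd p)} > 1 - e"
    if n: "n \<ge> Max (insert 0 (N ` \<Phi>))" for n
  proof -
    interpret K: prob_space "coupling n" by (rule prob_space_coupling)
    let ?D = "{p \<in> space M \<times> space M. w g (fst p) = w g (snd p)}"
    let ?Q = "\<lambda>l. {p \<in> space M \<times> space M. fst p \<in> W l \<and> snd p \<notin> W l}"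
    let ?R = "{p \<in> space M \<times> space M. fst p \<in> space M - V k}"
    have D: "?D \<in> sets (coupling n)"
    proof -
      have "{p \<in> space (M \<Otimes>\<^sub>M M). w g (fst p) = w g (snd p)} \<in> sets (M \<Otimes>\<^sub>M M)"
        by (rule sets_eq_count_space[OF measurable_compose[OF measurable_fst w_measurable[OF g]]
          measurable_compose[OF measurable_snd w_measurable[OF g]] countable_L])
      then show ?thesis by (simp add: space_pair_measure)
    qed
    have Q: "?Q l \<in> sets (coupling n)" if "l \<in> \<Phi>" for l
      using W[OF that] unfolding sets_coupling space_pair_measure[symmetric] by measurable
    have QU: "(\<Union>l\<in>\<Phi>. ?Q l) \<in> sets (coupling n)"
      by (rule sets.finite_UN[OF \<Phi>(1)]) (rule Q)
    have R: "?R \<in> sets (coupling n)"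
      using V[of k] unfolding sets_coupling space_pair_measure[symmetric] by measurable
    have nN: "n \<ge> N l" if "l \<in> \<Phi>" for l
      using n that \<Phi>(1) by (meson Max_ge finite_imageI finite_insert image_eqI insertI2 order_trans)
    have Ql: "K.prob (?Q l) \<le> e'" if "l \<in> \<Phi>" for l
      using N[rule_format, OF that nN[OF that]] e' by (simp add: K.emeasure_eq_measure ennreal_less_iff)
    have "K.prob ?R = prob (space M - V k)"
      using coupling_marginals(1)[of "space M - V k" n] V[of k]
      by (simp add: K.emeasure_eq_measure emeasure_eq_measure)
    also have "\<dots> < e / 2" using k V[of k] by (simp add: prob_compl)
    finally have Rl: "K.prob ?R < e / 2" .
    have "space (coupling n) - ?D \<subseteq> (\<Union>l\<in>\<Phi>. ?Q l) \<union> ?R"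
      by (auto simp: W_def V_def \<Phi>_def)
    then have "K.prob (space (coupling n) - ?D) \<le> K.prob ((\<Union>l\<in>\<Phi>. ?Q l) \<union> ?R)"
      by (rule K.finite_measure_mono[OF _ sets.Un[OF QU R]])
    also have "\<dots> \<le> K.prob (\<Union>l\<in>\<Phi>. ?Q l) + K.prob ?R"
      by (rule measure_Un_le[OF QU R])
    also have "K.prob (\<Union>l\<in>\<Phi>. ?Q l) \<le> (\<Sum>l\<in>\<Phi>. K.prob (?Q l))"
      by (rule measure_UNION_le[OF \<Phi>(1)]) (rule Q)
    also have "\<dots> \<le> (\<Sum>l\<in>\<Phi>. e')" by (rule sum_mono) (use Ql in auto)
    finally have "K.prob (space (coupling n) - ?D) < e" using Rl e' by simp
    then show ?thesis using K.prob_compl[OF D] by simp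
  qed
  then show thesis by (rule that)
qed

end

section \<open>The twisted action on pairs and its almost invariant sets\<close>

context profinite_cocycle
begin

definition pairs :: "(('x \<times> 'x) \<times> 'l) measure" where
  "pairs = (M \<Otimes>\<^sub>M M) \<Otimes>\<^sub>M count_space (carrier L)"

definition twist :: "'g \<Rightarrow> ('x \<times> 'x) \<times> 'l \<Rightarrow> ('x \<times> 'x) \<times> 'l" where
  "twist g z = ((a g (fst (fst z)), a g (snd (fst z))),
     w g (fst (fst z)) \<otimes>\<^bsub>L\<^esub> snd z \<otimes>\<^bsub>L\<^esub> inv\<^bsub>L\<^esub> w g (snd (fst z)))"

lemma space_pairs: "space pairs = (space M \<times> space M) \<times> carrier L"
  by (simp add: pairs_def space_pair_measure)

lemma pairs_proj_measurable:
  "(\<lambda>z. fst (fst z)) \<in> measurable pairs M" "(\<lambda>z. snd (fst z)) \<in> measurable pairs M"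
  "snd \<in> measurable pairs (count_space (carrier L))" "fst \<in> measurable pairs (M \<Otimes>\<^sub>M M)"
  unfolding pairs_def by measurable

lemmas pairs_r_measurable =
  measurable_compose[OF pairs_proj_measurable(1) r_measurable]
  measurable_compose[OF pairs_proj_measurable(2) r_measurable]

lemma sigma_finite_fibre: "sigma_finite_measure (count_space (carrier L))"
  by (rule sigma_finite_measure_count_space_countable[OF countable_L])

lemma twist_measurable:
  assumes g: "g \<in> carrier G"
  shows "twist g \<in> measurable pairs pairs"
proof -
  let ?C = "count_space (carrier L)"
  let ?f = "\<lambda>(u, l, v). u \<otimes>\<^bsub>L\<^esub> l \<otimes>\<^bsub>L\<^esub> inv\<^bsub>L\<^esub> v"
  have 1: "(\<lambda>z. (a g (fst (fst z)), a g (snd (fst z)))) \<in> measurable pairs (M \<Otimes>\<^sub>M M)"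
    by (intro measurable_Pair measurable_compose[OF pairs_proj_measurable(1) a_measurable[OF g]]
      measurable_compose[OF pairs_proj_measurable(2) a_measurable[OF g]])
  have "(\<lambda>z. (w g (fst (fst z)), snd z, w g (snd (fst z)))) \<in> measurable pairs (?C \<Otimes>\<^sub>M ?C \<Otimes>\<^sub>M ?C)"
    by (intro measurable_Pair pairs_proj_measurable(3)
      measurable_compose[OF pairs_proj_measurable(1) w_measurable[OF g]]
      measurable_compose[OF pairs_proj_measurable(2) w_measurable[OF g]])
  then have 2: "(\<lambda>z. (w g (fst (fst z)), snd z, w g (snd (fst z)))) \<in>
      measurable pairs (count_space (carrier L \<times> carrier L \<times> carrier L))"
    using countable_L by (simp add: pair_measure_countable)
  have 3: "?f \<in> measurable (count_space (carrier L \<times> carrier L \<times> carrier L)) ?C" by auto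
  have "(\<lambda>z. ((a g (fst (fst z)), a g (snd (fst z))), ?f (w g (fst (fst z)), snd z, w g (snd (fst z)))))
      \<in> measurable pairs ((M \<Otimes>\<^sub>M M) \<Otimes>\<^sub>M ?C)"
    by (intro measurable_Pair 1 measurable_compose[OF 2 3])
  then show ?thesis by (simp add: twist_def[abs_def] pairs_def)
qed

lemma nn_integral_pairs:
  "F \<in> borel_measurable pairs \<Longrightarrow>
    (\<integral>\<^sup>+z. F z \<partial>pairs) = (\<integral>\<^sup>+p. \<integral>\<^sup>+l. F (p, l) \<partial>count_space (carrier L) \<partial>(M \<Otimes>\<^sub>M M))"
  unfolding pairs_def by (rule sigma_finite_measure.nn_integral_fst[OF sigma_finite_fibre, symmetric])

lemma distr_product:
  assumes g: "g \<in> carrier G"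
  shows "distr (M \<Otimes>\<^sub>M M) (M \<Otimes>\<^sub>M M) (\<lambda>(x, y). (a g x, a g y)) = M \<Otimes>\<^sub>M M"
  using pair_measure_distr[OF a_measurable[OF g] a_measurable[OF g]] a_distr[OF g]
    prob_space_imp_sigma_finite[OF prob_M] by simp

text \<open>For a fixed pair of points the group coordinate is moved by a left and a right
  multiplication, a permutation that preserves counting measure; on the pairs the diagonal action
  preserves the product measure.\<close>

lemma twist_nn_integral:
  assumes g: "g \<in> carrier G" and F: "F \<in> borel_measurable pairs"
  shows "(\<integral>\<^sup>+z. F (twist g z) \<partial>pairs) = (\<integral>\<^sup>+z. F z \<partial>pairs)"
proof -
  define K where "K p = (\<integral>\<^sup>+l. F (p, l) \<partial>count_space (carrier L))" for p
  have Km: "K \<in> borel_measurable (M \<Otimes>\<^sub>M M)"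
    unfolding K_def
    by (rule sigma_finite_measure.borel_measurable_nn_integral_fst[OF sigma_finite_fibre])
      (use F in \<open>simp add: pairs_def\<close>)
  have tm: "(\<lambda>(x, y). (a g x, a g y)) \<in> measurable (M \<Otimes>\<^sub>M M) (M \<Otimes>\<^sub>M M)"
    using a_measurable[OF g] by measurable
  have "(\<integral>\<^sup>+z. F (twist g z) \<partial>pairs) =
      (\<integral>\<^sup>+p. \<integral>\<^sup>+l. F (twist g (p, l)) \<partial>count_space (carrier L) \<partial>(M \<Otimes>\<^sub>M M))"
    by (rule nn_integral_pairs) (rule measurable_compose[OF twist_measurable[OF g] F])
  also have "\<dots> = (\<integral>\<^sup>+p. K ((\<lambda>(x, y). (a g x, a g y)) p) \<partial>(M \<Otimes>\<^sub>M M))"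
  proof (rule nn_integral_cong)
    fix p assume "p \<in> space (M \<Otimes>\<^sub>M M)"
    then obtain x y where p: "p = (x, y)" "x \<in> space M" "y \<in> space M"
      by (auto simp: space_pair_measure)
    define u v where "u = w g x" and "v = w g y"
    have uv: "u \<in> carrier L" "v \<in> carrier L" using p g by (auto simp: u_def v_def w_closed)
    have c: "l \<otimes>\<^bsub>L\<^esub> inv\<^bsub>L\<^esub> v \<otimes>\<^bsub>L\<^esub> v = l" "l \<otimes>\<^bsub>L\<^esub> v \<otimes>\<^bsub>L\<^esub> inv\<^bsub>L\<^esub> v = l"
      if "l \<in> carrier L" for l using that uv by (simp_all add: L.m_assoc)
    have "bij_betw (\<lambda>l. u \<otimes>\<^bsub>L\<^esub> l \<otimes>\<^bsub>L\<^esub> inv\<^bsub>L\<^esub> v) (carrier L) (carrier L)"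
      by (rule bij_betw_byWitness[where f' = "\<lambda>l. inv\<^bsub>L\<^esub> u \<otimes>\<^bsub>L\<^esub> l \<otimes>\<^bsub>L\<^esub> v"])
        (use uv in \<open>auto simp: c simp flip: L.m_assoc\<close>)
    from nn_integral_bij_count_space[OF this, of "\<lambda>l. F ((a g x, a g y), l)"]
    show "(\<integral>\<^sup>+l. F (twist g (p, l)) \<partial>count_space (carrier L)) = K ((\<lambda>(x, y). (a g x, a g y)) p)"
      by (simp add: p twist_def K_def u_def v_def)
  qed
  also have "\<dots> = (\<integral>\<^sup>+p. K p \<partial>distr (M \<Otimes>\<^sub>M M) (M \<Otimes>\<^sub>M M) (\<lambda>(x, y). (a g x, a g y)))"
    by (rule nn_integral_distr[symmetric, OF tm]) (use Km in simp)
  also have "\<dots> = (\<integral>\<^sup>+p. K p \<partial>(M \<Otimes>\<^sub>M M))" by (simp only: distr_product[OF g])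
  also have "\<dots> = (\<integral>\<^sup>+z. F z \<partial>pairs)" unfolding K_def by (rule nn_integral_pairs[OF F, symmetric])
  finally show ?thesis .
qed

lemma twist_closed: "\<lbrakk>g \<in> carrier G; z \<in> space pairs\<rbrakk> \<Longrightarrow> twist g z \<in> space pairs"
  using measurable_space[OF twist_measurable] by blast

text \<open>The action law is the cocycle identity at each of the two points: the left factors
  compose in order, and the inverses on the right compose in the reverse order.\<close>

lemma mp_twist: "mp_group_action G pairs twist"
proof (rule mp_group_action.intro)
  show "Group.group G" by (rule group_G)
  show "twist g \<in> measurable pairs pairs" if "g \<in> carrier G" for g using twist_measurable[OF that] .
  show "distr pairs pairs (twist g) = pairs" if g: "g \<in> carrier G" for g
  proof (rule measure_eqI)
    fix A assume "A \<in> sets (distr pairs pairs (twist g))"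
    then have A: "A \<in> sets pairs" by simp
    have "emeasure (distr pairs pairs (twist g)) A = (\<integral>\<^sup>+z. indicator A z \<partial>distr pairs pairs (twist g))"
      using A by simp
    also have "\<dots> = (\<integral>\<^sup>+z. indicator A (twist g z) \<partial>pairs)"
      by (rule nn_integral_distr[OF twist_measurable[OF g]]) (use A in simp)
    also have "\<dots> = emeasure pairs A"
      using twist_nn_integral[OF g borel_measurable_indicator[OF A]] A by simp
    finally show "emeasure (distr pairs pairs (twist g)) A = emeasure pairs A" .
  qed simp
  show "twist (g \<otimes>\<^bsub>G\<^esub> h) z = twist g (twist h z)"
    if "g \<in> carrier G" "h \<in> carrier G" "z \<in> space pairs" for g h z
    using that
    by (auto simp: twist_def space_pairs a_mult w_mult a_closed w_closed L.inv_mult_group L.m_assoc)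
  show "twist \<one>\<^bsub>G\<^esub> z = z" if "z \<in> space pairs" for z
    using that by (auto simp: twist_def space_pairs a_one w_one)
qed

text \<open>
  The weights \<open>1 / sqrt\<close> make this a unit vector even if the atoms of level \<open>n\<close> have different
  measures; on null atoms the weight is the junk value \<open>1 / 0 = 0\<close>.
\<close>

definition level_vector :: "nat \<Rightarrow> ('x \<times> 'x) \<times> 'l \<Rightarrow> complex" where
  "level_vector n z = (if r n (fst (fst z)) = r n (snd (fst z)) \<and> snd z = \<one>\<^bsub>L\<^esub>
     then complex_of_real (1 / sqrt (measure M (atom n (r n (fst (fst z)))))) else 0)"

lemma snd_eq_sets: "{z \<in> space pairs. snd z = \<one>\<^bsub>L\<^esub>} \<in> sets pairs"
proof -
  have "{z \<in> space pairs. snd z = \<one>\<^bsub>L\<^esub>} = snd -` {\<one>\<^bsub>L\<^esub>} \<inter> space pairs" by auto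
  then show ?thesis using measurable_sets[OF pairs_proj_measurable(3), of "{\<one>\<^bsub>L\<^esub>}"] by simp
qed

lemma diagonal_sets: "{z \<in> space pairs. r n (fst (fst z)) = r n (snd (fst z)) \<and> snd z = \<one>\<^bsub>L\<^esub>} \<in> sets pairs"
  by (intro sets.sets_Collect_conj snd_eq_sets sets_eq_count_space[OF pairs_r_measurable countableI_type])

lemma level_function_measurable:
  "(\<lambda>z. f (r n (fst (fst z)))) \<in> borel_measurable pairs"
  by (rule measurable_compose[OF pairs_r_measurable(1)]) simp

lemma level_vector_measurable: "level_vector n \<in> borel_measurable pairs"
  unfolding level_vector_def
  by (intro measurable_If level_function_measurable diagonal_sets)

text \<open>The squared modulus of \<open>level_vector\<close> is the density of the coupling placed
  on the sheet where the group coordinate is 1. Integrals over \<open>pairs\<close> thereby become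
  coupling probabilities.\<close>

lemma nn_integral_diagonal:
  assumes A: "A \<in> sets (M \<Otimes>\<^sub>M M)"
  shows "(\<integral>\<^sup>+z. (if r n (fst (fst z)) = r n (snd (fst z)) \<and> snd z = \<one>\<^bsub>L\<^esub> \<and> fst z \<in> A
      then ennreal (1 / measure M (atom n (r n (fst (fst z))))) else 0) \<partial>pairs) = emeasure (coupling n) A"
    (is "(\<integral>\<^sup>+z. ?F z \<partial>pairs) = _")
proof -
  let ?d = "\<lambda>p. (case p of (x, y) \<Rightarrow> if r n x = r n y then ennreal (1 / measure M (atom n (r n x))) else 0)
    * indicator A p"
  have "{z \<in> space pairs. fst z \<in> A} \<in> sets pairs"
    using measurable_sets[OF pairs_proj_measurable(4) A] by (simp add: vimage_def Int_def conj_commute)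
  then have Fm: "?F \<in> borel_measurable pairs"
    by (intro measurable_If level_function_measurable sets.sets_Collect_conj snd_eq_sets
      sets_eq_count_space[OF pairs_r_measurable countableI_type]) auto
  have "(\<integral>\<^sup>+z. ?F z \<partial>pairs) = (\<integral>\<^sup>+p. \<integral>\<^sup>+l. ?F (p, l) \<partial>count_space (carrier L) \<partial>(M \<Otimes>\<^sub>M M))"
    by (rule nn_integral_pairs[OF Fm])
  also have "\<dots> = (\<integral>\<^sup>+p. ?d p \<partial>(M \<Otimes>\<^sub>M M))"
  proof (rule nn_integral_cong)
    fix p
    have "(\<integral>\<^sup>+l. ?F (p, l) \<partial>count_space (carrier L)) =
        (\<integral>\<^sup>+l. ?d p * indicator {\<one>\<^bsub>L\<^esub>} l \<partial>count_space (carrier L))"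
      by (intro nn_integral_cong) (auto simp: split_beta indicator_def)
    also have "\<dots> = ?d p * emeasure (count_space (carrier L)) {\<one>\<^bsub>L\<^esub>}"
      by (rule nn_integral_cmult_indicator) simp
    finally show "(\<integral>\<^sup>+l. ?F (p, l) \<partial>count_space (carrier L)) = ?d p" by simp
  qed
  also have "\<dots> = emeasure (coupling n) A"
    unfolding coupling_def by (rule emeasure_density[symmetric]) (use A in auto)
  finally show ?thesis .
qed

lemma level_vector_norm:
  "(\<integral>\<^sup>+z. ennreal ((cmod (level_vector n z))\<^sup>2) \<partial>pairs) = 1"
proof -
  interpret K: prob_space "coupling n" by (rule prob_space_coupling)
  have "(\<integral>\<^sup>+z. ennreal ((cmod (level_vector n z))\<^sup>2) \<partial>pairs) =
    (\<integral>\<^sup>+z. (if r n (fst (fst z)) = r n (snd (fst z)) \<and> snd z = \<one>\<^bsub>L\<^esub> \<and> fst z \<in> space (M \<Otimes>\<^sub>M M)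
      then ennreal (1 / measure M (atom n (r n (fst (fst z))))) else 0) \<partial>pairs)"
    by (intro nn_integral_cong)
      (auto simp: level_vector_def norm_divide power_divide space_pairs space_pair_measure)
  also have "\<dots> = 1" using K.emeasure_space_1 by (simp add: nn_integral_diagonal space_pair_measure)
  finally show ?thesis .
qed

lemma level_vector_l2: "level_vector n \<in> l2_functions pairs"
proof -
  have "integrable pairs (\<lambda>z. (cmod (level_vector n z))\<^sup>2)"
    by (rule integrableI_nonneg) (use level_vector_measurable[of n] level_vector_norm[of n] in auto)
  then show ?thesis by (simp add: l2_functions_def level_vector_measurable)
qed

lemma level_vector_unit: "l2_ip pairs (level_vector n) (level_vector n) = 1"
  using l2_nn_integral[OF level_vector_l2, of n] level_vector_norm[of n]
  by (simp add: l2_norm_eq)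

text \<open>A point \<open>((x, y), 1)\<close> with \<open>x\<close> and \<open>y\<close> in one
  atom stays on the sheet 1 under \<open>twist g\<close> exactly if \<open>w g x = w g y\<close>,
  and the weights at both ends agree. Almost invariance of the level vectors is thus the same as
  agreement of the cocycle on coupled points.\<close>

lemma level_vector_coefficient:
  assumes g: "g \<in> carrier G"
  shows "Re (l2_ip pairs (\<lambda>z. level_vector n (twist g z)) (level_vector n)) =
    measure (coupling n) {p \<in> space M \<times> space M. w g (fst p) = w g (snd p)}"
proof -
  interpret K: prob_space "coupling n" by (rule prob_space_coupling)
  let ?A = "{p \<in> space M \<times> space M. w g (fst p) = w g (snd p)}"
  define q where "q z = (if r n (fst (fst z)) = r n (snd (fst z)) \<and> snd z = \<one>\<^bsub>L\<^esub> \<and> fst z \<in> ?A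
      then 1 / measure M (atom n (r n (fst (fst z)))) else 0)" for z :: "('x \<times> 'x) \<times> 'l"
  have A: "?A \<in> sets (M \<Otimes>\<^sub>M M)"
    using sets_eq_count_space[OF measurable_compose[OF measurable_fst w_measurable[OF g]]
          measurable_compose[OF measurable_snd w_measurable[OF g]] countable_L]
    by (simp add: space_pair_measure)
  have eq: "level_vector n (twist g z) * cnj (level_vector n z) = complex_of_real (q z)"
    if z: "z \<in> space pairs" for z
  proof -
    obtain x y l where z': "z = ((x, y), l)" "x \<in> space M" "y \<in> space M" "l \<in> carrier L"
      using z by (auto simp: space_pairs)
    show ?thesis
    proof (cases "r n x = r n y \<and> l = \<one>\<^bsub>L\<^esub>")
      case False
      then show ?thesis by (auto simp: level_vector_def q_def z')
    next
      case True
      have "(w g x \<otimes>\<^bsub>L\<^esub> \<one>\<^bsub>L\<^esub> \<otimes>\<^bsub>L\<^esub> inv\<^bsub>L\<^esub> w g y = \<one>\<^bsub>L\<^esub>) \<longleftrightarrow> w g x = w g y"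
        using w_closed[OF g z'(2)] w_closed[OF g z'(3)]
        by (metis L.inv_closed L.inv_equality L.inv_inv L.r_inv L.r_one)
      moreover have "r n (a g x) = r n (a g y)" using r_equivariant g z' True by blast
      moreover have "measure M (atom n (r n (a g x))) = measure M (atom n (r n x))"
        by (rule measure_atom_eq[OF g z'(2)])
      ultimately show ?thesis
        using z' True by (simp add: level_vector_def twist_def q_def flip: of_real_mult)
    qed
  qed
  have "{z \<in> space pairs. fst z \<in> ?A} \<in> sets pairs"
    using measurable_sets[OF pairs_proj_measurable(4) A] by (simp add: vimage_def Int_def conj_commute)
  then have qm: "q \<in> borel_measurable pairs"
    unfolding q_def
    by (intro measurable_If level_function_measurable sets.sets_Collect_conj snd_eq_sets
      sets_eq_count_space[OF pairs_r_measurable countableI_type]) auto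
  have "l2_ip pairs (\<lambda>z. level_vector n (twist g z)) (level_vector n) = (\<integral>z. complex_of_real (q z) \<partial>pairs)"
    unfolding l2_ip_def by (rule Bochner_Integration.integral_cong[OF refl eq])
  also have "\<dots> = complex_of_real (\<integral>z. q z \<partial>pairs)" by simp
  finally have "Re (l2_ip pairs (\<lambda>z. level_vector n (twist g z)) (level_vector n)) = (\<integral>z. q z \<partial>pairs)"
    by simp
  also have "\<dots> = enn2real (\<integral>\<^sup>+z. ennreal (q z) \<partial>pairs)"
    by (rule integral_eq_nn_integral[OF qm]) (simp add: q_def)
  also have "(\<integral>\<^sup>+z. ennreal (q z) \<partial>pairs) = emeasure (coupling n) ?A"
    by (subst nn_integral_diagonal[OF A, symmetric], intro nn_integral_cong) (auto simp: q_def)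
  finally show ?thesis by (simp add: measure_def)
qed

definition square :: "nat \<Rightarrow> nat \<Rightarrow> (('x \<times> 'x) \<times> 'l) set" where
  "square n b = {z \<in> space pairs. r n (fst (fst z)) = b \<and> r n (snd (fst z)) = b}"

lemma square_sets: "square n b \<in> sets pairs"
proof -
  have "square n b = (\<lambda>z. r n (fst (fst z))) -` {b} \<inter> space pairs \<inter>
      ((\<lambda>z. r n (snd (fst z))) -` {b} \<inter> space pairs)" by (auto simp: square_def)
  then show ?thesis using measurable_sets[OF pairs_r_measurable(1)] measurable_sets[OF pairs_r_measurable(2)]
    by auto
qed

lemma sum_atoms: "(\<Sum>b\<in>r n ` space M. measure M (atom n b)) = 1"
proof -
  have "(\<Union>b\<in>r n ` space M. atom n b) = space M" by (auto simp: atom_def)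
  moreover have "measure M (\<Union>b\<in>r n ` space M. atom n b) = (\<Sum>b\<in>r n ` space M. measure M (atom n b))"
    by (rule finite_measure_finite_Union) (auto simp: r_finite disjoint_family_on_def atom_def)
  ultimately show ?thesis using prob_space by simp
qed

text \<open>An invariant vector near the level vector exists globally; averaging over the atoms
  finds one square on which it is still near, relative to the measure of the atom. There it is close
  to a multiple of an indicator function, and a level set of it is an honest invariant set.\<close>

lemma almost_invariant_set:
  assumes T: "relative_property_T G H" and e: "e > 0"
  obtains n b S where "measure M (atom n b) > 0" "S \<in> sets pairs" "S \<subseteq> square n b"
    "\<And>h. h \<in> H \<inter> stab n b \<Longrightarrow> AE z in pairs. twist h z \<in> S \<longleftrightarrow> z \<in> S"
    "emeasure pairs {z \<in> square n b. (z \<in> S) \<noteq> (snd z = \<one>\<^bsub>L\<^esub>)} \<le> ennreal (e * (measure M (atom n b))\<^sup>2)"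
proof -
  interpret A: mp_group_action G pairs twist by (rule mp_twist)
  let ?\<pi> = "koopman G pairs twist"
  have e4: "e / 4 > 0" using e by simp
  obtain F \<kappa> where F: "finite F" "F \<subseteq> carrier G" and \<kappa>: "\<kappa> > 0"
    and inv: "\<And>\<xi>. \<lbrakk>\<xi> \<in> carrier (l2_module pairs); l2_ip pairs \<xi> \<xi> = 1;
        \<And>g. g \<in> F \<Longrightarrow> Re (l2_ip pairs (?\<pi> g \<xi>) \<xi>) > 1 - \<kappa>\<rbrakk> \<Longrightarrow>
      \<exists>\<eta>\<in>carrier (l2_module pairs). (\<forall>h\<in>H. ?\<pi> h \<eta> = \<eta>) \<and>
        Re (l2_ip pairs (\<xi> \<ominus>\<^bsub>l2_module pairs\<^esub> \<eta>) (\<xi> \<ominus>\<^bsub>l2_module pairs\<^esub> \<eta>)) < e / 4"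
    by (rule relative_property_T_near_invariant[OF group_G countable_G normal_H T A.unitary_rep_koopman e4]) blast
  \<comment> \<open>\<open>koopman\<close> composes with the inverse, so the coefficient at
    \<open>g\<close> is governed by the cocycle of the inverse of \<open>g\<close>.\<close>
  have "\<forall>g\<in>F. \<exists>N. \<forall>n\<ge>N.
      measure (coupling n) {p \<in> space M \<times> space M. w (inv\<^bsub>G\<^esub> g) (fst p) = w (inv\<^bsub>G\<^esub> g) (snd p)} > 1 - \<kappa>"
  proof
    fix g assume "g \<in> F"
    then have "inv\<^bsub>G\<^esub> g \<in> carrier G" using F by auto
    then show "\<exists>N. \<forall>n\<ge>N.
      measure (coupling n) {p \<in> space M \<times> space M. w (inv\<^bsub>G\<^esub> g) (fst p) = w (inv\<^bsub>G\<^esub> g) (snd p)} > 1 - \<kappa>"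
      by (rule coupling_cocycle_agrees[OF _ \<kappa>]) blast
  qed
  from bchoice[OF this] obtain N where N: "\<forall>g\<in>F. \<forall>n\<ge>N g.
      measure (coupling n) {p \<in> space M \<times> space M. w (inv\<^bsub>G\<^esub> g) (fst p) = w (inv\<^bsub>G\<^esub> g) (snd p)} > 1 - \<kappa>" ..
  define n where "n = Max (insert 0 (N ` F))"
  have nN: "n \<ge> N g" if "g \<in> F" for g
    unfolding n_def using that F(1) by (intro Max_ge) auto
  define \<xi> where "\<xi> = l2_rep pairs (level_vector n)"
  have "\<exists>\<eta>\<in>carrier (l2_module pairs). (\<forall>h\<in>H. ?\<pi> h \<eta> = \<eta>) \<and>
        Re (l2_ip pairs (\<xi> \<ominus>\<^bsub>l2_module pairs\<^esub> \<eta>) (\<xi> \<ominus>\<^bsub>l2_module pairs\<^esub> \<eta>)) < e / 4"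
  proof (rule inv)
    show "\<xi> \<in> carrier (l2_module pairs)" by (simp add: \<xi>_def l2_module_simps level_vector_l2)
    show "l2_ip pairs \<xi> \<xi> = 1"
      unfolding \<xi>_def l2_module_ip[OF level_vector_l2 level_vector_l2] by (rule level_vector_unit)
    fix g assume g: "g \<in> F"
    then have gG: "inv\<^bsub>G\<^esub> g \<in> carrier G" "g \<in> carrier G" using F by auto
    show "Re (l2_ip pairs (?\<pi> g \<xi>) \<xi>) > 1 - \<kappa>"
      unfolding \<xi>_def A.koopman_rep[OF gG(2) level_vector_l2]
        l2_module_ip[OF A.l2_comp(1)[OF gG(1) level_vector_l2] level_vector_l2]
        level_vector_coefficient[OF gG(1)]
      using N g nN by blast
  qed
  then obtain F0 where F0: "F0 \<in> l2_functions pairs"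
    and Finv: "\<And>h. h \<in> H \<Longrightarrow> ?\<pi> h (l2_rep pairs F0) = l2_rep pairs F0"
    and Fnear: "Re (l2_ip pairs (\<xi> \<ominus>\<^bsub>l2_module pairs\<^esub> l2_rep pairs F0) (\<xi> \<ominus>\<^bsub>l2_module pairs\<^esub> l2_rep pairs F0)) < e / 4"
    by (auto simp: l2_module_simps)
  define q where "q z = (cmod (level_vector n z - F0 z))\<^sup>2" for z
  have q_int: "integrable pairs q"
    using l2_integrable[OF l2_diff[OF level_vector_l2 F0], of n] by (simp add: q_def[abs_def])
  have q0: "q z \<ge> 0" for z by (simp add: q_def)
  have qe: "(\<integral>z. q z \<partial>pairs) < e / 4"
    using Fnear unfolding \<xi>_def l2_module_diff[OF level_vector_l2 F0]
      l2_module_ip[OF l2_diff[OF level_vector_l2 F0] l2_diff[OF level_vector_l2 F0]]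
    unfolding l2_norm_eq by (simp add: q_def)
  let ?B = "r n ` space M"
  let ?\<mu> = "\<lambda>b. measure M (atom n b)"
  have int_b: "integrable pairs (\<lambda>z. indicator (square n b) z * q z)" for b
    using integrable_mult_indicator[OF square_sets q_int] by simp
  \<comment> \<open>Otherwise summing over the disjoint squares would give at least
    \<open>e / 4\<close> times the total measure 1 of the atoms.\<close>
  have "\<exists>b\<in>?B. (\<integral>z. indicator (square n b) z * q z \<partial>pairs) < e / 4 * ?\<mu> b"
  proof (rule ccontr)
    assume "\<not> ?thesis"
    then have "(\<Sum>b\<in>?B. e / 4 * ?\<mu> b) \<le> (\<Sum>b\<in>?B. \<integral>z. indicator (square n b) z * q z \<partial>pairs)"
      by (intro sum_mono) (auto simp: not_less)
    also have "\<dots> = (\<integral>z. (\<Sum>b\<in>?B. indicator (square n b) z * q z) \<partial>pairs)"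
      by (rule Bochner_Integration.integral_sum[symmetric]) (rule int_b)
    also have "\<dots> \<le> (\<integral>z. q z \<partial>pairs)"
    proof (rule integral_mono)
      fix z
      have "(\<Sum>b\<in>?B. indicator (square n b) z * q z) \<le> (\<Sum>b\<in>?B. if b = r n (fst (fst z)) then q z else 0)"
        by (rule sum_mono) (auto simp: square_def indicator_def q0)
      also have "\<dots> \<le> q z" using r_finite[of n] q0 by (simp add: sum.delta)
      finally show "(\<Sum>b\<in>?B. indicator (square n b) z * q z) \<le> q z" .
    qed (use q_int int_b in auto)
    finally have "e / 4 * (\<Sum>b\<in>?B. ?\<mu> b) < e / 4" using qe by (simp add: sum_distrib_left)
    then show False unfolding sum_atoms by simp
  qed
  then obtain b where b: "(\<integral>z. indicator (square n b) z * q z \<partial>pairs) < e / 4 * ?\<mu> b" by blast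
  have "0 \<le> (\<integral>z. indicator (square n b) z * q z \<partial>pairs)"
    by (rule integral_nonneg_AE) (auto simp: q0)
  then have "0 < e / 4 * ?\<mu> b" using b by linarith
  then have mu: "?\<mu> b > 0" using e by (simp add: zero_less_mult_iff)
  \<comment> \<open>On this square the level vector has only the values \<open>1 / s\<close> and 0,
    so \<open>s * F0\<close> should be near the indicator of \<open>l = 1\<close>. Cutting at
    distance \<open>1 / 2\<close> from the value 1 keeps invariance.\<close>
  define s where "s = sqrt (?\<mu> b)"
  have s: "s > 0" "s\<^sup>2 = ?\<mu> b" using mu by (auto simp: s_def)
  define S where "S = {z \<in> square n b. cmod (complex_of_real s * F0 z - 1) < 1 / 2}"
  note F0m = l2_measurable[OF F0]
  have Sm: "S \<in> sets pairs"
  proof -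
    have "{z \<in> space pairs. cmod (complex_of_real s * F0 z - 1) < 1 / 2} \<in> sets pairs"
      using F0m by measurable
    then have "square n b \<inter> {z \<in> space pairs. cmod (complex_of_real s * F0 z - 1) < 1 / 2} \<in> sets pairs"
      using square_sets by blast
    also have "square n b \<inter> {z \<in> space pairs. cmod (complex_of_real s * F0 z - 1) < 1 / 2} = S"
      by (auto simp: S_def square_def)
    finally show ?thesis .
  qed
  have Sinv: "AE z in pairs. twist h z \<in> S \<longleftrightarrow> z \<in> S" if h: "h \<in> H \<inter> stab n b" for h
  proof -
    have hG: "h \<in> carrier G" using h H_carrier by blast
    have "AE z in pairs. F0 (twist h z) = F0 z"
      by (rule A.koopman_invariant[OF hG F0 Finv]) (use h in auto)
    then show ?thesis
    proof (rule AE_mp, intro AE_I2 impI)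
      fix z assume z: "z \<in> space pairs" and eq: "F0 (twist h z) = F0 z"
      have ax: "r n (a h x) = b \<longleftrightarrow> r n x = b" if x: "x \<in> space M" for x
      proof
        assume "r n x = b"
        then show "r n (a h x) = b" using h x by (auto simp: stab_def atom_def)
      next
        assume rx: "r n (a h x) = b"
        obtain y where "y \<in> atom n b" using mu by (metis measure_empty ex_in_conv less_irrefl)
        then have y: "y \<in> space M" "r n y = b" "r n (a h y) = b" using h by (auto simp: stab_def atom_def)
        have "r n (a (inv\<^bsub>G\<^esub> h) (a h x)) = r n (a (inv\<^bsub>G\<^esub> h) (a h y))"
          by (rule r_equivariant) (use rx y x hG a_closed in auto)
        then show "r n x = b" using a_inv_cancel(2)[OF hG] x y by simp
      qed
      have zs: "fst (fst z) \<in> space M" "snd (fst z) \<in> space M" using z by (auto simp: space_pairs)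
      have fst_twist: "fst (fst (twist h z)) = a h (fst (fst z))" "snd (fst (twist h z)) = a h (snd (fst z))"
        by (simp_all add: twist_def)
      have "twist h z \<in> square n b \<longleftrightarrow> z \<in> square n b"
        using z twist_closed[OF hG z] by (simp add: square_def ax zs fst_twist)
      then show "twist h z \<in> S \<longleftrightarrow> z \<in> S" by (simp add: S_def eq)
    qed
  qed
  let ?D = "{z \<in> square n b. (z \<in> S) \<noteq> (snd z = \<one>\<^bsub>L\<^esub>)}"
  have "?D = (square n b \<inter> S - {z \<in> space pairs. snd z = \<one>\<^bsub>L\<^esub>}) \<union> (square n b \<inter> {z \<in> space pairs. snd z = \<one>\<^bsub>L\<^esub>} - S)"
    by (auto simp: square_def)
  also have "\<dots> \<in> sets pairs" using square_sets Sm snd_eq_sets by blast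
  finally have Dm: "?D \<in> sets pairs" .
  \<comment> \<open>Wherever the cut is wrong, \<open>s * F0\<close> misses the indicator by at
    least \<open>1 / 2\<close>. Squaring gives the factor 4, and \<open>s^2\<close> supplies one of
    the two factors \<open>measure M (atom n b)\<close> of the bound; the other one comes from the
    choice of the square.\<close>
  have Dq: "1 \<le> 4 * ?\<mu> b * q z" if z: "z \<in> ?D" for z
  proof -
    have lv: "complex_of_real s * level_vector n z = (if snd z = \<one>\<^bsub>L\<^esub> then 1 else 0)"
      using z s(1) by (auto simp: level_vector_def square_def s_def[symmetric])
    have "cmod (complex_of_real s * level_vector n z - complex_of_real s * F0 z) \<ge> 1 / 2"
    proof (cases "snd z = \<one>\<^bsub>L\<^esub>")
      case True
      then have "\<not> cmod (complex_of_real s * F0 z - 1) < 1 / 2" using z by (auto simp: S_def)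
      then show ?thesis unfolding lv using True by (simp add: norm_minus_commute)
    next
      case False
      then have "cmod (complex_of_real s * F0 z - 1) < 1 / 2" using z by (auto simp: S_def)
      moreover have "1 \<le> cmod (complex_of_real s * F0 z - 1) + cmod (complex_of_real s * F0 z)"
        using norm_triangle_ineq4[of "complex_of_real s * F0 z" "complex_of_real s * F0 z - 1"] by simp
      ultimately show ?thesis unfolding lv using False by simp
    qed
    then have "s * cmod (level_vector n z - F0 z) \<ge> 1 / 2"
      using s(1) by (simp add: norm_mult flip: right_diff_distrib)
    then have "(s * cmod (level_vector n z - F0 z))\<^sup>2 \<ge> (1 / 2)\<^sup>2" by (rule power_mono) simp
    then show ?thesis using s(2) by (simp add: power_mult_distrib q_def power_divide)
  qed
  have "emeasure pairs ?D = (\<integral>\<^sup>+z. indicator ?D z \<partial>pairs)" using Dm by simp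
  also have "\<dots> \<le> (\<integral>\<^sup>+z. ennreal (4 * ?\<mu> b * (indicator (square n b) z * q z)) \<partial>pairs)"
  proof (rule nn_integral_mono)
    fix z
    show "indicator ?D z \<le> ennreal (4 * ?\<mu> b * (indicator (square n b) z * q z))"
      using Dq[of z] by (auto simp: indicator_def)
  qed
  also have "\<dots> = ennreal (\<integral>z. 4 * ?\<mu> b * (indicator (square n b) z * q z) \<partial>pairs)"
    by (rule nn_integral_eq_integral) (use int_b q0 in auto)
  also have "\<dots> = ennreal (4 * ?\<mu> b * (\<integral>z. indicator (square n b) z * q z \<partial>pairs))"
    by simp
  also have "\<dots> \<le> ennreal (4 * ?\<mu> b * (e / 4 * ?\<mu> b))"
    using b mu by (intro ennreal_leI mult_left_mono) auto
  also have "4 * ?\<mu> b * (e / 4 * ?\<mu> b) = e * (?\<mu> b)\<^sup>2" by (simp add: power2_eq_square)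
  finally have "emeasure pairs ?D \<le> ennreal (e * (?\<mu> b)\<^sup>2)" .
  moreover have "S \<subseteq> square n b" by (auto simp: S_def)
  ultimately show thesis using that[OF mu Sm _ Sinv] by blast
qed

end

context profinite_cocycle
begin

subsection \<open>Untwisting on an atom\<close>

lemma countable_H: "countable H"
  using countable_subset[OF H.subset countable_G] .

text \<open>By equivariance \<open>a g\<close> maps each atom into a single atom of the same level,
  so one point decides.\<close>

lemma stabI: "\<lbrakk>g \<in> carrier G; x \<in> atom n b; a g x \<in> atom n b\<rbrakk> \<Longrightarrow> g \<in> stab n b"
proof -
  assume g: "g \<in> carrier G" and x: "x \<in> atom n b" and gx: "a g x \<in> atom n b"
  have "a g y \<in> atom n b" if "y \<in> atom n b" for y
    using r_equivariant[OF g, of y x n] a_closed[OF g, of y] x gx that by (simp add: atom_def)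
  then show ?thesis using g by (simp add: stab_def)
qed

lemma stabD: "\<lbrakk>g \<in> stab n b; x \<in> atom n b\<rbrakk> \<Longrightarrow> a g x \<in> atom n b" "g \<in> stab n b \<Longrightarrow> g \<in> carrier G"
  by (auto simp: stab_def)

lemma atom_space: "x \<in> atom n b \<Longrightarrow> x \<in> space M"
  by (simp add: atom_def)

lemma subgroup_stab:
  assumes "x \<in> atom n b"
  shows "subgroup (stab n b) G"
proof (rule G.subgroupI)
  show "stab n b \<subseteq> carrier G" by (auto simp: stab_def)
  show "stab n b \<noteq> {}" using assms stabI[of "\<one>\<^bsub>G\<^esub>" x n b] a_one[of x] atom_space[of x n b] by auto
next
  fix g assume g: "g \<in> stab n b"
  note gG = stabD(2)[OF g]
  show "inv\<^bsub>G\<^esub> g \<in> stab n b"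
    using stabI[of "inv\<^bsub>G\<^esub> g" "a g x" n b] gG a_inv_cancel(2)[OF gG atom_space[OF assms]]
      stabD(1)[OF g assms] assms by simp
next
  fix g h assume "g \<in> stab n b" "h \<in> stab n b"
  then show "g \<otimes>\<^bsub>G\<^esub> h \<in> stab n b"
    using stabI[of "g \<otimes>\<^bsub>G\<^esub> h" x n b] assms a_mult[of g h x] atom_space[OF assms]
      stabD(1)[of h n b x] stabD(1)[of g n b "a h x"] stabD(2) by simp
qed

lemma stab_mem_iff: "\<lbrakk>h \<in> stab n b; x \<in> space M\<rbrakk> \<Longrightarrow> a h x \<in> atom n b \<longleftrightarrow> x \<in> atom n b"
proof
  assume h: "h \<in> stab n b" and x: "x \<in> space M" and hx: "a h x \<in> atom n b"
  have "inv\<^bsub>G\<^esub> h \<in> stab n b" using subgroup.m_inv_closed[OF subgroup_stab[OF hx] h] .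
  then show "x \<in> atom n b" using stabD(1)[OF _ hx] a_inv_cancel(2)[OF stabD(2)[OF h] x] by metis
qed (rule stabD)

text \<open>A right coset of the stabilizer is determined by the atom that the inverse of a
  representative sends \<open>x\<close> to, and a level has only finitely many atoms.\<close>

lemma finite_index_stab:
  assumes x: "x \<in> atom n b"
  shows "finite (rcosets\<^bsub>G\<^esub> stab n b)"
proof -
  interpret S: subgroup "stab n b" G by (rule subgroup_stab[OF x])
  define f where "f C = (SOME k. \<exists>g\<in>C. g \<in> carrier G \<and> k = r n (a (inv\<^bsub>G\<^esub> g) x))" for C
  have f: "\<exists>g\<in>C. g \<in> carrier G \<and> f C = r n (a (inv\<^bsub>G\<^esub> g) x)" if C: "C \<in> rcosets\<^bsub>G\<^esub> stab n b" for C
  proof -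
    obtain g where g: "g \<in> carrier G" "C = stab n b #>\<^bsub>G\<^esub> g" using C by (auto simp: RCOSETS_def)
    have "g \<in> C" using G.rcos_self[OF g(1) subgroup_stab[OF x]] g(2) by simp
    then have "\<exists>k. \<exists>g\<in>C. g \<in> carrier G \<and> k = r n (a (inv\<^bsub>G\<^esub> g) x)" using g(1) by blast
    then show ?thesis unfolding f_def by (rule someI_ex)
  qed
  have img: "f ` (rcosets\<^bsub>G\<^esub> stab n b) \<subseteq> r n ` space M"
  proof (rule image_subsetI)
    fix C assume C: "C \<in> rcosets\<^bsub>G\<^esub> stab n b"
    obtain g where g: "g \<in> carrier G" "f C = r n (a (inv\<^bsub>G\<^esub> g) x)" using f[OF C] by blast
    then show "f C \<in> r n ` space M"
      using a_closed[OF G.inv_closed[OF g(1)] atom_space[OF x]] by simp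
  qed
  have inj: "inj_on f (rcosets\<^bsub>G\<^esub> stab n b)"
  proof (rule inj_onI)
    fix C D assume C: "C \<in> rcosets\<^bsub>G\<^esub> stab n b" and D: "D \<in> rcosets\<^bsub>G\<^esub> stab n b" and eq: "f C = f D"
    obtain g h where g: "g \<in> C" "g \<in> carrier G" "f C = r n (a (inv\<^bsub>G\<^esub> g) x)"
      and h: "h \<in> D" "h \<in> carrier G" "f D = r n (a (inv\<^bsub>G\<^esub> h) x)" using f[OF C] f[OF D] by blast
    note xs = atom_space[OF x]
    have 1: "r n (a g (a (inv\<^bsub>G\<^esub> g) x)) = r n (a g (a (inv\<^bsub>G\<^esub> h) x))"
      by (rule r_equivariant) (use g h eq xs a_closed in auto)
    have "g \<otimes>\<^bsub>G\<^esub> inv\<^bsub>G\<^esub> h \<in> stab n b"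
    proof (rule stabI[OF _ x])
      show "a (g \<otimes>\<^bsub>G\<^esub> inv\<^bsub>G\<^esub> h) x \<in> atom n b"
        using 1 a_mult[of g "inv\<^bsub>G\<^esub> h" x] a_inv_cancel(1)[OF g(2) xs] g h xs x
          a_closed[of g] a_closed[of "inv\<^bsub>G\<^esub> h" x]
        by (simp add: atom_def)
    qed (use g h in auto)
    then have "g \<in> stab n b #>\<^bsub>G\<^esub> h"
      using g h by (auto simp: r_coset_def G.m_assoc intro!: bexI[of _ "g \<otimes>\<^bsub>G\<^esub> inv\<^bsub>G\<^esub> h"])
    moreover have "D = stab n b #>\<^bsub>G\<^esub> h"
      using D h(1) G.repr_independence[OF _ _ subgroup_stab[OF x]] by (auto simp: RCOSETS_def)
    ultimately have "g \<in> C \<inter> D" using g by blast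
    then show "C = D" using G.rcos_disjoint[OF subgroup_stab[OF x]] C D
      by (auto simp: pairwise_def disjnt_def)
  qed
  show ?thesis by (rule finite_imageD[OF finite_subset[OF img r_finite] inj])
qed

text \<open>The union of all translates of \<open>B\<close> is exactly \<open>H\<close>-invariant,
  and measurable because \<open>H\<close> is countable, so ergodicity applies to it.\<close>

lemma orbit_of_positive_set:
  assumes B: "B \<in> sets M" and pos: "emeasure M B \<noteq> 0"
  shows "AE x in M. \<exists>h\<in>H. a h x \<in> B"
proof -
  define B' where "B' = (\<Union>h\<in>H. a h -` B \<inter> space M)"
  have "B' \<in> sets M" unfolding B'_def
    by (intro sets.countable_UN'' countable_H measurable_sets[OF a_measurable] H_carrier B)
  moreover have "a k x \<in> B' \<longleftrightarrow> x \<in> B'" if k: "k \<in> H" and x: "x \<in> space M" for k x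
  proof -
    have kG: "k \<in> carrier G" using k H_carrier by blast
    have 1: "a h (a k x) \<in> B \<Longrightarrow> \<exists>h\<in>H. a h x \<in> B" if "h \<in> H" for h
      using that k x a_mult[of h k x] H_carrier H.m_closed by metis
    have 2: "a h x \<in> B \<Longrightarrow> \<exists>h\<in>H. a h (a k x) \<in> B" if "h \<in> H" for h
      using that k x a_mult[of "h \<otimes>\<^bsub>G\<^esub> inv\<^bsub>G\<^esub> k" k x] H_carrier[OF that] kG
      by (intro bexI[of _ "h \<otimes>\<^bsub>G\<^esub> inv\<^bsub>G\<^esub> k"]) (auto simp: G.m_assoc)
    show ?thesis unfolding B'_def using 1 2 x a_closed[OF kG x] by auto
  qed
  moreover have "B \<subseteq> B'"
  proof
    fix x assume "x \<in> B"
    then have "x \<in> space M" "a \<one>\<^bsub>G\<^esub> x \<in> B" using sets.sets_into_space[OF B] a_one by auto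
    then show "x \<in> B'" using H.one_closed by (auto simp: B'_def)
  qed
  then have "emeasure M B' \<noteq> 0" using emeasure_mono[OF _ \<open>B' \<in> sets M\<close>] pos by (metis le_zero_eq)
  ultimately have "AE x in M. x \<in> B'" by (rule ergodic_H)
  then show ?thesis by eventually_elim (auto simp: B'_def)
qed

text \<open>Ergodicity on the whole space passes to atoms: almost every point of the atom is moved
  into \<open>B\<close> by some element of \<open>H\<close>, and an element that moves a point of
  the atom into the atom stabilizes it. Since invariance is applied only to pull back from
  \<open>B\<close>, it is required in one direction.\<close>

lemma ergodic_atom:
  assumes B: "B \<in> sets M" "B \<subseteq> atom n b" and pos: "emeasure M B \<noteq> 0"
    and inv: "\<And>h. h \<in> H \<inter> stab n b \<Longrightarrow> AE x in M. x \<in> atom n b \<longrightarrow> a h x \<in> B \<longrightarrow> x \<in> B"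
  shows "AE x in M. x \<in> atom n b \<longrightarrow> x \<in> B"
proof -
  have "AE x in M. \<forall>h\<in>H \<inter> stab n b. x \<in> atom n b \<longrightarrow> a h x \<in> B \<longrightarrow> x \<in> B"
    using inv countable_subset[OF _ countable_H] by (subst AE_ball_countable) auto
  then show ?thesis using orbit_of_positive_set[OF B(1) pos]
  proof eventually_elim
    case (elim x)
    show ?case
    proof
      assume x: "x \<in> atom n b"
      obtain h where h: "h \<in> H" "a h x \<in> B" using elim by blast
      then have "h \<in> stab n b" using stabI[OF H_carrier x] B(2) by blast
      then show "x \<in> B" using elim h x by blast
    qed
  qed
qed

text \<open>By ergodicity some point of the first atom is moved into the second, and equivariance
  extends this from one point to the whole atom.\<close>

lemma transitive_on_atoms:
  assumes "measure M (atom n b) > 0" "measure M (atom n b') > 0"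
  obtains h where "h \<in> H" "\<And>x. x \<in> atom n b \<Longrightarrow> a h x \<in> atom n b'"
proof -
  have ne: "emeasure M (atom n b) \<noteq> 0" "emeasure M (atom n b') \<noteq> 0"
    using assms by (auto simp: emeasure_eq_measure)
  have "AE x in M. \<exists>h\<in>H. a h x \<in> atom n b'" by (rule orbit_of_positive_set[OF atom_sets ne(2)])
  then have AE1: "AE x in M. \<exists>h\<in>H. a h x \<in> atom n b'" .
  have "\<exists>x\<in>atom n b. \<exists>h\<in>H. a h x \<in> atom n b'"
  proof (rule ccontr)
    assume neg: "\<not> ?thesis"
    have "AE x in M. x \<notin> atom n b" using AE1 by eventually_elim (use neg in blast)
    then show False using ne(1) AE_iff_null_sets[OF atom_sets] by auto
  qed
  then obtain x h where x: "x \<in> atom n b" and h: "h \<in> H" "a h x \<in> atom n b'" by blast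
  have "a h y \<in> atom n b'" if "y \<in> atom n b" for y
    using r_equivariant[of h y x n] that x h H_carrier a_closed by (auto simp: atom_def)
  with h(1) show thesis by (rule that)
qed

end

section \<open>The untwisting map read off from an almost invariant set\<close>

locale almost_invariant = profinite_cocycle G H L M a w r
  for G :: "'g monoid" and H and L :: "'l monoid" and M :: "'x measure" and a w r +
  fixes n b :: nat and S :: "(('x \<times> 'x) \<times> 'l) set"
  assumes atom_pos: "measure M (atom n b) > 0"
    and S_sets: "S \<in> sets pairs" and S_square: "S \<subseteq> square n b"
    and S_invariant: "h \<in> H \<inter> stab n b \<Longrightarrow> AE z in pairs. twist h z \<in> S \<longleftrightarrow> z \<in> S"
    and S_near: "emeasure pairs {z \<in> square n b. (z \<in> S) \<noteq> (snd z = \<one>\<^bsub>L\<^esub>)}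
      \<le> ennreal (1 / 100 * (measure M (atom n b))\<^sup>2)"
begin

abbreviation (input) base where "base \<equiv> atom n b"
abbreviation (input) \<mu> where "\<mu> \<equiv> measure M base"
abbreviation (input) K where "K \<equiv> H \<inter> stab n b"

lemma atom_nonempty: obtains x where "x \<in> base"
proof -
  have "base \<noteq> {}" using atom_pos by auto
  then show thesis using that by blast
qed

lemma K_subgroup: "subgroup K G"
proof -
  obtain x where "x \<in> base" by (rule atom_nonempty)
  then show ?thesis by (intro G.subgroups_Inter_pair H.subgroup_axioms subgroup_stab)
qed

lemma K_carrier: "h \<in> K \<Longrightarrow> h \<in> carrier G"
  using H_carrier by blast

lemma countable_K: "countable K"
  using countable_subset[OF _ countable_H] by auto

definition D where "D = {z \<in> square n b. (z \<in> S) \<noteq> (snd z = \<one>\<^bsub>L\<^esub>)}"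

lemma D_sets: "D \<in> sets pairs"
proof -
  have "D = (square n b \<inter> S - {z \<in> space pairs. snd z = \<one>\<^bsub>L\<^esub>}) \<union> (square n b \<inter> {z \<in> space pairs. snd z = \<one>\<^bsub>L\<^esub>} - S)"
    by (auto simp: D_def square_def)
  also have "\<dots> \<in> sets pairs" using square_sets S_sets snd_eq_sets by blast
  finally show ?thesis .
qed

lemma square_iff: "((x, y), l) \<in> square n b \<longleftrightarrow> x \<in> base \<and> y \<in> base \<and> l \<in> carrier L"
  by (auto simp: square_def space_pairs atom_def)

lemma disagreement_sets:
  assumes g: "g \<in> carrier G"
  shows "{p \<in> base \<times> base. w g (fst p) \<noteq> w g (snd p)} \<in> sets (M \<Otimes>\<^sub>M M)"
proof -
  have "{p \<in> space (M \<Otimes>\<^sub>M M). w g (fst p) = w g (snd p)} \<in> sets (M \<Otimes>\<^sub>M M)"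
    by (rule sets_eq_count_space[OF measurable_compose[OF measurable_fst w_measurable[OF g]]
        measurable_compose[OF measurable_snd w_measurable[OF g]] countable_L])
  then have "base \<times> base - {p \<in> space (M \<Otimes>\<^sub>M M). w g (fst p) = w g (snd p)} \<in> sets (M \<Otimes>\<^sub>M M)" by auto
  also have "base \<times> base - {p \<in> space (M \<Otimes>\<^sub>M M). w g (fst p) = w g (snd p)} =
      {p \<in> base \<times> base. w g (fst p) \<noteq> w g (snd p)}"
    by (auto simp: space_pair_measure atom_def)
  finally show ?thesis .
qed

text \<open>If \<open>w h x\<close> and \<open>w h y\<close> differ, \<open>twist h\<close> moves
  \<open>((x, y), 1)\<close> off the sheet 1. As \<open>S\<close> is invariant, it differs from that
  sheet either at this point or at its image, and both events have the measure of \<open>D\<close>.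
  The bound is the same for all \<open>h\<close>.\<close>

lemma cocycle_nearly_constant_pairs:
  assumes h: "h \<in> K"
  shows "emeasure (M \<Otimes>\<^sub>M M) {p \<in> base \<times> base. w h (fst p) \<noteq> w h (snd p)} \<le> ennreal (1 / 50 * \<mu>\<^sup>2)"
proof -
  interpret A: mp_group_action G pairs twist by (rule mp_twist)
  interpret SC: sigma_finite_measure "count_space (carrier L)" by (rule sigma_finite_fibre)
  note hG = K_carrier[OF h]
  let ?Q = "{p \<in> base \<times> base. w h (fst p) \<noteq> w h (snd p)}"
  have Q: "?Q \<in> sets (M \<Otimes>\<^sub>M M)" by (rule disagreement_sets[OF hG])
  have tD: "twist h -` D \<inter> space pairs \<in> sets pairs" by (rule measurable_sets[OF A.T_measurable[OF hG] D_sets])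
  have "emeasure (M \<Otimes>\<^sub>M M) ?Q = emeasure pairs (?Q \<times> {\<one>\<^bsub>L\<^esub>})"
    unfolding pairs_def by (subst SC.emeasure_pair_measure_Times[OF Q]) auto
  also have "\<dots> \<le> emeasure pairs (D \<union> (twist h -` D \<inter> space pairs))"
  proof (rule emeasure_mono_AE)
    show "AE z in pairs. z \<in> ?Q \<times> {\<one>\<^bsub>L\<^esub>} \<longrightarrow> z \<in> D \<union> (twist h -` D \<inter> space pairs)"
      using S_invariant[OF h]
    proof (rule AE_mp, intro AE_I2 impI)
      fix z assume z: "z \<in> space pairs" "twist h z \<in> S \<longleftrightarrow> z \<in> S" "z \<in> ?Q \<times> {\<one>\<^bsub>L\<^esub>}"
      then obtain x y where xy: "z = ((x, y), \<one>\<^bsub>L\<^esub>)" "x \<in> base" "y \<in> base" "w h x \<noteq> w h y" by auto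
      have uv: "w h x \<in> carrier L" "w h y \<in> carrier L" using w_closed[OF hG] xy atom_space by auto
      have ne: "w h x \<otimes>\<^bsub>L\<^esub> \<one>\<^bsub>L\<^esub> \<otimes>\<^bsub>L\<^esub> inv\<^bsub>L\<^esub> w h y \<noteq> \<one>\<^bsub>L\<^esub>"
        using xy(4) uv by (metis L.inv_closed L.inv_equality L.inv_inv L.r_one)
      show "z \<in> D \<union> (twist h -` D \<inter> space pairs)"
      proof (cases "z \<in> D")
        case False
        then have "z \<in> S" using xy by (auto simp: D_def square_iff)
        then have "twist h z \<in> S" using z by simp
        moreover have "twist h z \<in> square n b" using S_square calculation by blast
        moreover have "snd (twist h z) \<noteq> \<one>\<^bsub>L\<^esub>" using ne by (simp add: twist_def xy)
        ultimately show ?thesis using z by (auto simp: D_def)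
      qed simp
    qed
  qed (use D_sets tD in auto)
  also have "\<dots> \<le> emeasure pairs D + emeasure pairs (twist h -` D \<inter> space pairs)"
    by (rule emeasure_subadditive[OF D_sets tD])
  also have "emeasure pairs (twist h -` D \<inter> space pairs) = emeasure pairs D"
    using emeasure_distr[OF A.T_measurable[OF hG] D_sets] A.T_distr[OF hG] by simp
  also have "emeasure pairs D + emeasure pairs D \<le> ennreal (1 / 100 * \<mu>\<^sup>2) + ennreal (1 / 100 * \<mu>\<^sup>2)"
    using S_near unfolding D_def by (intro add_mono)
  also have "\<dots> = ennreal (1 / 50 * \<mu>\<^sup>2)" by (simp flip: ennreal_plus)
  finally show ?thesis .
qed

lemma w_fibre_sets: "g \<in> carrier G \<Longrightarrow> {x \<in> base. w g x \<noteq> l} \<in> sets M"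
proof -
  assume g: "g \<in> carrier G"
  have "w g -` (carrier L - {l}) \<inter> space M \<inter> base \<in> sets M"
    by (intro sets.Int measurable_sets[OF w_measurable[OF g]]) auto
  also have "w g -` (carrier L - {l}) \<inter> space M \<inter> base = {x \<in> base. w g x \<noteq> l}"
    using w_closed[OF g] by (auto simp: atom_def)
  finally show ?thesis .
qed

text \<open>Take the value \<open>w h y\<close> at a random point \<open>y\<close> of the atom: on
  average it is missed on a set of measure at most \<open>\<mu> / 50\<close>, so not every candidate
  can be missed on more than \<open>\<mu> / 20\<close>.\<close>

lemma cocycle_nearly_constant:
  assumes h: "h \<in> K"
  shows "\<exists>l\<in>carrier L. measure M {x \<in> base. w h x \<noteq> l} \<le> \<mu> / 20"
proof (rule ccontr)
  assume neg: "\<not> ?thesis"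
  note hG = K_carrier[OF h]
  let ?Q = "{p \<in> base \<times> base. w h (fst p) \<noteq> w h (snd p)}"
  have Q: "?Q \<in> sets (M \<Otimes>\<^sub>M M)" by (rule disagreement_sets[OF hG])
  have "ennreal (\<mu> / 20) * emeasure M base = (\<integral>\<^sup>+y. ennreal (\<mu> / 20) * indicator base y \<partial>M)"
    by (rule nn_integral_cmult_indicator[symmetric]) simp
  also have "\<dots> \<le> (\<integral>\<^sup>+y. emeasure M (Pair y -` ?Q) \<partial>M)"
  proof (rule nn_integral_mono)
    fix y assume y: "y \<in> space M"
    show "ennreal (\<mu> / 20) * indicator base y \<le> emeasure M (Pair y -` ?Q)"
    proof (cases "y \<in> base")
      case True
      have "Pair y -` ?Q = {x \<in> base. w h x \<noteq> w h y}" using True by auto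
      then show ?thesis
        using neg w_closed[OF hG y] True by (auto simp: emeasure_eq_measure not_le intro: less_imp_le)
    qed simp
  qed
  also have "\<dots> = emeasure (M \<Otimes>\<^sub>M M) ?Q" by (rule emeasure_pair_measure_alt[OF Q, symmetric])
  also have "\<dots> \<le> ennreal (1 / 50 * \<mu>\<^sup>2)" by (rule cocycle_nearly_constant_pairs[OF h])
  finally have "\<mu> / 20 * \<mu> \<le> 1 / 50 * \<mu>\<^sup>2"
    by (simp add: emeasure_eq_measure flip: ennreal_mult)
  moreover have "\<mu>\<^sup>2 > 0" using atom_pos by simp
  ultimately show False by (simp add: power2_eq_square)
qed

definition \<delta> where "\<delta> h = (SOME l. l \<in> carrier L \<and> measure M {x \<in> base. w h x \<noteq> l} \<le> \<mu> / 20)"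

lemma \<delta>:
  assumes "h \<in> K"
  shows "\<delta> h \<in> carrier L" "measure M {x \<in> base. w h x \<noteq> \<delta> h} \<le> \<mu> / 20"
proof -
  have "\<delta> h \<in> carrier L \<and> measure M {x \<in> base. w h x \<noteq> \<delta> h} \<le> \<mu> / 20"
    unfolding \<delta>_def by (rule someI_ex) (use cocycle_nearly_constant[OF assms] in blast)
  then show "\<delta> h \<in> carrier L" "measure M {x \<in> base. w h x \<noteq> \<delta> h} \<le> \<mu> / 20" by auto
qed

end

context profinite_cocycle
begin

lemma slice_sets:
  assumes A: "A \<in> sets pairs" and l: "l \<in> carrier L" and x: "x \<in> space M"
  shows "{y. ((x, y), l) \<in> A} \<in> sets M"
proof -
  have "(\<lambda>y. ((x, y), l)) \<in> measurable M pairs"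
    unfolding pairs_def using x l by (intro measurable_Pair) auto
  from measurable_sets[OF this A] show ?thesis
    using sets.sets_into_space[OF A] by (auto simp: space_pairs vimage_def Int_def conj_commute
      elim!: back_subst[of "\<lambda>B. B \<in> sets M"])
qed

lemma slice_measurable:
  assumes A: "A \<in> sets pairs" and l: "l \<in> carrier L"
  shows "(\<lambda>x. measure M {y. ((x, y), l) \<in> A}) \<in> borel_measurable M"
proof -
  have "(\<lambda>p. (p, l)) \<in> measurable (M \<Otimes>\<^sub>M M) pairs"
    unfolding pairs_def using l by (intro measurable_Pair) auto
  from measurable_sets[OF this A] have B: "(\<lambda>p. (p, l)) -` A \<inter> space (M \<Otimes>\<^sub>M M) \<in> sets (M \<Otimes>\<^sub>M M)" .
  have eq: "{y. ((x, y), l) \<in> A} = Pair x -` ((\<lambda>p. (p, l)) -` A \<inter> space (M \<Otimes>\<^sub>M M))" for x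
    using sets.sets_into_space[OF A] by (auto simp: space_pairs space_pair_measure)
  show ?thesis unfolding measure_def eq using measurable_emeasure_Pair[OF B] by measurable
qed

end

context almost_invariant
begin

lemma vimage_atom_eq:
  assumes h: "h \<in> stab n b" and B: "B \<in> sets M" "B \<subseteq> base"
  shows "{x \<in> base. a h x \<in> B} = a h -` B \<inter> space M"
proof (rule equalityI; rule subsetI)
    fix x assume "x \<in> {x \<in> base. a h x \<in> B}"
    then show "x \<in> a h -` B \<inter> space M" by (simp add: atom_def)
  next
    fix x assume "x \<in> a h -` B \<inter> space M"
    then have x: "a h x \<in> B" "x \<in> space M" by simp_all
    have "x \<in> base" by (rule iffD1[OF stab_mem_iff[OF h x(2)] subsetD[OF B(2) x(1)]])
    then show "x \<in> {x \<in> base. a h x \<in> B}" using x(1) by simp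
  qed
lemma measure_a_vimage_atom:
  assumes h: "h \<in> stab n b" and B: "B \<in> sets M" "B \<subseteq> base"
  shows "{x \<in> base. a h x \<in> B} \<in> sets M" "measure M {x \<in> base. a h x \<in> B} = measure M B"
proof -
  note hG = stabD(2)[OF h]
  note eq = vimage_atom_eq[OF h B]
  show "{x \<in> base. a h x \<in> B} \<in> sets M"
    unfolding eq by (rule measurable_sets[OF a_measurable[OF hG] B(1)])
  have "emeasure M (a h -` B \<inter> space M) = emeasure M B"
    by (rule emeasure_a_vimage[OF hG B(1)])
  then show "measure M {x \<in> base. a h x \<in> B} = measure M B"
    unfolding eq measure_def by (rule arg_cong)
qed

text \<open>The three exceptional sets together have measure at most \<open>3 / 20\<close> of the
  atom. At any remaining point all three cocycle values are the typical ones, and the cocycle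
  identity relates them.\<close>

lemma \<delta>_hom:
  assumes h: "h \<in> K" and k: "k \<in> K"
  shows "\<delta> (h \<otimes>\<^bsub>G\<^esub> k) = \<delta> h \<otimes>\<^bsub>L\<^esub> \<delta> k"
proof -
  have hk: "h \<otimes>\<^bsub>G\<^esub> k \<in> K" by (rule subgroup.m_closed[OF K_subgroup h k])
  note G = K_carrier[OF h] K_carrier[OF k] K_carrier[OF hk]
  define A where "A = {x \<in> base. w (h \<otimes>\<^bsub>G\<^esub> k) x \<noteq> \<delta> (h \<otimes>\<^bsub>G\<^esub> k)}"
  define B where "B = {x \<in> base. w k x \<noteq> \<delta> k}"
  define B' where "B' = {x \<in> base. w h x \<noteq> \<delta> h}"
  define C where "C = {x \<in> base. a k x \<in> B'}"
  have kS: "k \<in> stab n b" using k by simp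
  have s: "A \<in> sets M" "B \<in> sets M" "B' \<in> sets M"
    unfolding A_def B_def B'_def by (rule w_fibre_sets[OF G(3)] w_fibre_sets[OF G(2)] w_fibre_sets[OF G(1)])+
  have "B' \<subseteq> base" by (auto simp: B'_def)
  note C = measure_a_vimage_atom[OF kS s(3) this, folded C_def]
  have "measure M (A \<union> B \<union> C) \<le> measure M (A \<union> B) + measure M C"
    by (rule measure_Un_le[OF sets.Un[OF s(1,2)] C(1)])
  also have "measure M (A \<union> B) \<le> measure M A + measure M B"
    by (rule measure_Un_le[OF s(1,2)])
  finally have "measure M (A \<union> B \<union> C) \<le> \<mu> / 20 + \<mu> / 20 + \<mu> / 20"
    using \<delta>(2)[OF h] \<delta>(2)[OF k] \<delta>(2)[OF hk] C(2) unfolding A_def B_def B'_def by linarith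
  then have lt: "measure M (A \<union> B \<union> C) < \<mu>" using atom_pos by simp
  have "\<not> base \<subseteq> A \<union> B \<union> C"
  proof
    assume "base \<subseteq> A \<union> B \<union> C"
    from finite_measure_mono[OF this sets.Un[OF sets.Un[OF s(1,2)] C(1)]] lt show False by simp
  qed
  then have "\<exists>x\<in>base. x \<notin> A \<and> x \<notin> B \<and> x \<notin> C" by blast
  then obtain x where x: "x \<in> base" "w (h \<otimes>\<^bsub>G\<^esub> k) x = \<delta> (h \<otimes>\<^bsub>G\<^esub> k)" "w k x = \<delta> k" "a k x \<notin> base \<or> w h (a k x) = \<delta> h"
    unfolding A_def B_def C_def B'_def by blast
  moreover have "a k x \<in> base" using k x(1) stabD(1) by blast
  ultimately show ?thesis using w_mult[OF G(1,2) atom_space[OF x(1)]] by simp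
qed


lemma S_base: "((x, y), l) \<in> S \<Longrightarrow> x \<in> base \<and> y \<in> base \<and> l \<in> carrier L"
  using subsetD[OF S_square] square_iff by blast

definition m where "m l x = measure M {y. ((x, y), l) \<in> S}"
definition d where "d l x = measure M {y. ((x, y), l) \<in> D}"

text \<open>
  Up to \<open>\<mu> / 20\<close>, the mass that the slice of \<open>S\<close> at \<open>x\<close> has at \<open>l\<close> is moved by \<open>h\<close> to
  \<open>w h x \<cdot> l \<cdot> (\<delta> h)\<^sup>-\<^sup>1\<close>.  Hence the place where this mass is large is an equivariant function of \<open>x\<close>.
\<close>

lemma slice_transport:
  assumes h: "h \<in> K"
  shows "AE x in M. x \<in> base \<longrightarrow> (\<forall>l\<in>carrier L.
    m l x - \<mu> / 20 \<le> m (w h x \<otimes>\<^bsub>L\<^esub> l \<otimes>\<^bsub>L\<^esub> inv\<^bsub>L\<^esub> \<delta> h) (a h x))"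
proof -
  interpret PP: pair_sigma_finite "M \<Otimes>\<^sub>M M" "count_space (carrier L)"
    by (intro pair_sigma_finite.intro sigma_finite_fibre)
      (rule MM.sigma_finite_measure_axioms)
  note hG = K_carrier[OF h]
  have "AE p in M \<Otimes>\<^sub>M M. AE l in count_space (carrier L). twist h (p, l) \<in> S \<longleftrightarrow> (p, l) \<in> S"
    by (rule PP.AE_pair[folded pairs_def, OF S_invariant[OF h]])
  then have "AE p in M \<Otimes>\<^sub>M M. \<forall>l\<in>carrier L. twist h (p, l) \<in> S \<longleftrightarrow> (p, l) \<in> S"
    by (simp add: AE_count_space)
  then have "AE x in M. AE y in M. \<forall>l\<in>carrier L. twist h ((x, y), l) \<in> S \<longleftrightarrow> ((x, y), l) \<in> S"
    by (rule MM.AE_pair)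
  then show ?thesis
  proof (rule AE_mp, intro AE_I2 impI ballI)
    fix x l assume x: "x \<in> space M" "x \<in> base" and l: "l \<in> carrier L"
      and ae: "AE y in M. \<forall>l\<in>carrier L. twist h ((x, y), l) \<in> S \<longleftrightarrow> ((x, y), l) \<in> S"
    define l' where "l' = w h x \<otimes>\<^bsub>L\<^esub> l \<otimes>\<^bsub>L\<^esub> inv\<^bsub>L\<^esub> \<delta> h"
    have l': "l' \<in> carrier L" using l \<delta>(1)[OF h] w_closed[OF hG x(1)] by (simp add: l'_def)
    \<comment> \<open>If \<open>w h y = \<delta> h\<close>, the twist carries
      \<open>((x, y), l)\<close> to \<open>((a h x, a h y), l')\<close>, so invariance of
      \<open>S\<close> puts \<open>y\<close> into \<open>?A3\<close>; \<open>?A2\<close> is the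
      exceptional rest.\<close>
    let ?A2 = "{y \<in> base. w h y \<noteq> \<delta> h}" and ?A3 = "{y \<in> base. a h y \<in> {y. ((a h x, y), l') \<in> S}}"
    have sl: "{y. ((a h x, y), l') \<in> S} \<in> sets M"
      by (rule slice_sets[OF S_sets l' a_closed[OF hG x(1)]])
    have sb: "{y. ((a h x, y), l') \<in> S} \<subseteq> base" using S_square by (auto simp: square_iff dest!: subsetD)
    have A3: "?A3 \<in> sets M" "measure M ?A3 = m l' (a h x)"
      using measure_a_vimage_atom[OF _ sl sb, of h] h by (auto simp: m_def)
    have "m l x \<le> measure M (?A2 \<union> ?A3)"
      unfolding m_def
    proof (rule finite_measure_mono_AE)
      show "AE y in M. y \<in> {y. ((x, y), l) \<in> S} \<longrightarrow> y \<in> ?A2 \<union> ?A3"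
        using ae
      proof (rule AE_mp, intro AE_I2 impI)
        fix y assume inv: "\<forall>l\<in>carrier L. twist h ((x, y), l) \<in> S \<longleftrightarrow> ((x, y), l) \<in> S"
          and y: "y \<in> {y. ((x, y), l) \<in> S}"
        then have "twist h ((x, y), l) \<in> S" using l by simp
        moreover have "y \<in> base" using y S_square by (auto simp: square_iff dest!: subsetD)
        ultimately show "y \<in> ?A2 \<union> ?A3" by (auto simp: twist_def l'_def)
      qed
    qed (use A3(1) w_fibre_sets[OF hG] in auto)
    also have "\<dots> \<le> measure M ?A2 + measure M ?A3"
      by (rule measure_Un_le) (use A3(1) w_fibre_sets[OF hG] in auto)
    also have "\<dots> \<le> \<mu> / 20 + m l' (a h x)" using \<delta>(2)[OF h] A3(2) by simp
    finally show "m l x - \<mu> / 20 \<le> m (w h x \<otimes>\<^bsub>L\<^esub> l \<otimes>\<^bsub>L\<^esub> inv\<^bsub>L\<^esub> \<delta> h) (a h x)"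
      by (simp add: l'_def)
  qed
qed

definition peaked where "peaked = {x \<in> base. \<forall>l\<in>carrier L. d l x < \<mu> / 10}"

lemma peaked_sets: "peaked \<in> sets M"
proof -
  have "{x \<in> space M. \<not> d l x < \<mu> / 10} \<in> sets M" if "l \<in> carrier L" for l
    using slice_measurable[OF D_sets that] unfolding d_def by measurable
  then have "base - (\<Union>l\<in>carrier L. {x \<in> space M. \<not> d l x < \<mu> / 10}) \<in> sets M"
    using countable_L by (intro sets.Diff sets.countable_UN'') auto
  also have "base - (\<Union>l\<in>carrier L. {x \<in> space M. \<not> d l x < \<mu> / 10}) = peaked"
    by (auto simp: peaked_def atom_def)
  finally show ?thesis .
qed

text \<open>Otherwise almost every point of the atom would have a slice of \<open>D\<close> of
  measure at least \<open>\<mu> / 10\<close>, and by Fubini \<open>D\<close> would have measure at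
  least \<open>\<mu>^2 / 10\<close>.\<close>

lemma peaked_pos: "emeasure M peaked \<noteq> 0"
proof
  assume "emeasure M peaked = 0"
  then have null: "measure M peaked = 0" by (simp add: measure_def)
  have sub: "peaked \<subseteq> base" by (auto simp: peaked_def)
  have bad: "measure M (base - peaked) = \<mu>"
    using finite_measure_Diff[OF atom_sets peaked_sets sub] null by simp
  have "ennreal (\<mu> / 10) * emeasure M (base - peaked) =
      (\<integral>\<^sup>+x. ennreal (\<mu> / 10) * indicator (base - peaked) x \<partial>M)"
    by (rule nn_integral_cmult_indicator[symmetric]) (use peaked_sets in auto)
  also have "\<dots> \<le> (\<integral>\<^sup>+x. \<integral>\<^sup>+y. \<integral>\<^sup>+l. indicator D ((x, y), l) \<partial>count_space (carrier L) \<partial>M \<partial>M)"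
  proof (rule nn_integral_mono)
    fix x assume x: "x \<in> space M"
    show "ennreal (\<mu> / 10) * indicator (base - peaked) x \<le>
        (\<integral>\<^sup>+y. \<integral>\<^sup>+l. indicator D ((x, y), l) \<partial>count_space (carrier L) \<partial>M)"
    proof (cases "x \<in> base - peaked")
      case True
      then obtain l where l: "l \<in> carrier L" "d l x \<ge> \<mu> / 10" by (auto simp: peaked_def not_less)
      have "ennreal (\<mu> / 10) \<le> emeasure M {y. ((x, y), l) \<in> D}"
        using l(2) by (simp add: d_def emeasure_eq_measure)
      also have "\<dots> = (\<integral>\<^sup>+y. indicator D ((x, y), l) \<partial>M)"
        by (subst nn_integral_indicator[OF slice_sets[OF D_sets l(1) x], symmetric])
          (auto intro!: nn_integral_cong simp: indicator_def)
      also have "\<dots> \<le> (\<integral>\<^sup>+y. \<integral>\<^sup>+l. indicator D ((x, y), l) \<partial>count_space (carrier L) \<partial>M)"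
        by (intro nn_integral_mono) (rule nn_integral_ge_point[OF l(1)])
      finally show ?thesis using True by simp
    qed simp
  qed
  also have "\<dots> = (\<integral>\<^sup>+p. \<integral>\<^sup>+l. indicator D (p, l) \<partial>count_space (carrier L) \<partial>(M \<Otimes>\<^sub>M M))"
    by (rule nn_integral_fst)
      (rule sigma_finite_measure.borel_measurable_nn_integral_fst[OF sigma_finite_fibre],
        use borel_measurable_indicator[OF D_sets] in \<open>simp add: pairs_def\<close>)
  also have "\<dots> = (\<integral>\<^sup>+z. indicator D z \<partial>pairs)"
    by (rule nn_integral_pairs[symmetric]) (rule borel_measurable_indicator[OF D_sets])
  also have "\<dots> = emeasure pairs D" using D_sets by simp
  also have "\<dots> \<le> ennreal (1 / 100 * \<mu>\<^sup>2)" using S_near by (simp add: D_def)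
  finally have "\<mu> / 10 * \<mu> \<le> 1 / 100 * \<mu>\<^sup>2"
    by (simp add: emeasure_eq_measure bad flip: ennreal_mult)
  moreover have "\<mu>\<^sup>2 > 0" using atom_pos by simp
  ultimately show False by (simp add: power2_eq_square)
qed

text \<open>\<open>D\<close> is the difference between \<open>S\<close> and the sheet 1: over
  \<open>l = 1\<close> the slice of \<open>S\<close> is the atom without the slice of
  \<open>D\<close>, and over any other \<open>l\<close> it is contained in that slice.\<close>

lemma peaked_slices:
  assumes x: "x \<in> peaked"
  shows "m \<one>\<^bsub>L\<^esub> x > 9 / 10 * \<mu>" and "\<lbrakk>l \<in> carrier L; l \<noteq> \<one>\<^bsub>L\<^esub>\<rbrakk> \<Longrightarrow> m l x < \<mu> / 10"
proof -
  have xb: "x \<in> base" "\<And>l. l \<in> carrier L \<Longrightarrow> d l x < \<mu> / 10" using x by (auto simp: peaked_def)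
  note xs = atom_space[OF xb(1)]
  have one: "{y. ((x, y), \<one>\<^bsub>L\<^esub>) \<in> S} = base - {y. ((x, y), \<one>\<^bsub>L\<^esub>) \<in> D}"
    using S_base xb(1) by (auto simp: D_def square_iff)
  have "{y. ((x, y), \<one>\<^bsub>L\<^esub>) \<in> D} \<subseteq> base" by (auto simp: D_def square_iff)
  then have "m \<one>\<^bsub>L\<^esub> x = \<mu> - d \<one>\<^bsub>L\<^esub> x"
    unfolding m_def d_def one by (intro finite_measure_Diff slice_sets[OF D_sets] xs) auto
  then show "m \<one>\<^bsub>L\<^esub> x > 9 / 10 * \<mu>" using xb(2)[of "\<one>\<^bsub>L\<^esub>"] by simp
  assume l: "l \<in> carrier L" "l \<noteq> \<one>\<^bsub>L\<^esub>"
  have "{y. ((x, y), l) \<in> S} \<subseteq> {y. ((x, y), l) \<in> D}" using S_square l by (auto simp: D_def)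
  then have "m l x \<le> d l x" unfolding m_def d_def
    by (rule finite_measure_mono[OF _ slice_sets[OF D_sets l(1) xs]])
  then show "m l x < \<mu> / 10" using xb(2)[OF l(1)] by simp
qed

text \<open>Ergodicity moves almost every point of the atom to a peaked one. Transporting the peak
  back costs \<open>1 / 20\<close> and leaves \<open>9 / 10 - 1 / 20 = 17 / 20\<close>. Conversely a
  value of height \<open>7 / 10\<close> arrives at the peaked point with height at least
  \<open>13 / 20\<close>, and there only \<open>l = 1\<close> exceeds \<open>1 / 10\<close>; the
  transport is injective in \<open>l\<close>.\<close>

lemma unique_peak:
  "AE x in M. x \<in> base \<longrightarrow> (\<exists>l\<in>carrier L. m l x \<ge> 17 / 20 * \<mu>) \<and>
    (\<forall>l\<in>carrier L. \<forall>l'\<in>carrier L. m l x \<ge> 7 / 10 * \<mu> \<and> m l' x \<ge> 7 / 10 * \<mu> \<longrightarrow> l = l')"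
proof -
  let ?P = "\<lambda>h x. x \<in> base \<longrightarrow> (\<forall>l\<in>carrier L.
    m l x - \<mu> / 20 \<le> m (w h x \<otimes>\<^bsub>L\<^esub> l \<otimes>\<^bsub>L\<^esub> inv\<^bsub>L\<^esub> \<delta> h) (a h x))"
  have 1: "AE x in M. \<forall>h\<in>K. ?P h x"
    using slice_transport countable_K by (subst AE_ball_countable) auto
  \<comment> \<open>The way back starts at \<open>a h x\<close>, where \<open>h\<close> depends on
    \<open>x\<close>; all pairs from the countable group are therefore treated at once.\<close>
  have 2: "AE x in M. \<forall>h\<in>K. \<forall>k\<in>K. ?P k (a h x)"
    using AE_a[OF K_carrier 1] countable_K by (subst AE_ball_countable) auto
  show ?thesis using 1 2 orbit_of_positive_set[OF peaked_sets peaked_pos]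
  proof (rule AE_mp[OF _ AE_mp[OF _ AE_mp[OF _ AE_I2]]], intro impI)
    fix x assume xs: "x \<in> space M" and P1: "\<forall>h\<in>K. ?P h x" and P2: "\<forall>h\<in>K. \<forall>k\<in>K. ?P k (a h x)"
      and ex: "\<exists>h\<in>H. a h x \<in> peaked" and x: "x \<in> base"
    obtain h where h: "h \<in> H" "a h x \<in> peaked" using ex by blast
    then have hx: "a h x \<in> base" by (auto simp: peaked_def)
    have hK: "h \<in> K" using stabI[OF H_carrier[OF h(1)] x hx] h(1) by blast
    note hG = K_carrier[OF hK]
    define k where "k = inv\<^bsub>G\<^esub> h"
    have kK: "k \<in> K" using subgroup.m_inv_closed[OF K_subgroup hK] by (simp add: k_def)
    have kx: "a k (a h x) = x" using a_inv_cancel(2)[OF hG xs] by (simp add: k_def)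
    \<comment> \<open>The place to which the transport by \<open>k\<close> carries the peak
      \<open>l = 1\<close> of the peaked point \<open>a h x\<close>.\<close>
    define l0 where "l0 = w k (a h x) \<otimes>\<^bsub>L\<^esub> \<one>\<^bsub>L\<^esub> \<otimes>\<^bsub>L\<^esub> inv\<^bsub>L\<^esub> \<delta> k"
    have l0: "l0 \<in> carrier L"
      using w_closed[OF K_carrier[OF kK] a_closed[OF hG xs]] \<delta>(1)[OF kK] by (simp add: l0_def)
    have "m \<one>\<^bsub>L\<^esub> (a h x) - \<mu> / 20 \<le> m l0 (a k (a h x))"
      using P2 hK kK hx L.one_closed unfolding l0_def by blast
    then have "m l0 x \<ge> 17 / 20 * \<mu>" using peaked_slices(1)[OF h(2)] kx by simp
    moreover have "l = l'" if ll: "l \<in> carrier L" "l' \<in> carrier L" "m l x \<ge> 7 / 10 * \<mu>" "m l' x \<ge> 7 / 10 * \<mu>" for l l'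
    proof -
      have tr1: "w h x \<otimes>\<^bsub>L\<^esub> l \<otimes>\<^bsub>L\<^esub> inv\<^bsub>L\<^esub> \<delta> h = \<one>\<^bsub>L\<^esub>" if "l \<in> carrier L" "m l x \<ge> 7 / 10 * \<mu>" for l
      proof (rule ccontr)
        assume ne: "\<not> ?thesis"
        have c: "w h x \<otimes>\<^bsub>L\<^esub> l \<otimes>\<^bsub>L\<^esub> inv\<^bsub>L\<^esub> \<delta> h \<in> carrier L"
          using that(1) w_closed[OF hG xs] \<delta>(1)[OF hK] by simp
        have "m l x - \<mu> / 20 \<le> m (w h x \<otimes>\<^bsub>L\<^esub> l \<otimes>\<^bsub>L\<^esub> inv\<^bsub>L\<^esub> \<delta> h) (a h x)"
          using P1 hK x that(1) by blast
        then show False using peaked_slices(2)[OF h(2) c ne] that(2) atom_pos by simp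
      qed
      have "w h x \<otimes>\<^bsub>L\<^esub> l \<otimes>\<^bsub>L\<^esub> inv\<^bsub>L\<^esub> \<delta> h = w h x \<otimes>\<^bsub>L\<^esub> l' \<otimes>\<^bsub>L\<^esub> inv\<^bsub>L\<^esub> \<delta> h"
        using tr1[OF ll(1,3)] tr1[OF ll(2,4)] by simp
      then show "l = l'"
        using ll(1,2) w_closed[OF hG xs] \<delta>(1)[OF hK] by simp
    qed
    ultimately show "(\<exists>l\<in>carrier L. m l x \<ge> 17 / 20 * \<mu>) \<and>
      (\<forall>l\<in>carrier L. \<forall>l'\<in>carrier L. m l x \<ge> 7 / 10 * \<mu> \<and> m l' x \<ge> 7 / 10 * \<mu> \<longrightarrow> l = l')"
      using l0 by blast
  qed
qed

definition "enum = from_nat_into (carrier L)"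

lemma enum: "enum k \<in> carrier L" "l \<in> carrier L \<Longrightarrow> \<exists>k. enum k = l"
  using from_nat_into[of "carrier L" k] from_nat_into_surj[OF countable_L] L.one_closed
  by (auto simp: enum_def)

text \<open>The place of the peak. The threshold \<open>4 / 5\<close> lies between
  \<open>7 / 10\<close>, above which the place is unique, and \<open>17 / 20\<close>, which the peak
  attains; so the first value of the enumeration to pass it is the peak, and measurability is
  inherited from the heights. The value 1 elsewhere is a default.\<close>

definition \<psi> where "\<psi> x = (if \<exists>k. m (enum k) x \<ge> 4 / 5 * \<mu>
  then enum (LEAST k. m (enum k) x \<ge> 4 / 5 * \<mu>) else \<one>\<^bsub>L\<^esub>)"

lemma \<psi>_measurable: "\<psi> \<in> measurable M (count_space (carrier L))"
proof -
  have mm [measurable]: "(\<lambda>x. m (enum k) x) \<in> borel_measurable M" for k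
    unfolding m_def by (rule slice_measurable[OF S_sets enum(1)])
  have l [measurable]: "(\<lambda>x. LEAST k. m (enum k) x \<ge> 4 / 5 * \<mu>) \<in> measurable M (count_space UNIV)"
    by measurable
  have "(\<lambda>x. enum (LEAST k. m (enum k) x \<ge> 4 / 5 * \<mu>)) \<in> measurable M (count_space (carrier L))"
    by (rule measurable_compose[OF l]) (use enum in auto)
  moreover have "(\<lambda>x. \<one>\<^bsub>L\<^esub>) \<in> measurable M (count_space (carrier L))" by simp
  moreover have "{x \<in> space M. \<exists>k. m (enum k) x \<ge> 4 / 5 * \<mu>} \<in> sets M" by measurable
  ultimately show ?thesis unfolding \<psi>_def by (rule measurable_If)
qed

text \<open>The peak of height \<open>17 / 20\<close> at \<open>x\<close> arrives at
  \<open>a h x\<close> with height at least \<open>4 / 5\<close>; uniqueness there identifies its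
  new place with \<open>\<psi> (a h x)\<close>.\<close>

lemma \<psi>_equivariant:
  assumes h: "h \<in> K"
  shows "AE x in M. x \<in> base \<longrightarrow> \<psi> (a h x) \<otimes>\<^bsub>L\<^esub> \<delta> h = w h x \<otimes>\<^bsub>L\<^esub> \<psi> x"
proof -
  note hG = K_carrier[OF h]
  show ?thesis using unique_peak AE_a[OF hG unique_peak] slice_transport[OF h]
  proof (rule AE_mp[OF _ AE_mp[OF _ AE_mp[OF _ AE_I2]]], intro impI)
    let ?U = "\<lambda>x. (\<exists>l\<in>carrier L. m l x \<ge> 17 / 20 * \<mu>) \<and>
      (\<forall>l\<in>carrier L. \<forall>l'\<in>carrier L. m l x \<ge> 7 / 10 * \<mu> \<and> m l' x \<ge> 7 / 10 * \<mu> \<longrightarrow> l = l')"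
    fix x assume xs: "x \<in> space M" and x: "x \<in> base" and U: "x \<in> base \<longrightarrow> ?U x"
      "a h x \<in> base \<longrightarrow> ?U (a h x)" and tr: "x \<in> base \<longrightarrow> (\<forall>l\<in>carrier L.
        m l x - \<mu> / 20 \<le> m (w h x \<otimes>\<^bsub>L\<^esub> l \<otimes>\<^bsub>L\<^esub> inv\<^bsub>L\<^esub> \<delta> h) (a h x))"
    have hx: "a h x \<in> base" using h x stabD(1) by blast
    have \<psi>: "\<psi> y \<in> carrier L" "m (\<psi> y) y \<ge> 17 / 20 * \<mu>" if y: "?U y" for y
    proof -
      obtain l where l: "l \<in> carrier L" "m l y \<ge> 17 / 20 * \<mu>" using y by blast
      obtain k where k: "enum k = l" using enum(2)[OF l(1)] by blast
      have ex: "m (enum k) y \<ge> 4 / 5 * \<mu>" using l(2) atom_pos by (simp add: k)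
      have "m (\<psi> y) y \<ge> 4 / 5 * \<mu>"
        unfolding \<psi>_def using LeastI[of "\<lambda>k. m (enum k) y \<ge> 4 / 5 * \<mu>", OF ex] ex by auto
      moreover show c: "\<psi> y \<in> carrier L" using enum(1) by (simp add: \<psi>_def)
      ultimately have "m (\<psi> y) y \<ge> 7 / 10 * \<mu>" "m l y \<ge> 7 / 10 * \<mu>" using l(2) atom_pos by auto
      then have "\<psi> y = l" using y c l(1) by blast
      then show "m (\<psi> y) y \<ge> 17 / 20 * \<mu>" using l(2) by simp
    qed
    have Ux: "?U x" using U(1) x by (rule mp)
    have Uh: "?U (a h x)" using U(2) hx by (rule mp)
    define l' where "l' = w h x \<otimes>\<^bsub>L\<^esub> \<psi> x \<otimes>\<^bsub>L\<^esub> inv\<^bsub>L\<^esub> \<delta> h"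
    note c = w_closed[OF hG xs] \<psi>(1)[OF Ux] \<delta>(1)[OF h]
    have "m (\<psi> x) x - \<mu> / 20 \<le> m l' (a h x)" using tr x c(2) unfolding l'_def by blast
    then have "m l' (a h x) \<ge> 7 / 10 * \<mu>" using \<psi>(2)[OF Ux] atom_pos by simp
    moreover have "m (\<psi> (a h x)) (a h x) \<ge> 7 / 10 * \<mu>" using \<psi>(2)[OF Uh] atom_pos by simp
    moreover have "l' \<in> carrier L" using c by (simp add: l'_def)
    ultimately have "\<psi> (a h x) = l'" using Uh \<psi>(1)[OF Uh] by blast
    then show "\<psi> (a h x) \<otimes>\<^bsub>L\<^esub> \<delta> h = w h x \<otimes>\<^bsub>L\<^esub> \<psi> x" using c by (simp add: l'_def L.m_assoc)
  qed
qed

end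

context profinite_cocycle
begin

lemma untwisting_on_atom:
  assumes T: "relative_property_T G H"
  obtains n b \<delta> \<psi> where "measure M (atom n b) > 0"
    "\<And>h. h \<in> H \<inter> stab n b \<Longrightarrow> \<delta> h \<in> carrier L"
    "\<And>h k. \<lbrakk>h \<in> H \<inter> stab n b; k \<in> H \<inter> stab n b\<rbrakk> \<Longrightarrow> \<delta> (h \<otimes>\<^bsub>G\<^esub> k) = \<delta> h \<otimes>\<^bsub>L\<^esub> \<delta> k"
    "\<psi> \<in> measurable M (count_space (carrier L))"
    "\<And>h. h \<in> H \<inter> stab n b \<Longrightarrow>
      AE x in M. x \<in> atom n b \<longrightarrow> \<psi> (a h x) \<otimes>\<^bsub>L\<^esub> \<delta> h = w h x \<otimes>\<^bsub>L\<^esub> \<psi> x"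
proof -
  \<comment> \<open>The budget behind this constant: one twist doubles it to \<open>1 / 50\<close>;
    averaging then yields \<open>\<delta> h\<close> off a share \<open>1 / 20\<close> of the atom,
    and slices within \<open>1 / 10\<close> of the sheet 1 on a set of positive measure. Peaks of
    height \<open>9 / 10\<close> survive two transports of cost \<open>1 / 20\<close> far above the
    noise level \<open>1 / 10\<close>.\<close>
  have "(1 / 100 :: real) > 0" by simp
  from almost_invariant_set[OF T this] obtain n b S where S: "measure M (atom n b) > 0" "S \<in> sets pairs"
    "S \<subseteq> square n b" "\<And>h. h \<in> H \<inter> stab n b \<Longrightarrow> AE z in pairs. twist h z \<in> S \<longleftrightarrow> z \<in> S"
    "emeasure pairs {z \<in> square n b. (z \<in> S) \<noteq> (snd z = \<one>\<^bsub>L\<^esub>)} \<le> ennreal (1 / 100 * (measure M (atom n b))\<^sup>2)"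
    by blast
  interpret almost_invariant G H L M a w r n b S
    by unfold_locales (fact S)+
  show thesis by (rule that[OF S(1) \<delta>(1) \<delta>_hom \<psi>_measurable \<psi>_equivariant])
qed

end

context profinite_cocycle
begin

text \<open>A substitute for the density theorem. If \<open>W\<close> filled at most half of every
  atom of some deep level, it would fill at most half of every union \<open>V\<close> of such atoms;
  but some \<open>V\<close> differs from \<open>W\<close> by less than a quarter of the measure of
  \<open>W\<close> on either side.\<close>

lemma density_atom:
  assumes W: "W \<in> sets M" and pos: "measure M W > 0"
  obtains m b where "m \<ge> n" "measure M (W \<inter> atom m b) > measure M (atom m b) / 2"
proof (rule ccontr)
  assume "\<not> thesis"
  with that have neg: "measure M (W \<inter> atom m b) \<le> measure M (atom m b) / 2" if "m \<ge> n" for m b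
    using that by (meson not_le)
  obtain N U where U: "measure M {x \<in> space M. (x \<in> W) \<noteq> (r N x \<in> U)} < measure M W / 4"
    using r_generates[OF W, of "measure M W / 4"] pos by auto
  define m where "m = max n N"
  \<comment> \<open>Rewrites a union of atoms of level \<open>N\<close> as a union of atoms of the
    deeper level \<open>m\<close>.\<close>
  define U' where "U' = {r m x | x. x \<in> space M \<and> r N x \<in> U}"
  have U': "r m x \<in> U' \<longleftrightarrow> r N x \<in> U" if x: "x \<in> space M" for x
  proof
    assume "r m x \<in> U'"
    then obtain y where "y \<in> space M" "r N y \<in> U" "r m x = r m y" by (auto simp: U'_def)
    then show "r N x \<in> U" using r_mono[of N m x y] x by (simp add: m_def)
  qed (use x in \<open>auto simp: U'_def\<close>)
  define V where "V = {x \<in> space M. r m x \<in> U'}"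
  have V: "V \<in> sets M" unfolding V_def by measurable
  have fin: "finite (U' \<inter> r m ` space M)" using r_finite by blast
  have Vu: "V = (\<Union>b\<in>U' \<inter> r m ` space M. atom m b)" by (auto simp: V_def atom_def)
  have "measure M (W \<inter> V) = measure M (\<Union>b\<in>U' \<inter> r m ` space M. W \<inter> atom m b)"
    unfolding Vu by (simp only: Int_UN_distrib)
  also have "\<dots> = (\<Sum>b\<in>U' \<inter> r m ` space M. measure M (W \<inter> atom m b))"
    by (rule finite_measure_finite_Union[OF fin]) (use W in \<open>auto simp: disjoint_family_on_def atom_def\<close>)
  also have "\<dots> \<le> (\<Sum>b\<in>U' \<inter> r m ` space M. measure M (atom m b) / 2)"
    by (rule sum_mono) (rule neg, simp add: m_def)
  also have "\<dots> = (\<Sum>b\<in>U' \<inter> r m ` space M. measure M (atom m b)) / 2"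
    by (rule sum_divide_distrib[symmetric])
  also have "(\<Sum>b\<in>U' \<inter> r m ` space M. measure M (atom m b)) = measure M V"
    unfolding Vu by (rule finite_measure_finite_Union[OF fin, symmetric]) (auto simp: disjoint_family_on_def atom_def)
  finally have 1: "measure M (W \<inter> V) \<le> measure M V / 2" .
  have D: "{x \<in> space M. (x \<in> W) \<noteq> (r N x \<in> U)} \<in> sets M" using W by measurable
  have sub: "V - W \<subseteq> {x \<in> space M. (x \<in> W) \<noteq> (r N x \<in> U)}" "W - V \<subseteq> {x \<in> space M. (x \<in> W) \<noteq> (r N x \<in> U)}"
    using U' sets.sets_into_space[OF W] by (auto simp: V_def)
  have 2: "measure M (V - W) < measure M W / 4" "measure M (W - V) < measure M W / 4"
    using finite_measure_mono[OF sub(1) D] finite_measure_mono[OF sub(2) D] U by linarith+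
  have 3: "measure M (V - W) = measure M V - measure M (W \<inter> V)"
    using finite_measure_Diff'[OF V W] by (simp add: Int_commute)
  have 4: "measure M (W - V) = measure M W - measure M (W \<inter> V)"
    using finite_measure_Diff'[OF W V] .
  show False using 1 2 3 4 pos by linarith
qed

lemma AE_atom_exists:
  assumes "AE x in M. x \<in> B \<longrightarrow> P x" and "B \<in> sets M" "measure M B > 0"
  obtains x where "x \<in> B" "P x"
proof (rule ccontr)
  assume "\<not> thesis"
  with that have "\<not> P x" if "x \<in> B" for x using that by blast
  then have "AE x in M. x \<notin> B" using assms(1) by (auto elim: AE_mp)
  then have "emeasure M B = 0" using AE_iff_null_sets[OF assms(2)] by auto
  then show False using assms(3) by (simp add: measure_def)
qed

end

subsection \<open>Extension to the stabilizer in the whole group\<close>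

locale untwisted_cocycle = profinite_cocycle G H L M a w r
  for G :: "'g monoid" and H and L :: "'l monoid" and M :: "'x measure" and a w r +
  fixes n c :: nat and \<delta> :: "'g \<Rightarrow> 'l" and \<psi> :: "'x \<Rightarrow> 'l"
  assumes base_pos: "measure M (atom n c) > 0"
    and \<delta>_closed: "h \<in> H \<inter> stab n c \<Longrightarrow> \<delta> h \<in> carrier L"
    and \<psi>_measurable: "\<psi> \<in> measurable M (count_space (carrier L))"
    and \<psi>_equivariant: "h \<in> H \<inter> stab n c \<Longrightarrow>
      AE x in M. x \<in> atom n c \<longrightarrow> \<psi> (a h x) \<otimes>\<^bsub>L\<^esub> \<delta> h = w h x \<otimes>\<^bsub>L\<^esub> \<psi> x"
    and finitely_generated: "finitely_generated_group (G Mod H)"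
begin

lemma \<psi>_closed: "x \<in> space M \<Longrightarrow> \<psi> x \<in> carrier L"
  using measurable_space[OF \<psi>_measurable] by force

text \<open>The cocycle cohomologous to \<open>w\<close> through \<open>\<psi>\<close>; on the atom
  its value at \<open>h\<close> in \<open>K\<close> is the constant
  \<open>\<delta> h\<close>.\<close>

definition w' where "w' g x = inv\<^bsub>L\<^esub> \<psi> (a g x) \<otimes>\<^bsub>L\<^esub> w g x \<otimes>\<^bsub>L\<^esub> \<psi> x"

lemma w'_closed: "\<lbrakk>g \<in> carrier G; x \<in> space M\<rbrakk> \<Longrightarrow> w' g x \<in> carrier L"
  by (simp add: w'_def \<psi>_closed w_closed a_closed)

lemma w'_mult:
  assumes "g \<in> carrier G" "h \<in> carrier G" "x \<in> space M"
  shows "w' (g \<otimes>\<^bsub>G\<^esub> h) x = w' g (a h x) \<otimes>\<^bsub>L\<^esub> w' h x"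
proof -
  note hx = a_closed[OF assms(2,3)]
  note c = \<psi>_closed[OF hx] \<psi>_closed[OF assms(3)] \<psi>_closed[OF a_closed[OF assms(1) hx]]
    w_closed[OF assms(1) hx] w_closed[OF assms(2,3)]
  have "\<psi> (a h x) \<otimes>\<^bsub>L\<^esub> (inv\<^bsub>L\<^esub> \<psi> (a h x) \<otimes>\<^bsub>L\<^esub> y) = y" if "y \<in> carrier L" for y
    using c that by (simp add: L.m_assoc[symmetric])
  then show ?thesis using c assms by (simp add: w'_def w_mult a_mult L.m_assoc)
qed

lemma w'_measurable:
  assumes g: "g \<in> carrier G"
  shows "w' g \<in> measurable M (count_space (carrier L))"
proof -
  let ?C = "count_space (carrier L)"
  let ?f = "\<lambda>(u, v, z). inv\<^bsub>L\<^esub> u \<otimes>\<^bsub>L\<^esub> v \<otimes>\<^bsub>L\<^esub> z"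
  have "(\<lambda>x. (\<psi> (a g x), w g x, \<psi> x)) \<in> measurable M (?C \<Otimes>\<^sub>M ?C \<Otimes>\<^sub>M ?C)"
    by (intro measurable_Pair measurable_compose[OF a_measurable[OF g] \<psi>_measurable]
      w_measurable[OF g] \<psi>_measurable)
  then have 1: "(\<lambda>x. (\<psi> (a g x), w g x, \<psi> x)) \<in> measurable M (count_space (carrier L \<times> carrier L \<times> carrier L))"
    using countable_L by (simp add: pair_measure_countable)
  have 2: "?f \<in> measurable (count_space (carrier L \<times> carrier L \<times> carrier L)) ?C" by auto
  show ?thesis using measurable_compose[OF 1 2] by (simp add: w'_def[abs_def])
qed

lemma fibre_sets: "f \<in> measurable M (count_space (carrier L)) \<Longrightarrow> {x \<in> space M. f x = l} \<in> sets M"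
proof -
  assume f: "f \<in> measurable M (count_space (carrier L))"
  have "f -` (carrier L \<inter> {l}) \<inter> space M \<in> sets M" by (rule measurable_sets[OF f]) auto
  also have "f -` (carrier L \<inter> {l}) \<inter> space M = {x \<in> space M. f x = l}"
    using measurable_space[OF f] by auto
  finally show ?thesis .
qed

lemma w'_one: "x \<in> space M \<Longrightarrow> w' \<one>\<^bsub>G\<^esub> x = \<one>\<^bsub>L\<^esub>"
  by (simp add: w'_def a_one w_one \<psi>_closed)

lemma w'_inv:
  assumes g: "g \<in> carrier G" and x: "x \<in> space M"
  shows "w' (inv\<^bsub>G\<^esub> g) x = inv\<^bsub>L\<^esub> w' g (a (inv\<^bsub>G\<^esub> g) x)"
proof -
  note ig = G.inv_closed[OF g]
  have "w' g (a (inv\<^bsub>G\<^esub> g) x) \<otimes>\<^bsub>L\<^esub> w' (inv\<^bsub>G\<^esub> g) x = \<one>\<^bsub>L\<^esub>"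
    using w'_mult[OF g ig x] w'_one[OF x] g by simp
  then have "inv\<^bsub>L\<^esub> w' (inv\<^bsub>G\<^esub> g) x = w' g (a (inv\<^bsub>G\<^esub> g) x)"
    using L.inv_equality w'_closed[OF ig x] w'_closed[OF g a_closed[OF ig x]] by blast
  then show ?thesis using L.inv_inv[OF w'_closed[OF ig x]] by metis
qed

abbreviation (input) base where "base \<equiv> atom n c"
abbreviation (input) K where "K \<equiv> H \<inter> stab n c"

lemma w'_eq_\<delta>:
  assumes h: "h \<in> K"
  shows "AE x in M. x \<in> base \<longrightarrow> w' h x = \<delta> h"
  using \<psi>_equivariant[OF h]
proof (rule AE_mp, intro AE_I2 impI)
  fix x assume x: "x \<in> space M" "x \<in> base" "x \<in> base \<longrightarrow> \<psi> (a h x) \<otimes>\<^bsub>L\<^esub> \<delta> h = w h x \<otimes>\<^bsub>L\<^esub> \<psi> x"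
  have hG: "h \<in> carrier G" using h H_carrier by blast
  note c = \<psi>_closed[OF x(1)] \<psi>_closed[OF a_closed[OF hG x(1)]] w_closed[OF hG x(1)] \<delta>_closed[OF h]
  have "w' h x = inv\<^bsub>L\<^esub> \<psi> (a h x) \<otimes>\<^bsub>L\<^esub> (\<psi> (a h x) \<otimes>\<^bsub>L\<^esub> \<delta> h)"
    using x c by (simp add: w'_def L.m_assoc)
  then show "w' h x = \<delta> h" using c by (simp add: L.m_assoc[symmetric])
qed

lemma base_element: obtains x where "x \<in> base" "x \<in> space M"
proof -
  have "base \<noteq> {}" using base_pos by auto
  then show thesis using that atom_space by blast
qed

lemma K_conj:
  assumes g: "g \<in> stab n c" and h: "h \<in> K"
  shows "g \<otimes>\<^bsub>G\<^esub> h \<otimes>\<^bsub>G\<^esub> inv\<^bsub>G\<^esub> g \<in> K"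
proof -
  obtain x where x: "x \<in> base" by (rule base_element)
  interpret S: subgroup "stab n c" G by (rule subgroup_stab[OF x])
  show ?thesis using H.inv_op_closed2[of g h] g h S.m_closed S.m_inv_closed S.subset by auto
qed

text \<open>Evaluate the cocycle on \<open>g h = (g h g^-1) g\<close> in both ways; by normality the
  conjugate lies again in \<open>H\<close>, where the values are known.\<close>

lemma w'_conj:
  assumes g: "g \<in> stab n c" and h: "h \<in> K"
  shows "AE x in M. x \<in> base \<longrightarrow> w' g (a h x) \<otimes>\<^bsub>L\<^esub> \<delta> h = \<delta> (g \<otimes>\<^bsub>G\<^esub> h \<otimes>\<^bsub>G\<^esub> inv\<^bsub>G\<^esub> g) \<otimes>\<^bsub>L\<^esub> w' g x"
proof -
  define k where "k = g \<otimes>\<^bsub>G\<^esub> h \<otimes>\<^bsub>G\<^esub> inv\<^bsub>G\<^esub> g"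
  have k: "k \<in> K" unfolding k_def by (rule K_conj[OF g h])
  have G: "g \<in> carrier G" "h \<in> carrier G" "k \<in> carrier G" using g h k H_carrier stabD(2) by auto
  have kg: "k \<otimes>\<^bsub>G\<^esub> g = g \<otimes>\<^bsub>G\<^esub> h" using G by (simp add: k_def G.m_assoc)
  show ?thesis using w'_eq_\<delta>[OF h] AE_a[OF G(1) w'_eq_\<delta>[OF k]]
  proof (rule AE_mp[OF _ AE_mp[OF _ AE_I2]], intro impI)
    fix x assume xs: "x \<in> space M" and 1: "x \<in> base \<longrightarrow> w' h x = \<delta> h"
      and 2: "a g x \<in> base \<longrightarrow> w' k (a g x) = \<delta> k" and x: "x \<in> base"
    have "w' g (a h x) \<otimes>\<^bsub>L\<^esub> w' h x = w' k (a g x) \<otimes>\<^bsub>L\<^esub> w' g x"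
      using w'_mult[OF G(1,2) xs] w'_mult[OF G(3,1) xs] kg by simp
    then show "w' g (a h x) \<otimes>\<^bsub>L\<^esub> \<delta> h = \<delta> (g \<otimes>\<^bsub>G\<^esub> h \<otimes>\<^bsub>G\<^esub> inv\<^bsub>G\<^esub> g) \<otimes>\<^bsub>L\<^esub> w' g x"
      using 1 2 x stabD(1)[OF g x] by (simp add: k_def)
  qed
qed

text \<open>\<open>H\<close> is transitive on the atoms of positive measure, so a representative can
  be corrected by an element of \<open>H\<close> that brings its image of the atom back.\<close>

lemma coset_meets_stab:
  assumes C: "C \<in> rcosets\<^bsub>G\<^esub> H"
  obtains g where "g \<in> C" "g \<in> stab n c"
proof -
  obtain s where s: "s \<in> carrier G" "C = H #>\<^bsub>G\<^esub> s" using C by (auto simp: RCOSETS_def)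
  obtain x where x: "x \<in> base" "x \<in> space M" by (rule base_element)
  have "measure M (atom n (r n (a s x))) > 0"
    using measure_atom_eq[OF s(1) x(2), of n] base_pos x(1) by (simp add: atom_def)
  from transitive_on_atoms[OF this base_pos] obtain h where
    h: "h \<in> H" "\<And>y. y \<in> atom n (r n (a s x)) \<Longrightarrow> a h y \<in> base" by blast
  have "a s x \<in> atom n (r n (a s x))" using a_closed[OF s(1) x(2)] by (simp add: atom_def)
  then have "a (h \<otimes>\<^bsub>G\<^esub> s) x \<in> base" using h s x H_carrier by (simp add: a_mult)
  then have "h \<otimes>\<^bsub>G\<^esub> s \<in> stab n c" using stabI[OF _ x(1)] h s H_carrier by blast
  moreover have "h \<otimes>\<^bsub>G\<^esub> s \<in> C" using s h by (auto simp: r_coset_def)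
  ultimately show thesis using that by blast
qed

lemma sub_atom_stab:
  assumes "atom m b \<subseteq> base" "x \<in> atom m b"
  shows "stab m b \<subseteq> stab n c"
proof
  fix g assume g: "g \<in> stab m b"
  show "g \<in> stab n c"
    using stabI[OF stabD(2)[OF g], of x n c] stabD(1)[OF g assms(2)] assms by blast
qed

text \<open>
  The set where \<open>w' g = l\<close> meets its translates by \<open>H \<inter> stab m b\<close>; comparing both values at a common
  point shows that it is invariant, and ergodicity applies.
\<close>

lemma nearly_constant_imp_constant:
  assumes g: "g \<in> stab n c" and sub: "atom m b \<subseteq> base" and pos: "measure M (atom m b) > 0"
    and l: "l \<in> carrier L"
    and half: "measure M {x \<in> atom m b. w' g x = l} > measure M (atom m b) / 2"
  shows "AE x in M. x \<in> atom m b \<longrightarrow> w' g x = l"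
proof -
  define B where "B = {x \<in> atom m b. w' g x = l}"
  note gG = stabD(2)[OF g]
  have B: "B \<in> sets M" "B \<subseteq> atom m b"
  proof -
    have "atom m b \<inter> {x \<in> space M. w' g x = l} \<in> sets M"
      by (rule sets.Int[OF atom_sets fibre_sets[OF w'_measurable[OF gG]]])
    also have "atom m b \<inter> {x \<in> space M. w' g x = l} = B" by (auto simp: B_def atom_def)
    finally show "B \<in> sets M" .
  qed (auto simp: B_def)
  have Bpos: "measure M B > measure M (atom m b) / 2" using half by (simp add: B_def)
  then have Bne: "emeasure M B \<noteq> 0" using pos by (auto simp: measure_def)
  have "AE x in M. x \<in> atom m b \<longrightarrow> x \<in> B"
  proof (rule ergodic_atom[OF B Bne])
    fix k assume k: "k \<in> H \<inter> stab m b"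
    obtain x0 where "x0 \<in> atom m b" using pos by (metis measure_empty ex_in_conv less_irrefl)
    then have kK: "k \<in> K" using k sub_atom_stab[OF sub] by blast
    have kG: "k \<in> carrier G" using k H_carrier by blast
    define k' where "k' = g \<otimes>\<^bsub>G\<^esub> k \<otimes>\<^bsub>G\<^esub> inv\<^bsub>G\<^esub> g"
    have dc: "\<delta> k \<in> carrier L" "\<delta> k' \<in> carrier L"
      unfolding k'_def by (rule \<delta>_closed[OF kK] \<delta>_closed[OF K_conj[OF g kK]])+
    note E = w'_conj[OF g kK, folded k'_def]
    define B' where "B' = a k -` B \<inter> space M"
    have B': "B' \<in> sets M" "measure M B' = measure M B"
      unfolding B'_def
      by (rule measurable_sets[OF a_measurable[OF kG] B(1)])
        (simp add: measure_def emeasure_a_vimage[OF kG B(1)])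
    have B'sub: "B' \<subseteq> atom m b"
    proof
      fix x assume "x \<in> B'"
      then have "x \<in> space M" "a k x \<in> atom m b" using B(2) by (auto simp: B'_def)
      then show "x \<in> atom m b" using stab_mem_iff[of k m b x] k by blast
    qed
    \<comment> \<open>\<open>B\<close> and its translate lie in the atom and each fills more than
      half of it, so they meet in positive measure.\<close>
    have "measure M (B \<union> B') + measure M (B \<inter> B') = measure M B + measure M B'"
      using finite_measure_Union'[OF B(1) B'(1)] finite_measure_Diff'[OF B'(1) B(1)] by (simp add: Int_commute)
    moreover have "measure M (B \<union> B') \<le> measure M (atom m b)"
      by (rule finite_measure_mono) (use B(2) B'sub in auto)
    ultimately have "measure M (B \<inter> B') > 0" using Bpos B'(2) by linarith
    \<comment> \<open>The relation between \<open>l\<close>, \<open>\<delta> k\<close> and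
      \<open>\<delta> k'\<close> is free of \<open>x\<close>, so one common point proves it; below
      it is applied where only \<open>a k x\<close> is known to lie in \<open>B\<close>.\<close>
    moreover have "AE x in M. x \<in> B \<inter> B' \<longrightarrow> l \<otimes>\<^bsub>L\<^esub> \<delta> k = \<delta> k' \<otimes>\<^bsub>L\<^esub> l"
      using E
    proof (rule AE_mp, intro AE_I2 impI)
      fix x assume "x \<in> base \<longrightarrow> w' g (a k x) \<otimes>\<^bsub>L\<^esub> \<delta> k = \<delta> k' \<otimes>\<^bsub>L\<^esub> w' g x" and x: "x \<in> B \<inter> B'"
      moreover have "x \<in> base" using x B(2) sub by blast
      ultimately show "l \<otimes>\<^bsub>L\<^esub> \<delta> k = \<delta> k' \<otimes>\<^bsub>L\<^esub> l" by (simp add: B_def B'_def)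
    qed
    ultimately have eq: "l \<otimes>\<^bsub>L\<^esub> \<delta> k = \<delta> k' \<otimes>\<^bsub>L\<^esub> l"
      using AE_atom_exists[OF _ sets.Int[OF B(1) B'(1)], of "\<lambda>x. l \<otimes>\<^bsub>L\<^esub> \<delta> k = \<delta> k' \<otimes>\<^bsub>L\<^esub> l"] by blast
    show "AE x in M. x \<in> atom m b \<longrightarrow> a k x \<in> B \<longrightarrow> x \<in> B"
      using E
    proof (rule AE_mp, intro AE_I2 impI)
      fix x assume xs: "x \<in> space M" and e: "x \<in> base \<longrightarrow> w' g (a k x) \<otimes>\<^bsub>L\<^esub> \<delta> k = \<delta> k' \<otimes>\<^bsub>L\<^esub> w' g x"
        and x: "x \<in> atom m b" "a k x \<in> B"
      then have "\<delta> k' \<otimes>\<^bsub>L\<^esub> l = \<delta> k' \<otimes>\<^bsub>L\<^esub> w' g x" using eq sub by (auto simp: B_def)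
      then have "w' g x = l" using dc l w'_closed[OF gG xs] by simp
      then show "x \<in> B" using x by (simp add: B_def)
    qed
  qed
  then show ?thesis by eventually_elim (auto simp: B_def)
qed

definition steady where
  "steady m b h \<longleftrightarrow> h \<in> stab m b \<and> (\<exists>l\<in>carrier L. AE x in M. x \<in> atom m b \<longrightarrow> w' h x = l)"

lemma steady_mult:
  assumes x0: "x0 \<in> atom m b" and g: "steady m b g" and h: "steady m b h"
  shows "steady m b (g \<otimes>\<^bsub>G\<^esub> h)"
proof -
  have s: "g \<in> stab m b" "h \<in> stab m b" using g h by (auto simp: steady_def)
  note G = stabD(2)[OF s(1)] stabD(2)[OF s(2)]
  obtain l l' where l: "l \<in> carrier L" "AE x in M. x \<in> atom m b \<longrightarrow> w' g x = l"
    "l' \<in> carrier L" "AE x in M. x \<in> atom m b \<longrightarrow> w' h x = l'"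
    using g h by (auto simp: steady_def)
  have "AE x in M. x \<in> atom m b \<longrightarrow> w' (g \<otimes>\<^bsub>G\<^esub> h) x = l \<otimes>\<^bsub>L\<^esub> l'"
    using AE_a[OF G(2) l(2)] l(4)
  proof (rule AE_mp[OF _ AE_mp[OF _ AE_I2]], intro impI)
    fix x assume "x \<in> space M" "x \<in> atom m b" "x \<in> atom m b \<longrightarrow> w' h x = l'"
      "a h x \<in> atom m b \<longrightarrow> w' g (a h x) = l"
    then show "w' (g \<otimes>\<^bsub>G\<^esub> h) x = l \<otimes>\<^bsub>L\<^esub> l'" using w'_mult[OF G, of x] stabD(1)[OF s(2), of x] by simp
  qed
  moreover have "g \<otimes>\<^bsub>G\<^esub> h \<in> stab m b" using subgroup.m_closed[OF subgroup_stab[OF x0] s] .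
  ultimately show ?thesis using L.m_closed[OF l(1,3)] by (auto simp: steady_def)
qed

lemma steady_inv:
  assumes x0: "x0 \<in> atom m b" and h: "steady m b h"
  shows "steady m b (inv\<^bsub>G\<^esub> h)"
proof -
  have s: "h \<in> stab m b" using h by (auto simp: steady_def)
  note G = stabD(2)[OF s]
  have ih: "inv\<^bsub>G\<^esub> h \<in> stab m b" using subgroup.m_inv_closed[OF subgroup_stab[OF x0] s] .
  obtain l where l: "l \<in> carrier L" "AE x in M. x \<in> atom m b \<longrightarrow> w' h x = l"
    using h by (auto simp: steady_def)
  have "AE x in M. x \<in> atom m b \<longrightarrow> w' (inv\<^bsub>G\<^esub> h) x = inv\<^bsub>L\<^esub> l"
    using AE_a[OF G.inv_closed[OF G] l(2)]
  proof (rule AE_mp, intro AE_I2 impI)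
    fix x assume "x \<in> space M" "x \<in> atom m b"
      "a (inv\<^bsub>G\<^esub> h) x \<in> atom m b \<longrightarrow> w' h (a (inv\<^bsub>G\<^esub> h) x) = l"
    then show "w' (inv\<^bsub>G\<^esub> h) x = inv\<^bsub>L\<^esub> l" using w'_inv[OF G, of x] stabD(1)[OF ih, of x] by simp
  qed
  then show ?thesis using ih L.inv_closed[OF l(1)] by (auto simp: steady_def)
qed

text \<open>The chosen generators stabilize the large atom but perhaps not the small one;
  multiplying by an element of \<open>K\<close> repairs this and changes the cocycle only by
  constants. Products and inverses of steady elements are steady, so every coset of \<open>H\<close>
  contains a steady element, and any \<open>h\<close> in the stabilizer differs from one by an
  element of \<open>H \<inter> stab m b\<close>, which is steady as well.\<close>

lemma deep_atom_stab:
  assumes nm: "n \<le> m" and sub: "atom m b \<subseteq> base" and pos: "measure M (atom m b) > 0"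
    and gens: "finite F" "F \<subseteq> stab n c" "generate (G Mod H) ((\<lambda>g. H #>\<^bsub>G\<^esub> g) ` F) = carrier (G Mod H)"
    and half: "\<And>g. g \<in> F \<Longrightarrow> \<exists>l\<in>carrier L. measure M {x \<in> atom m b. w' g x = l} > measure M (atom m b) / 2"
    and h: "h \<in> stab m b"
  shows "steady m b h"
proof -
  obtain x0 where x0: "x0 \<in> atom m b" using pos by (metis measure_empty ex_in_conv less_irrefl)
  have x0': "x0 \<in> base" "x0 \<in> space M" "r m x0 = b" using x0 sub by (auto simp: atom_def)
  have Kb: "steady m b k" if k: "k \<in> H \<inter> stab m b" for k
  proof -
    have kK: "k \<in> K" using k sub_atom_stab[OF sub x0] by blast
    have "AE x in M. x \<in> atom m b \<longrightarrow> w' k x = \<delta> k" using w'_eq_\<delta>[OF kK] sub by (auto elim: AE_mp)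
    then show ?thesis using k \<delta>_closed[OF kK] by (auto simp: steady_def)
  qed
  have gen: "\<exists>h\<in>H #>\<^bsub>G\<^esub> g. steady m b h" if gF: "g \<in> F" for g
  proof -
    have g: "g \<in> stab n c" using gF gens(2) by blast
    note gG = stabD(2)[OF g]
    have ig: "inv\<^bsub>G\<^esub> g \<in> stab n c" using subgroup.m_inv_closed[OF subgroup_stab[OF x0'(1)] g] .
    obtain l where l: "l \<in> carrier L" "AE x in M. x \<in> atom m b \<longrightarrow> w' g x = l"
      using half[OF gF] nearly_constant_imp_constant[OF g sub pos] by blast
    \<comment> \<open>\<open>k\<close> will carry the atom of \<open>x0\<close> to the atom of
      \<open>y\<close>, so \<open>g\<close> followed after \<open>k\<close> brings it back. As
      \<open>y\<close> lies in \<open>base\<close> and \<open>m\<close> is at least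
      \<open>n\<close>, this \<open>k\<close> belongs to \<open>K\<close>.\<close>
    define y where "y = a (inv\<^bsub>G\<^esub> g) x0"
    have y: "y \<in> space M" "y \<in> base" "a g y = x0"
      using a_closed[of "inv\<^bsub>G\<^esub> g" x0] gG x0' stabD(1)[OF ig x0'(1)] a_inv_cancel(1)[OF gG x0'(2)]
      by (auto simp: y_def)
    have py: "measure M (atom m (r m y)) > 0"
      using measure_atom_eq[OF gG y(1), of m] pos y(3) x0'(3) by simp
    obtain k where k: "k \<in> H" "\<And>x. x \<in> atom m b \<Longrightarrow> a k x \<in> atom m (r m y)"
      by (rule transitive_on_atoms[OF pos py]) blast
    note kG = H_carrier[OF k(1)]
    have kx0: "a k x0 \<in> space M" "r m (a k x0) = r m y" using k(2)[OF x0] by (auto simp: atom_def)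
    have "r n (a k x0) = r n y" by (rule r_mono[OF nm kx0(1) y(1) kx0(2)])
    then have "a k x0 \<in> base" using kx0(1) y(2) by (simp add: atom_def)
    then have kK: "k \<in> K" using stabI[OF kG x0'(1)] k(1) by blast
    have gk: "g \<otimes>\<^bsub>G\<^esub> k \<in> carrier G" using gG kG by simp
    have "r m (a g (a k x0)) = r m (a g y)" by (rule r_equivariant[OF gG kx0(1) y(1) kx0(2)])
    then have "a (g \<otimes>\<^bsub>G\<^esub> k) x0 \<in> atom m b"
      using a_mult[OF gG kG x0'(2)] a_closed[OF gG kx0(1)] y(3) x0'(3) by (simp add: atom_def)
    then have st: "g \<otimes>\<^bsub>G\<^esub> k \<in> stab m b" by (rule stabI[OF gk x0])
    define k' where "k' = g \<otimes>\<^bsub>G\<^esub> k \<otimes>\<^bsub>G\<^esub> inv\<^bsub>G\<^esub> g"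
    have k': "k' \<in> K" unfolding k'_def by (rule K_conj[OF g kK])
    have "AE x in M. x \<in> atom m b \<longrightarrow> w' (g \<otimes>\<^bsub>G\<^esub> k) x = \<delta> k' \<otimes>\<^bsub>L\<^esub> l"
      using l(2) w'_eq_\<delta>[OF kK] w'_conj[OF g kK, folded k'_def]
    proof (rule AE_mp[OF _ AE_mp[OF _ AE_mp[OF _ AE_I2]]], intro impI)
      fix x assume xs: "x \<in> space M" and x: "x \<in> atom m b" and 1: "x \<in> atom m b \<longrightarrow> w' g x = l"
        and 2: "x \<in> base \<longrightarrow> w' k x = \<delta> k" and 3: "x \<in> base \<longrightarrow> w' g (a k x) \<otimes>\<^bsub>L\<^esub> \<delta> k = \<delta> k' \<otimes>\<^bsub>L\<^esub> w' g x"
      have "x \<in> base" using x sub by blast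
      then show "w' (g \<otimes>\<^bsub>G\<^esub> k) x = \<delta> k' \<otimes>\<^bsub>L\<^esub> l" using w'_mult[OF gG kG xs] 1 2 3 x by simp
    qed
    then have "steady m b (g \<otimes>\<^bsub>G\<^esub> k)"
      using st \<delta>_closed[OF k'] l(1) by (auto simp: steady_def)
    \<comment> \<open>The correction was made on the right, while \<open>H #> g\<close> has its
      elements of \<open>H\<close> on the left; conjugation by \<open>g\<close> exchanges the
      sides.\<close>
    moreover have "g \<otimes>\<^bsub>G\<^esub> k = k' \<otimes>\<^bsub>G\<^esub> g" using gG kG by (simp add: k'_def G.m_assoc)
    then have "g \<otimes>\<^bsub>G\<^esub> k \<in> H #>\<^bsub>G\<^esub> g" using k' by (auto simp: r_coset_def)
    ultimately show ?thesis by blast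
  qed
  have all: "\<exists>h\<in>C. h \<in> carrier G \<and> steady m b h"
    if "C \<in> generate (G Mod H) ((\<lambda>g. H #>\<^bsub>G\<^esub> g) ` F)" for C
    using that
  proof (induction rule: generate.induct)
    case one
    have "steady m b \<one>\<^bsub>G\<^esub>" by (rule Kb) (use subgroup.one_closed[OF subgroup_stab[OF x0]] H.one_closed in blast)
    then show ?case using H.one_closed by (auto simp: FactGroup_def)
  next
    case (incl C)
    then obtain g where g: "g \<in> F" "C = H #>\<^bsub>G\<^esub> g" by blast
    obtain h where "h \<in> C" "steady m b h" using gen[OF g(1)] g(2) by blast
    then show ?case using stabD(2) by (auto simp: steady_def)
  next
    case (inv C)
    then obtain g where g: "g \<in> F" "C = H #>\<^bsub>G\<^esub> g" by blast
    have gG: "g \<in> carrier G" using g(1) gens(2) stabD(2) by blast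
    obtain h where h: "h \<in> C" "steady m b h" using gen[OF g(1)] g(2) by blast
    have hG: "h \<in> carrier G" using h(2) stabD(2) by (auto simp: steady_def)
    have "C \<in> carrier (G Mod H)" using g(2) gG by (auto simp: FactGroup_def RCOSETS_def)
    then have "inv\<^bsub>G Mod H\<^esub> C = set_inv\<^bsub>G\<^esub> C" by (rule H.inv_FactGroup)
    then have "inv\<^bsub>G\<^esub> h \<in> inv\<^bsub>G Mod H\<^esub> C" using h(1) by (auto simp: SET_INV_def)
    then show ?case using steady_inv[OF x0 h(2)] hG by blast
  next
    case (eng C C')
    then obtain h h' where h: "h \<in> C" "h \<in> carrier G" "steady m b h"
      "h' \<in> C'" "h' \<in> carrier G" "steady m b h'" by blast
    have "h \<otimes>\<^bsub>G\<^esub> h' \<in> C \<otimes>\<^bsub>G Mod H\<^esub> C'" using h by (auto simp: FactGroup_def set_mult_def)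
    then show ?case using steady_mult[OF x0 h(3,6)] h(2,5) by blast
  qed
  note hG = stabD(2)[OF h]
  have "H #>\<^bsub>G\<^esub> h \<in> carrier (G Mod H)" using hG by (auto simp: FactGroup_def RCOSETS_def)
  then have "\<exists>h'\<in>H #>\<^bsub>G\<^esub> h. h' \<in> carrier G \<and> steady m b h'" using all gens(3) by blast
  then obtain h' where h': "h' \<in> H #>\<^bsub>G\<^esub> h" "steady m b h'" by blast
  then obtain k where k: "k \<in> H" "h' = k \<otimes>\<^bsub>G\<^esub> h" by (auto simp: r_coset_def)
  note kG = H_carrier[OF k(1)]
  have keq: "k = h' \<otimes>\<^bsub>G\<^esub> inv\<^bsub>G\<^esub> h" using k(2) kG hG by (simp add: G.m_assoc)
  interpret S: subgroup "stab m b" G by (rule subgroup_stab[OF x0])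
  have "h' \<in> stab m b" using h'(2) by (simp add: steady_def)
  then have "k \<in> stab m b" unfolding keq using S.m_closed S.m_inv_closed h by blast
  then have "inv\<^bsub>G\<^esub> k \<in> H \<inter> stab m b" using k(1) S.m_inv_closed H.m_inv_closed by blast
  then have "steady m b (inv\<^bsub>G\<^esub> k \<otimes>\<^bsub>G\<^esub> h')" by (rule steady_mult[OF x0 Kb h'(2)])
  moreover have "inv\<^bsub>G\<^esub> k \<otimes>\<^bsub>G\<^esub> h' = h" using k(2) kG hG by (simp add: G.m_assoc[symmetric])
  ultimately show ?thesis by simp
qed

text \<open>Countably many joint patterns of \<open>\<psi>\<close> and of the cocycle at finitely
  many generators cover the atom. One pattern has positive measure and thus fills more than half of
  some deep atom, which makes all generators nearly constant there simultaneously. Including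
  \<open>\<psi>\<close> in the pattern yields the last conclusion, from which injectivity of
  \<open>\<epsilon>\<close> will follow.\<close>

lemma homomorphism_on_deep_atom:
  obtains m b \<epsilon> l0 where "measure M (atom m b) > 0"
    "\<And>g. g \<in> stab m b \<Longrightarrow> \<epsilon> g \<in> carrier L"
    "\<And>g h. \<lbrakk>g \<in> stab m b; h \<in> stab m b\<rbrakk> \<Longrightarrow> \<epsilon> (g \<otimes>\<^bsub>G\<^esub> h) = \<epsilon> g \<otimes>\<^bsub>L\<^esub> \<epsilon> h"
    "\<And>g. g \<in> stab m b \<Longrightarrow> AE x in M. x \<in> atom m b \<longrightarrow> \<psi> (a g x) \<otimes>\<^bsub>L\<^esub> \<epsilon> g = w g x \<otimes>\<^bsub>L\<^esub> \<psi> x"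
    "measure M {x \<in> atom m b. \<psi> x = l0} > measure M (atom m b) / 2"
proof -
  obtain \<C> where \<C>: "finite \<C>" "\<C> \<subseteq> carrier (G Mod H)" "generate (G Mod H) \<C> = carrier (G Mod H)"
    using finitely_generated by (auto simp: finitely_generated_group_def)
  have cr: "C \<in> rcosets\<^bsub>G\<^esub> H" if "C \<in> \<C>" for C using that \<C>(2) by (auto simp: FactGroup_def)
  have "\<forall>C\<in>\<C>. \<exists>g. g \<in> C \<and> g \<in> stab n c"
  proof
    fix C assume "C \<in> \<C>"
    then obtain g where "g \<in> C" "g \<in> stab n c" by (rule coset_meets_stab[OF cr])
    then show "\<exists>g. g \<in> C \<and> g \<in> stab n c" by blast
  qed
  from bchoice[OF this] obtain f where f: "\<forall>C\<in>\<C>. f C \<in> C \<and> f C \<in> stab n c" ..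
  define F where "F = f ` \<C>"
  have F: "finite F" "F \<subseteq> stab n c" using \<C>(1) f by (auto simp: F_def)
  have FG: "g \<in> carrier G" if "g \<in> F" for g using that F(2) stabD(2) by blast
  have "H #>\<^bsub>G\<^esub> f C = C" if C: "C \<in> \<C>" for C
  proof -
    obtain s where s: "s \<in> carrier G" "C = H #>\<^bsub>G\<^esub> s" using cr[OF C] by (auto simp: RCOSETS_def)
    have "f C \<in> H #>\<^bsub>G\<^esub> s" using f C s(2) by blast
    then show ?thesis using G.repr_independence[OF _ s(1) H.subgroup_axioms] s(2) by metis
  qed
  then have "(\<lambda>g. H #>\<^bsub>G\<^esub> g) ` F = \<C>" by (simp add: F_def image_image)
  then have gens: "generate (G Mod H) ((\<lambda>g. H #>\<^bsub>G\<^esub> g) ` F) = carrier (G Mod H)" using \<C>(3) by simp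
  \<comment> \<open>The first component of \<open>p\<close> is the value of \<open>\<psi>\<close>,
    the second one the values on \<open>F\<close>; finiteness of \<open>F\<close> keeps the index
    set countable.\<close>
  define \<W> where "\<W> p = {x \<in> base. \<psi> x = fst p \<and> (\<forall>g\<in>F. w' g x = snd p g)}" for p :: "'l \<times> ('g \<Rightarrow> 'l)"
  define I where "I = carrier L \<times> (PiE F (\<lambda>_. carrier L))"
  have cI: "countable I" unfolding I_def using countable_L F(1) by (intro countable_SIGMA countable_PiE) auto
  have Wm: "\<W> p \<in> sets M" for p
  proof -
    have "{x \<in> space M. \<psi> x = fst p} \<in> sets M" by (rule fibre_sets[OF \<psi>_measurable])
    moreover have "{x \<in> space M. \<forall>g\<in>F. w' g x = snd p g} \<in> sets M"
      by (rule sets.sets_Collect_finite_All[OF _ F(1)]) (rule fibre_sets[OF w'_measurable[OF FG]])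
    ultimately have "base \<inter> ({x \<in> space M. \<psi> x = fst p} \<inter> {x \<in> space M. \<forall>g\<in>F. w' g x = snd p g}) \<in> sets M"
      by (intro sets.Int atom_sets)
    also have "base \<inter> ({x \<in> space M. \<psi> x = fst p} \<inter> {x \<in> space M. \<forall>g\<in>F. w' g x = snd p g}) = \<W> p"
      by (auto simp: \<W>_def atom_def)
    finally show ?thesis .
  qed
  have "\<exists>p\<in>I. measure M (\<W> p) > 0"
  proof (rule ccontr)
    assume neg: "\<not> ?thesis"
    have "\<W> p \<in> null_sets M" if p: "p \<in> I" for p
    proof -
      have "measure M (\<W> p) = 0" using neg p by (simp add: zero_less_measure_iff)
      then show ?thesis using Wm[of p] by (auto simp: emeasure_eq_measure intro!: null_setsI)
    qed
    then have "(\<Union>p\<in>I. \<W> p) \<in> null_sets M" by (rule null_sets_UN'[OF cI])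
    moreover have "base \<subseteq> (\<Union>p\<in>I. \<W> p)"
    proof
      fix x assume x: "x \<in> base"
      then have xs: "x \<in> space M" by (rule atom_space)
      have "(\<psi> x, restrict (\<lambda>g. w' g x) F) \<in> I" using \<psi>_closed[OF xs] w'_closed[OF FG xs] by (auto simp: I_def)
      moreover have "x \<in> \<W> (\<psi> x, restrict (\<lambda>g. w' g x) F)" using x by (simp add: \<W>_def)
      ultimately show "x \<in> (\<Union>p\<in>I. \<W> p)" by blast
    qed
    ultimately have "base \<in> null_sets M" using null_sets_subset[OF _ atom_sets] by blast
    then show False using base_pos by (simp add: measure_def null_setsD1)
  qed
  then obtain p where p: "p \<in> I" "measure M (\<W> p) > 0" by blast
  obtain m b where m: "m \<ge> n" "measure M (\<W> p \<inter> atom m b) > measure M (atom m b) / 2"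
    by (rule density_atom[OF Wm p(2)])
  have "measure M (\<W> p \<inter> atom m b) > 0" using m(2) measure_nonneg[of M "atom m b"] by linarith
  then have ne: "\<W> p \<inter> atom m b \<noteq> {}" by auto
  have pos: "measure M (atom m b) > 0"
    using finite_measure_mono[of "\<W> p \<inter> atom m b" "atom m b"] \<open>measure M (\<W> p \<inter> atom m b) > 0\<close> by simp
  obtain x0 where x0: "x0 \<in> \<W> p" "x0 \<in> atom m b" using ne by blast
  \<comment> \<open>The deep atom meets \<open>base\<close> in \<open>x0\<close>, and atoms are
    nested.\<close>
  have sub: "atom m b \<subseteq> base"
  proof
    fix x assume x: "x \<in> atom m b"
    have "x0 \<in> base" using x0(1) by (simp add: \<W>_def)
    moreover have "r n x = r n x0" using r_mono[OF m(1), of x x0] x x0(2) by (simp add: atom_def)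
    ultimately show "x \<in> base" using x by (simp add: atom_def)
  qed
  have half: "\<exists>l\<in>carrier L. measure M {x \<in> atom m b. w' g x = l} > measure M (atom m b) / 2" if g: "g \<in> F" for g
  proof
    show "snd p g \<in> carrier L" using p(1) g by (auto simp: I_def)
    have "atom m b \<inter> {x \<in> space M. w' g x = snd p g} \<in> sets M"
      by (rule sets.Int[OF atom_sets fibre_sets[OF w'_measurable[OF FG[OF g]]]])
    also have "atom m b \<inter> {x \<in> space M. w' g x = snd p g} = {x \<in> atom m b. w' g x = snd p g}"
      by (auto simp: atom_def)
    finally have "measure M (\<W> p \<inter> atom m b) \<le> measure M {x \<in> atom m b. w' g x = snd p g}"
      by (rule finite_measure_mono[rotated]) (use g in \<open>auto simp: \<W>_def\<close>)
    then show "measure M {x \<in> atom m b. w' g x = snd p g} > measure M (atom m b) / 2" using m(2) by linarith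
  qed
  have const: "steady m b h" if "h \<in> stab m b" for h
    by (rule deep_atom_stab[OF m(1) sub pos F gens half that])
  define \<epsilon> where "\<epsilon> h = (SOME l. l \<in> carrier L \<and> (AE x in M. x \<in> atom m b \<longrightarrow> w' h x = l))" for h
  have \<epsilon>: "\<epsilon> h \<in> carrier L" "AE x in M. x \<in> atom m b \<longrightarrow> w' h x = \<epsilon> h" if h: "h \<in> stab m b" for h
  proof -
    have "\<exists>l. l \<in> carrier L \<and> (AE x in M. x \<in> atom m b \<longrightarrow> w' h x = l)"
      using const[OF h] by (auto simp: steady_def)
    from someI_ex[OF this] show "\<epsilon> h \<in> carrier L" "AE x in M. x \<in> atom m b \<longrightarrow> w' h x = \<epsilon> h"
      by (simp_all add: \<epsilon>_def)
  qed
  have hom: "\<epsilon> (g \<otimes>\<^bsub>G\<^esub> h) = \<epsilon> g \<otimes>\<^bsub>L\<^esub> \<epsilon> h" if g: "g \<in> stab m b" and h: "h \<in> stab m b" for g h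
  proof -
    have gh: "g \<otimes>\<^bsub>G\<^esub> h \<in> stab m b" using subgroup.m_closed[OF subgroup_stab[OF x0(2)] g h] .
    note G = stabD(2)[OF g] stabD(2)[OF h]
    have "AE x in M. x \<in> atom m b \<longrightarrow> \<epsilon> (g \<otimes>\<^bsub>G\<^esub> h) = \<epsilon> g \<otimes>\<^bsub>L\<^esub> \<epsilon> h"
      using \<epsilon>(2)[OF gh] \<epsilon>(2)[OF h] AE_a[OF G(2) \<epsilon>(2)[OF g]]
    proof (rule AE_mp[OF _ AE_mp[OF _ AE_mp[OF _ AE_I2]]], intro impI)
      fix x assume "x \<in> space M" "x \<in> atom m b" "x \<in> atom m b \<longrightarrow> w' (g \<otimes>\<^bsub>G\<^esub> h) x = \<epsilon> (g \<otimes>\<^bsub>G\<^esub> h)"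
        "x \<in> atom m b \<longrightarrow> w' h x = \<epsilon> h" "a h x \<in> atom m b \<longrightarrow> w' g (a h x) = \<epsilon> g"
      then show "\<epsilon> (g \<otimes>\<^bsub>G\<^esub> h) = \<epsilon> g \<otimes>\<^bsub>L\<^esub> \<epsilon> h"
        using w'_mult[OF G, of x] stabD(1)[OF h, of x] by simp
    qed
    then show ?thesis by (rule AE_atom_exists[OF _ atom_sets pos])
  qed
  have eqv: "AE x in M. x \<in> atom m b \<longrightarrow> \<psi> (a g x) \<otimes>\<^bsub>L\<^esub> \<epsilon> g = w g x \<otimes>\<^bsub>L\<^esub> \<psi> x" if g: "g \<in> stab m b" for g
    using \<epsilon>(2)[OF g]
  proof (rule AE_mp, intro AE_I2 impI)
    fix x assume x: "x \<in> space M" "x \<in> atom m b" "x \<in> atom m b \<longrightarrow> w' g x = \<epsilon> g"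
    note gG = stabD(2)[OF g]
    note c = \<psi>_closed[OF x(1)] \<psi>_closed[OF a_closed[OF gG x(1)]] w_closed[OF gG x(1)]
    have "\<epsilon> g = inv\<^bsub>L\<^esub> \<psi> (a g x) \<otimes>\<^bsub>L\<^esub> (w g x \<otimes>\<^bsub>L\<^esub> \<psi> x)"
      using x c by (simp add: w'_def L.m_assoc)
    then show "\<psi> (a g x) \<otimes>\<^bsub>L\<^esub> \<epsilon> g = w g x \<otimes>\<^bsub>L\<^esub> \<psi> x"
      using c by (simp add: L.m_assoc[symmetric])
  qed
  have "atom m b \<inter> {x \<in> space M. \<psi> x = fst p} \<in> sets M"
    by (rule sets.Int[OF atom_sets fibre_sets[OF \<psi>_measurable]])
  also have "atom m b \<inter> {x \<in> space M. \<psi> x = fst p} = {x \<in> atom m b. \<psi> x = fst p}"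
    by (auto simp: atom_def)
  finally have "measure M (\<W> p \<inter> atom m b) \<le> measure M {x \<in> atom m b. \<psi> x = fst p}"
    by (rule finite_measure_mono[rotated]) (auto simp: \<W>_def)
  then have "measure M {x \<in> atom m b. \<psi> x = fst p} > measure M (atom m b) / 2" using m(2) by linarith
  from that[OF pos \<epsilon>(1) hom eqv this] show thesis .
qed

end

subsection \<open>Measure preserving maps and completions\<close>

lemma mp_map_distr:
  assumes "mp_map M N f"
  shows "distr (completion M) N f = N"
proof (rule measure_eqI)
  fix B assume "B \<in> sets (distr (completion M) N f)"
  then have "B \<in> sets N" by simp
  then show "emeasure (distr (completion M) N f) B = emeasure N B"
    using assms by (simp add: mp_map_def emeasure_distr del: emeasure_completion)
qed simp

lemma mp_map_AE:
  assumes f: "mp_map M N f" and P: "AE y in N. P y"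
  shows "AE x in M. P (f x)"
proof -
  have "AE y in distr (completion M) N f. P y" unfolding mp_map_distr[OF f] by (rule P)
  then have "AE x in completion M. P (f x)"
    by (rule AE_distrD[rotated]) (use f in \<open>simp add: mp_map_def\<close>)
  then show ?thesis by (simp add: AE_completion_iff)
qed

lemma mp_map_space: "\<lbrakk>mp_map M N f; x \<in> space M\<rbrakk> \<Longrightarrow> f x \<in> space N"
  unfolding mp_map_def using measurable_space[of f "completion M" N x] by simp

text \<open>A set of the completion agrees with its main part off a null set, and preimages of null
  sets are null. With completions on both sides such maps compose, whereas a map from the completion
  of \<open>M\<close> to \<open>N\<close> cannot directly be followed by one that is measurable only
  on the completion of \<open>N\<close>.\<close>

lemma mp_map_completion:
  assumes f: "mp_map M N f"
  shows "f \<in> measurable (completion M) (completion N)"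
    and "distr (completion M) (completion N) f = completion N"
proof -
  have fm: "f \<in> measurable (completion M) N" using f by (simp add: mp_map_def)
  have main: "f -` B \<inter> space M \<in> sets (completion M) \<and>
      emeasure (completion M) (f -` B \<inter> space M) = emeasure (completion N) B"
    if B: "B \<in> sets (completion N)" for B
  proof -
    let ?B = "main_part N B"
    have s: "f -` ?B \<inter> space M \<in> sets (completion M)"
      using measurable_sets[OF fm, of ?B] B by simp
    have "AE x in M. f x \<in> ?B \<longleftrightarrow> f x \<in> B" by (rule mp_map_AE[OF f AE_in_main_part[OF B]])
    then have ae: "AE x in completion M. f x \<in> ?B \<longleftrightarrow> f x \<in> B" by (rule AE_completion)
    then have ae': "AE x in completion M. x \<in> f -` ?B \<inter> space M \<longleftrightarrow> x \<in> f -` B \<inter> space M"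
      by eventually_elim auto
    have s': "f -` B \<inter> space M \<in> sets (completion M)"
      by (rule completion.in_sets_AE[OF ae' s]) simp
    have "emeasure (completion M) (f -` B \<inter> space M) = emeasure (completion M) (f -` ?B \<inter> space M)"
      using ae' by (intro emeasure_eq_AE s s') auto
    also have "\<dots> = emeasure N ?B" using f B by (simp add: mp_map_def del: emeasure_completion)
    also have "\<dots> = emeasure (completion N) B" using B by simp
    finally show ?thesis using s' by blast
  qed
  show fm': "f \<in> measurable (completion M) (completion N)"
    by (rule measurableI) (use main mp_map_space[OF f] in auto)
  show "distr (completion M) (completion N) f = completion N"
  proof (rule measure_eqI)
    fix B assume "B \<in> sets (distr (completion M) (completion N) f)"
    then have B: "B \<in> sets (completion N)" by simp
    show "emeasure (distr (completion M) (completion N) f) B = emeasure (completion N) B"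
      unfolding emeasure_distr[OF fm' B] using main[OF B] by simp
  qed simp
qed

lemma mp_mapI:
  assumes f: "f \<in> measurable (completion M) (completion N)"
    and d: "distr (completion M) (completion N) f = completion N"
  shows "mp_map M N f"
  unfolding mp_map_def
proof (intro conjI ballI)
  show "f \<in> measurable (completion M) N"
    by (rule measurableI) (use measurable_space[OF f] measurable_sets[OF f] in auto)
  fix B assume B: "B \<in> sets N"
  have "emeasure (completion M) (f -` B \<inter> space M) = emeasure (distr (completion M) (completion N) f) B"
    using emeasure_distr[OF f, of B] B by simp
  then show "emeasure (completion M) (f -` B \<inter> space M) = emeasure N B"
    using d B by simp
qed

lemma prob_space_completion: "prob_space M \<Longrightarrow> prob_space (completion M)"
  by (rule prob_spaceI) (simp add: prob_space.emeasure_space_1)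

lemma AE_completion_sets:
  assumes "AE x in M. P x"
  shows "{x \<in> space M. P x} \<in> sets (completion M)"
proof -
  have "AE x in completion M. x \<in> space M \<longleftrightarrow> x \<in> {x \<in> space M. P x}"
    using AE_completion[OF assms] AE_space by eventually_elim auto
  then show ?thesis by (rule completion.in_sets_AE) auto
qed

text \<open>The sets that can be approximated by cylinders form a sigma-algebra containing the
  coordinate sets. Finite unions work because in an inverse limit the coordinate \<open>m\<close>
  determines all earlier ones, so two cylinders can be described at a common level.\<close>

lemma inverse_limit_cylinder_approximation:
  assumes L: "inverse_limit_measure P q L" and P: "\<And>n. sets (P n) = Pow (space (P n))" and V: "V \<in> sets L" and e: "e > 0"
  obtains n U where "measure L {z \<in> space L. (z \<in> V) \<noteq> (z n \<in> U)} < e"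
proof -
  interpret L: prob_space L using L by (simp add: inverse_limit_measure_def)
  let ?S = "inverse_limit_set P q"
  have sp: "space L = ?S" and sL: "sets L = (\<inter>) ?S ` sets (PiM UNIV P)"
    using L by (simp_all add: inverse_limit_measure_def sets_restrict_space)
  have SO: "?S \<subseteq> (\<Pi>\<^sub>E i\<in>UNIV. space (P i))" by (auto simp: inverse_limit_set_def PiE_def)
  have det: "z n = z' n" if "z \<in> ?S" "z' \<in> ?S" "n \<le> m" "z m = z' m" for z z' n m
    using that(3,4)
  proof (induction m rule: dec_induct)
    case (step k)
    have "z k = q k (z (Suc k))" "z' k = q k (z' (Suc k))" using that(1,2) by (simp_all add: inverse_limit_set_def)
    then show ?case using step by simp
  qed simp
  have cyl: "{z \<in> ?S. z n \<in> U} \<in> sets L" for n U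
  proof -
    have "{f \<in> (\<Pi>\<^sub>E i\<in>UNIV. space (P i)). f n \<in> U \<inter> space (P n)} \<in> sets (PiM UNIV P)"
    proof -
      have "U \<inter> space (P n) \<in> sets (P n)" by (simp add: P)
      from measurable_sets[OF measurable_component_singleton[of n UNIV P] this]
      have "(\<lambda>x. x n) -` (U \<inter> space (P n)) \<inter> space (PiM UNIV P) \<in> sets (PiM UNIV P)" by simp
      also have "(\<lambda>x. x n) -` (U \<inter> space (P n)) \<inter> space (PiM UNIV P) =
          {f \<in> (\<Pi>\<^sub>E i\<in>UNIV. space (P i)). f n \<in> U \<inter> space (P n)}" by (auto simp: space_PiM)
      finally show ?thesis .
    qed
    then have "?S \<inter> {f \<in> (\<Pi>\<^sub>E i\<in>UNIV. space (P i)). f n \<in> U \<inter> space (P n)} \<in> sets L" unfolding sL by blast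
    also have "?S \<inter> {f \<in> (\<Pi>\<^sub>E i\<in>UNIV. space (P i)). f n \<in> U \<inter> space (P n)} = {z \<in> ?S. z n \<in> U}"
      using SO by (auto simp: inverse_limit_set_def)
    finally show ?thesis .
  qed
  have level_up: "\<exists>U'. \<forall>z\<in>?S. z n \<in> U \<longleftrightarrow> z m \<in> U'" if "n \<le> m" for n m U
  proof (intro exI ballI iffI)
    let ?U = "{z m | z. z \<in> ?S \<and> z n \<in> U}"
    fix z assume z: "z \<in> ?S"
    show "z m \<in> ?U" if "z n \<in> U" using z that by blast
    assume "z m \<in> ?U"
    then obtain z' where "z' \<in> ?S" "z' n \<in> U" "z m = z' m" by blast
    then show "z n \<in> U" using det[OF z _ \<open>n \<le> m\<close>] by metis
  qed
  define D where "D A n U = {z \<in> ?S. (z \<in> A) \<noteq> (z n \<in> U)}" for A and n :: nat and U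
  have SA: "?S \<inter> A \<in> sets L" if "A \<in> sets (PiM UNIV P)" for A using that unfolding sL by blast
  have DL: "D A n U \<in> sets L" if A: "A \<in> sets (PiM UNIV P)" for A n U
  proof -
    have "D A n U = (?S \<inter> A - {z \<in> ?S. z n \<in> U}) \<union> ({z \<in> ?S. z n \<in> U} - ?S \<inter> A)" by (auto simp: D_def)
    also have "\<dots> \<in> sets L" by (intro sets.Un sets.Diff cyl SA A)
    finally show ?thesis .
  qed
  define Q where "Q A \<longleftrightarrow> A \<in> sets (PiM UNIV P) \<and> (\<forall>e>0. \<exists>n U. measure L (D A n U) < e)" for A
  have Q_Un: "Q (A \<union> B)" if A: "Q A" and B: "Q B" for A B
    unfolding Q_def
  proof (intro conjI allI impI)
    have AB: "A \<in> sets (PiM UNIV P)" "B \<in> sets (PiM UNIV P)" using A B by (auto simp: Q_def)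
    then show "A \<union> B \<in> sets (PiM UNIV P)" by blast
    fix e :: real assume "e > 0"
    then have e2: "e / 2 > 0" by simp
    obtain n U where nU: "measure L (D A n U) < e / 2" using A e2 unfolding Q_def by blast
    obtain n' U' where nU': "measure L (D B n' U') < e / 2" using B e2 unfolding Q_def by blast
    define m where "m = max n n'"
    obtain V where V: "\<forall>z\<in>?S. z n \<in> U \<longleftrightarrow> z m \<in> V" using level_up[of n m U] by (auto simp: m_def)
    obtain V' where V': "\<forall>z\<in>?S. z n' \<in> U' \<longleftrightarrow> z m \<in> V'" using level_up[of n' m U'] by (auto simp: m_def)
    have "D (A \<union> B) m (V \<union> V') \<subseteq> D A n U \<union> D B n' U'" using V V' by (auto simp: D_def)
    then have "measure L (D (A \<union> B) m (V \<union> V')) \<le> measure L (D A n U \<union> D B n' U')"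
      by (rule L.finite_measure_mono) (intro sets.Un DL AB)
    also have "\<dots> \<le> measure L (D A n U) + measure L (D B n' U')" by (rule measure_Un_le) (intro DL AB)+
    also have "\<dots> < e" using nU nU' by simp
    finally show "\<exists>n U. measure L (D (A \<union> B) n U) < e" by blast
  qed
  let ?\<Omega> = "\<Pi>\<^sub>E i\<in>UNIV. space (P i)"
  let ?G = "{{f \<in> ?\<Omega>. f i \<in> A} | i A. i \<in> UNIV \<and> A \<in> sets (P i)}"
  have sP: "sets (PiM UNIV P) = sigma_sets ?\<Omega> ?G" by (rule sets_PiM_single)
  have QA: "Q A" if "A \<in> sigma_sets ?\<Omega> ?G" for A
    using that
  proof (induction rule: sigma_sets.induct)
    case (Basic A)
    then obtain i B where "A = {f \<in> ?\<Omega>. f i \<in> B}" by blast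
    then have "D A i B = {}" using SO by (auto simp: D_def)
    moreover have "A \<in> sets (PiM UNIV P)" unfolding sP using Basic by (rule sigma_sets.Basic)
    ultimately show ?case unfolding Q_def by (metis measure_empty)
  next
    case Empty
    have "D {} 0 {} = {}" by (auto simp: D_def)
    then show ?case unfolding Q_def by (metis measure_empty sets.empty_sets)
  next
    case (Compl A)
    then have A: "A \<in> sets (PiM UNIV P)" by (simp add: Q_def)
    \<comment> \<open>Complementing both sets leaves their symmetric difference inside the limit
      unchanged.\<close>
    have "D (?\<Omega> - A) n (- U) = D A n U" for n U using SO by (auto simp: D_def)
    moreover have "?\<Omega> - A \<in> sets (PiM UNIV P)"
      using sets.compl_sets[OF A] by (simp add: space_PiM)
    ultimately show ?case using Compl(2) unfolding Q_def by metis
  next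
    case (Union A)
    have As: "A i \<in> sets (PiM UNIV P)" for i using Union(2) by (simp add: Q_def)
    have Us: "(\<Union>i. A i) \<in> sets (PiM UNIV P)" using As by blast
    have QB: "Q (\<Union>i<k. A i)" for k :: nat
    proof (induction k)
      case 0
      have "D {} 0 {} = {}" by (auto simp: D_def)
      then show ?case unfolding Q_def by (metis measure_empty sets.empty_sets UN_empty lessThan_0)
    next
      case (Suc k)
      then show ?case using Q_Un[OF Suc Union(2)[of k]] by (simp add: lessThan_Suc Un_commute)
    qed
    show ?case unfolding Q_def
    proof (intro conjI allI impI Us)
      fix e :: real assume e: "e > 0"
      \<comment> \<open>By continuity from below a finite part of the union misses less than
        \<open>e / 2\<close>; the finite part is approximated within the other
        \<open>e / 2\<close>.\<close>
      let ?B = "\<lambda>k::nat. ?S \<inter> (\<Union>i<k. A i)"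
      have BL: "?B k \<in> sets L" for k by (rule SA) (use QB in \<open>simp add: Q_def\<close>)
      have inc: "incseq ?B" by (rule incseq_SucI) (simp add: lessThan_Suc le_infI2)
      have "(\<lambda>k. measure L (?B k)) \<longlonglongrightarrow> measure L (\<Union>k. ?B k)"
        by (rule L.finite_Lim_measure_incseq[OF _ inc]) (use BL in blast)
      moreover have "(\<Union>k. ?B k) = ?S \<inter> (\<Union>i. A i)" by auto
      ultimately have "(\<lambda>k. measure L (?B k)) \<longlonglongrightarrow> measure L (?S \<inter> (\<Union>i. A i))" by simp
      then have "\<forall>\<^sub>F k in sequentially. measure L (?B k) > measure L (?S \<inter> (\<Union>i. A i)) - e / 2"
        by (rule order_tendstoD) (use e in simp)
      then obtain k where k: "measure L (?B k) > measure L (?S \<inter> (\<Union>i. A i)) - e / 2"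
        by (auto simp: eventually_sequentially)
      have e2: "e / 2 > 0" using e by simp
      then obtain n U where nU: "measure L (D (\<Union>i<k. A i) n U) < e / 2" using QB[of k] unfolding Q_def by blast
      let ?R = "?S \<inter> (\<Union>i. A i) - ?B k"
      have RL: "?R \<in> sets L" by (intro sets.Diff SA Us BL)
      have R: "measure L ?R = measure L (?S \<inter> (\<Union>i. A i)) - measure L (?B k)"
        by (rule L.finite_measure_Diff[OF SA[OF Us] BL]) auto
      have Bk: "(\<Union>i<k. A i) \<in> sets (PiM UNIV P)" using QB[of k] by (simp add: Q_def)
      have "D (\<Union>i. A i) n U \<subseteq> ?R \<union> D (\<Union>i<k. A i) n U" by (auto simp: D_def)
      then have "measure L (D (\<Union>i. A i) n U) \<le> measure L (?R \<union> D (\<Union>i<k. A i) n U)"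
        by (rule L.finite_measure_mono) (intro sets.Un RL DL Bk)
      also have "\<dots> \<le> measure L ?R + measure L (D (\<Union>i<k. A i) n U)" by (rule measure_Un_le[OF RL DL[OF Bk]])
      also have "\<dots> < e" using R k nU by linarith
      finally show "\<exists>n U. measure L (D (\<Union>i. A i) n U) < e" by blast
    qed
  qed
  obtain A where A: "A \<in> sets (PiM UNIV P)" "V = ?S \<inter> A" using V unfolding sL by blast
  then obtain n U where lt: "measure L (D A n U) < e" using QA e unfolding Q_def sP by blast
  have "D A n U = {z \<in> space L. (z \<in> V) \<noteq> (z n \<in> U)}" using A(2) by (auto simp: D_def sp)
  from lt[unfolded this] show thesis by (rule that)
qed

subsection \<open>Piecewise translations\<close>

locale countable_mp_action =
  fixes L :: "'l monoid" and N :: "'y measure" and b :: "'l \<Rightarrow> 'y \<Rightarrow> 'y"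
  assumes group_L: "Group.group L" and countable_L: "countable (carrier L)"
    and prob_N: "prob_space N"
    and b_measurable: "l \<in> carrier L \<Longrightarrow> b l \<in> measurable N N"
    and b_distr: "l \<in> carrier L \<Longrightarrow> distr N N (b l) = N"
    and b_mult: "\<lbrakk>l \<in> carrier L; k \<in> carrier L; y \<in> space N\<rbrakk> \<Longrightarrow> b (l \<otimes>\<^bsub>L\<^esub> k) y = b l (b k y)"
    and b_one: "y \<in> space N \<Longrightarrow> b \<one>\<^bsub>L\<^esub> y = y"
begin

sublocale L: Group.group L by (rule group_L)
sublocale prob_space N by (rule prob_N)

lemma b_closed: "\<lbrakk>l \<in> carrier L; y \<in> space N\<rbrakk> \<Longrightarrow> b l y \<in> space N"
  using measurable_space[OF b_measurable] by blast

lemma b_inv_cancel: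
  "\<lbrakk>l \<in> carrier L; y \<in> space N\<rbrakk> \<Longrightarrow> b l (b (inv\<^bsub>L\<^esub> l) y) = y"
  "\<lbrakk>l \<in> carrier L; y \<in> space N\<rbrakk> \<Longrightarrow> b (inv\<^bsub>L\<^esub> l) (b l y) = y"
  using b_mult[of l "inv\<^bsub>L\<^esub> l" y] b_mult[of "inv\<^bsub>L\<^esub> l" l y] b_one[of y] by auto

lemma b_inj: "\<lbrakk>l \<in> carrier L; y \<in> space N; z \<in> space N; b l y = b l z\<rbrakk> \<Longrightarrow> y = z"
  using b_inv_cancel(2)[of l y] b_inv_cancel(2)[of l z] by metis

lemma emeasure_b_vimage:
  assumes "l \<in> carrier L" "B \<in> sets N"
  shows "emeasure N (b l -` B \<inter> space N) = emeasure N B"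
  using emeasure_distr[OF b_measurable[OF assms(1)] assms(2)] b_distr[OF assms(1)] by simp

lemma b_image:
  assumes l: "l \<in> carrier L" and B: "B \<in> sets N"
  shows "b l ` B \<in> sets N" "emeasure N (b l ` B) = emeasure N B"
proof -
  note Bs = sets.sets_into_space[OF B]
  have eq: "b l ` B = b (inv\<^bsub>L\<^esub> l) -` B \<inter> space N"
  proof (rule equalityI; rule subsetI)
    fix z assume "z \<in> b l ` B"
    then show "z \<in> b (inv\<^bsub>L\<^esub> l) -` B \<inter> space N" using Bs l b_inv_cancel(2) b_closed by auto
  next
    fix z assume "z \<in> b (inv\<^bsub>L\<^esub> l) -` B \<inter> space N"
    then show "z \<in> b l ` B" using b_inv_cancel(1)[OF l, of z] by (metis IntD1 IntD2 image_eqI vimageD)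
  qed
  show "b l ` B \<in> sets N" unfolding eq by (rule measurable_sets[OF b_measurable B]) (use l in simp)
  show "emeasure N (b l ` B) = emeasure N B" unfolding eq by (rule emeasure_b_vimage) (use l B in auto)
qed

context
  fixes t :: "'y \<Rightarrow> 'l"
  assumes t: "t \<in> measurable N (count_space (carrier L))"
begin

lemma t_closed: "y \<in> space N \<Longrightarrow> t y \<in> carrier L"
  using measurable_space[OF t] by simp

lemma t_fibre: "{y \<in> space N. t y = l} \<in> sets N"
proof -
  have "t -` (carrier L \<inter> {l}) \<inter> space N \<in> sets N" by (rule measurable_sets[OF t]) auto
  also have "t -` (carrier L \<inter> {l}) \<inter> space N = {y \<in> space N. t y = l}" using t_closed by auto
  finally show ?thesis .
qed

lemma piecewise_measurable: "(\<lambda>y. b (t y) y) \<in> measurable N N"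
proof (rule measurableI)
  fix B assume B: "B \<in> sets N"
  have "(\<lambda>y. b (t y) y) -` B \<inter> space N = (\<Union>l\<in>carrier L. {y \<in> space N. t y = l} \<inter> (b l -` B \<inter> space N))"
    using t_closed by auto
  also have "\<dots> \<in> sets N"
    by (intro sets.countable_UN'' countable_L sets.Int t_fibre measurable_sets[OF b_measurable B])
  finally show "(\<lambda>y. b (t y) y) -` B \<inter> space N \<in> sets N" .
qed (use b_closed t_closed in auto)

text \<open>Cut \<open>C\<close> according to the value of \<open>t\<close>. Each piece is moved by
  a single measure preserving element, and injectivity makes the images of the countably many pieces
  disjoint.\<close>

lemma piecewise_image:
  assumes C: "C \<in> sets N" and inj: "inj_on (\<lambda>y. b (t y) y) C"
  shows "(\<lambda>y. b (t y) y) ` C \<in> sets N" "emeasure N ((\<lambda>y. b (t y) y) ` C) = emeasure N C"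
proof -
  define Cl where "Cl l = C \<inter> {y \<in> space N. t y = l}" for l
  have Cl: "Cl l \<in> sets N" for l unfolding Cl_def by (rule sets.Int[OF C t_fibre])
  have CU: "C = (\<Union>l\<in>carrier L. Cl l)" using sets.sets_into_space[OF C] t_closed by (auto simp: Cl_def)
  have img: "(\<lambda>y. b (t y) y) ` C = (\<Union>l\<in>carrier L. b l ` Cl l)"
    by (subst CU) (auto simp: Cl_def image_iff)
  show "(\<lambda>y. b (t y) y) ` C \<in> sets N"
    unfolding img by (intro sets.countable_UN'' countable_L b_image(1) Cl)
  have disj: "disjoint_family_on (\<lambda>l. b l ` Cl l) (carrier L)"
    unfolding disjoint_family_on_def
  proof (intro ballI impI)
    fix l k assume "l \<in> carrier L" "k \<in> carrier L" "l \<noteq> k"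
    show "b l ` Cl l \<inter> b k ` Cl k = {}"
    proof (rule ccontr)
      assume "b l ` Cl l \<inter> b k ` Cl k \<noteq> {}"
      then obtain y z where yz: "y \<in> Cl l" "z \<in> Cl k" "b l y = b k z" by auto
      then have "b (t y) y = b (t z) z" "y \<in> C" "z \<in> C" by (auto simp: Cl_def)
      then have "y = z" using inj by (auto dest: inj_onD)
      then show False using yz \<open>l \<noteq> k\<close> by (auto simp: Cl_def)
    qed
  qed
  have "emeasure N (\<Union>l\<in>carrier L. b l ` Cl l) = (\<integral>\<^sup>+l. emeasure N (b l ` Cl l) \<partial>count_space (carrier L))"
    by (rule emeasure_UN_countable[OF _ countable_L disj]) (rule b_image(1)[OF _ Cl])
  also have "\<dots> = (\<integral>\<^sup>+l. emeasure N (Cl l) \<partial>count_space (carrier L))"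
    by (rule nn_integral_cong) (use b_image(2)[OF _ Cl] in auto)
  also have "\<dots> = emeasure N (\<Union>l\<in>carrier L. Cl l)"
    by (rule emeasure_UN_countable[OF _ countable_L, symmetric]) (auto simp: Cl disjoint_family_on_def, auto simp: Cl_def)
  finally show "emeasure N ((\<lambda>y. b (t y) y) ` C) = emeasure N C" using CU img by simp
qed

text \<open>An injective piecewise translation of a conull set preserves measure, so in a
  probability space its image is conull: surjectivity modulo null sets comes for free, and the
  inverse is measurable because images of measurable sets are.\<close>

lemma piecewise_automorphism:
  assumes Y: "Y \<in> sets N" "AE y in N. y \<in> Y" and inj: "inj_on (\<lambda>y. b (t y) y) Y"
  shows "distr N N (\<lambda>y. b (t y) y) = N"
    and "\<exists>g\<in>measurable N N. distr N N g = N \<and> (AE y in N. g (b (t y) y) = y) \<and> (AE y in N. b (t (g y)) (g y) = y)"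
proof -
  define T where "T y = b (t y) y" for y
  have Tm: "T \<in> measurable N N" unfolding T_def by (rule piecewise_measurable)
  have im: "T ` C \<in> sets N" "emeasure N (T ` C) = emeasure N C" if "C \<in> sets N" "C \<subseteq> Y" for C
    unfolding T_def by (rule piecewise_image[OF that(1) inj_on_subset[OF inj that(2)]])+
  have injT: "inj_on T Y" using inj by (simp add: T_def[abs_def])
  have "emeasure N Y = 1" using Y by (simp add: emeasure_eq_1_AE)
  then have "emeasure N (T ` Y) = 1" using im(2)[OF Y(1)] by simp
  then have TY: "AE y in N. y \<in> T ` Y"
    using AE_in_set_eq_1[OF im(1)[OF Y(1)]] by (simp add: measure_def)
  have e: "emeasure N (A \<inter> T ` Y) = emeasure N A" "emeasure N (A \<inter> Y) = emeasure N A" if "A \<in> sets N" for A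
    using that TY Y im(1)[OF Y(1)] by (auto intro!: emeasure_eq_AE)
  show "distr N N (\<lambda>y. b (t y) y) = N"
    unfolding T_def[symmetric]
  proof (rule measure_eqI)
    fix B assume "B \<in> sets (distr N N T)"
    then have B: "B \<in> sets N" by simp
    note TB = measurable_sets[OF Tm B]
    have "emeasure (distr N N T) B = emeasure N (T -` B \<inter> space N)" by (rule emeasure_distr[OF Tm B])
    also have "\<dots> = emeasure N ((T -` B \<inter> space N) \<inter> Y)" by (rule e(2)[OF TB, symmetric])
    also have "\<dots> = emeasure N (T ` ((T -` B \<inter> space N) \<inter> Y))"
      by (rule im(2)[symmetric]) (use TB Y in auto)
    also have "T ` ((T -` B \<inter> space N) \<inter> Y) = B \<inter> T ` Y" using sets.sets_into_space[OF Y(1)] by auto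
    also have "emeasure N \<dots> = emeasure N B" by (rule e(1)[OF B])
    finally show "emeasure (distr N N T) B = emeasure N B" .
  qed simp
  \<comment> \<open>Off the image, a null set, the identity is an arbitrary measurable
    choice.\<close>
  define g where "g z = (if z \<in> T ` Y then inv_into Y T z else z)" for z
  have gT: "g (T y) = y" if "y \<in> Y" for y using that injT by (simp add: g_def)
  have gv: "g -` C \<inter> space N = T ` (C \<inter> Y) \<union> (C - T ` Y)" if "C \<in> sets N" for C
  proof (rule equalityI; rule subsetI)
    fix z assume z: "z \<in> g -` C \<inter> space N"
    show "z \<in> T ` (C \<inter> Y) \<union> (C - T ` Y)"
    proof (cases "z \<in> T ` Y")
      case True
      then obtain y where "y \<in> Y" "z = T y" by blast
      then show ?thesis using z gT by auto
    next
      case False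
      then show ?thesis using z by (simp add: g_def)
    qed
  next
    fix z assume z: "z \<in> T ` (C \<inter> Y) \<union> (C - T ` Y)"
    then show "z \<in> g -` C \<inter> space N"
    proof
      assume "z \<in> T ` (C \<inter> Y)"
      then obtain y where "y \<in> C" "y \<in> Y" "z = T y" by blast
      then show ?thesis using gT measurable_space[OF Tm] sets.sets_into_space[OF Y(1)] by auto
    next
      assume "z \<in> C - T ` Y"
      then show ?thesis using sets.sets_into_space[OF that] by (auto simp: g_def)
    qed
  qed
  have gs: "T ` (C \<inter> Y) \<union> (C - T ` Y) \<in> sets N" if "C \<in> sets N" for C
    using im(1)[of "C \<inter> Y"] im(1)[OF Y(1)] that Y(1) by auto
  have gm: "g \<in> measurable N N"
  proof (rule measurableI)
    fix z assume "z \<in> space N"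
    then show "g z \<in> space N" using sets.sets_into_space[OF Y(1)] inv_into_into[of z T Y] by (auto simp: g_def)
  qed (use gv gs in auto)
  have "distr N N g = N"
  proof (rule measure_eqI)
    fix C assume "C \<in> sets (distr N N g)"
    then have C: "C \<in> sets N" by simp
    have "emeasure (distr N N g) C = emeasure N (T ` (C \<inter> Y) \<union> (C - T ` Y))"
      using emeasure_distr[OF gm C] gv[OF C] by simp
    also have "\<dots> = emeasure N (T ` (C \<inter> Y))"
      using TY im(1)[of "C \<inter> Y"] C Y(1) gs[OF C] by (intro emeasure_eq_AE) auto
    also have "\<dots> = emeasure N C" using im(2)[of "C \<inter> Y"] e(2)[OF C] C Y(1) by simp
    finally show "emeasure (distr N N g) C = emeasure N C" .
  qed simp
  moreover have "AE y in N. g (T y) = y" using Y(2) by eventually_elim (rule gT)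
  moreover have "AE y in N. T (g y) = y" using TY
  proof eventually_elim
    case (elim y)
    then show ?case using gT by auto
  qed
  ultimately show "\<exists>g\<in>measurable N N. distr N N g = N \<and> (AE y in N. g (b (t y) y) = y) \<and> (AE y in N. b (t (g y)) (g y) = y)"
    using gm unfolding T_def by blast
qed

end


text \<open>
  Enumerate \<open>L\<close> and let step \<open>k\<close> move, by the \<open>k\<close>-th element, all unused points of \<open>A\<close> that it
  sends to unused points of \<open>B\<close>.  What remains of \<open>A\<close> and \<open>B\<close> has equal measure, and no element
  of \<open>L\<close> moves the one rest into the other, so ergodicity makes both null.
\<close>

lemma partial_isomorphism_between:
  assumes A: "A \<in> sets N" and B: "B \<in> sets N" and AB: "emeasure N A = emeasure N B"
    and erg: "\<And>C. \<lbrakk>C \<in> sets N; \<And>l y. \<lbrakk>l \<in> carrier L; y \<in> space N\<rbrakk> \<Longrightarrow> b l y \<in> C \<longleftrightarrow> y \<in> C; emeasure N C \<noteq> 0\<rbrakk>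
      \<Longrightarrow> AE y in N. y \<in> C"
  obtains t A' where "t \<in> measurable N (count_space (carrier L))" "A' \<in> sets N" "A' \<subseteq> A"
    "AE y in N. y \<in> A \<longrightarrow> y \<in> A'" "inj_on (\<lambda>y. b (t y) y) A'" "\<And>y. y \<in> A' \<Longrightarrow> b (t y) y \<in> B"
proof -
  define e where "e = from_nat_into (carrier L)"
  have e: "e k \<in> carrier L" "l \<in> carrier L \<Longrightarrow> \<exists>k. e k = l" for k l
    using from_nat_into[of "carrier L" k] from_nat_into_surj[OF countable_L] L.one_closed
    by (auto simp: e_def)
  define piece where "piece k UV = {y \<in> A - fst UV. b (e k) y \<in> B - snd UV}" for k and UV :: "'y set \<times> 'y set"
  \<comment> \<open>The state is the pair of used parts of \<open>A\<close> and \<open>B\<close>;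
    each step enlarges both by sets of equal measure.\<close>
  define st where "st = rec_nat ({}, {}) (\<lambda>k UV. (fst UV \<union> piece k UV, snd UV \<union> b (e k) ` piece k UV))"
  define U where "U k = fst (st k)" for k
  define V where "V k = snd (st k)" for k
  define Q where "Q k = piece k (st k)" for k
  have st0: "U 0 = {}" "V 0 = {}" by (simp_all add: U_def V_def st_def)
  have stS: "U (Suc k) = U k \<union> Q k" "V (Suc k) = V k \<union> b (e k) ` Q k" for k
    by (simp_all add: U_def V_def st_def Q_def)
  have Q: "Q k = {y \<in> A - U k. b (e k) y \<in> B - V k}" for k
    by (simp add: Q_def piece_def U_def V_def)
  note sA = sets.sets_into_space[OF A]
  have Qm: "Q k \<in> sets N" if "U k \<in> sets N" "V k \<in> sets N" for k
  proof -
    have "(A - U k) \<inter> (b (e k) -` (B - V k) \<inter> space N) \<in> sets N"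
      by (intro sets.Int sets.Diff A that measurable_sets[OF b_measurable[OF e(1)]] B)
    also have "(A - U k) \<inter> (b (e k) -` (B - V k) \<inter> space N) = Q k" using sA by (auto simp: Q)
    finally show ?thesis .
  qed
  have UV: "U k \<in> sets N \<and> V k \<in> sets N \<and> U k \<subseteq> A \<and> V k \<subseteq> B \<and> emeasure N (U k) = emeasure N (V k)" for k
  proof (induction k)
    case 0
    show ?case by (simp add: st0)
  next
    case (Suc k)
    then have s: "U k \<in> sets N" "V k \<in> sets N" by auto
    note im = b_image[OF e(1)[of k] Qm[OF s]]
    have "emeasure N (U k \<union> Q k) = emeasure N (U k) + emeasure N (Q k)"
      by (rule plus_emeasure[symmetric]) (use s Qm[OF s] in \<open>auto simp: Q\<close>)
    moreover have "emeasure N (V k \<union> b (e k) ` Q k) = emeasure N (V k) + emeasure N (b (e k) ` Q k)"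
      by (rule plus_emeasure[symmetric]) (use s im in \<open>auto simp: Q\<close>)
    ultimately show ?case using Suc s Qm[OF s] im unfolding stS by (auto simp: Q)
  qed
  have Qs: "Q k \<in> sets N" for k using Qm UV by blast
  have Umono: "j \<le> k \<Longrightarrow> U j \<subseteq> U k" and Vmono: "j \<le> k \<Longrightarrow> V j \<subseteq> V k" for j k
    by (rule lift_Suc_mono_le[of _ j k]; auto simp: stS)+
  define A' where "A' = (\<Union>k. U k)"
  define B' where "B' = (\<Union>k. V k)"
  have A'Q: "A' = (\<Union>k. Q k)"
  proof -
    have "U k \<subseteq> (\<Union>k. Q k)" for k by (induction k) (auto simp: st0 stS)
    moreover have "Q k \<subseteq> U (Suc k)" for k by (simp add: stS)
    ultimately show ?thesis unfolding A'_def by blast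
  qed
  have sets': "A' \<in> sets N" "B' \<in> sets N" unfolding A'_def B'_def using UV by blast+
  have sub: "A' \<subseteq> A" "B' \<subseteq> B" unfolding A'_def B'_def using UV by blast+
  have meas: "emeasure N A' = emeasure N B'"
  proof -
    have "emeasure N A' = (SUP k. emeasure N (U k))"
      unfolding A'_def by (rule SUP_emeasure_incseq[symmetric]) (use UV Umono in \<open>auto simp: incseq_def\<close>)
    also have "\<dots> = (SUP k. emeasure N (V k))" using UV by simp
    also have "\<dots> = emeasure N B'"
      unfolding B'_def by (rule SUP_emeasure_incseq) (use UV Vmono in \<open>auto simp: incseq_def\<close>)
    finally show ?thesis .
  qed
  have null: "emeasure N (A - A') = 0"
  proof (rule ccontr)
    assume nz: "emeasure N (A - A') \<noteq> 0"
    have "emeasure N (A - A') = emeasure N A - emeasure N A'"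
      by (rule emeasure_Diff) (use sets' A sub in auto)
    also have "\<dots> = emeasure N B - emeasure N B'" using AB meas by simp
    also have "\<dots> = emeasure N (B - B')"
      by (rule emeasure_Diff[symmetric]) (use sets' B sub in auto)
    finally have nzB: "emeasure N (B - B') \<noteq> 0" using nz by simp
    define C where "C = (\<Union>l\<in>carrier L. b l -` (B - B') \<inter> space N)"
    have C: "C \<in> sets N" unfolding C_def
      by (intro sets.countable_UN'' countable_L measurable_sets[OF b_measurable] sets.Diff B sets')
    have Cinv: "b k y \<in> C \<longleftrightarrow> y \<in> C" if k: "k \<in> carrier L" and y: "y \<in> space N" for k y
    proof -
      have 1: "\<exists>l\<in>carrier L. b l y \<in> B - B'" if "l \<in> carrier L" "b l (b k y) \<in> B - B'" for l
        using that k y b_mult[of l k y] by (intro bexI[of _ "l \<otimes>\<^bsub>L\<^esub> k"]) auto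
      have 2: "\<exists>l\<in>carrier L. b l (b k y) \<in> B - B'" if "l \<in> carrier L" "b l y \<in> B - B'" for l
        using that k y b_mult[of "l \<otimes>\<^bsub>L\<^esub> inv\<^bsub>L\<^esub> k" k y]
        by (intro bexI[of _ "l \<otimes>\<^bsub>L\<^esub> inv\<^bsub>L\<^esub> k"]) (auto simp: L.m_assoc)
      have memC: "z \<in> C \<longleftrightarrow> (\<exists>l\<in>carrier L. b l z \<in> B - B')" if "z \<in> space N" for z
        using that by (auto simp: C_def)
      show ?thesis unfolding memC[OF y] memC[OF b_closed[OF k y]] using 1 2 by blast
    qed
    have "B - B' \<subseteq> C"
    proof
      fix y assume y: "y \<in> B - B'"
      then have "y \<in> space N" using sets.sets_into_space[OF B] by blast
      then show "y \<in> C" using y b_one[of y] L.one_closed by (auto simp: C_def intro!: bexI[of _ "\<one>\<^bsub>L\<^esub>"])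
    qed
    then have "emeasure N C \<noteq> 0" using emeasure_mono[OF _ C] nzB by (metis le_zero_eq)
    then have AEC: "AE y in N. y \<in> C" using erg[OF C Cinv] by blast
    have "C \<inter> (A - A') = {}"
    proof (rule ccontr)
      assume "C \<inter> (A - A') \<noteq> {}"
      then obtain y l where y: "y \<in> A" "y \<notin> A'" "l \<in> carrier L" "b l y \<in> B" "b l y \<notin> B'"
        by (auto simp: C_def)
      obtain k where "e k = l" using e(2)[OF y(3)] by blast
      then have "y \<in> Q k" using y by (auto simp: Q A'_def B'_def)
      then show False using y(2) A'Q by blast
    qed
    then have "AE y in N. y \<notin> A - A'" using AEC by (auto elim: AE_mp)
    then show False using nz AE_iff_null_sets[of "A - A'" N] A sets' by auto
  qed
  define \<kappa> where "\<kappa> y = (LEAST k. y \<in> Q k)" for y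
  have \<kappa>: "y \<in> Q (\<kappa> y)" if "y \<in> A'" for y
    using that unfolding A'Q \<kappa>_def by (auto intro: LeastI)
  define t where "t y = (if y \<in> A' then e (\<kappa> y) else \<one>\<^bsub>L\<^esub>)" for y
  have "t \<in> measurable N (count_space (carrier L))"
    unfolding t_def
  proof (rule measurable_If)
    have \<kappa>m: "\<kappa> \<in> measurable N (count_space UNIV)"
      unfolding \<kappa>_def by (rule measurable_Least) (use Qs in \<open>simp add: pred_def sets.Int_space_eq2 Int_def\<close>)
    show "(\<lambda>y. e (\<kappa> y)) \<in> measurable N (count_space (carrier L))"
      by (rule measurable_compose[OF \<kappa>m]) (use e(1) in auto)
    show "{y \<in> space N. y \<in> A'} \<in> sets N" using sets'(1) by simp
  qed simp
  moreover have "inj_on (\<lambda>y. b (t y) y) A'"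
  proof (rule inj_onI)
    fix y z assume y: "y \<in> A'" and z: "z \<in> A'" and eq: "b (t y) y = b (t z) z"
    \<comment> \<open>The image of a point lies in the layer of \<open>B'\<close> added at its own
      step; layers of different steps are disjoint, so equal images force equal steps.\<close>
    have img: "b (e (\<kappa> x)) x \<in> V (Suc (\<kappa> x)) - V (\<kappa> x)" if "x \<in> A'" for x
      using \<kappa>[OF that] by (auto simp: stS) (auto simp: Q)
    have eq': "b (e (\<kappa> y)) y = b (e (\<kappa> z)) z" using eq y z by (simp add: t_def)
    have "\<kappa> y = \<kappa> z"
    proof (rule ccontr)
      assume "\<kappa> y \<noteq> \<kappa> z"
      then consider "Suc (\<kappa> y) \<le> \<kappa> z" | "Suc (\<kappa> z) \<le> \<kappa> y" by linarith
      then show False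
        using img[OF y] img[OF z] eq' Vmono by cases (metis DiffD1 DiffD2 subsetD)+
    qed
    then show "y = z" using eq' b_inj[OF e(1), of y z] y z sub(1) sA by auto
  qed
  moreover have "b (t y) y \<in> B" if y: "y \<in> A'" for y
    using \<kappa>[OF y] y by (auto simp: t_def Q)
  moreover have "AE y in N. y \<in> A \<longrightarrow> y \<in> A'"
  proof -
    have "A - A' \<in> null_sets N" using null A sets' by (auto intro: null_setsI)
    then have "AE y in N. y \<notin> A - A'" by (rule AE_not_in)
    then show ?thesis by eventually_elim auto
  qed
  ultimately show thesis using that sets'(1) sub(1) by blast
qed

end

subsection \<open>Orbit equivalence\<close>

locale orbit_equivalent_actions =
  fixes \<Gamma> :: "'g monoid" and \<Gamma>\<^sub>0 :: "'g set" and \<mu> :: "'x measure" and \<alpha> :: "'g \<Rightarrow> 'x \<Rightarrow> 'x"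
    and \<Lambda> :: "'l monoid" and \<nu> :: "'y measure" and \<beta> :: "'l \<Rightarrow> 'y \<Rightarrow> 'y"
    and P :: "nat \<Rightarrow> nat measure" and c q and Z :: "(nat \<Rightarrow> nat) measure"
    and f :: "'x \<Rightarrow> nat \<Rightarrow> nat" and f' and \<theta> :: "'x \<Rightarrow> 'y" and \<theta>'
  assumes group_\<Gamma>: "Group.group \<Gamma>" and countable_\<Gamma>: "countable (carrier \<Gamma>)" and normal_\<Gamma>\<^sub>0: "\<Gamma>\<^sub>0 \<lhd> \<Gamma>"
    and mp_\<alpha>: "mp_action \<Gamma> \<mu> \<alpha>" and free_\<alpha>: "free_action \<Gamma> \<mu> \<alpha>"
    and ergodic_\<alpha>: "ergodic_action (\<Gamma>\<lparr>carrier := \<Gamma>\<^sub>0\<rparr>) \<mu> \<alpha>"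
    and group_\<Lambda>: "Group.group \<Lambda>" and countable_\<Lambda>: "countable (carrier \<Lambda>)"
    and mp_\<beta>: "mp_action \<Lambda> \<nu> \<beta>" and free_\<beta>: "free_action \<Lambda> \<nu> \<beta>" and ergodic_\<beta>: "ergodic_action \<Lambda> \<nu> \<beta>"
    and inverse_system: "inverse_system \<Gamma> P c q" and inverse_limit: "inverse_limit_measure P q Z"
    and mp_f: "mp_map \<mu> Z f" and mp_f': "mp_map Z \<mu> f'" and f'_f: "AE x in \<mu>. f' (f x) = x"
    and f_equivariant: "g \<in> carrier \<Gamma> \<Longrightarrow> AE x in \<mu>. f (\<alpha> g x) = (\<lambda>n. c n g (f x n))"
    and mp_\<theta>: "mp_map \<mu> \<nu> \<theta>" and mp_\<theta>': "mp_map \<nu> \<mu> \<theta>'"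
    and \<theta>'_\<theta>: "AE x in \<mu>. \<theta>' (\<theta> x) = x" and \<theta>_\<theta>': "AE y in \<nu>. \<theta> (\<theta>' y) = y"
    and \<theta>_orbit: "AE x in \<mu>. \<theta> ` orbit \<Gamma> \<alpha> x = orbit \<Lambda> \<beta> (\<theta> x)"
begin

interpretation \<Gamma>: Group.group \<Gamma> by (rule group_\<Gamma>)
interpretation \<Lambda>: Group.group \<Lambda> by (rule group_\<Lambda>)
interpretation A: group_action \<Gamma> "space \<mu>" \<alpha> using mp_\<alpha> by (simp add: mp_action_def)
interpretation B: group_action \<Lambda> "space \<nu>" \<beta> using mp_\<beta> by (simp add: mp_action_def)

lemma prob_\<mu>: "prob_space \<mu>" and prob_\<nu>: "prob_space \<nu>"
  using mp_\<alpha> mp_\<beta> by (simp_all add: mp_action_def)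

lemma mp_\<alpha>_map: "g \<in> carrier \<Gamma> \<Longrightarrow> mp_map \<mu> \<mu> (\<alpha> g)"
  and mp_\<beta>_map: "l \<in> carrier \<Lambda> \<Longrightarrow> mp_map \<nu> \<nu> (\<beta> l)"
  using mp_\<alpha> mp_\<beta> by (simp_all add: mp_action_def)

lemma \<alpha>_mult: "\<lbrakk>g \<in> carrier \<Gamma>; h \<in> carrier \<Gamma>; x \<in> space \<mu>\<rbrakk> \<Longrightarrow> \<alpha> (g \<otimes>\<^bsub>\<Gamma>\<^esub> h) x = \<alpha> g (\<alpha> h x)"
  using A.composition_rule by blast

lemma \<alpha>_one: "x \<in> space \<mu> \<Longrightarrow> \<alpha> \<one>\<^bsub>\<Gamma>\<^esub> x = x"
  using A.id_eq_one by (metis restrict_apply')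

lemma \<alpha>_closed: "\<lbrakk>g \<in> carrier \<Gamma>; x \<in> space \<mu>\<rbrakk> \<Longrightarrow> \<alpha> g x \<in> space \<mu>"
  using A.element_image by blast

lemma \<alpha>_inv_cancel: "\<lbrakk>g \<in> carrier \<Gamma>; x \<in> space \<mu>\<rbrakk> \<Longrightarrow> \<alpha> (inv\<^bsub>\<Gamma>\<^esub> g) (\<alpha> g x) = x"
  using \<alpha>_mult[of "inv\<^bsub>\<Gamma>\<^esub> g" g x] \<alpha>_one[of x] by simp

text \<open>\<open>mp_map\<close> makes maps measurable only from a completed source. Passing to the
  completion on both sides gives the strict measurability that the locale asks for.\<close>

sublocale Y: countable_mp_action \<Lambda> "completion \<nu>" \<beta>
proof (rule countable_mp_action.intro)
  show "\<beta> (l \<otimes>\<^bsub>\<Lambda>\<^esub> k) y = \<beta> l (\<beta> k y)"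
    if "l \<in> carrier \<Lambda>" "k \<in> carrier \<Lambda>" "y \<in> space (completion \<nu>)" for l k y
    using B.composition_rule that by simp
  show "\<beta> \<one>\<^bsub>\<Lambda>\<^esub> y = y" if "y \<in> space (completion \<nu>)" for y
    using B.id_eq_one that by (metis restrict_apply' space_completion)
  show "Group.group \<Lambda>" "countable (carrier \<Lambda>)" "prob_space (completion \<nu>)"
    by (rule group_\<Lambda> countable_\<Lambda> prob_space_completion[OF prob_\<nu>])+
  show "\<beta> l \<in> measurable (completion \<nu>) (completion \<nu>)"
    "distr (completion \<nu>) (completion \<nu>) (\<beta> l) = completion \<nu>" if "l \<in> carrier \<Lambda>" for l
    by (rule mp_map_completion[OF mp_\<beta>_map[OF that]])+
qed

definition good where
  "good x \<longleftrightarrow> x \<in> space \<mu> \<and> f' (f x) = x \<and> f x \<in> space Z \<and>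
     (\<forall>g\<in>carrier \<Gamma>. f (\<alpha> g x) = (\<lambda>n. c n g (f x n))) \<and> \<theta> x \<in> space \<nu> \<and>
     \<theta>' (\<theta> x) = x \<and> \<theta> ` orbit \<Gamma> \<alpha> x = orbit \<Lambda> \<beta> (\<theta> x) \<and>
     (\<forall>l\<in>carrier \<Lambda>. l \<noteq> \<one>\<^bsub>\<Lambda>\<^esub> \<longrightarrow> \<beta> l (\<theta> x) \<noteq> \<theta> x) \<and> (\<forall>g\<in>carrier \<Gamma>. g \<noteq> \<one>\<^bsub>\<Gamma>\<^esub> \<longrightarrow> \<alpha> g x \<noteq> x)"

lemma AE_good: "AE x in \<mu>. good x"
proof -
  have 1: "AE x in \<mu>. \<forall>g\<in>carrier \<Gamma>. f (\<alpha> g x) = (\<lambda>n. c n g (f x n))"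
    using f_equivariant countable_\<Gamma> by (subst AE_ball_countable) auto
  have 2: "AE x in \<mu>. \<forall>g\<in>carrier \<Gamma>. g \<noteq> \<one>\<^bsub>\<Gamma>\<^esub> \<longrightarrow> \<alpha> g x \<noteq> x"
    using free_\<alpha> countable_\<Gamma> by (subst AE_ball_countable) (auto simp: free_action_def)
  have "AE y in \<nu>. \<forall>l\<in>carrier \<Lambda>. l \<noteq> \<one>\<^bsub>\<Lambda>\<^esub> \<longrightarrow> \<beta> l y \<noteq> y"
    using free_\<beta> countable_\<Lambda> by (subst AE_ball_countable) (auto simp: free_action_def)
  then have 3: "AE x in \<mu>. \<forall>l\<in>carrier \<Lambda>. l \<noteq> \<one>\<^bsub>\<Lambda>\<^esub> \<longrightarrow> \<beta> l (\<theta> x) \<noteq> \<theta> x"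
    by (rule mp_map_AE[OF mp_\<theta>])
  show ?thesis using 1 2 3 f'_f \<theta>'_\<theta> \<theta>_orbit AE_space
  proof eventually_elim
    case (elim x)
    then show ?case using mp_map_space[OF mp_f, of x] mp_map_space[OF mp_\<theta>, of x] by (simp add: good_def)
  qed
qed

text \<open>Demanding \<open>good\<close> along the whole orbit makes the set exactly invariant, and
  countability of \<open>\<Gamma>\<close> keeps it conull.\<close>

definition X\<^sub>0 where "X\<^sub>0 = {x \<in> space \<mu>. \<forall>g\<in>carrier \<Gamma>. good (\<alpha> g x)}"

lemma AE_X\<^sub>0: "AE x in \<mu>. x \<in> X\<^sub>0"
proof -
  have "AE x in \<mu>. \<forall>g\<in>carrier \<Gamma>. good (\<alpha> g x)"
    using mp_map_AE[OF mp_\<alpha>_map AE_good] countable_\<Gamma> by (subst AE_ball_countable) auto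
  then show ?thesis using AE_space by eventually_elim (simp add: X\<^sub>0_def)
qed

lemma X\<^sub>0_sets: "X\<^sub>0 \<in> sets (completion \<mu>)"
  using AE_completion_sets[OF AE_X\<^sub>0] by (simp add: X\<^sub>0_def)

lemma X\<^sub>0_space: "x \<in> X\<^sub>0 \<Longrightarrow> x \<in> space \<mu>"
  by (simp add: X\<^sub>0_def)

lemma X\<^sub>0_good: "x \<in> X\<^sub>0 \<Longrightarrow> good x"
  using \<alpha>_one[of x] \<Gamma>.one_closed by (force simp: X\<^sub>0_def)

lemma X\<^sub>0_invariant:
  assumes g: "g \<in> carrier \<Gamma>" and x: "x \<in> space \<mu>"
  shows "\<alpha> g x \<in> X\<^sub>0 \<longleftrightarrow> x \<in> X\<^sub>0"
proof
  assume a: "x \<in> X\<^sub>0"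
  have "good (\<alpha> h (\<alpha> g x))" if h: "h \<in> carrier \<Gamma>" for h
    using a \<alpha>_mult[OF h g x] h g by (simp add: X\<^sub>0_def flip: \<alpha>_mult)
  then show "\<alpha> g x \<in> X\<^sub>0" using \<alpha>_closed[OF g x] by (simp add: X\<^sub>0_def)
next
  assume a: "\<alpha> g x \<in> X\<^sub>0"
  have "good (\<alpha> h x)" if h: "h \<in> carrier \<Gamma>" for h
  proof -
    have "good (\<alpha> (h \<otimes>\<^bsub>\<Gamma>\<^esub> inv\<^bsub>\<Gamma>\<^esub> g) (\<alpha> g x))" using a h g by (simp add: X\<^sub>0_def)
    then show ?thesis using \<alpha>_mult[of h "inv\<^bsub>\<Gamma>\<^esub> g" "\<alpha> g x"] \<alpha>_inv_cancel[OF g x] \<alpha>_closed[OF g x] h g by simp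
  qed
  then show "x \<in> X\<^sub>0" using x by (simp add: X\<^sub>0_def)
qed

text \<open>
  On the conull, exactly invariant set \<open>X\<^sub>0\<close> all almost everywhere identities hold pointwise, so the
  restriction to it satisfies the pointwise axioms of \<open>profinite_cocycle\<close>.
\<close>

definition M where "M = restrict_space (completion \<mu>) X\<^sub>0"

lemma space_M: "space M = X\<^sub>0"
  using X\<^sub>0_space by (auto simp: M_def space_restrict_space)

lemma X\<^sub>0_Int: "X\<^sub>0 \<inter> space (completion \<mu>) \<in> sets (completion \<mu>)"
proof -
  have "X\<^sub>0 \<inter> space (completion \<mu>) = X\<^sub>0" using X\<^sub>0_space by auto
  then show ?thesis using X\<^sub>0_sets by simp
qed

lemma sets_M: "A \<in> sets M \<longleftrightarrow> A \<subseteq> X\<^sub>0 \<and> A \<in> sets (completion \<mu>)"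
  unfolding M_def by (rule sets_restrict_space_iff[OF X\<^sub>0_Int])

lemma emeasure_M: "A \<subseteq> X\<^sub>0 \<Longrightarrow> emeasure M A = emeasure (completion \<mu>) A"
  unfolding M_def by (rule emeasure_restrict_space[OF X\<^sub>0_Int])

lemma AE_M: "(AE x in M. p x) \<longleftrightarrow> (AE x in \<mu>. p x)"
proof -
  have "(AE x in M. p x) \<longleftrightarrow> (AE x in \<mu>. x \<in> X\<^sub>0 \<longrightarrow> p x)"
    unfolding M_def AE_restrict_space_iff[OF X\<^sub>0_Int] AE_completion_iff ..
  also have "\<dots> \<longleftrightarrow> (AE x in \<mu>. p x)"
  proof
    assume "AE x in \<mu>. x \<in> X\<^sub>0 \<longrightarrow> p x"
    then show "AE x in \<mu>. p x" using AE_X\<^sub>0 by eventually_elim simp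
  qed (auto elim: AE_mp)
  finally show ?thesis .
qed

text \<open>The orbit cocycle. On \<open>X\<^sub>0\<close> the description is proper: existence is
  the orbit equivalence, and uniqueness the freeness of \<open>\<Lambda>\<close> at
  \<open>\<theta> x\<close>.\<close>

definition w where "w g x = (THE l. l \<in> carrier \<Lambda> \<and> \<theta> (\<alpha> g x) = \<beta> l (\<theta> x))"

lemma \<beta>_free:
  assumes x: "x \<in> X\<^sub>0" and l: "l \<in> carrier \<Lambda>" and k: "k \<in> carrier \<Lambda>" and eq: "\<beta> l (\<theta> x) = \<beta> k (\<theta> x)"
  shows "l = k"
proof (rule ccontr)
  assume "l \<noteq> k"
  then have ne: "inv\<^bsub>\<Lambda>\<^esub> k \<otimes>\<^bsub>\<Lambda>\<^esub> l \<noteq> \<one>\<^bsub>\<Lambda>\<^esub>" using l k by (metis \<Lambda>.inv_closed \<Lambda>.inv_equality \<Lambda>.inv_inv)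
  note xg = X\<^sub>0_good[OF x]
  have y: "\<theta> x \<in> space (completion \<nu>)" using xg by (simp add: good_def)
  have "\<beta> (inv\<^bsub>\<Lambda>\<^esub> k \<otimes>\<^bsub>\<Lambda>\<^esub> l) (\<theta> x) = \<theta> x"
    using Y.b_mult[of "inv\<^bsub>\<Lambda>\<^esub> k" l, OF _ l y] Y.b_inv_cancel(2)[OF k y] eq k by simp
  then show False using xg ne l k by (simp add: good_def)
qed

lemma w:
  assumes g: "g \<in> carrier \<Gamma>" and x: "x \<in> X\<^sub>0"
  shows "w g x \<in> carrier \<Lambda>" "\<theta> (\<alpha> g x) = \<beta> (w g x) (\<theta> x)"
proof -
  have "\<theta> (\<alpha> g x) \<in> \<theta> ` orbit \<Gamma> \<alpha> x" using g by (auto simp: orbit_def)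
  then have "\<theta> (\<alpha> g x) \<in> orbit \<Lambda> \<beta> (\<theta> x)" using X\<^sub>0_good[OF x] by (simp add: good_def)
  then obtain l where l: "l \<in> carrier \<Lambda>" "\<theta> (\<alpha> g x) = \<beta> l (\<theta> x)" by (auto simp: orbit_def)
  have "w g x = l" unfolding w_def
    by (rule the_equality) (use l \<beta>_free[OF x] in auto)
  then show "w g x \<in> carrier \<Lambda>" "\<theta> (\<alpha> g x) = \<beta> (w g x) (\<theta> x)" using l by auto
qed

lemma w_eq_iff:
  assumes "g \<in> carrier \<Gamma>" "x \<in> X\<^sub>0" "l \<in> carrier \<Lambda>"
  shows "w g x = l \<longleftrightarrow> \<theta> (\<alpha> g x) = \<beta> l (\<theta> x)"
  using w[OF assms(1,2)] \<beta>_free[OF assms(2) w(1)[OF assms(1,2)] assms(3)] by auto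

lemma w_mult:
  assumes g: "g \<in> carrier \<Gamma>" and h: "h \<in> carrier \<Gamma>" and x: "x \<in> X\<^sub>0"
  shows "w (g \<otimes>\<^bsub>\<Gamma>\<^esub> h) x = w g (\<alpha> h x) \<otimes>\<^bsub>\<Lambda>\<^esub> w h x"
proof -
  note xs = X\<^sub>0_space[OF x]
  have hx: "\<alpha> h x \<in> X\<^sub>0" using X\<^sub>0_invariant[OF h xs] x by simp
  have y: "\<theta> x \<in> space (completion \<nu>)" using X\<^sub>0_good[OF x] by (simp add: good_def)
  have "\<theta> (\<alpha> (g \<otimes>\<^bsub>\<Gamma>\<^esub> h) x) = \<beta> (w g (\<alpha> h x) \<otimes>\<^bsub>\<Lambda>\<^esub> w h x) (\<theta> x)"
    using \<alpha>_mult[OF g h xs] w(2)[OF g hx] w(2)[OF h x] Y.b_mult[OF w(1)[OF g hx] w(1)[OF h x] y] by simp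
  then show ?thesis
    using w_eq_iff[of "g \<otimes>\<^bsub>\<Gamma>\<^esub> h" x "w g (\<alpha> h x) \<otimes>\<^bsub>\<Lambda>\<^esub> w h x"] g h x w(1)[OF g hx] w(1)[OF h x] by simp
qed

lemma sets_P: "sets (P n) = Pow (space (P n))"
  using inverse_system by (simp add: inverse_system_def)

lemma coordinate_measurable: "(\<lambda>z. z n) \<in> measurable (completion Z) (count_space UNIV)"
proof -
  have "(\<lambda>z. z n) \<in> measurable (completion Z) (P n)"
    using inverse_limit by (simp add: inverse_limit_measure_def mp_map_def)
  moreover have "(\<lambda>k. k) \<in> measurable (P n) (count_space UNIV)"
    by (rule measurableI) (auto simp: sets_P)
  ultimately show ?thesis by (rule measurable_compose)
qed

lemma f_coordinate_measurable: "(\<lambda>x. f x n) \<in> measurable (completion \<mu>) (count_space UNIV)"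
  by (rule measurable_compose[OF mp_map_completion(1)[OF mp_f] coordinate_measurable])

lemma f_inj: "\<lbrakk>x \<in> X\<^sub>0; y \<in> X\<^sub>0; f x = f y\<rbrakk> \<Longrightarrow> x = y"
  using X\<^sub>0_good[of x] X\<^sub>0_good[of y] unfolding good_def by metis

text \<open>Equality of two points is not a measurable condition in an abstract measure space. Here
  both points are images under \<open>\<theta>\<close> of points of \<open>X\<^sub>0\<close>, where
  \<open>\<theta>\<close> and \<open>f\<close> are injective, so equality can be tested on countably
  many coordinates in the natural numbers.\<close>

lemma w_fibre: 
  assumes g: "g \<in> carrier \<Gamma>" and l: "l \<in> carrier \<Lambda>"
  shows "{x \<in> X\<^sub>0. w g x = l} \<in> sets (completion \<mu>)"
proof -
  have eq: "w g x = l \<longleftrightarrow> (\<forall>n. f (\<alpha> g x) n = f (\<theta>' (\<beta> l (\<theta> x))) n)" if x: "x \<in> X\<^sub>0" for x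
  proof -
    note xs = X\<^sub>0_space[OF x] and xg = X\<^sub>0_good[OF x]
    have gx: "\<alpha> g x \<in> X\<^sub>0" using X\<^sub>0_invariant[OF g xs] x by simp
    have "\<beta> l (\<theta> x) \<in> \<theta> ` orbit \<Gamma> \<alpha> x" using xg l by (auto simp: good_def orbit_def)
    then obtain h where h: "h \<in> carrier \<Gamma>" "\<beta> l (\<theta> x) = \<theta> (\<alpha> h x)" by (auto simp: orbit_def)
    have hx: "\<alpha> h x \<in> X\<^sub>0" using X\<^sub>0_invariant[OF h(1) xs] x by simp
    have \<theta>': "\<theta>' (\<theta> y) = y" if "y \<in> X\<^sub>0" for y using X\<^sub>0_good[OF that] by (simp add: good_def)
    have "w g x = l \<longleftrightarrow> \<theta> (\<alpha> g x) = \<theta> (\<alpha> h x)" using w_eq_iff[OF g x l] h(2) by simp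
    also have "\<dots> \<longleftrightarrow> \<alpha> g x = \<alpha> h x" using \<theta>'[OF gx] \<theta>'[OF hx] by metis
    also have "\<dots> \<longleftrightarrow> f (\<alpha> g x) = f (\<alpha> h x)" using f_inj[OF gx hx] by auto
    finally show ?thesis using h(2) \<theta>'[OF hx] by (simp add: fun_eq_iff)
  qed
  have m1: "(\<lambda>x. f (\<alpha> g x) n) \<in> measurable (completion \<mu>) (count_space UNIV)" for n
    by (rule measurable_compose[OF mp_map_completion(1)[OF mp_\<alpha>_map[OF g]] f_coordinate_measurable])
  have m2: "(\<lambda>x. f (\<theta>' (\<beta> l (\<theta> x))) n) \<in> measurable (completion \<mu>) (count_space UNIV)" for n
    by (rule measurable_compose[OF mp_map_completion(1)[OF mp_\<theta>]
      measurable_compose[OF mp_map_completion(1)[OF mp_\<beta>_map[OF l]]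
      measurable_compose[OF mp_map_completion(1)[OF mp_\<theta>'] f_coordinate_measurable]]])
  have "{x \<in> space (completion \<mu>). \<forall>n. f (\<alpha> g x) n = f (\<theta>' (\<beta> l (\<theta> x))) n} \<in> sets (completion \<mu>)"
    by (rule sets.sets_Collect_countable_All) (rule sets_eq_count_space[OF m1 m2 countableI_type])
  then have "X\<^sub>0 \<inter> {x \<in> space (completion \<mu>). \<forall>n. f (\<alpha> g x) n = f (\<theta>' (\<beta> l (\<theta> x))) n} \<in> sets (completion \<mu>)"
    by (rule sets.Int[OF X\<^sub>0_sets])
  also have "X\<^sub>0 \<inter> {x \<in> space (completion \<mu>). \<forall>n. f (\<alpha> g x) n = f (\<theta>' (\<beta> l (\<theta> x))) n} = {x \<in> X\<^sub>0. w g x = l}"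
    using eq X\<^sub>0_space by auto
  finally show ?thesis .
qed

text \<open>Ergodicity is given for sets of \<open>\<mu>\<close> that are invariant almost
  everywhere; the main part translates from the completion and loses only the exactness of the
  invariance.\<close>

lemma ergodic_M:
  assumes B: "B \<in> sets M" and inv: "\<And>h x. \<lbrakk>h \<in> \<Gamma>\<^sub>0; x \<in> X\<^sub>0\<rbrakk> \<Longrightarrow> \<alpha> h x \<in> B \<longleftrightarrow> x \<in> B"
    and nz: "emeasure M B \<noteq> 0"
  shows "AE x in M. x \<in> B"
proof -
  interpret N: normal \<Gamma>\<^sub>0 \<Gamma> by (rule normal_\<Gamma>\<^sub>0)
  have Bc: "B \<in> sets (completion \<mu>)" "B \<subseteq> X\<^sub>0" using B sets_M by auto
  define A where "A = main_part \<mu> B"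
  have A: "A \<in> sets \<mu>" using Bc by (simp add: A_def)
  have AB: "AE x in \<mu>. x \<in> A \<longleftrightarrow> x \<in> B" unfolding A_def by (rule AE_in_main_part[OF Bc(1)])
  have "invariant_set (\<Gamma>\<lparr>carrier := \<Gamma>\<^sub>0\<rparr>) \<mu> \<alpha> A"
    unfolding invariant_set_def
  proof
    fix g assume "g \<in> carrier (\<Gamma>\<lparr>carrier := \<Gamma>\<^sub>0\<rparr>)"
    then have g: "g \<in> \<Gamma>\<^sub>0" "g \<in> carrier \<Gamma>" using N.subset by auto
    show "AE x in \<mu>. \<alpha> g x \<in> A \<longleftrightarrow> x \<in> A"
      using AB mp_map_AE[OF mp_\<alpha>_map[OF g(2)] AB] AE_X\<^sub>0
      by eventually_elim (use inv[OF g(1)] in simp)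
  qed
  moreover have "emeasure \<mu> A \<noteq> 0" using nz emeasure_M[OF Bc(2)] Bc(1) by (simp add: A_def)
  ultimately have "emeasure \<mu> (space \<mu> - A) = 0" using ergodic_\<alpha> A by (auto simp: ergodic_action_def)
  then have "space \<mu> - A \<in> null_sets \<mu>" using A by auto
  then have "AE x in \<mu>. x \<notin> space \<mu> - A" by (rule AE_not_in)
  then have "AE x in \<mu>. x \<in> B" using AB AE_space by eventually_elim auto
  then show ?thesis by (simp add: AE_M)
qed

text \<open>Transport \<open>W\<close> to the inverse limit by \<open>f'\<close>, approximate it
  there by a cylinder, and pull back by \<open>f\<close>; the cylinder becomes a condition on one
  coordinate of \<open>f x\<close>.\<close>

lemma levels_generate:
  assumes W: "W \<in> sets M" and e: "e > 0"
  shows "\<exists>n U. measure M {x \<in> X\<^sub>0. (x \<in> W) \<noteq> (f x n \<in> U)} < e"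
proof -
  have Wc: "W \<in> sets (completion \<mu>)" "W \<subseteq> X\<^sub>0" using W sets_M by auto
  define V where "V = f' -` W \<inter> space Z"
  have V: "V \<in> sets (completion Z)"
    using measurable_sets[OF mp_map_completion(1)[OF mp_f'] Wc(1)] by (simp add: V_def)
  obtain n U where U: "measure Z {z \<in> space Z. (z \<in> main_part Z V) \<noteq> (z n \<in> U)} < e"
    using inverse_limit_cylinder_approximation[OF inverse_limit sets_P _ e, of "main_part Z V"] V by auto
  define D where "D = {z \<in> space Z. (z \<in> main_part Z V) \<noteq> (z n \<in> U)}"
  have D: "D \<in> sets (completion Z)"
  proof -
    have "{z \<in> space Z. z n \<in> U} \<in> sets (completion Z)"
      using measurable_sets[OF coordinate_measurable[of n], of U] by (simp add: vimage_def Int_def conj_commute)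
    then have "(main_part Z V - {z \<in> space Z. z n \<in> U}) \<union> ({z \<in> space Z. z n \<in> U} - main_part Z V) \<in> sets (completion Z)"
      using V by (intro sets.Un sets.Diff) auto
    also have "(main_part Z V - {z \<in> space Z. z n \<in> U}) \<union> ({z \<in> space Z. z n \<in> U} - main_part Z V) = D"
      using sets.sets_into_space[OF main_part_sets[OF V]] by (auto simp: D_def)
    finally show ?thesis .
  qed
  let ?E = "{x \<in> X\<^sub>0. (x \<in> W) \<noteq> (f x n \<in> U)}"
  have fD: "f -` D \<inter> space \<mu> \<in> sets (completion \<mu>)"
    using measurable_sets[OF mp_map_completion(1)[OF mp_f] D] by simp
  have ae: "AE x in \<mu>. x \<in> ?E \<longleftrightarrow> x \<in> f -` D \<inter> space \<mu>"
    using mp_map_AE[OF mp_f AE_in_main_part[OF V]] AE_X\<^sub>0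
  proof eventually_elim
    case (elim x)
    then have "f x \<in> V \<longleftrightarrow> x \<in> W" using X\<^sub>0_good[of x] by (simp add: V_def good_def)
    then show ?case using elim X\<^sub>0_good[of x] by (simp add: D_def good_def)
  qed
  then have ae': "AE x in completion \<mu>. x \<in> f -` D \<inter> space \<mu> \<longleftrightarrow> x \<in> ?E"
    unfolding AE_completion_iff by eventually_elim simp
  have E: "?E \<in> sets (completion \<mu>)"
    by (rule completion.in_sets_AE[OF ae' fD]) (use X\<^sub>0_space in auto)
  have "emeasure M ?E = emeasure (completion \<mu>) ?E" by (rule emeasure_M) auto
  also have "\<dots> = emeasure (completion \<mu>) (f -` D \<inter> space \<mu>)"
    using ae' by (intro emeasure_eq_AE E fD) auto
  also have "\<dots> = emeasure (completion Z) D"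
    using emeasure_distr[OF mp_map_completion(1)[OF mp_f] D] mp_map_completion(2)[OF mp_f] by simp
  finally have "measure M ?E = measure (completion Z) D" by (simp add: measure_def del: emeasure_completion)
  \<comment> \<open>On sets of \<open>Z\<close> the completion has the same measure. The coordinates
    are measurable already there because \<open>Z\<close> carries the trace of the product
    sigma-algebra.\<close>
  moreover have "D \<in> sets Z"
  proof -
    have "(\<lambda>z. z n) -` (U \<inter> space (P n)) \<inter> space Z \<in> sets Z"
    proof -
      have "(\<lambda>z. z n) \<in> measurable (PiM UNIV P) (P n)" by simp
      then have "(\<lambda>z. z n) \<in> measurable (restrict_space (PiM UNIV P) (inverse_limit_set P q)) (P n)"
        by (rule measurable_restrict_space1)
      then have "(\<lambda>z. z n) \<in> measurable Z (P n)"
        using inverse_limit by (subst measurable_cong_sets[OF _ refl]) (auto simp: inverse_limit_measure_def)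
      then show ?thesis by (rule measurable_sets) (simp add: sets_P)
    qed
    moreover have "(\<lambda>z. z n) -` (U \<inter> space (P n)) \<inter> space Z = {z \<in> space Z. z n \<in> U}"
      using inverse_limit by (auto simp: inverse_limit_measure_def inverse_limit_set_def)
    ultimately have "{z \<in> space Z. z n \<in> U} \<in> sets Z" by simp
    then have "(main_part Z V - {z \<in> space Z. z n \<in> U}) \<union> ({z \<in> space Z. z n \<in> U} - main_part Z V) \<in> sets Z"
      using V by (intro sets.Un sets.Diff) auto
    also have "(main_part Z V - {z \<in> space Z. z n \<in> U}) \<union> ({z \<in> space Z. z n \<in> U} - main_part Z V) = D"
      using sets.sets_into_space[OF main_part_sets[OF V]] by (auto simp: D_def)
    finally show ?thesis .
  qed
  ultimately have "measure M ?E < e" using U[folded D_def] by simp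
  then show ?thesis by blast
qed

sublocale pc: profinite_cocycle \<Gamma> \<Gamma>\<^sub>0 \<Lambda> M \<alpha> w "\<lambda>n x. f x n"
proof (rule profinite_cocycle.intro)
  show "Group.group \<Gamma>" "countable (carrier \<Gamma>)" "\<Gamma>\<^sub>0 \<lhd> \<Gamma>" "Group.group \<Lambda>" "countable (carrier \<Lambda>)"
    by (rule group_\<Gamma> countable_\<Gamma> normal_\<Gamma>\<^sub>0 group_\<Lambda> countable_\<Lambda>)+
  show "prob_space M"
  proof (rule prob_spaceI)
    have "emeasure (completion \<mu>) X\<^sub>0 = 1"
      using prob_space.emeasure_eq_1_AE[OF prob_space_completion[OF prob_\<mu>] X\<^sub>0_sets]
        AE_completion[OF AE_X\<^sub>0] by blast
    then show "emeasure M (space M) = 1" using emeasure_M[of X\<^sub>0] by (simp add: space_M del: emeasure_completion)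
  qed
  fix g assume g: "g \<in> carrier \<Gamma>"
  note gm = mp_map_completion[OF mp_\<alpha>_map[OF g]]
  show am: "\<alpha> g \<in> measurable M M"
    unfolding M_def by (rule measurable_restrict_space3[OF gm(1)]) (use X\<^sub>0_invariant[OF g] X\<^sub>0_space in auto)
  show "distr M M (\<alpha> g) = M"
  proof (rule measure_eqI)
    fix A assume "A \<in> sets (distr M M (\<alpha> g))"
    then have A: "A \<in> sets M" by simp
    then have Ac: "A \<subseteq> X\<^sub>0" "A \<in> sets (completion \<mu>)" using sets_M by auto
    have eq: "\<alpha> g -` A \<inter> space M = \<alpha> g -` A \<inter> space (completion \<mu>)"
      using Ac(1) X\<^sub>0_invariant[OF g] X\<^sub>0_space by (auto simp: space_M)
    have "emeasure (distr M M (\<alpha> g)) A = emeasure M (\<alpha> g -` A \<inter> space M)" by (rule emeasure_distr[OF am A])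
    also have "\<dots> = emeasure (completion \<mu>) (\<alpha> g -` A \<inter> space M)"
      by (rule emeasure_M) (auto simp: space_M)
    also have "\<dots> = emeasure (distr (completion \<mu>) (completion \<mu>) (\<alpha> g)) A"
      unfolding eq by (rule emeasure_distr[OF gm(1) Ac(2), symmetric])
    also have "\<dots> = emeasure M A" unfolding gm(2) by (rule emeasure_M[OF Ac(1), symmetric])
    finally show "emeasure (distr M M (\<alpha> g)) A = emeasure M A" .
  qed simp
  show "w g \<in> measurable M (count_space (carrier \<Lambda>))"
  proof (subst measurable_count_space_eq_countable[OF countable_\<Lambda>], intro conjI ballI)
    show "w g \<in> space M \<rightarrow> carrier \<Lambda>" using w(1)[OF g] by (simp add: space_M)
    fix l assume l: "l \<in> carrier \<Lambda>"
    have "w g -` {l} \<inter> space M = {x \<in> X\<^sub>0. w g x = l}" by (auto simp: space_M)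
    then show "w g -` {l} \<inter> space M \<in> sets M" using w_fibre[OF g l] by (auto simp: sets_M)
  qed
next
  show "\<alpha> (g \<otimes>\<^bsub>\<Gamma>\<^esub> h) x = \<alpha> g (\<alpha> h x)" "w (g \<otimes>\<^bsub>\<Gamma>\<^esub> h) x = w g (\<alpha> h x) \<otimes>\<^bsub>\<Lambda>\<^esub> w h x"
    if "g \<in> carrier \<Gamma>" "h \<in> carrier \<Gamma>" "x \<in> space M" for g h x
    using that \<alpha>_mult w_mult X\<^sub>0_space by (simp_all add: space_M)
  show "\<alpha> \<one>\<^bsub>\<Gamma>\<^esub> x = x" if "x \<in> space M" for x using that \<alpha>_one X\<^sub>0_space by (simp add: space_M)
  show "AE x in M. x \<in> B"
    if "B \<in> sets M" "\<And>h x. \<lbrakk>h \<in> \<Gamma>\<^sub>0; x \<in> space M\<rbrakk> \<Longrightarrow> \<alpha> h x \<in> B \<longleftrightarrow> x \<in> B" "emeasure M B \<noteq> 0" for B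
    using ergodic_M[OF that(1) _ that(3)] that(2) by (simp add: space_M)
  show "(\<lambda>x. f x n) \<in> measurable M (count_space UNIV)" for n
    unfolding M_def by (rule measurable_restrict_space1[OF f_coordinate_measurable])
  have fS: "f x n \<in> space (P n) \<and> q n (f x (Suc n)) = f x n" if "x \<in> X\<^sub>0" for x n
    using X\<^sub>0_good[OF that] inverse_limit
    by (simp add: good_def inverse_limit_measure_def inverse_limit_set_def)
  show "finite ((\<lambda>x. f x n) ` space M)" for n
  proof (rule finite_subset)
    show "(\<lambda>x. f x n) ` space M \<subseteq> space (P n)" using fS by (auto simp: space_M)
    show "finite (space (P n))" using inverse_system by (simp add: inverse_system_def)
  qed
  show "f (\<alpha> g x) n = f (\<alpha> g y) n"
    if "g \<in> carrier \<Gamma>" "x \<in> space M" "y \<in> space M" "f x n = f y n" for g x y n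
    using that X\<^sub>0_good[of x] X\<^sub>0_good[of y] by (simp add: good_def space_M)
  show "f x n = f y n" if "x \<in> space M" "y \<in> space M" "f x (Suc n) = f y (Suc n)" for x y n
    using fS[of x n] fS[of y n] that by (auto simp: space_M)
  show "\<exists>n U. measure M {x \<in> space M. (x \<in> W) \<noteq> (f x n \<in> U)} < e" if "W \<in> sets M" "e > 0" for W e
    using levels_generate[OF that] by (simp add: space_M)
qed

end

section \<open>Composition and normalized restriction of measure preserving maps\<close>

lemma mp_map_comp:
  assumes f: "mp_map M N f" and g: "mp_map N K g"
  shows "mp_map M K (\<lambda>x. g (f x))"
proof (rule mp_mapI)
  note F = mp_map_completion[OF f] and G = mp_map_completion[OF g]
  show m: "(\<lambda>x. g (f x)) \<in> measurable (completion M) (completion K)"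
    by (rule measurable_compose[OF F(1) G(1)])
  have "distr (completion M) (completion K) (g \<circ> f) = distr (distr (completion M) (completion N) f) (completion K) g"
    by (rule distr_distr[symmetric, OF G(1) F(1)])
  then show "distr (completion M) (completion K) (\<lambda>x. g (f x)) = completion K"
    by (simp add: F(2) G(2) comp_def)
qed

lemma AE_inverse_transfer:
  assumes g: "mp_map N M g" and fg: "AE y in N. f (g y) = y" and P: "AE x in M. P (f x)"
  shows "AE y in N. P y"
  using mp_map_AE[OF g P] fg by eventually_elim simp

lemma AE_uniform_measure_of_AE:
  assumes "R \<in> sets M" "AE x in M. x \<in> R \<longrightarrow> P x"
  shows "AE x in uniform_measure M R. P x"
proof (rule AE_uniform_measureI)
  show "R \<in> sets M" "AE x in M. x \<in> R \<longrightarrow> P x" by fact+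
qed

lemma completion_uniform_measure:
  assumes R: "R \<in> sets M" and E: "E \<in> sets (completion M)"
  shows "E \<in> sets (completion (uniform_measure M R))"
    and "emeasure (completion (uniform_measure M R)) E = emeasure (completion M) (R \<inter> E) / emeasure M R"
proof -
  let ?U = "uniform_measure M R" and ?E = "main_part M E"
  have E': "?E \<in> sets M" using E by simp
  have ae: "AE x in M. x \<in> ?E \<longleftrightarrow> x \<in> E" by (rule AE_in_main_part[OF E])
  then have "AE x in ?U. x \<in> ?E \<longleftrightarrow> x \<in> E"
    by (intro AE_uniform_measure_of_AE[OF R]) (auto elim: AE_mp)
  then have aeU: "AE x in completion ?U. x \<in> ?E \<longleftrightarrow> x \<in> E" by (rule AE_completion)
  show EU: "E \<in> sets (completion ?U)"
    by (rule completion.in_sets_AE[OF aeU]) (use E' sets.sets_into_space[OF E] in auto)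
  have "emeasure (completion ?U) E = emeasure (completion ?U) ?E"
    using aeU E' by (intro emeasure_eq_AE EU) auto
  also have "\<dots> = emeasure ?U ?E" using E' by simp
  also have "\<dots> = emeasure M (R \<inter> ?E) / emeasure M R" by (rule emeasure_uniform_measure[OF R E'])
  also have "emeasure M (R \<inter> ?E) = emeasure (completion M) (R \<inter> ?E)" using R E' by simp
  also have "\<dots> = emeasure (completion M) (R \<inter> E)"
    using AE_completion[OF ae] R E E' by (intro emeasure_eq_AE) auto
  finally show "emeasure (completion ?U) E = emeasure (completion M) (R \<inter> E) / emeasure M R" .
qed

lemma mp_map_uniform_measure:
  assumes f: "mp_map M N f" and R: "R \<in> sets M" and Y: "Y \<in> sets N"
    and XY: "AE x in M. x \<in> R \<longleftrightarrow> f x \<in> Y"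
  shows "mp_map (uniform_measure M R) (uniform_measure N Y) f"
  unfolding mp_map_def
proof (intro conjI ballI)
  have fm: "f \<in> measurable (completion M) N" using f by (simp add: mp_map_def)
  have vi: "f -` B \<inter> space M \<in> sets (completion M)" if "B \<in> sets N" for B
    using measurable_sets[OF fm that] by simp
  show "f \<in> measurable (completion (uniform_measure M R)) (uniform_measure N Y)"
  proof (rule measurableI)
    fix B assume "B \<in> sets (uniform_measure N Y)"
    then show "f -` B \<inter> space (completion (uniform_measure M R)) \<in> sets (completion (uniform_measure M R))"
      using completion_uniform_measure(1)[OF R vi] by simp
  qed (use mp_map_space[OF f] in simp)
  have pre: "emeasure (completion M) (R \<inter> (f -` B \<inter> space M)) = emeasure N (Y \<inter> B)" if B: "B \<in> sets N" for B
  proof -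
    have "emeasure (completion M) (R \<inter> (f -` B \<inter> space M)) = emeasure (completion M) (f -` (Y \<inter> B) \<inter> space M)"
    proof (rule emeasure_eq_AE)
      show "AE x in completion M. x \<in> R \<inter> (f -` B \<inter> space M) \<longleftrightarrow> x \<in> f -` (Y \<inter> B) \<inter> space M"
        using AE_completion[OF XY] by eventually_elim auto
      show "R \<inter> (f -` B \<inter> space M) \<in> sets (completion M)" using vi[OF B] R by auto
      show "f -` (Y \<inter> B) \<inter> space M \<in> sets (completion M)" by (rule vi) (use B Y in auto)
    qed
    also have "\<dots> = emeasure N (Y \<inter> B)" using f B Y unfolding mp_map_def by blast
    finally show ?thesis .
  qed
  have "R \<inter> (f -` space N \<inter> space M) = R"
    using sets.sets_into_space[OF R] mp_map_space[OF f] by auto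
  then have XYe: "emeasure M R = emeasure N Y"
    using pre[of "space N"] R sets.sets_into_space[OF Y] by (simp add: Int_absorb2)
  fix B assume "B \<in> sets (uniform_measure N Y)"
  then have B: "B \<in> sets N" by simp
  show "emeasure (completion (uniform_measure M R)) (f -` B \<inter> space (uniform_measure M R)) = emeasure (uniform_measure N Y) B"
    using completion_uniform_measure(2)[OF R vi[OF B]] pre[OF B] XYe
    by (simp add: emeasure_uniform_measure[OF Y B] del: emeasure_completion)
qed

lemma prob_iso_uniform_measure:
  assumes f: "prob_iso M N f" and R: "R \<in> sets M" "emeasure M R \<noteq> 0" and Y: "Y \<in> sets N" "emeasure N Y \<noteq> 0"
    and XY: "AE x in M. x \<in> R \<longleftrightarrow> f x \<in> Y"
  shows "prob_iso (uniform_measure M R) (uniform_measure N Y) f"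
proof -
  obtain g where g: "mp_map N M g" "AE x in M. g (f x) = x" "AE y in N. f (g y) = y"
    and fm: "mp_map M N f" "prob_space M" "prob_space N" using f by (auto simp: prob_iso_def)
  have YX: "AE y in N. y \<in> Y \<longleftrightarrow> g y \<in> R"
    using mp_map_AE[OF g(1) XY] g(3) by eventually_elim simp
  have fin: "emeasure M R \<noteq> \<infinity>" "emeasure N Y \<noteq> \<infinity>"
    using finite_measure.emeasure_finite[OF prob_space.finite_measure[OF fm(2)]]
      finite_measure.emeasure_finite[OF prob_space.finite_measure[OF fm(3)]] by simp_all
  have "prob_space (uniform_measure M R)" "prob_space (uniform_measure N Y)"
    by (rule prob_space_uniform_measure[OF R(2) fin(1)] prob_space_uniform_measure[OF Y(2) fin(2)])+
  moreover have "AE x in M. x \<in> R \<longrightarrow> g (f x) = x" using g(2) by eventually_elim simp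
  then have "AE x in uniform_measure M R. g (f x) = x" by (rule AE_uniform_measure_of_AE[OF R(1)])
  moreover have "AE y in N. y \<in> Y \<longrightarrow> f (g y) = y" using g(3) by eventually_elim simp
  then have "AE y in uniform_measure N Y. f (g y) = y" by (rule AE_uniform_measure_of_AE[OF Y(1)])
  ultimately show ?thesis
    unfolding prob_iso_def
    using mp_map_uniform_measure[OF fm(1) R(1) Y(1) XY] mp_map_uniform_measure[OF g(1) Y(1) R(1) YX] by blast
qed

lemma uniform_measure_null:
  assumes "R \<in> sets M" "A \<in> sets M" "AE x in M. x \<in> R \<longrightarrow> x \<notin> A"
  shows "emeasure (uniform_measure M R) A = 0"
proof -
  have "AE x in M. x \<notin> R \<inter> A" using assms(3) by eventually_elim auto
  then have "emeasure M (R \<inter> A) = 0"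
    using AE_iff_null_sets[of "R \<inter> A" M] assms by auto
  then show ?thesis by (simp add: emeasure_uniform_measure[OF assms(1,2)])
qed

section \<open>The partial conjugacy defined by the untwisting map\<close>

locale untwisted_orbit_equivalence = orbit_equivalent_actions \<Gamma> \<Gamma>\<^sub>0 \<mu> \<alpha> \<Lambda> \<nu> \<beta> P c q Z f f' \<theta> \<theta>'
  for \<Gamma> :: "'g monoid" and \<Gamma>\<^sub>0 and \<mu> :: "'x measure" and \<alpha> and \<Lambda> :: "'l monoid" and \<nu> :: "'y measure" and \<beta>
    and P c q Z f f' \<theta> \<theta>' +
  fixes m b :: nat and \<epsilon> :: "'g \<Rightarrow> 'l" and \<psi> :: "'x \<Rightarrow> 'l" and l\<^sub>0 :: 'l
  assumes \<psi>_measurable: "\<psi> \<in> measurable M (count_space (carrier \<Lambda>))"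
    and atom_pos: "measure M (pc.atom m b) > 0"
    and \<epsilon>_closed: "g \<in> pc.stab m b \<Longrightarrow> \<epsilon> g \<in> carrier \<Lambda>"
    and \<epsilon>_mult: "\<lbrakk>g \<in> pc.stab m b; h \<in> pc.stab m b\<rbrakk> \<Longrightarrow> \<epsilon> (g \<otimes>\<^bsub>\<Gamma>\<^esub> h) = \<epsilon> g \<otimes>\<^bsub>\<Lambda>\<^esub> \<epsilon> h"
    and \<psi>_equivariant: "g \<in> pc.stab m b \<Longrightarrow>
      AE x in M. x \<in> pc.atom m b \<longrightarrow> \<psi> (\<alpha> g x) \<otimes>\<^bsub>\<Lambda>\<^esub> \<epsilon> g = w g x \<otimes>\<^bsub>\<Lambda>\<^esub> \<psi> x"
    and \<psi>_half: "measure M {x \<in> pc.atom m b. \<psi> x = l\<^sub>0} > measure M (pc.atom m b) / 2"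
begin

abbreviation (input) "base \<equiv> pc.atom m b"
abbreviation (input) "\<Gamma>\<^sub>1 \<equiv> pc.stab m b"

lemma base_X\<^sub>0: "x \<in> base \<Longrightarrow> x \<in> X\<^sub>0"
  using pc.atom_space[of x m b] by (simp add: space_M)

lemma base_element: obtains x where "x \<in> base"
proof -
  have "base \<noteq> {}" using atom_pos by auto
  then show thesis using that by blast
qed

lemma subgroup_\<Gamma>\<^sub>1: "subgroup \<Gamma>\<^sub>1 \<Gamma>"
proof -
  obtain x where "x \<in> base" by (rule base_element)
  then show ?thesis by (rule pc.subgroup_stab)
qed

lemma \<Gamma>\<^sub>1_carrier: "g \<in> \<Gamma>\<^sub>1 \<Longrightarrow> g \<in> carrier \<Gamma>"
  by (rule pc.stabD(2))

lemma \<psi>_closed: "x \<in> X\<^sub>0 \<Longrightarrow> \<psi> x \<in> carrier \<Lambda>"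
  using measurable_space[OF \<psi>_measurable, of x] by (simp add: space_M)

text \<open>The points of the atom where the untwisting identity holds for the whole stabilizer at
  once. This set is again invariant, so equivariance and injectivity hold on it pointwise.\<close>

definition Xb where "Xb = {x \<in> base. \<forall>g\<in>\<Gamma>\<^sub>1. \<psi> (\<alpha> g x) \<otimes>\<^bsub>\<Lambda>\<^esub> \<epsilon> g = w g x \<otimes>\<^bsub>\<Lambda>\<^esub> \<psi> x}"

lemma Xb_base: "x \<in> Xb \<Longrightarrow> x \<in> base" and Xb_X\<^sub>0: "x \<in> Xb \<Longrightarrow> x \<in> X\<^sub>0"
  using base_X\<^sub>0 by (auto simp: Xb_def)

lemma AE_Xb: "AE x in \<mu>. x \<in> base \<longleftrightarrow> x \<in> Xb"
proof -
  have "countable \<Gamma>\<^sub>1" using countable_subset[OF _ countable_\<Gamma>] \<Gamma>\<^sub>1_carrier by blast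
  then have "AE x in M. \<forall>g\<in>\<Gamma>\<^sub>1. x \<in> base \<longrightarrow> \<psi> (\<alpha> g x) \<otimes>\<^bsub>\<Lambda>\<^esub> \<epsilon> g = w g x \<otimes>\<^bsub>\<Lambda>\<^esub> \<psi> x"
    using \<psi>_equivariant by (subst AE_ball_countable) auto
  then have "AE x in M. x \<in> base \<longleftrightarrow> x \<in> Xb" by eventually_elim (auto simp: Xb_def)
  then show ?thesis by (simp add: AE_M)
qed

lemma base_sets: "base \<in> sets (completion \<mu>)"
  using pc.atom_sets[of m b] sets_M by blast

lemma Xb_sets: "Xb \<in> sets (completion \<mu>)"
proof (rule completion.in_sets_AE[OF _ base_sets])
  show "AE x in completion \<mu>. x \<in> base \<longleftrightarrow> x \<in> Xb" by (rule AE_completion[OF AE_Xb])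
qed (use Xb_X\<^sub>0 X\<^sub>0_space in auto)

lemma emeasure_Xb: "emeasure (completion \<mu>) Xb = emeasure M base"
proof -
  have "emeasure (completion \<mu>) Xb = emeasure (completion \<mu>) base"
    using AE_completion[OF AE_Xb] by (intro emeasure_eq_AE Xb_sets base_sets) auto
  then show ?thesis using emeasure_M[of base] base_X\<^sub>0 by (simp add: subset_iff del: emeasure_completion)
qed

lemma emeasure_base: "emeasure M base \<noteq> 0"
  using atom_pos by (auto simp: measure_def)

text \<open>Compare the identities at \<open>x\<close> for the product of \<open>g\<close> and
  \<open>h\<close> and for \<open>h\<close> alone; cancelling \<open>\<epsilon> h\<close> leaves the
  identity for \<open>g\<close> at \<open>\<alpha> h x\<close>.\<close>

lemma Xb_invariant:
  assumes h: "h \<in> \<Gamma>\<^sub>1" and x: "x \<in> Xb"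
  shows "\<alpha> h x \<in> Xb"
proof -
  note hG = \<Gamma>\<^sub>1_carrier[OF h] and xb = Xb_base[OF x] and x0 = Xb_X\<^sub>0[OF x]
  have hx: "\<alpha> h x \<in> base" by (rule pc.stabD(1)[OF h xb])
  note hx0 = base_X\<^sub>0[OF hx]
  have "\<psi> (\<alpha> g (\<alpha> h x)) \<otimes>\<^bsub>\<Lambda>\<^esub> \<epsilon> g = w g (\<alpha> h x) \<otimes>\<^bsub>\<Lambda>\<^esub> \<psi> (\<alpha> h x)" if g: "g \<in> \<Gamma>\<^sub>1" for g
  proof -
    note gG = \<Gamma>\<^sub>1_carrier[OF g]
    have gh: "g \<otimes>\<^bsub>\<Gamma>\<^esub> h \<in> \<Gamma>\<^sub>1" by (rule subgroup.m_closed[OF subgroup_\<Gamma>\<^sub>1 g h])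
    have gx: "\<alpha> g (\<alpha> h x) \<in> X\<^sub>0" using X\<^sub>0_invariant[OF gG X\<^sub>0_space[OF hx0]] hx0 by simp
    note c = \<psi>_closed[OF gx] \<psi>_closed[OF hx0] \<psi>_closed[OF x0] \<epsilon>_closed[OF g] \<epsilon>_closed[OF h]
      w(1)[OF gG hx0] w(1)[OF hG x0]
    have 1: "\<psi> (\<alpha> h x) \<otimes>\<^bsub>\<Lambda>\<^esub> \<epsilon> h = w h x \<otimes>\<^bsub>\<Lambda>\<^esub> \<psi> x" using x h by (simp add: Xb_def)
    have "\<psi> (\<alpha> (g \<otimes>\<^bsub>\<Gamma>\<^esub> h) x) \<otimes>\<^bsub>\<Lambda>\<^esub> \<epsilon> (g \<otimes>\<^bsub>\<Gamma>\<^esub> h) = w (g \<otimes>\<^bsub>\<Gamma>\<^esub> h) x \<otimes>\<^bsub>\<Lambda>\<^esub> \<psi> x"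
      using x gh by (simp add: Xb_def)
    then have "\<psi> (\<alpha> g (\<alpha> h x)) \<otimes>\<^bsub>\<Lambda>\<^esub> (\<epsilon> g \<otimes>\<^bsub>\<Lambda>\<^esub> \<epsilon> h) = w g (\<alpha> h x) \<otimes>\<^bsub>\<Lambda>\<^esub> (\<psi> (\<alpha> h x) \<otimes>\<^bsub>\<Lambda>\<^esub> \<epsilon> h)"
      using \<epsilon>_mult[OF g h] \<alpha>_mult[OF gG hG X\<^sub>0_space[OF x0]] w_mult[OF gG hG x0] c 1 by (simp add: Y.L.m_assoc)
    then have "\<psi> (\<alpha> g (\<alpha> h x)) \<otimes>\<^bsub>\<Lambda>\<^esub> \<epsilon> g \<otimes>\<^bsub>\<Lambda>\<^esub> \<epsilon> h = w g (\<alpha> h x) \<otimes>\<^bsub>\<Lambda>\<^esub> \<psi> (\<alpha> h x) \<otimes>\<^bsub>\<Lambda>\<^esub> \<epsilon> h"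
      using c by (simp add: Y.L.m_assoc)
    then show ?thesis using c by simp
  qed
  then show ?thesis using hx by (simp add: Xb_def)
qed

definition \<rho>\<^sub>1 where "\<rho>\<^sub>1 x = \<beta> (inv\<^bsub>\<Lambda>\<^esub> \<psi> x) (\<theta> x)"

lemma \<theta>_space: "x \<in> X\<^sub>0 \<Longrightarrow> \<theta> x \<in> space (completion \<nu>)"
  using X\<^sub>0_good[of x] by (simp add: good_def)

lemma \<theta>'_\<theta>_X\<^sub>0: "x \<in> X\<^sub>0 \<Longrightarrow> \<theta>' (\<theta> x) = x"
  using X\<^sub>0_good[of x] by (simp add: good_def)

lemma \<rho>\<^sub>1_equivariant:
  assumes g: "g \<in> \<Gamma>\<^sub>1" and x: "x \<in> Xb"
  shows "\<rho>\<^sub>1 (\<alpha> g x) = \<beta> (\<epsilon> g) (\<rho>\<^sub>1 x)"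
proof -
  note gG = \<Gamma>\<^sub>1_carrier[OF g] and x0 = Xb_X\<^sub>0[OF x] and gx0 = Xb_X\<^sub>0[OF Xb_invariant[OF g x]]
  note c = \<psi>_closed[OF gx0] \<psi>_closed[OF x0] \<epsilon>_closed[OF g] w(1)[OF gG x0]
  note y = \<theta>_space[OF x0]
  have 1: "\<psi> (\<alpha> g x) \<otimes>\<^bsub>\<Lambda>\<^esub> \<epsilon> g = w g x \<otimes>\<^bsub>\<Lambda>\<^esub> \<psi> x" using x g by (simp add: Xb_def)
  have "w g x = \<psi> (\<alpha> g x) \<otimes>\<^bsub>\<Lambda>\<^esub> \<epsilon> g \<otimes>\<^bsub>\<Lambda>\<^esub> inv\<^bsub>\<Lambda>\<^esub> \<psi> x"
    unfolding 1 using c by (simp add: Y.L.m_assoc)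
  then have 2: "inv\<^bsub>\<Lambda>\<^esub> \<psi> (\<alpha> g x) \<otimes>\<^bsub>\<Lambda>\<^esub> w g x = \<epsilon> g \<otimes>\<^bsub>\<Lambda>\<^esub> inv\<^bsub>\<Lambda>\<^esub> \<psi> x"
    using c by (simp add: Y.L.m_assoc[symmetric])
  have "\<rho>\<^sub>1 (\<alpha> g x) = \<beta> (inv\<^bsub>\<Lambda>\<^esub> \<psi> (\<alpha> g x)) (\<beta> (w g x) (\<theta> x))"
    by (simp add: \<rho>\<^sub>1_def w(2)[OF gG x0])
  also have "\<dots> = \<beta> (inv\<^bsub>\<Lambda>\<^esub> \<psi> (\<alpha> g x) \<otimes>\<^bsub>\<Lambda>\<^esub> w g x) (\<theta> x)"
    by (rule Y.b_mult[symmetric]) (use c y in auto)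
  also have "\<dots> = \<beta> (\<epsilon> g) (\<beta> (inv\<^bsub>\<Lambda>\<^esub> \<psi> x) (\<theta> x))"
    unfolding 2 by (rule Y.b_mult) (use c y in auto)
  finally show ?thesis by (simp add: \<rho>\<^sub>1_def)
qed

text \<open>\<open>\<rho>\<^sub>1\<close> moves points only within orbits of
  \<open>\<Lambda>\<close>, so orbit equivalence yields some \<open>g\<close> that takes
  \<open>x\<close> to \<open>x'\<close>; both lie in the atom, hence \<open>g\<close> stabilizes it,
  and freeness identifies \<open>l\<close> with \<open>\<epsilon> g\<close>. Injectivity of
  \<open>\<rho>\<^sub>1\<close> and the finite index of the image group both rest on this.\<close>

lemma \<rho>\<^sub>1_orbit:
  assumes x: "x \<in> Xb" and x': "x' \<in> Xb" and l: "l \<in> carrier \<Lambda>" and eq: "\<beta> l (\<rho>\<^sub>1 x) = \<rho>\<^sub>1 x'"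
  obtains g where "g \<in> \<Gamma>\<^sub>1" "x' = \<alpha> g x" "l = \<epsilon> g"
proof -
  note x0 = Xb_X\<^sub>0[OF x] and x0' = Xb_X\<^sub>0[OF x']
  note c = \<psi>_closed[OF x0] \<psi>_closed[OF x0'] l
  note y = \<theta>_space[OF x0] and y' = \<theta>_space[OF x0']
  have "\<theta> x' = \<beta> (\<psi> x') (\<rho>\<^sub>1 x')" unfolding \<rho>\<^sub>1_def using Y.b_inv_cancel(1)[OF c(2) y'] by simp
  also have "\<dots> = \<beta> (\<psi> x') (\<beta> (l \<otimes>\<^bsub>\<Lambda>\<^esub> inv\<^bsub>\<Lambda>\<^esub> \<psi> x) (\<theta> x))"
    unfolding eq[symmetric] unfolding \<rho>\<^sub>1_def using Y.b_mult[of l "inv\<^bsub>\<Lambda>\<^esub> \<psi> x" "\<theta> x"] c y by simp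
  also have "\<dots> = \<beta> (\<psi> x' \<otimes>\<^bsub>\<Lambda>\<^esub> (l \<otimes>\<^bsub>\<Lambda>\<^esub> inv\<^bsub>\<Lambda>\<^esub> \<psi> x)) (\<theta> x)"
    by (rule Y.b_mult[symmetric]) (use c y in auto)
  finally have "\<theta> x' \<in> orbit \<Lambda> \<beta> (\<theta> x)" using c by (auto simp: orbit_def)
  then have "\<theta> x' \<in> \<theta> ` orbit \<Gamma> \<alpha> x" using X\<^sub>0_good[OF x0] by (simp add: good_def)
  then obtain g where g: "g \<in> carrier \<Gamma>" "\<theta> x' = \<theta> (\<alpha> g x)" by (auto simp: orbit_def)
  have gx: "\<alpha> g x \<in> X\<^sub>0" using X\<^sub>0_invariant[OF g(1) X\<^sub>0_space[OF x0]] x0 by simp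
  have "x' = \<theta>' (\<theta> x')" by (rule \<theta>'_\<theta>_X\<^sub>0[OF x0', symmetric])
  also have "\<dots> = \<theta>' (\<theta> (\<alpha> g x))" by (rule arg_cong[OF g(2)])
  also have "\<dots> = \<alpha> g x" by (rule \<theta>'_\<theta>_X\<^sub>0[OF gx])
  finally have xg: "x' = \<alpha> g x" .
  have gs: "g \<in> \<Gamma>\<^sub>1" by (rule pc.stabI[OF g(1) Xb_base[OF x] Xb_base[OF x', unfolded xg]])
  have "\<beta> (\<epsilon> g) (\<rho>\<^sub>1 x) = \<beta> l (\<rho>\<^sub>1 x)"
    unfolding eq xg by (rule \<rho>\<^sub>1_equivariant[OF gs x, symmetric])
  then have "\<beta> (\<epsilon> g \<otimes>\<^bsub>\<Lambda>\<^esub> inv\<^bsub>\<Lambda>\<^esub> \<psi> x) (\<theta> x) = \<beta> (l \<otimes>\<^bsub>\<Lambda>\<^esub> inv\<^bsub>\<Lambda>\<^esub> \<psi> x) (\<theta> x)"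
    unfolding \<rho>\<^sub>1_def
    using Y.b_mult[of l "inv\<^bsub>\<Lambda>\<^esub> \<psi> x" "\<theta> x"] Y.b_mult[of "\<epsilon> g" "inv\<^bsub>\<Lambda>\<^esub> \<psi> x" "\<theta> x"] c y \<epsilon>_closed[OF gs] by simp
  then have "\<epsilon> g \<otimes>\<^bsub>\<Lambda>\<^esub> inv\<^bsub>\<Lambda>\<^esub> \<psi> x = l \<otimes>\<^bsub>\<Lambda>\<^esub> inv\<^bsub>\<Lambda>\<^esub> \<psi> x"
    by (intro \<beta>_free[OF x0]) (use c \<epsilon>_closed[OF gs] in auto)
  then have "l = \<epsilon> g" using c \<epsilon>_closed[OF gs] by simp
  with gs xg show thesis by (rule that)
qed

lemma \<epsilon>_one: "\<epsilon> \<one>\<^bsub>\<Gamma>\<^esub> = \<one>\<^bsub>\<Lambda>\<^esub>"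
proof -
  have one: "\<one>\<^bsub>\<Gamma>\<^esub> \<in> \<Gamma>\<^sub>1" by (rule subgroup.one_closed[OF subgroup_\<Gamma>\<^sub>1])
  have "\<epsilon> \<one>\<^bsub>\<Gamma>\<^esub> \<otimes>\<^bsub>\<Lambda>\<^esub> \<epsilon> \<one>\<^bsub>\<Gamma>\<^esub> = \<epsilon> \<one>\<^bsub>\<Gamma>\<^esub>" using \<epsilon>_mult[OF one one] by simp
  then show ?thesis using Y.L.l_cancel_one'[OF \<epsilon>_closed[OF one] \<epsilon>_closed[OF one]] by metis
qed

text \<open>
  As \<open>\<psi>\<close> is constant on more than half of the atom, \<open>g\<close> moves some point with \<open>\<psi> x = l\<^sub>0\<close> to another such
  point; if \<open>\<epsilon> g\<close> is trivial, these two points have the same image under \<open>\<theta>\<close>.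
\<close>

lemma \<epsilon>_kernel:
  assumes g: "g \<in> \<Gamma>\<^sub>1" and e: "\<epsilon> g = \<one>\<^bsub>\<Lambda>\<^esub>"
  shows "g = \<one>\<^bsub>\<Gamma>\<^esub>"
proof -
  note gG = \<Gamma>\<^sub>1_carrier[OF g]
  define W where "W = {x \<in> base. \<psi> x = l\<^sub>0}"
  have "\<psi> -` (carrier \<Lambda> \<inter> {l\<^sub>0}) \<inter> space M \<in> sets M"
    by (rule measurable_sets[OF \<psi>_measurable]) auto
  then have "\<psi> -` (carrier \<Lambda> \<inter> {l\<^sub>0}) \<inter> space M \<inter> base \<in> sets M"
    by (rule sets.Int[OF _ pc.atom_sets])
  also have "\<psi> -` (carrier \<Lambda> \<inter> {l\<^sub>0}) \<inter> space M \<inter> base = W"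
    using \<psi>_closed base_X\<^sub>0 by (auto simp: W_def space_M)
  finally have W: "W \<in> sets M" .
  define W' where "W' = \<alpha> g -` W \<inter> space M"
  have W': "W' \<in> sets M" unfolding W'_def by (rule measurable_sets[OF pc.a_measurable[OF gG] W])
  have mW': "measure M W' = measure M W"
    unfolding W'_def measure_def by (simp add: pc.emeasure_a_vimage[OF gG W])
  have sub: "W \<subseteq> base" "W' \<subseteq> base"
    using pc.stab_mem_iff[OF g] by (auto simp: W_def W'_def)
  have "measure M (W \<union> W') + measure M (W \<inter> W') = measure M W + measure M W'"
    using pc.finite_measure_Union'[OF W W'] pc.finite_measure_Diff'[OF W' W] by (simp add: Int_commute)
  moreover have "measure M (W \<union> W') \<le> measure M base"
    by (rule pc.finite_measure_mono) (use sub in auto)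
  ultimately have pos: "measure M (W \<inter> W') > 0" using \<psi>_half mW' by (simp add: W_def)
  have "AE x in M. x \<in> W \<inter> W' \<longrightarrow> x \<in> Xb"
    using AE_Xb sub unfolding AE_M by (auto elim: AE_mp)
  then obtain x where x: "x \<in> W \<inter> W'" "x \<in> Xb"
    by (rule pc.AE_atom_exists[OF _ sets.Int[OF W W'] pos])
  note x0 = Xb_X\<^sub>0[OF x(2)]
  have gx0: "\<alpha> g x \<in> X\<^sub>0" using X\<^sub>0_invariant[OF gG X\<^sub>0_space[OF x0]] x0 by simp
  have "\<psi> (\<alpha> g x) \<otimes>\<^bsub>\<Lambda>\<^esub> \<epsilon> g = w g x \<otimes>\<^bsub>\<Lambda>\<^esub> \<psi> x" using x(2) g by (simp add: Xb_def)
  moreover have "\<psi> x = l\<^sub>0" "\<psi> (\<alpha> g x) = l\<^sub>0" using x(1) by (auto simp: W_def W'_def)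
  ultimately have "l\<^sub>0 = w g x \<otimes>\<^bsub>\<Lambda>\<^esub> l\<^sub>0" using e \<psi>_closed[OF x0] by simp
  then have "w g x = \<one>\<^bsub>\<Lambda>\<^esub>" using \<psi>_closed[OF x0] \<open>\<psi> x = l\<^sub>0\<close> w(1)[OF gG x0] Y.L.r_cancel_one' by metis
  then have "\<theta> (\<alpha> g x) = \<theta> x" using w(2)[OF gG x0] Y.b_one[OF \<theta>_space[OF x0]] by simp
  then have "\<theta>' (\<theta> (\<alpha> g x)) = \<theta>' (\<theta> x)" by (rule arg_cong)
  then have "\<alpha> g x = x" unfolding \<theta>'_\<theta>_X\<^sub>0[OF x0] \<theta>'_\<theta>_X\<^sub>0[OF gx0] .
  then show ?thesis using X\<^sub>0_good[OF x0] gG by (auto simp: good_def)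
qed

lemma \<epsilon>_inv: "g \<in> \<Gamma>\<^sub>1 \<Longrightarrow> \<epsilon> (inv\<^bsub>\<Gamma>\<^esub> g) = inv\<^bsub>\<Lambda>\<^esub> \<epsilon> g"
proof -
  assume g: "g \<in> \<Gamma>\<^sub>1"
  have ig: "inv\<^bsub>\<Gamma>\<^esub> g \<in> \<Gamma>\<^sub>1" by (rule subgroup.m_inv_closed[OF subgroup_\<Gamma>\<^sub>1 g])
  have "\<epsilon> (inv\<^bsub>\<Gamma>\<^esub> g) \<otimes>\<^bsub>\<Lambda>\<^esub> \<epsilon> g = \<one>\<^bsub>\<Lambda>\<^esub>" using \<epsilon>_mult[OF ig g] \<epsilon>_one \<Gamma>\<^sub>1_carrier[OF g] by simp
  from Y.L.inv_equality[OF this \<epsilon>_closed[OF g] \<epsilon>_closed[OF ig]] show ?thesis by simp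
qed

lemma \<epsilon>_inj: "inj_on \<epsilon> \<Gamma>\<^sub>1"
proof (rule inj_onI)
  fix g h assume g: "g \<in> \<Gamma>\<^sub>1" and h: "h \<in> \<Gamma>\<^sub>1" and eq: "\<epsilon> g = \<epsilon> h"
  note G = \<Gamma>\<^sub>1_carrier[OF g] \<Gamma>\<^sub>1_carrier[OF h]
  have ih: "inv\<^bsub>\<Gamma>\<^esub> h \<in> \<Gamma>\<^sub>1" by (rule subgroup.m_inv_closed[OF subgroup_\<Gamma>\<^sub>1 h])
  have gh: "g \<otimes>\<^bsub>\<Gamma>\<^esub> inv\<^bsub>\<Gamma>\<^esub> h \<in> \<Gamma>\<^sub>1" by (rule subgroup.m_closed[OF subgroup_\<Gamma>\<^sub>1 g ih])
  have "\<epsilon> (g \<otimes>\<^bsub>\<Gamma>\<^esub> inv\<^bsub>\<Gamma>\<^esub> h) = \<one>\<^bsub>\<Lambda>\<^esub>" using \<epsilon>_mult[OF g ih] \<epsilon>_inv[OF h] eq \<epsilon>_closed[OF h] by simp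
  then have "g \<otimes>\<^bsub>\<Gamma>\<^esub> inv\<^bsub>\<Gamma>\<^esub> h = \<one>\<^bsub>\<Gamma>\<^esub>" by (rule \<epsilon>_kernel[OF gh])
  then have "inv\<^bsub>\<Gamma>\<^esub> (inv\<^bsub>\<Gamma>\<^esub> h) = g" by (rule pc.G.inv_equality) (use G in auto)
  then show "g = h" using G by simp
qed

lemma subgroup_\<Lambda>\<^sub>1: "subgroup (\<epsilon> ` \<Gamma>\<^sub>1) \<Lambda>"
proof (rule Y.L.subgroupI)
  show "\<epsilon> ` \<Gamma>\<^sub>1 \<subseteq> carrier \<Lambda>" using \<epsilon>_closed by blast
  show "\<epsilon> ` \<Gamma>\<^sub>1 \<noteq> {}" using subgroup.one_closed[OF subgroup_\<Gamma>\<^sub>1] by blast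
next
  fix l assume "l \<in> \<epsilon> ` \<Gamma>\<^sub>1"
  then obtain g where g: "g \<in> \<Gamma>\<^sub>1" "l = \<epsilon> g" by blast
  then show "inv\<^bsub>\<Lambda>\<^esub> l \<in> \<epsilon> ` \<Gamma>\<^sub>1"
    using \<epsilon>_inv[OF g(1)] subgroup.m_inv_closed[OF subgroup_\<Gamma>\<^sub>1 g(1)] by (metis imageI)
next
  fix l k assume "l \<in> \<epsilon> ` \<Gamma>\<^sub>1" "k \<in> \<epsilon> ` \<Gamma>\<^sub>1"
  then obtain g h where g: "g \<in> \<Gamma>\<^sub>1" "l = \<epsilon> g" "h \<in> \<Gamma>\<^sub>1" "k = \<epsilon> h" by blast
  then show "l \<otimes>\<^bsub>\<Lambda>\<^esub> k \<in> \<epsilon> ` \<Gamma>\<^sub>1"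
    using \<epsilon>_mult[OF g(1,3)] subgroup.m_closed[OF subgroup_\<Gamma>\<^sub>1 g(1,3)] by (metis imageI)
qed

lemma \<epsilon>_iso: "\<epsilon> \<in> iso (\<Gamma>\<lparr>carrier := \<Gamma>\<^sub>1\<rparr>) (\<Lambda>\<lparr>carrier := \<epsilon> ` \<Gamma>\<^sub>1\<rparr>)"
  using \<epsilon>_mult \<epsilon>_inj by (auto simp: iso_def hom_def bij_betw_def)

end

lemma AE_in_image:
  assumes g: "mp_map N M g" and fg: "AE y in N. f (g y) = y" and P: "AE x in M. x \<in> A"
  shows "AE y in N. y \<in> f ` A"
  using mp_map_AE[OF g P] fg
proof eventually_elim
  case (elim y)
  then show ?case by (metis imageI)
qed

context orbit_equivalent_actions
begin

lemma ergodic_completion_\<nu>: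
  assumes C: "C \<in> sets (completion \<nu>)"
    and inv: "\<And>l y. \<lbrakk>l \<in> carrier \<Lambda>; y \<in> space (completion \<nu>)\<rbrakk> \<Longrightarrow> \<beta> l y \<in> C \<longleftrightarrow> y \<in> C"
    and nz: "emeasure (completion \<nu>) C \<noteq> 0"
  shows "AE y in completion \<nu>. y \<in> C"
proof -
  define A where "A = main_part \<nu> C"
  have A: "A \<in> sets \<nu>" using C by (simp add: A_def)
  have AC: "AE y in \<nu>. y \<in> A \<longleftrightarrow> y \<in> C" unfolding A_def by (rule AE_in_main_part[OF C])
  have "invariant_set \<Lambda> \<nu> \<beta> A"
    unfolding invariant_set_def
  proof
    fix l assume l: "l \<in> carrier \<Lambda>"
    show "AE y in \<nu>. \<beta> l y \<in> A \<longleftrightarrow> y \<in> A"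
      using AC mp_map_AE[OF mp_\<beta>_map[OF l] AC] AE_space
      by eventually_elim (use inv[OF l] in simp)
  qed
  moreover have "emeasure \<nu> A \<noteq> 0" using nz C by (simp add: A_def)
  ultimately have "emeasure \<nu> (space \<nu> - A) = 0" using ergodic_\<beta> A by (auto simp: ergodic_action_def)
  then have "space \<nu> - A \<in> null_sets \<nu>" using A by auto
  then have "AE y in \<nu>. y \<notin> space \<nu> - A" by (rule AE_not_in)
  then have "AE y in \<nu>. y \<in> C" using AC AE_space by eventually_elim auto
  then show ?thesis by (rule AE_completion)
qed

end

section \<open>Extension within the orbits and the resulting conjugacy\<close>

context untwisted_orbit_equivalence
begin

text \<open>The image of \<open>Xb\<close> under \<open>\<theta>\<close>, written through the
  inverse \<open>\<theta>'\<close> so that it is a preimage and therefore measurable.\<close>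

definition D where "D = {y \<in> space \<nu>. \<theta>' y \<in> Xb \<and> \<theta> (\<theta>' y) = y}"

lemma D_sets: "D \<in> sets (completion \<nu>)"
proof -
  have "\<theta>' -` Xb \<inter> space (completion \<nu>) \<in> sets (completion \<nu>)"
    by (rule measurable_sets[OF mp_map_completion(1)[OF mp_\<theta>'] Xb_sets])
  then have "\<theta>' -` Xb \<inter> space (completion \<nu>) \<inter> {y \<in> space \<nu>. \<theta> (\<theta>' y) = y} \<in> sets (completion \<nu>)"
    by (rule sets.Int[OF _ AE_completion_sets[OF \<theta>_\<theta>']])
  also have "\<theta>' -` Xb \<inter> space (completion \<nu>) \<inter> {y \<in> space \<nu>. \<theta> (\<theta>' y) = y} = D"
    by (auto simp: D_def)
  finally show ?thesis .
qed

lemma D_Collect: "{y \<in> space \<nu>. y \<in> D} = D"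
  by (auto simp: D_def)

lemma \<theta>_D_iff: "x \<in> X\<^sub>0 \<Longrightarrow> \<theta> x \<in> D \<longleftrightarrow> x \<in> Xb"
  using \<theta>_space[of x] \<theta>'_\<theta>_X\<^sub>0[of x] by (auto simp: D_def)

lemma D_image: "D = \<theta> ` Xb"
proof (rule equalityI; rule subsetI)
  fix y assume "y \<in> D"
  then show "y \<in> \<theta> ` Xb" by (auto simp: D_def intro: image_eqI[of _ _ "\<theta>' y"])
next
  fix y assume "y \<in> \<theta> ` Xb"
  then show "y \<in> D" using \<theta>_D_iff Xb_X\<^sub>0 by blast
qed

lemma emeasure_D: "emeasure (completion \<nu>) D = emeasure M base"
proof -
  have "emeasure (completion \<nu>) D = emeasure (distr (completion \<mu>) (completion \<nu>) \<theta>) D"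
    by (simp only: mp_map_completion(2)[OF mp_\<theta>])
  also have "\<dots> = emeasure (completion \<mu>) (\<theta> -` D \<inter> space (completion \<mu>))"
    by (rule emeasure_distr[OF mp_map_completion(1)[OF mp_\<theta>] D_sets])
  also have "\<dots> = emeasure (completion \<mu>) Xb"
  proof (rule emeasure_eq_AE)
    show "AE x in completion \<mu>. x \<in> \<theta> -` D \<inter> space (completion \<mu>) \<longleftrightarrow> x \<in> Xb"
      using AE_completion[OF AE_X\<^sub>0] by eventually_elim (use \<theta>_D_iff X\<^sub>0_space in auto)
  qed (intro measurable_sets[OF mp_map_completion(1)[OF mp_\<theta>] D_sets] Xb_sets)+
  finally show ?thesis by (simp only: emeasure_Xb)
qed

definition t\<^sub>1 where "t\<^sub>1 y = (if y \<in> D then inv\<^bsub>\<Lambda>\<^esub> \<psi> (\<theta>' y) else \<one>\<^bsub>\<Lambda>\<^esub>)"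

lemma t\<^sub>1_measurable: "t\<^sub>1 \<in> measurable (completion \<nu>) (count_space (carrier \<Lambda>))"
proof -
  let ?C = "count_space (carrier \<Lambda>)"
  \<comment> \<open>\<open>\<psi>\<close> is measurable only on the restricted space
    \<open>M\<close>, so it is extended by 1 before being composed with
    \<open>\<theta>'\<close>.\<close>
  let ?\<psi> = "\<lambda>x. if x \<in> X\<^sub>0 then \<psi> x else \<one>\<^bsub>\<Lambda>\<^esub>"
  have "?\<psi> \<in> measurable (completion \<mu>) ?C"
    using \<psi>_measurable measurable_restrict_space_iff[OF X\<^sub>0_Int, of "\<one>\<^bsub>\<Lambda>\<^esub>" ?C \<psi>] by (simp add: M_def)
  from measurable_compose[OF mp_map_completion(1)[OF mp_\<theta>'] this]
  have 1: "(\<lambda>y. ?\<psi> (\<theta>' y)) \<in> measurable (completion \<nu>) ?C" .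
  have 2: "(\<lambda>l. inv\<^bsub>\<Lambda>\<^esub> l) \<in> measurable ?C ?C" by auto
  have 3: "{y \<in> space (completion \<nu>). y \<in> D} \<in> sets (completion \<nu>)" using D_sets by (simp add: D_Collect)
  have "(\<lambda>y. if y \<in> D then inv\<^bsub>\<Lambda>\<^esub> (?\<psi> (\<theta>' y)) else \<one>\<^bsub>\<Lambda>\<^esub>) \<in> measurable (completion \<nu>) ?C"
    by (rule measurable_If[OF measurable_compose[OF 1 2] _ 3]) simp
  also have "(\<lambda>y. if y \<in> D then inv\<^bsub>\<Lambda>\<^esub> (?\<psi> (\<theta>' y)) else \<one>\<^bsub>\<Lambda>\<^esub>) = t\<^sub>1"
    using Xb_X\<^sub>0 by (auto simp: t\<^sub>1_def D_def fun_eq_iff)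
  finally show ?thesis .
qed

lemma t\<^sub>1_\<theta>: "x \<in> Xb \<Longrightarrow> \<beta> (t\<^sub>1 (\<theta> x)) (\<theta> x) = \<rho>\<^sub>1 x"
  using \<theta>_D_iff[OF Xb_X\<^sub>0, of x] \<theta>'_\<theta>_X\<^sub>0[OF Xb_X\<^sub>0, of x] by (simp add: t\<^sub>1_def \<rho>\<^sub>1_def)

text \<open>The case \<open>l = 1\<close> of the orbit lemma: two points with equal image differ by
  an element of the kernel of \<open>\<epsilon>\<close>.\<close>

lemma \<rho>\<^sub>1_inj: "inj_on \<rho>\<^sub>1 Xb"
proof (rule inj_onI)
  fix x x' assume x: "x \<in> Xb" and x': "x' \<in> Xb" and eq: "\<rho>\<^sub>1 x = \<rho>\<^sub>1 x'"
  note x0 = Xb_X\<^sub>0[OF x]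
  have "\<rho>\<^sub>1 x \<in> space (completion \<nu>)"
    unfolding \<rho>\<^sub>1_def by (rule Y.b_closed) (use \<psi>_closed[OF x0] \<theta>_space[OF x0] in auto)
  then have "\<beta> \<one>\<^bsub>\<Lambda>\<^esub> (\<rho>\<^sub>1 x) = \<rho>\<^sub>1 x'" using Y.b_one eq by simp
  from \<rho>\<^sub>1_orbit[OF x x' Y.L.one_closed this] obtain g where
    g: "g \<in> \<Gamma>\<^sub>1" "x' = \<alpha> g x" "\<one>\<^bsub>\<Lambda>\<^esub> = \<epsilon> g" by blast
  have "g = \<one>\<^bsub>\<Gamma>\<^esub>" by (rule \<epsilon>_kernel[OF g(1) g(3)[symmetric]])
  then show "x = x'" using g(2) \<alpha>_one[OF X\<^sub>0_space[OF x0]] by simp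
qed

lemma t\<^sub>1_inj: "inj_on (\<lambda>y. \<beta> (t\<^sub>1 y) y) D"
proof (rule inj_onI)
  fix y z assume "y \<in> D" "z \<in> D" and eq: "\<beta> (t\<^sub>1 y) y = \<beta> (t\<^sub>1 z) z"
  then obtain x x' where x: "x \<in> Xb" "y = \<theta> x" "x' \<in> Xb" "z = \<theta> x'" unfolding D_image by blast
  have "\<rho>\<^sub>1 x = \<rho>\<^sub>1 x'" using eq unfolding x(2,4) t\<^sub>1_\<theta>[OF x(1)] t\<^sub>1_\<theta>[OF x(3)] .
  then have "x = x'" by (rule inj_onD[OF \<rho>\<^sub>1_inj _ x(1,3)])
  then show "y = z" using x by simp
qed

definition D' where "D' = \<rho>\<^sub>1 ` Xb"

lemma D'_image: "D' = (\<lambda>y. \<beta> (t\<^sub>1 y) y) ` D"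
  unfolding D_image D'_def image_image using t\<^sub>1_\<theta> by (intro image_cong) auto

lemma D'_sets: "D' \<in> sets (completion \<nu>)"
  and emeasure_D': "emeasure (completion \<nu>) D' = emeasure M base"
  unfolding D'_image
  using Y.piecewise_image[OF t\<^sub>1_measurable D_sets t\<^sub>1_inj] emeasure_D by simp_all

lemma D'_invariant:
  assumes g: "g \<in> \<Gamma>\<^sub>1" and y: "y \<in> space \<nu>"
  shows "\<beta> (\<epsilon> g) y \<in> D' \<longleftrightarrow> y \<in> D'"
proof -
  have step: "\<beta> (\<epsilon> h) z \<in> D'" if h: "h \<in> \<Gamma>\<^sub>1" and z: "z \<in> D'" for h z
  proof -
    obtain x where x: "x \<in> Xb" "z = \<rho>\<^sub>1 x" using z by (auto simp: D'_def)
    have "\<beta> (\<epsilon> h) z = \<rho>\<^sub>1 (\<alpha> h x)" unfolding x(2) by (rule \<rho>\<^sub>1_equivariant[OF h x(1), symmetric])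
    then show ?thesis using Xb_invariant[OF h x(1)] by (simp add: D'_def)
  qed
  show ?thesis
  proof
    assume a: "\<beta> (\<epsilon> g) y \<in> D'"
    have ig: "inv\<^bsub>\<Gamma>\<^esub> g \<in> \<Gamma>\<^sub>1" by (rule subgroup.m_inv_closed[OF subgroup_\<Gamma>\<^sub>1 g])
    have "\<beta> (\<epsilon> (inv\<^bsub>\<Gamma>\<^esub> g)) (\<beta> (\<epsilon> g) y) = y"
      unfolding \<epsilon>_inv[OF g] by (rule Y.b_inv_cancel(2)) (use \<epsilon>_closed[OF g] y in auto)
    then show "y \<in> D'" using step[OF ig a] by simp
  qed (rule step[OF g])
qed

text \<open>Translate \<open>D'\<close> by the inverses of coset representatives. By the orbit lemma
  translates for distinct cosets are disjoint; all have the measure of the atom, so there are at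
  most its reciprocal many cosets.\<close>

lemma finite_index_\<Lambda>\<^sub>1: "finite (rcosets\<^bsub>\<Lambda>\<^esub> (\<epsilon> ` \<Gamma>\<^sub>1))"
proof -
  let ?R = "rcosets\<^bsub>\<Lambda>\<^esub> (\<epsilon> ` \<Gamma>\<^sub>1)"
  have "\<forall>C\<in>?R. \<exists>l. l \<in> carrier \<Lambda> \<and> C = \<epsilon> ` \<Gamma>\<^sub>1 #>\<^bsub>\<Lambda>\<^esub> l" by (auto simp: RCOSETS_def)
  from bchoice[OF this] obtain f where f: "\<forall>C\<in>?R. f C \<in> carrier \<Lambda> \<and> C = \<epsilon> ` \<Gamma>\<^sub>1 #>\<^bsub>\<Lambda>\<^esub> f C" ..
  define S where "S C = \<beta> (inv\<^bsub>\<Lambda>\<^esub> f C) ` D'" for C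
  have S: "S C \<in> sets (completion \<nu>)" "emeasure (completion \<nu>) (S C) = emeasure M base" if "C \<in> ?R" for C
    using Y.b_image[OF _ D'_sets, of "inv\<^bsub>\<Lambda>\<^esub> f C"] f that emeasure_D' by (auto simp: S_def)
  have disj: "C = C'" if C: "C \<in> ?R" and C': "C' \<in> ?R" and ne: "S C \<inter> S C' \<noteq> {}" for C C'
  proof -
    obtain z where "z \<in> S C" "z \<in> S C'" using ne by blast
    then obtain x x' where x: "x \<in> Xb" "x' \<in> Xb" "\<beta> (inv\<^bsub>\<Lambda>\<^esub> f C) (\<rho>\<^sub>1 x) = \<beta> (inv\<^bsub>\<Lambda>\<^esub> f C') (\<rho>\<^sub>1 x')"
      unfolding S_def D'_def by auto
    have fc: "f C \<in> carrier \<Lambda>" "f C' \<in> carrier \<Lambda>" using f C C' by auto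
    have sp: "\<rho>\<^sub>1 y \<in> space (completion \<nu>)" if "y \<in> Xb" for y
      using sets.sets_into_space[OF D'_sets] that by (auto simp: D'_def)
    have "\<beta> (f C' \<otimes>\<^bsub>\<Lambda>\<^esub> inv\<^bsub>\<Lambda>\<^esub> f C) (\<rho>\<^sub>1 x) = \<beta> (f C') (\<beta> (inv\<^bsub>\<Lambda>\<^esub> f C) (\<rho>\<^sub>1 x))"
      by (rule Y.b_mult) (use fc sp[OF x(1)] in auto)
    also have "\<dots> = \<rho>\<^sub>1 x'" unfolding x(3) by (rule Y.b_inv_cancel(1)[OF fc(2) sp[OF x(2)]])
    finally have "\<beta> (f C' \<otimes>\<^bsub>\<Lambda>\<^esub> inv\<^bsub>\<Lambda>\<^esub> f C) (\<rho>\<^sub>1 x) = \<rho>\<^sub>1 x'" .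
    then obtain g where g: "g \<in> \<Gamma>\<^sub>1" "f C' \<otimes>\<^bsub>\<Lambda>\<^esub> inv\<^bsub>\<Lambda>\<^esub> f C = \<epsilon> g"
      using \<rho>\<^sub>1_orbit[OF x(1,2), of "f C' \<otimes>\<^bsub>\<Lambda>\<^esub> inv\<^bsub>\<Lambda>\<^esub> f C"] fc by blast
    have "f C' = \<epsilon> g \<otimes>\<^bsub>\<Lambda>\<^esub> f C" unfolding g(2)[symmetric] using fc by (simp add: Y.L.m_assoc)
    then have "f C' \<in> \<epsilon> ` \<Gamma>\<^sub>1 #>\<^bsub>\<Lambda>\<^esub> f C" using g(1) by (auto simp: r_coset_def)
    from Y.L.repr_independence[OF this fc(1) subgroup_\<Lambda>\<^sub>1] show "C = C'" using f C C' by metis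
  qed
  have pos: "measure M base > 0" by (rule atom_pos)
  obtain k :: nat where k: "1 / measure M base < real k" using reals_Archimedean2 by blast
  have "card F \<le> k" if F: "F \<subseteq> ?R" "finite F" for F
  proof -
    have "(\<Sum>C\<in>F. emeasure (completion \<nu>) (S C)) = emeasure (completion \<nu>) (\<Union>C\<in>F. S C)"
    proof (rule sum_emeasure[OF _ _ F(2)])
      show "S ` F \<subseteq> sets (completion \<nu>)" using S(1) F(1) by blast
      show "disjoint_family_on S F" unfolding disjoint_family_on_def using disj F(1) by blast
    qed
    also have "\<dots> \<le> 1" by (rule Y.measure_le_1)
    also have "(\<Sum>C\<in>F. emeasure (completion \<nu>) (S C)) = (\<Sum>C\<in>F. emeasure M base)"
      by (rule sum.cong) (use S(2) F(1) in auto)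
    also have "\<dots> = ennreal (real (card F) * measure M base)"
      by (simp add: pc.emeasure_eq_measure ennreal_mult ennreal_of_nat_eq_real_of_nat)
    finally have "real (card F) * measure M base \<le> 1" by simp
    then have "real (card F) \<le> 1 / measure M base" using pos by (simp add: field_simps)
    then show "card F \<le> k" using k by linarith
  qed
  then show ?thesis using finite_if_finite_subsets_card_bdd[of ?R k] by blast
qed

text \<open>\<open>\<rho>\<^sub>1\<close> preserves measure, so the complements of \<open>D\<close>
  and \<open>D'\<close> have equal measure, and ergodicity of \<open>\<Lambda>\<close> supplies a
  piecewise translation between them. Both pieces translate by elements of \<open>\<Lambda>\<close>,
  so the glued map stays in the orbits at every point.\<close>

lemma untwisting_automorphism:
  obtains \<tau> Y' where "prob_iso \<nu> \<nu> \<tau>" "\<And>y. y \<in> space \<nu> \<Longrightarrow> \<tau> y \<in> orbit \<Lambda> \<beta> y"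
    "AE y in \<nu>. y \<in> Y'" "Y' \<subseteq> space \<nu>" "inj_on \<tau> Y'" "\<And>x. x \<in> Xb \<Longrightarrow> \<tau> (\<theta> x) = \<rho>\<^sub>1 x"
    "\<And>x. \<lbrakk>x \<in> X\<^sub>0; \<theta> x \<in> Y'\<rbrakk> \<Longrightarrow> \<tau> (\<theta> x) \<in> D' \<longleftrightarrow> x \<in> Xb"
proof -
  let ?N = "completion \<nu>"
  note D = D_sets and D' = D'_sets
  have "emeasure ?N (space ?N - D) = emeasure ?N (space ?N) - emeasure ?N D"
    by (rule emeasure_compl[OF D]) (simp add: Y.emeasure_eq_measure del: emeasure_completion)
  also have "\<dots> = emeasure ?N (space ?N) - emeasure ?N D'" by (simp only: emeasure_D emeasure_D')
  also have "\<dots> = emeasure ?N (space ?N - D')"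
    by (rule emeasure_compl[OF D', symmetric]) (simp add: Y.emeasure_eq_measure del: emeasure_completion)
  finally have eq: "emeasure ?N (space ?N - D) = emeasure ?N (space ?N - D')" .
  have s: "space ?N - D \<in> sets ?N" "space ?N - D' \<in> sets ?N" using D D' by blast+
  obtain t\<^sub>2 A where t\<^sub>2: "t\<^sub>2 \<in> measurable ?N (count_space (carrier \<Lambda>))" and A: "A \<in> sets ?N" "A \<subseteq> space ?N - D"
    and AEA: "AE y in ?N. y \<in> space ?N - D \<longrightarrow> y \<in> A" and inj2: "inj_on (\<lambda>y. \<beta> (t\<^sub>2 y) y) A"
    and im2: "\<And>y. y \<in> A \<Longrightarrow> \<beta> (t\<^sub>2 y) y \<in> space ?N - D'"
  proof (rule Y.partial_isomorphism_between[OF s eq])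
    fix C assume "C \<in> sets ?N" "\<And>l y. \<lbrakk>l \<in> carrier \<Lambda>; y \<in> space ?N\<rbrakk> \<Longrightarrow> \<beta> l y \<in> C \<longleftrightarrow> y \<in> C"
      "emeasure ?N C \<noteq> 0"
    then show "AE y in ?N. y \<in> C" by (rule ergodic_completion_\<nu>)
  qed (rule that)
  define t where "t y = (if y \<in> D then t\<^sub>1 y else t\<^sub>2 y)" for y
  have t: "t \<in> measurable ?N (count_space (carrier \<Lambda>))"
    unfolding t_def by (rule measurable_If[OF t\<^sub>1_measurable t\<^sub>2]) (use D in \<open>simp add: D_Collect\<close>)
  define \<tau> where "\<tau> y = \<beta> (t y) y" for y
  define Y' where "Y' = D \<union> A"
  have \<tau>1: "\<tau> y = \<beta> (t\<^sub>1 y) y" if "y \<in> D" for y using that by (simp add: \<tau>_def t_def)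
  have \<tau>2: "\<tau> y = \<beta> (t\<^sub>2 y) y" if "y \<in> A" for y using that A(2) by (auto simp: \<tau>_def t_def)
  have \<tau>D': "\<tau> y \<in> D'" if "y \<in> D" for y using that \<tau>1 by (auto simp: D'_image)
  have \<tau>nD': "\<tau> y \<notin> D'" if "y \<in> A" for y using im2[OF that] \<tau>2[OF that] by simp
  have Y': "Y' \<in> sets ?N" "Y' \<subseteq> space \<nu>"
    using D A sets.sets_into_space[OF D] unfolding Y'_def by auto
  have AEY: "AE y in ?N. y \<in> Y'"
    using AEA AE_space by eventually_elim (auto simp: Y'_def)
  \<comment> \<open>\<open>D'\<close> separates the images of the two pieces, so injectivity may be
    checked on each piece.\<close>
  have inj: "inj_on \<tau> Y'"
  proof (rule inj_onI)
    fix y z assume y: "y \<in> Y'" and z: "z \<in> Y'" and e: "\<tau> y = \<tau> z"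
    show "y = z"
    proof (cases "\<tau> y \<in> D'")
      case True
      then have "\<tau> z \<in> D'" using e by simp
      then have yD: "y \<in> D" and zD: "z \<in> D"
        using y z True \<tau>nD'[of y] \<tau>nD'[of z] unfolding Y'_def by blast+
      have "\<beta> (t\<^sub>1 y) y = \<beta> (t\<^sub>1 z) z" using e unfolding \<tau>1[OF yD] \<tau>1[OF zD] .
      from inj_onD[OF t\<^sub>1_inj this yD zD] show ?thesis .
    next
      case False
      then have "\<tau> z \<notin> D'" using e by simp
      then have yA: "y \<in> A" and zA: "z \<in> A"
        using y z False \<tau>D'[of y] \<tau>D'[of z] unfolding Y'_def by blast+
      have "\<beta> (t\<^sub>2 y) y = \<beta> (t\<^sub>2 z) z" using e unfolding \<tau>2[OF yA] \<tau>2[OF zA] .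
      from inj_onD[OF inj2 this yA zA] show ?thesis .
    qed
  qed
  have iso: "prob_iso \<nu> \<nu> \<tau>"
  proof -
    note pa = Y.piecewise_automorphism[OF t Y'(1) AEY inj[unfolded \<tau>_def]]
    obtain g where g: "g \<in> measurable ?N ?N" "distr ?N ?N g = ?N"
      "AE y in ?N. g (\<tau> y) = y" "AE y in ?N. \<tau> (g y) = y"
      using pa(2) unfolding \<tau>_def by blast
    have "mp_map \<nu> \<nu> g" by (rule mp_mapI[OF g(1,2)])
    moreover have "mp_map \<nu> \<nu> \<tau>"
      unfolding \<tau>_def by (rule mp_mapI[OF Y.piecewise_measurable[OF t] pa(1)])
    ultimately show ?thesis using g(3,4) prob_\<nu> unfolding prob_iso_def AE_completion_iff by blast
  qed
  have orb: "\<tau> y \<in> orbit \<Lambda> \<beta> y" if "y \<in> space \<nu>" for y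
    using Y.t_closed[OF t, of y] that by (auto simp: \<tau>_def orbit_def)
  have AEY': "AE y in \<nu>. y \<in> Y'" using AEY by (simp only: AE_completion_iff)
  have r1: "\<tau> (\<theta> x) = \<rho>\<^sub>1 x" if "x \<in> Xb" for x
    using t\<^sub>1_\<theta>[OF that] \<tau>1[of "\<theta> x"] that by (simp add: D_image)
  have iff: "\<tau> (\<theta> x) \<in> D' \<longleftrightarrow> x \<in> Xb" if x: "x \<in> X\<^sub>0" "\<theta> x \<in> Y'" for x
  proof
    assume "\<tau> (\<theta> x) \<in> D'"
    then have "\<theta> x \<in> D" using x(2) \<tau>nD' unfolding Y'_def by auto
    then show "x \<in> Xb" using \<theta>_D_iff[OF x(1)] by simp
  next
    assume "x \<in> Xb"
    then show "\<tau> (\<theta> x) \<in> D'" using r1 by (simp add: D'_def)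
  qed
  show thesis by (rule that[OF iso orb AEY' Y'(2) inj r1 iff])
qed

lemma virtual_conjugacy:
  "\<exists>\<tau> \<Gamma>\<^sub>1 \<Lambda>\<^sub>1 X\<^sub>1 Y\<^sub>1.
    prob_iso \<nu> \<nu> \<tau> \<and> (AE y in \<nu>. \<tau> y \<in> orbit \<Lambda> \<beta> y) \<and>
    finite_index_subgroup \<Gamma>\<^sub>1 \<Gamma> \<and> finite_index_subgroup \<Lambda>\<^sub>1 \<Lambda> \<and>
    ergodic_component (\<Gamma>\<lparr>carrier := \<Gamma>\<^sub>1\<rparr>) \<mu> \<alpha> X\<^sub>1 \<and>
    ergodic_component (\<Lambda>\<lparr>carrier := \<Lambda>\<^sub>1\<rparr>) \<nu> \<beta> Y\<^sub>1 \<and>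
    image_mod_null \<mu> \<nu> (\<tau> \<circ> \<theta>) X\<^sub>1 Y\<^sub>1 \<and>
    conjugacy (\<Gamma>\<lparr>carrier := \<Gamma>\<^sub>1\<rparr>) (uniform_measure \<mu> X\<^sub>1) \<alpha>
              (\<Lambda>\<lparr>carrier := \<Lambda>\<^sub>1\<rparr>) (uniform_measure \<nu> Y\<^sub>1) \<beta> (\<tau> \<circ> \<theta>)"
proof -
  let ?G = "pc.stab m b" and ?L = "\<epsilon> ` pc.stab m b"
  obtain \<tau> Y' where iso: "prob_iso \<nu> \<nu> \<tau>" and orb: "\<And>y. y \<in> space \<nu> \<Longrightarrow> \<tau> y \<in> orbit \<Lambda> \<beta> y"
    and AEY: "AE y in \<nu>. y \<in> Y'" and Y': "Y' \<subseteq> space \<nu>" and inj: "inj_on \<tau> Y'"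
    and r1: "\<And>x. x \<in> Xb \<Longrightarrow> \<tau> (\<theta> x) = \<rho>\<^sub>1 x"
    and iff: "\<And>x. \<lbrakk>x \<in> X\<^sub>0; \<theta> x \<in> Y'\<rbrakk> \<Longrightarrow> \<tau> (\<theta> x) \<in> D' \<longleftrightarrow> x \<in> Xb"
    by (rule untwisting_automorphism) blast
  define \<rho> where "\<rho> x = \<tau> (\<theta> x)" for x
  obtain \<tau>' where \<tau>': "mp_map \<nu> \<nu> \<tau>'" "AE y in \<nu>. \<tau>' (\<tau> y) = y" "AE y in \<nu>. \<tau> (\<tau>' y) = y"
    and mp_\<tau>: "mp_map \<nu> \<nu> \<tau>" using iso unfolding prob_iso_def by blast
  have mp_\<rho>: "mp_map \<mu> \<nu> \<rho>" unfolding \<rho>_def by (rule mp_map_comp[OF mp_\<theta> mp_\<tau>])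
  define \<rho>' where "\<rho>' y = \<theta>' (\<tau>' y)" for y
  have mp_\<rho>': "mp_map \<nu> \<mu> \<rho>'" unfolding \<rho>'_def by (rule mp_map_comp[OF \<tau>'(1) mp_\<theta>'])
  have \<rho>'_\<rho>: "AE x in \<mu>. \<rho>' (\<rho> x) = x"
    using mp_map_AE[OF mp_\<theta> \<tau>'(2)] \<theta>'_\<theta> by eventually_elim (simp add: \<rho>_def \<rho>'_def)
  have \<rho>_\<rho>': "AE y in \<nu>. \<rho> (\<rho>' y) = y"
    using mp_map_AE[OF \<tau>'(1) \<theta>_\<theta>'] \<tau>'(3) by eventually_elim (simp add: \<rho>_def \<rho>'_def)
  have iso_\<rho>: "prob_iso \<mu> \<nu> \<rho>"
    unfolding prob_iso_def using prob_\<mu> prob_\<nu> mp_\<rho> mp_\<rho>' \<rho>'_\<rho> \<rho>_\<rho>' by blast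
  \<comment> \<open>\<open>base\<close> and \<open>D'\<close> are measurable only for the
    completions; ergodic components have to be sets of \<open>\<mu>\<close> and
    \<open>\<nu>\<close>, hence the main parts.\<close>
  define X1 where "X1 = main_part \<mu> base"
  define Y1 where "Y1 = main_part \<nu> D'"
  have X1: "X1 \<in> sets \<mu>" and Y1: "Y1 \<in> sets \<nu>"
    using base_sets D'_sets by (simp_all add: X1_def Y1_def)
  have X1b: "AE x in \<mu>. x \<in> X1 \<longleftrightarrow> x \<in> base" unfolding X1_def by (rule AE_in_main_part[OF base_sets])
  have Y1D: "AE y in \<nu>. y \<in> Y1 \<longleftrightarrow> y \<in> D'" unfolding Y1_def by (rule AE_in_main_part[OF D'_sets])
  have X1e: "emeasure \<mu> X1 = emeasure M base"
    using base_sets emeasure_M[of base] base_X\<^sub>0 by (simp add: X1_def subset_iff)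
  have Y1e: "emeasure \<nu> Y1 = emeasure M base" using emeasure_D' D'_sets by (simp add: Y1_def)
  have X1p: "emeasure \<mu> X1 \<noteq> 0" and Y1p: "emeasure \<nu> Y1 \<noteq> 0"
    using X1e Y1e emeasure_base by simp_all
  have XY: "AE x in \<mu>. x \<in> X1 \<longleftrightarrow> \<rho> x \<in> Y1"
    using X1b AE_Xb mp_map_AE[OF mp_\<rho> Y1D] AE_X\<^sub>0 mp_map_AE[OF mp_\<theta> AEY]
    by eventually_elim (simp add: \<rho>_def iff)
  have AEbase: "AE x in \<mu>. x \<in> X1 \<longrightarrow> P x" if "AE x in M. x \<in> base \<longrightarrow> P x" for P
    using that[unfolded AE_M] X1b by eventually_elim simp
  have equiv: "\<rho> (\<alpha> g x) = \<beta> (\<epsilon> g) (\<rho> x)" if "g \<in> ?G" "x \<in> Xb" for g x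
    unfolding \<rho>_def r1[OF that(2)] r1[OF Xb_invariant[OF that]] by (rule \<rho>\<^sub>1_equivariant[OF that])
  have AE\<rho>: "AE x in \<mu>. x \<in> X1 \<longrightarrow> \<rho> (\<alpha> g x) = \<beta> (\<epsilon> g) (\<rho> x)" if g: "g \<in> ?G" for g
    using X1b AE_Xb by eventually_elim (use equiv[OF g] in simp)

  have fiG: "finite_index_subgroup ?G \<Gamma>"
  proof -
    obtain x where "x \<in> base" by (rule base_element)
    then show ?thesis using subgroup_\<Gamma>\<^sub>1 pc.finite_index_stab by (auto simp: finite_index_subgroup_def)
  qed
  have fiL: "finite_index_subgroup ?L \<Lambda>"
    using subgroup_\<Lambda>\<^sub>1 finite_index_\<Lambda>\<^sub>1 by (simp add: finite_index_subgroup_def)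

  have ecX: "ergodic_component (\<Gamma>\<lparr>carrier := ?G\<rparr>) \<mu> \<alpha> X1"
    unfolding ergodic_component_def
  proof (intro conjI X1)
    show "0 < emeasure \<mu> X1" using X1p by (simp add: zero_less_iff_neq_zero)
    show "invariant_set (\<Gamma>\<lparr>carrier := ?G\<rparr>) \<mu> \<alpha> X1"
      unfolding invariant_set_def
    proof
      fix g assume "g \<in> carrier (\<Gamma>\<lparr>carrier := ?G\<rparr>)"
      then have g: "g \<in> ?G" by simp
      show "AE x in \<mu>. \<alpha> g x \<in> X1 \<longleftrightarrow> x \<in> X1"
        using X1b mp_map_AE[OF mp_\<alpha>_map[OF \<Gamma>\<^sub>1_carrier[OF g]] X1b] AE_X\<^sub>0
        by eventually_elim (use pc.stab_mem_iff[OF g] in \<open>simp add: space_M\<close>)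
    qed
    show "ergodic_action (\<Gamma>\<lparr>carrier := ?G\<rparr>) (uniform_measure \<mu> X1) \<alpha>"
      unfolding ergodic_action_def
    proof (intro ballI impI)
      fix A assume "A \<in> sets (uniform_measure \<mu> X1)"
        and inv: "invariant_set (\<Gamma>\<lparr>carrier := ?G\<rparr>) (uniform_measure \<mu> X1) \<alpha> A"
      then have A: "A \<in> sets \<mu>" by simp
      have inv': "AE x in \<mu>. x \<in> X1 \<longrightarrow> (\<alpha> g x \<in> A \<longleftrightarrow> x \<in> A)" if g: "g \<in> ?G" for g
      proof -
        have "AE x in uniform_measure \<mu> X1. \<alpha> g x \<in> A \<longleftrightarrow> x \<in> A"
          using inv g by (simp add: invariant_set_def)
        then show ?thesis
          using AE_uniform_measure[of \<mu> X1] X1p X1 prob_space.finite_measure[OF prob_\<mu>]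
          by (simp add: finite_measure.emeasure_finite less_top[symmetric])
      qed
      \<comment> \<open>The elements of \<open>\<Gamma>\<^sub>0\<close> in the stabilizer already
        act ergodically on the atom, hence so does the whole stabilizer.\<close>
      define B where "B = base \<inter> A"
      have Bm: "B \<in> sets M" using base_sets A base_X\<^sub>0 unfolding sets_M B_def by auto
      show "emeasure (uniform_measure \<mu> X1) A = 0 \<or>
          emeasure (uniform_measure \<mu> X1) (space (uniform_measure \<mu> X1) - A) = 0"
      proof (cases "emeasure M B = 0")
        case True
        then have "B \<in> null_sets M" using Bm by (rule null_setsI)
        then have "AE x in M. x \<notin> B" by (rule AE_not_in)
        then have "AE x in M. x \<in> base \<longrightarrow> x \<notin> A" by eventually_elim (auto simp: B_def)
        then have "AE x in \<mu>. x \<in> X1 \<longrightarrow> x \<notin> A" by (rule AEbase)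
        then show ?thesis using uniform_measure_null[OF X1 A] by blast
      next
        case False
        have "AE x in M. x \<in> base \<longrightarrow> x \<in> B"
        proof (rule pc.ergodic_atom[OF Bm _ False])
          show "B \<subseteq> base" by (simp add: B_def)
          fix h assume "h \<in> \<Gamma>\<^sub>0 \<inter> ?G"
          then have h: "h \<in> ?G" by simp
          show "AE x in M. x \<in> base \<longrightarrow> \<alpha> h x \<in> B \<longrightarrow> x \<in> B"
            unfolding AE_M using inv'[OF h] X1b by eventually_elim (auto simp: B_def)
        qed
        then have "AE x in M. x \<in> base \<longrightarrow> x \<notin> space \<mu> - A" by eventually_elim (auto simp: B_def)
        then have "AE x in \<mu>. x \<in> X1 \<longrightarrow> x \<notin> space \<mu> - A" by (rule AEbase)
        then show ?thesis using uniform_measure_null[OF X1 sets.Diff[OF sets.top A]] by simp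
      qed
    qed
  qed

  have ecY: "ergodic_component (\<Lambda>\<lparr>carrier := ?L\<rparr>) \<nu> \<beta> Y1"
    unfolding ergodic_component_def
  proof (intro conjI Y1)
    show "0 < emeasure \<nu> Y1" using Y1p by (simp add: zero_less_iff_neq_zero)
    show "invariant_set (\<Lambda>\<lparr>carrier := ?L\<rparr>) \<nu> \<beta> Y1"
      unfolding invariant_set_def
    proof
      fix l assume "l \<in> carrier (\<Lambda>\<lparr>carrier := ?L\<rparr>)"
      then obtain g where g: "g \<in> ?G" "l = \<epsilon> g" by auto
      show "AE y in \<nu>. \<beta> l y \<in> Y1 \<longleftrightarrow> y \<in> Y1"
        unfolding g(2)
        using Y1D mp_map_AE[OF mp_\<beta>_map[OF \<epsilon>_closed[OF g(1)]] Y1D] AE_space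
        by eventually_elim (use D'_invariant[OF g(1)] in simp)
    qed
    show "ergodic_action (\<Lambda>\<lparr>carrier := ?L\<rparr>) (uniform_measure \<nu> Y1) \<beta>"
      unfolding ergodic_action_def
    proof (intro ballI impI)
      fix A assume "A \<in> sets (uniform_measure \<nu> Y1)"
        and inv: "invariant_set (\<Lambda>\<lparr>carrier := ?L\<rparr>) (uniform_measure \<nu> Y1) \<beta> A"
      then have A: "A \<in> sets \<nu>" by simp
      have inv': "AE x in \<mu>. x \<in> X1 \<longrightarrow> (\<beta> (\<epsilon> g) (\<rho> x) \<in> A \<longleftrightarrow> \<rho> x \<in> A)" if g: "g \<in> ?G" for g
      proof -
        have "AE y in uniform_measure \<nu> Y1. \<beta> (\<epsilon> g) y \<in> A \<longleftrightarrow> y \<in> A"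
          using inv g by (simp add: invariant_set_def)
        then have "AE y in \<nu>. y \<in> Y1 \<longrightarrow> (\<beta> (\<epsilon> g) y \<in> A \<longleftrightarrow> y \<in> A)"
          using AE_uniform_measure[of \<nu> Y1] Y1p Y1 prob_space.finite_measure[OF prob_\<nu>]
          by (simp add: finite_measure.emeasure_finite less_top[symmetric])
        from mp_map_AE[OF mp_\<rho> this] XY show ?thesis by eventually_elim simp
      qed
      \<comment> \<open>An invariant set in \<open>Y1\<close> is pulled back along
        \<open>\<rho>\<close>; equivariance makes the preimage invariant on the atom, where
        ergodicity is known.\<close>
      define B where "B = base \<inter> (\<rho> -` A \<inter> space \<mu>)"
      have "\<rho> -` A \<inter> space (completion \<mu>) \<in> sets (completion \<mu>)"
        by (rule measurable_sets[OF mp_map_completion(1)[OF mp_\<rho>]]) (use A in simp)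
      then have Bm: "B \<in> sets M" using base_sets base_X\<^sub>0 unfolding sets_M B_def by auto
      have push: "AE y in \<nu>. y \<in> Y1 \<longrightarrow> y \<notin> E" if "AE x in M. x \<in> base \<longrightarrow> \<rho> x \<notin> E" for E
      proof (rule AE_inverse_transfer[OF mp_\<rho>' \<rho>_\<rho>'])
        show "AE x in \<mu>. \<rho> x \<in> Y1 \<longrightarrow> \<rho> x \<notin> E" using AEbase[OF that] XY by eventually_elim simp
      qed
      show "emeasure (uniform_measure \<nu> Y1) A = 0 \<or>
          emeasure (uniform_measure \<nu> Y1) (space (uniform_measure \<nu> Y1) - A) = 0"
      proof (cases "emeasure M B = 0")
        case True
        then have "B \<in> null_sets M" using Bm by (rule null_setsI)
        then have "AE x in M. x \<notin> B" by (rule AE_not_in)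
        then have "AE x in M. x \<in> base \<longrightarrow> \<rho> x \<notin> A"
          using AE_space by eventually_elim (use X\<^sub>0_space in \<open>auto simp: B_def space_M\<close>)
        then show ?thesis using uniform_measure_null[OF Y1 A push] by blast
      next
        case False
        have "AE x in M. x \<in> base \<longrightarrow> x \<in> B"
        proof (rule pc.ergodic_atom[OF Bm _ False])
          show "B \<subseteq> base" by (simp add: B_def)
          fix h assume "h \<in> \<Gamma>\<^sub>0 \<inter> ?G"
          then have h: "h \<in> ?G" by simp
          show "AE x in M. x \<in> base \<longrightarrow> \<alpha> h x \<in> B \<longrightarrow> x \<in> B"
            unfolding AE_M using inv'[OF h] X1b AE\<rho>[OF h] AE_space by eventually_elim (auto simp: B_def)
        qed
        then have "AE x in M. x \<in> base \<longrightarrow> \<rho> x \<notin> space \<nu> - A" by eventually_elim (auto simp: B_def)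
        from uniform_measure_null[OF Y1 sets.Diff[OF sets.top A] push[OF this]] show ?thesis by simp
      qed
    qed
  qed

  have img: "image_mod_null \<mu> \<nu> \<rho> X1 Y1"
  proof -
    \<comment> \<open>A conull set on which \<open>\<rho>\<close> is injective and membership in
      \<open>X1\<close> corresponds exactly to membership of the image in \<open>Y1\<close>; then
      the identity between the images holds without exceptions.\<close>
    define X2 where "X2 = {x \<in> X\<^sub>0. \<theta> x \<in> Y' \<and> (x \<in> X1 \<longleftrightarrow> \<rho> x \<in> Y1)}"
    have AE2: "AE x in \<mu>. x \<in> X2"
      using AE_X\<^sub>0 mp_map_AE[OF mp_\<theta> AEY] XY by eventually_elim (simp add: X2_def)
    have sub: "X2 \<subseteq> space \<mu>" using X\<^sub>0_space by (auto simp: X2_def)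
    have "inj_on \<rho> X2"
    proof (rule inj_onI)
      fix x x' assume x: "x \<in> X2" "x' \<in> X2" and e: "\<rho> x = \<rho> x'"
      have "\<theta> x = \<theta> x'" by (rule inj_onD[OF inj]) (use x e in \<open>auto simp: X2_def \<rho>_def\<close>)
      then have "\<theta>' (\<theta> x) = \<theta>' (\<theta> x')" by (rule arg_cong)
      then show "x = x'" using x \<theta>'_\<theta>_X\<^sub>0 by (auto simp: X2_def)
    qed
    then have "bij_betw \<rho> X2 (\<rho> ` X2)" by (rule inj_on_imp_bij_betw)
    moreover have "AE y in \<nu>. y \<in> \<rho> ` X2" by (rule AE_in_image[OF mp_\<rho>' \<rho>_\<rho>' AE2])
    moreover have "\<rho> ` X2 \<subseteq> space \<nu>" using mp_map_space[OF mp_\<rho>] sub by blast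
    moreover have "\<rho> ` (X1 \<inter> X2) = Y1 \<inter> \<rho> ` X2" by (auto simp: X2_def)
    ultimately show ?thesis unfolding image_mod_null_def using sub AE2 by blast
  qed

  have conj: "conjugacy (\<Gamma>\<lparr>carrier := ?G\<rparr>) (uniform_measure \<mu> X1) \<alpha>
      (\<Lambda>\<lparr>carrier := ?L\<rparr>) (uniform_measure \<nu> Y1) \<beta> \<rho>"
    unfolding conjugacy_def
  proof (intro conjI bexI[OF _ \<epsilon>_iso] ballI)
    show "prob_iso (uniform_measure \<mu> X1) (uniform_measure \<nu> Y1) \<rho>"
      by (rule prob_iso_uniform_measure[OF iso_\<rho> X1 X1p Y1 Y1p XY])
    fix g assume "g \<in> carrier (\<Gamma>\<lparr>carrier := ?G\<rparr>)"
    then show "AE x in uniform_measure \<mu> X1. \<rho> (\<alpha> g x) = \<beta> (\<epsilon> g) (\<rho> x)"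
      by (intro AE_uniform_measure_of_AE[OF X1] AE\<rho>) simp
  qed
  have rho: "\<tau> \<circ> \<theta> = \<rho>" by (simp add: fun_eq_iff \<rho>_def)
  have "AE y in \<nu>. \<tau> y \<in> orbit \<Lambda> \<beta> y" by (rule AE_I2) (rule orb)
  then show ?thesis
    using iso fiG fiL ecX ecY img conj unfolding rho[symmetric] by blast
qed

end

theorem theoremA:
  fixes \<Gamma> :: "'g monoid" and \<Gamma>\<^sub>0 :: "'g set" and \<mu> :: "'x measure" and \<alpha> :: "'g \<Rightarrow> 'x \<Rightarrow> 'x"
    and \<Lambda> :: "'l monoid" and \<nu> :: "'y measure" and \<beta> :: "'l \<Rightarrow> 'y \<Rightarrow> 'y" and \<theta> :: "'x \<Rightarrow> 'y"
  assumes "group \<Gamma>" and "countable (carrier \<Gamma>)"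
    and "\<Gamma>\<^sub>0 \<lhd> \<Gamma>" and "infinite \<Gamma>\<^sub>0"
    and "relative_property_T \<Gamma> \<Gamma>\<^sub>0"
    and "finitely_generated_group (\<Gamma> Mod \<Gamma>\<^sub>0)"
    and "standard_prob_space \<mu>" and "mp_action \<Gamma> \<mu> \<alpha>"
    and "free_action \<Gamma> \<mu> \<alpha>" and "ergodic_action \<Gamma> \<mu> \<alpha>" and "profinite_action \<Gamma> \<mu> \<alpha>"
    and "ergodic_action (\<Gamma>\<lparr>carrier := \<Gamma>\<^sub>0\<rparr>) \<mu> \<alpha>"
    and "group \<Lambda>" and "countable (carrier \<Lambda>)"
    and "standard_prob_space \<nu>" and "mp_action \<Lambda> \<nu> \<beta>"
    and "free_action \<Lambda> \<nu> \<beta>" and "ergodic_action \<Lambda> \<nu> \<beta>"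
    and "orbit_equivalence \<Gamma> \<mu> \<alpha> \<Lambda> \<nu> \<beta> \<theta>"
  shows "\<exists>\<tau> \<Gamma>\<^sub>1 \<Lambda>\<^sub>1 X\<^sub>1 Y\<^sub>1.
    prob_iso \<nu> \<nu> \<tau> \<and> (AE y in \<nu>. \<tau> y \<in> orbit \<Lambda> \<beta> y) \<and>
    finite_index_subgroup \<Gamma>\<^sub>1 \<Gamma> \<and> finite_index_subgroup \<Lambda>\<^sub>1 \<Lambda> \<and>
    ergodic_component (\<Gamma>\<lparr>carrier := \<Gamma>\<^sub>1\<rparr>) \<mu> \<alpha> X\<^sub>1 \<and>
    ergodic_component (\<Lambda>\<lparr>carrier := \<Lambda>\<^sub>1\<rparr>) \<nu> \<beta> Y\<^sub>1 \<and>
    image_mod_null \<mu> \<nu> (\<tau> \<circ> \<theta>) X\<^sub>1 Y\<^sub>1 \<and>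
    conjugacy (\<Gamma>\<lparr>carrier := \<Gamma>\<^sub>1\<rparr>) (uniform_measure \<mu> X\<^sub>1) \<alpha>
              (\<Lambda>\<lparr>carrier := \<Lambda>\<^sub>1\<rparr>) (uniform_measure \<nu> Y\<^sub>1) \<beta> (\<tau> \<circ> \<theta>)"
proof -
  obtain P c q Z f where sys: "inverse_system \<Gamma> P c q" "inverse_limit_measure P q Z" "prob_iso \<mu> Z f"
    and fe: "\<And>g. g \<in> carrier \<Gamma> \<Longrightarrow> AE x in \<mu>. f (\<alpha> g x) = (\<lambda>n. c n g (f x n))"
    using assms(11) unfolding profinite_action_def by blast
  obtain f' where f': "mp_map \<mu> Z f" "mp_map Z \<mu> f'" "AE x in \<mu>. f' (f x) = x"
    using sys(3) unfolding prob_iso_def by blast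
  have oe: "prob_iso \<mu> \<nu> \<theta>" "AE x in \<mu>. \<theta> ` orbit \<Gamma> \<alpha> x = orbit \<Lambda> \<beta> (\<theta> x)"
    using assms(19) unfolding orbit_equivalence_def by blast+
  obtain \<theta>' where \<theta>': "mp_map \<mu> \<nu> \<theta>" "mp_map \<nu> \<mu> \<theta>'" "AE x in \<mu>. \<theta>' (\<theta> x) = x" "AE y in \<nu>. \<theta> (\<theta>' y) = y"
    using oe(1) unfolding prob_iso_def by blast
  interpret O: orbit_equivalent_actions \<Gamma> \<Gamma>\<^sub>0 \<mu> \<alpha> \<Lambda> \<nu> \<beta> P c q Z f f' \<theta> \<theta>'
    by (rule orbit_equivalent_actions.intro) (fact assms sys f' fe \<theta>' oe)+
  obtain n a \<delta> \<psi> where u: "measure O.M (O.pc.atom n a) > 0"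
    "\<And>h. h \<in> \<Gamma>\<^sub>0 \<inter> O.pc.stab n a \<Longrightarrow> \<delta> h \<in> carrier \<Lambda>"
    "\<psi> \<in> measurable O.M (count_space (carrier \<Lambda>))"
    "\<And>h. h \<in> \<Gamma>\<^sub>0 \<inter> O.pc.stab n a \<Longrightarrow>
      AE x in O.M. x \<in> O.pc.atom n a \<longrightarrow> \<psi> (\<alpha> h x) \<otimes>\<^bsub>\<Lambda>\<^esub> \<delta> h = O.w h x \<otimes>\<^bsub>\<Lambda>\<^esub> \<psi> x"
    by (rule O.pc.untwisting_on_atom[OF assms(5)]) blast
  interpret U: untwisted_cocycle \<Gamma> \<Gamma>\<^sub>0 \<Lambda> O.M \<alpha> O.w "\<lambda>n x. f x n" n a \<delta> \<psi>
    by (intro untwisted_cocycle.intro untwisted_cocycle_axioms.intro O.pc.profinite_cocycle_axioms)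
      (fact u assms)+
  obtain m b \<epsilon> l\<^sub>0 where e: "measure O.M (O.pc.atom m b) > 0"
    "\<And>g. g \<in> O.pc.stab m b \<Longrightarrow> \<epsilon> g \<in> carrier \<Lambda>"
    "\<And>g h. \<lbrakk>g \<in> O.pc.stab m b; h \<in> O.pc.stab m b\<rbrakk> \<Longrightarrow> \<epsilon> (g \<otimes>\<^bsub>\<Gamma>\<^esub> h) = \<epsilon> g \<otimes>\<^bsub>\<Lambda>\<^esub> \<epsilon> h"
    "\<And>g. g \<in> O.pc.stab m b \<Longrightarrow>
      AE x in O.M. x \<in> O.pc.atom m b \<longrightarrow> \<psi> (\<alpha> g x) \<otimes>\<^bsub>\<Lambda>\<^esub> \<epsilon> g = O.w g x \<otimes>\<^bsub>\<Lambda>\<^esub> \<psi> x"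
    "measure O.M {x \<in> O.pc.atom m b. \<psi> x = l\<^sub>0} > measure O.M (O.pc.atom m b) / 2"
    by (rule U.homomorphism_on_deep_atom) blast
  interpret V: untwisted_orbit_equivalence \<Gamma> \<Gamma>\<^sub>0 \<mu> \<alpha> \<Lambda> \<nu> \<beta> P c q Z f f' \<theta> \<theta>' m b \<epsilon> \<psi> l\<^sub>0
    by (intro untwisted_orbit_equivalence.intro untwisted_orbit_equivalence_axioms.intro
        O.orbit_equivalent_actions_axioms) (fact u e)+
  show ?thesis by (rule V.virtual_conjugacy)
qed

end
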